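(* Let $(\nabla\phi,\rho,p)$ be the solution of Problem (P) (described in the context), i.e. $(\rho,J=\rho\nabla\phi,p)$ is its minimizer, and let $(\nabla\psi,r,q)$ be such that $\psi\in W^{1,\infty}(D)$, $r\in L^2([0,T];H^{-1}(\mathbb T^d))\cap L^\infty([0,T];L^1(\mathbb T^d))$, $q\in L^\infty(D)$. Suppose that $(\nabla\psi,r,q)$ is a solution to $$\partial_t\psi+\tfrac12|\nabla\psi|^2+q\le0,\qquad r\big(\partial_t\psi+\tfrac12|\nabla\psi|^2+q\big)=0,$$ $$\partial_tr+\nabla\cdot(r\nabla\psi)=0\ \text{ in }\mathcal D',\qquad r|_{t=0}=\rho_0,\quad r|_{t=T}=\rho_T,\qquad \Delta q=r-1\ \text{ in }\mathcal D'.$$ Then $\rho=r$, and $\nabla\phi=\nabla\psi$ holds $d\rho$-a.e.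
   Context: $T>0$, $d$ is the space dimension, $\mathbb T^d=\mathbb R^d/\mathbb Z^d$, $D=[0,T]\times\mathbb T^d$. $\mathcal M(D)$ is the space of bounded measures on $D$, $\mathcal P(\mathbb T^d)$ the set of probability measures on $\mathbb T^d$, and $C([0,T];\mathcal P(\mathbb T^d)\text{-}w* )$ the set of curves of probability measures continuous for the weak-$*$ topology. Differential operators $\nabla,\Delta,\nabla\cdot$ are with respect to $x$. $\rho_0,\rho_T$ are given probability measures in $L^{2d/(d+2)}(\mathbb T^d)$. Problem (P): minimize $$\tilde I(\rho,J,p)=\sup_{c+|m|^2/2\le0}\Big\{\int_D c\,d\rho+m\cdot dJ\Big\}+\frac12\int_D|\nabla p|^2\,dt\,dx$$ (supremum over $(c,m)\in C(D)\times(C(D))^d$ with $c+|m|^2/2\le 0$ on $D$) among all $(\rho,J,p)$ with $\rho\in\mathcal M(D)\cap C([0,T];\mathcal P(\mathbb T^d)\text{-}w* )$, $J\in(\mathcal M(D))^d$, $\nabla p\in L^2(D)$ satisfying, in the sense of distributions, $\partial_t\rho+\nabla\cdot J=0$, $\Delta p=\rho-1$, $\rho(t=0)=\rho_0$, $\rho(t=T)=\rho_T$. It has a unique solution, $J=\rho v$ with $v\in L^2(D,d\rho)$, and $v=\nabla\phi$ $d\rho$-a.e. for a potential $\phi\in L^2_{loc}(]0,T[;H^1(\mathbb T^d))$; thus $\tilde I(\rho,J,p)=\frac12\int_D|\nabla\phi|^2d\rho+\frac12\int_D|\nabla p|^2dt\,dx$.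
   Formalization: The formal theorem additionally assumes r ≥ 0 almost everywhere on D; without it the claim fails, since signed solutions r with nonnegative data at t = 0 and t = T exist, while ρ is always nonnegative. *)

theory Defs
  imports "HOL-Probability.Probability"
begin

text \<open>
  The torus of dimension \<open>d = CARD('n)\<close> is represented by the half-open unit cell, which is a
  Borel isomorphic set of representatives. Measures on the torus, and functions that matter only
  almost everywhere, live on the cell; continuous and smooth functions on the torus are functions
  on the whole space that are invariant under translation by integer vectors. The test functions
  being periodic, all weak derivatives below are derivatives on the torus (no boundary of the cell).
\<close>

definition torus_cell :: "(real^'n) set" where
  "torus_cell = {x. \<forall>i. 0 \<le> x $ i \<and> x $ i < 1}"

definition zperiodic :: "(real^'n \<Rightarrow> 'b) \<Rightarrow> bool" where
  "zperiodic f \<longleftrightarrow> (\<forall>x k. (\<forall>i. k $ i \<in> \<int>) \<longrightarrow> f (x + k) = f x)"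

definition spacetime :: "real \<Rightarrow> (real \<times> (real^'n)) set" where
  "spacetime T = {0..T} \<times> torus_cell"

abbreviation torus_leb :: "(real^'n) measure" where
  "torus_leb \<equiv> restrict_space lborel torus_cell"

abbreviation torus_borel :: "(real^'n) measure" where
  "torus_borel \<equiv> restrict_space borel torus_cell"

abbreviation D_leb :: "real \<Rightarrow> (real \<times> (real^'n)) measure" where
  "D_leb T \<equiv> restrict_space lborel (spacetime T)"

abbreviation D_borel :: "real \<Rightarrow> (real \<times> (real^'n)) measure" where
  "D_borel T \<equiv> restrict_space borel (spacetime T)"

definition cont_torus :: "(real^'n \<Rightarrow> real) \<Rightarrow> bool" where
  "cont_torus f \<longleftrightarrow> continuous_on UNIV f \<and> zperiodic f"

definition cont_D :: "real \<Rightarrow> (real \<times> (real^'n) \<Rightarrow> 'b::topological_space) \<Rightarrow> bool" where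
  "cont_D T f \<longleftrightarrow> continuous_on ({0..T} \<times> UNIV) f \<and> (\<forall>t\<in>{0..T}. zperiodic (\<lambda>x. f (t, x)))"


section \<open>Smooth functions and classical derivatives\<close>

primrec C_k :: "nat \<Rightarrow> ('a::euclidean_space \<Rightarrow> real) \<Rightarrow> bool" where
  "C_k 0 f \<longleftrightarrow> continuous_on UNIV f"
| "C_k (Suc k) f \<longleftrightarrow> (\<forall>x. f differentiable (at x)) \<and>
      (\<forall>b\<in>Basis. C_k k (\<lambda>x. frechet_derivative f (at x) b))"

definition smooth :: "('a::euclidean_space \<Rightarrow> real) \<Rightarrow> bool" where
  "smooth f \<longleftrightarrow> (\<forall>k. C_k k f)"

definition grad :: "(real^'n \<Rightarrow> real) \<Rightarrow> real^'n \<Rightarrow> real^'n" where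
  "grad f x = (\<chi> i. frechet_derivative f (at x) (axis i 1))"

definition d_t :: "(real \<times> (real^'n) \<Rightarrow> real) \<Rightarrow> real \<times> (real^'n) \<Rightarrow> real" where
  "d_t f z = frechet_derivative f (at z) (1, 0)"

definition d_x :: "'n \<Rightarrow> (real \<times> (real^'n) \<Rightarrow> real) \<Rightarrow> real \<times> (real^'n) \<Rightarrow> real" where
  "d_x i f z = frechet_derivative f (at z) (0, axis i 1)"

definition grad_x :: "(real \<times> (real^'n) \<Rightarrow> real) \<Rightarrow> real \<times> (real^'n) \<Rightarrow> real^'n" where
  "grad_x f z = (\<chi> i. d_x i f z)"

definition lap_x :: "(real \<times> (real^'n) \<Rightarrow> real) \<Rightarrow> real \<times> (real^'n) \<Rightarrow> real" where
  "lap_x f z = (\<Sum>i\<in>UNIV. d_x i (d_x i f) z)"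

text \<open>Test functions on \<open>]0,T[\<close> times the torus: the support is compact in time.\<close>

definition test_fun :: "real \<Rightarrow> (real \<times> (real^'n) \<Rightarrow> real) \<Rightarrow> bool" where
  "test_fun T \<eta> \<longleftrightarrow> smooth \<eta> \<and> (\<forall>t. zperiodic (\<lambda>x. \<eta> (t, x))) \<and>
     (\<exists>a b. 0 < a \<and> a < b \<and> b < T \<and> (\<forall>t x. t \<notin> {a..b} \<longrightarrow> \<eta> (t, x) = 0))"


section \<open>Lebesgue and Sobolev spaces\<close>

definition in_L2 :: "'a measure \<Rightarrow> ('a \<Rightarrow> 'b::euclidean_space) \<Rightarrow> bool" where
  "in_L2 M f \<longleftrightarrow> f \<in> borel_measurable M \<and> (\<integral>\<^sup>+z. ennreal ((norm (f z))\<^sup>2) \<partial>M) < \<infinity>"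

definition in_Linf :: "'a measure \<Rightarrow> ('a \<Rightarrow> 'b::euclidean_space) \<Rightarrow> bool" where
  "in_Linf M f \<longleftrightarrow> f \<in> borel_measurable M \<and> (\<exists>C. AE z in M. norm (f z) \<le> C)"

text \<open>\<open>L\<^sup>1\<close> locally on \<open>]0,T[\<close> times the torus.\<close>

definition loc_L1 :: "real \<Rightarrow> (real \<times> (real^'n) \<Rightarrow> 'b::euclidean_space) \<Rightarrow> bool" where
  "loc_L1 T f \<longleftrightarrow> f \<in> borel_measurable (D_leb T) \<and>
     (\<forall>a b. 0 < a \<and> a < b \<and> b < T \<longrightarrow> set_integrable (D_leb T) ({a..b} \<times> torus_cell) f)"

definition has_weak_grad ::
    "real \<Rightarrow> (real \<times> (real^'n) \<Rightarrow> real) \<Rightarrow> (real \<times> (real^'n) \<Rightarrow> real^'n) \<Rightarrow> bool" where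
  "has_weak_grad T f g \<longleftrightarrow> loc_L1 T f \<and> loc_L1 T g \<and>
     (\<forall>\<eta> i. test_fun T \<eta> \<longrightarrow>
        (LINT z|D_leb T. f z * d_x i \<eta> z) = - (LINT z|D_leb T. g z $ i * \<eta> z))"

definition has_weak_dt ::
    "real \<Rightarrow> (real \<times> (real^'n) \<Rightarrow> real) \<Rightarrow> (real \<times> (real^'n) \<Rightarrow> real) \<Rightarrow> bool" where
  "has_weak_dt T f h \<longleftrightarrow> loc_L1 T f \<and> loc_L1 T h \<and>
     (\<forall>\<eta>. test_fun T \<eta> \<longrightarrow>
        (LINT z|D_leb T. f z * d_t \<eta> z) = - (LINT z|D_leb T. h z * \<eta> z))"

text \<open>The weak gradient, when it exists, is determined Lebesgue almost everywhere only;
  this picks a representative.\<close>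

definition weak_grad :: "real \<Rightarrow> (real \<times> (real^'n) \<Rightarrow> real) \<Rightarrow> real \<times> (real^'n) \<Rightarrow> real^'n" where
  "weak_grad T f = (SOME g. has_weak_grad T f g)"

text \<open>\<open>f\<close> belongs to \<open>L\<^sup>2\<close> locally on \<open>]0,T[\<close> with values in \<open>H\<^sup>1\<close>, with weak gradient \<open>g\<close>.\<close>

definition loc_L2_H1 ::
    "real \<Rightarrow> (real \<times> (real^'n) \<Rightarrow> real) \<Rightarrow> (real \<times> (real^'n) \<Rightarrow> real^'n) \<Rightarrow> bool" where
  "loc_L2_H1 T f g \<longleftrightarrow> has_weak_grad T f g \<and>
     (\<forall>a b. 0 < a \<and> a < b \<and> b < T \<longrightarrow>
        in_L2 (restrict_space lborel ({a..b} \<times> torus_cell)) f \<and>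
        in_L2 (restrict_space lborel ({a..b} \<times> torus_cell)) g)"

text \<open>\<open>f\<close> belongs to \<open>W\<^sup>1\<^sup>,\<^sup>\<infinity>(D)\<close>, with weak time derivative \<open>h\<close> and weak space gradient \<open>g\<close>.\<close>

definition in_W1inf ::
    "real \<Rightarrow> (real \<times> (real^'n) \<Rightarrow> real) \<Rightarrow> (real \<times> (real^'n) \<Rightarrow> real) \<Rightarrow>
       (real \<times> (real^'n) \<Rightarrow> real^'n) \<Rightarrow> bool" where
  "in_W1inf T f h g \<longleftrightarrow> in_Linf (D_leb T) f \<and> in_Linf (D_leb T) h \<and> in_Linf (D_leb T) g \<and>
     has_weak_dt T f h \<and> has_weak_grad T f g"

definition in_Linf_L1 :: "real \<Rightarrow> (real \<times> (real^'n) \<Rightarrow> real) \<Rightarrow> bool" where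
  "in_Linf_L1 T r \<longleftrightarrow> r \<in> borel_measurable (D_leb T) \<and>
     (\<exists>C. AE t in restrict_space lborel {0..T}.
        integrable torus_leb (\<lambda>x. r (t, x)) \<and> (LINT x|torus_leb. \<bar>r (t, x)\<bar>) \<le> C)"

text \<open>Dual norm of \<open>H\<^sup>1\<close>, for an integrable function \<open>u\<close>; smooth functions are dense in \<open>H\<^sup>1\<close>.\<close>

definition Hm1_norm :: "(real^'n \<Rightarrow> real) \<Rightarrow> ennreal" where
  "Hm1_norm u =
     (SUP \<eta>\<in>{\<eta>. smooth \<eta> \<and> zperiodic \<eta> \<and> (LINT x|torus_leb. (\<eta> x)\<^sup>2 + (norm (grad \<eta> x))\<^sup>2) \<le> 1}.
        ennreal \<bar>LINT x|torus_leb. u x * \<eta> x\<bar>)"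

definition in_L2_Hm1 :: "real \<Rightarrow> (real \<times> (real^'n) \<Rightarrow> real) \<Rightarrow> bool" where
  "in_L2_Hm1 T r \<longleftrightarrow> r \<in> borel_measurable (D_leb T) \<and>
     (\<integral>\<^sup>+t. (Hm1_norm (\<lambda>x. r (t, x)))\<^sup>2 \<partial>(restrict_space lborel {0..T})) < \<infinity>"


section \<open>Measures\<close>

text \<open>A bounded signed measure is a real-valued countably additive set function; integrals against
  it are defined through its Jordan decomposition.\<close>

definition signed_measure :: "'a measure \<Rightarrow> ('a set \<Rightarrow> real) \<Rightarrow> bool" where
  "signed_measure M \<nu> \<longleftrightarrow> \<nu> {} = 0 \<and>
     (\<forall>A::nat \<Rightarrow> 'a set. range A \<subseteq> sets M \<and> disjoint_family A \<longrightarrow> (\<lambda>i. \<nu> (A i)) sums \<nu> (\<Union>i. A i))"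

definition pos_variation :: "'a measure \<Rightarrow> ('a set \<Rightarrow> real) \<Rightarrow> 'a measure" where
  "pos_variation M \<nu> =
     measure_of (space M) (sets M) (\<lambda>A. SUP B\<in>{B \<in> sets M. B \<subseteq> A}. ennreal (\<nu> B))"

definition signed_integral :: "'a measure \<Rightarrow> ('a set \<Rightarrow> real) \<Rightarrow> ('a \<Rightarrow> real) \<Rightarrow> real" where
  "signed_integral M \<nu> f =
     (LINT z|pos_variation M \<nu>. f z) - (LINT z|pos_variation M (\<lambda>A. - \<nu> A). f z)"

definition vector_measure_D :: "real \<Rightarrow> ((real \<times> (real^'n)) set \<Rightarrow> real^'n) \<Rightarrow> bool" where
  "vector_measure_D T J \<longleftrightarrow> (\<forall>i. signed_measure (D_borel T) (\<lambda>A. J A $ i))"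

definition integral_dot ::
    "real \<Rightarrow> (real \<times> (real^'n) \<Rightarrow> real^'n) \<Rightarrow> ((real \<times> (real^'n)) set \<Rightarrow> real^'n) \<Rightarrow> real" where
  "integral_dot T m J = (\<Sum>i\<in>UNIV. signed_integral (D_borel T) (\<lambda>A. J A $ i) (\<lambda>z. m z $ i))"

text \<open>The measure \<open>\<rho>\<close> on \<open>D\<close> is \<open>\<mu> t (dx) dt\<close> for the weakly-* continuous curve \<open>\<mu>\<close> of
  probability measures. Such a curve is determined by \<open>\<rho>\<close> on \<open>[0,T]\<close>, and gives a meaning to
  \<open>\<rho>\<close> at time \<open>0\<close> and \<open>T\<close>.\<close>

definition wstar_curve ::
    "real \<Rightarrow> (real \<times> (real^'n)) measure \<Rightarrow> (real \<Rightarrow> (real^'n) measure) \<Rightarrow> bool" where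
  "wstar_curve T \<rho> \<mu> \<longleftrightarrow>
     (\<forall>t\<in>{0..T}. prob_space (\<mu> t) \<and> sets (\<mu> t) = sets torus_borel) \<and>
     (\<forall>\<eta>. cont_torus \<eta> \<longrightarrow> continuous_on {0..T} (\<lambda>t. LINT x|\<mu> t. \<eta> x)) \<and>
     sets \<rho> = sets (D_borel T) \<and>
     (\<forall>A\<in>sets \<rho>. emeasure \<rho> A = (\<integral>\<^sup>+t\<in>{0..T}. emeasure (\<mu> t) (Pair t -` A) \<partial>lborel))"

definition prob_in_Lp :: "real \<Rightarrow> (real^'n) measure \<Rightarrow> bool" where
  "prob_in_Lp s \<mu> \<longleftrightarrow> prob_space \<mu> \<and>
     (\<exists>f. f \<in> borel_measurable torus_leb \<and> (\<forall>x. 0 \<le> f x) \<and> \<mu> = density torus_leb (\<lambda>x. ennreal (f x)) \<and>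
        (\<integral>\<^sup>+x. ennreal (f x powr s) \<partial>torus_leb) < \<infinity>)"


section \<open>The minimization problem\<close>

text \<open>\<open>\<Delta>p = S - 1\<close> in the sense of distributions, the distribution \<open>S\<close> being given by its action
  on test functions.\<close>

definition poisson ::
    "real \<Rightarrow> (real \<times> (real^'n) \<Rightarrow> real) \<Rightarrow> ((real \<times> (real^'n) \<Rightarrow> real) \<Rightarrow> real) \<Rightarrow> bool" where
  "poisson T p S \<longleftrightarrow> (\<forall>\<eta>. test_fun T \<eta> \<longrightarrow>
     (LINT z|D_leb T. p z * lap_x \<eta> z) = S \<eta> - (LINT z|D_leb T. \<eta> z))"

definition admissible ::
    "real \<Rightarrow> (real^'n) measure \<Rightarrow> (real^'n) measure \<Rightarrow> (real \<times> (real^'n)) measure \<Rightarrow>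
       ((real \<times> (real^'n)) set \<Rightarrow> real^'n) \<Rightarrow> (real \<times> (real^'n) \<Rightarrow> real) \<Rightarrow> bool" where
  "admissible T \<rho>0 \<rho>T \<rho> J p \<longleftrightarrow>
     (\<exists>\<mu>. wstar_curve T \<rho> \<mu> \<and> \<mu> 0 = \<rho>0 \<and> \<mu> T = \<rho>T) \<and>
     vector_measure_D T J \<and>
     (\<exists>g. has_weak_grad T p g \<and> in_L2 (D_leb T) g) \<and>
     (\<forall>\<eta>. test_fun T \<eta> \<longrightarrow> (LINT z|\<rho>. d_t \<eta> z) + integral_dot T (grad_x \<eta>) J = 0) \<and>
     poisson T p (\<lambda>\<eta>. LINT z|\<rho>. \<eta> z)"

definition total_action ::
    "real \<Rightarrow> (real \<times> (real^'n)) measure \<Rightarrow> ((real \<times> (real^'n)) set \<Rightarrow> real^'n) \<Rightarrow>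
       (real \<times> (real^'n) \<Rightarrow> real) \<Rightarrow> ereal" where
  "total_action T \<rho> J p =
     (SUP (c, m)\<in>{(c, m). cont_D T c \<and> cont_D T m \<and>
                     (\<forall>z\<in>spacetime T. c z + (norm (m z))\<^sup>2 / 2 \<le> 0)}.
        ereal ((LINT z|\<rho>. c z) + integral_dot T m J)) +
     enn2ereal (\<integral>\<^sup>+z. ennreal ((norm (weak_grad T p z))\<^sup>2 / 2) \<partial>D_leb T)"

definition solves_P ::
    "real \<Rightarrow> (real^'n) measure \<Rightarrow> (real^'n) measure \<Rightarrow> (real \<times> (real^'n)) measure \<Rightarrow>
       ((real \<times> (real^'n)) set \<Rightarrow> real^'n) \<Rightarrow> (real \<times> (real^'n) \<Rightarrow> real) \<Rightarrow> bool" where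
  "solves_P T \<rho>0 \<rho>T \<rho> J p \<longleftrightarrow> admissible T \<rho>0 \<rho>T \<rho> J p \<and>
     (\<forall>\<rho>' J' p'. admissible T \<rho>0 \<rho>T \<rho>' J' p' \<longrightarrow> total_action T \<rho> J p \<le> total_action T \<rho>' J' p')"

text \<open>\<open>J = \<rho> v\<close> with \<open>v\<close> square integrable with respect to \<open>\<rho>\<close>.\<close>

definition has_velocity ::
    "(real \<times> (real^'n)) measure \<Rightarrow> ((real \<times> (real^'n)) set \<Rightarrow> real^'n) \<Rightarrow>
       (real \<times> (real^'n) \<Rightarrow> real^'n) \<Rightarrow> bool" where
  "has_velocity \<rho> J v \<longleftrightarrow> in_L2 \<rho> v \<and> (\<forall>A\<in>sets \<rho>. J A = (LINT z:A|\<rho>. v z))"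


section \<open>The Euler-Poisson system\<close>

definition weak_continuity ::
    "real \<Rightarrow> (real \<times> (real^'n) \<Rightarrow> real) \<Rightarrow> (real \<times> (real^'n) \<Rightarrow> real^'n) \<Rightarrow> bool" where
  "weak_continuity T r v \<longleftrightarrow> (\<forall>\<eta>. test_fun T \<eta> \<longrightarrow>
     (LINT z|D_leb T. r z * (d_t \<eta> z + v z \<bullet> grad_x \<eta> z)) = 0)"

text \<open>The values at time \<open>0\<close> and \<open>T\<close> are those of the representative of \<open>t \<mapsto> r(t,\<cdot>)\<close> that is
  continuous with values in distributions.\<close>

definition has_traces ::
    "real \<Rightarrow> (real \<times> (real^'n) \<Rightarrow> real) \<Rightarrow> (real^'n) measure \<Rightarrow> (real^'n) measure \<Rightarrow> bool" where
  "has_traces T r \<rho>0 \<rho>T \<longleftrightarrow> (\<forall>\<eta>. smooth \<eta> \<and> zperiodic \<eta> \<longrightarrow>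
     (\<exists>h. continuous_on {0..T} h \<and>
        (AE t in restrict_space lborel {0..T}. (LINT x|torus_leb. r (t, x) * \<eta> x) = h t) \<and>
        h 0 = (LINT x|\<rho>0. \<eta> x) \<and> h T = (LINT x|\<rho>T. \<eta> x)))"

end

theory Submission imports Defs begin

text \<open>
  The triple \<open>(r, r \<nabla>\<psi>, q)\<close> is admissible for Problem (P), so the minimal action is at most
  \<open>E = 1/2 \<integral> r |\<nabla>\<psi>|\<^sup>2 + 1/2 \<integral> |\<nabla>q|\<^sup>2\<close>. Conversely, let \<open>\<Psi>\<close> be a mollification of \<open>\<psi>\<close>. By convexity
  it still satisfies the Hamilton-Jacobi inequality up to a small error, so testing the dual
  form of the action of \<open>(\<rho>, J)\<close> with \<open>m = \<nabla>\<Psi>\<close> and \<open>c = - |m|\<^sup>2 / 2\<close> bounds it from below by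
  \<open>\<integral> (\<partial>\<^sub>t\<Psi> + q) d\<rho> + \<integral> \<nabla>\<Psi> \<cdot> dJ\<close>. The continuity equations of \<open>\<rho>\<close> and \<open>r\<close>, which have the same
  end points, turn \<open>\<integral> \<partial>\<^sub>t\<Psi> d\<rho> + \<integral> \<nabla>\<Psi> \<cdot> dJ\<close> into \<open>\<integral> r (\<partial>\<^sub>t\<Psi> + \<nabla>\<psi> \<cdot> \<nabla>\<Psi>)\<close>, which tends to
  \<open>\<integral> r (1/2 |\<nabla>\<psi>|\<^sup>2 - q)\<close> because equality holds where \<open>r > 0\<close>. With both Poisson equations the
  comparison of the two bounds reads \<open>1/2 \<integral> |\<nabla>p - \<nabla>q|\<^sup>2 \<le> 0\<close>. Hence \<open>\<nabla>p = \<nabla>q\<close>, so \<open>\<rho> = r\<close>.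
  The estimate is then sharp, and perturbing \<open>m\<close> to \<open>\<nabla>\<Psi> + s w\<close> gives
  \<open>s \<integral> (\<nabla>\<phi> - \<nabla>\<psi>) \<cdot> w d\<rho> \<le> s\<^sup>2 / 2 \<integral> |w|\<^sup>2 d\<rho>\<close> for all \<open>s\<close>, so that the velocities agree.
\<close>

subsection \<open>Smooth functions\<close>

text \<open>The obstacle is that \<open>\<rho>\<close> may be singular with respect to Lebesgue
  measure, while \<open>\<nabla>\<psi>\<close>, \<open>\<partial>\<^sub>t\<psi>\<close> and
  \<open>q\<close> are known only almost everywhere, so they cannot be integrated against
  \<open>\<rho>\<close>. Whatever is paired with \<open>\<rho>\<close> is therefore a mollification,
  and limits are taken on the Lebesgue side: the Poisson equation of \<open>p\<close> turns the
  integral of the mollified \<open>q\<close> against \<open>\<rho>\<close> into an integral of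
  \<open>\<nabla>p\<close> against its gradient, which converges strongly in L2, and the common end
  points move the transport terms from \<open>\<rho>\<close> to \<open>r\<close>. Test functions
  vanish near t = 0 and t = T, so end values are reached through time cutoffs, and mollifications
  have to be smooth up to the ends, whence the contraction of time. That the candidate is admissible
  is not given either: \<open>\<nabla>q\<close> is square integrable only because \<open>q\<close>
  is bounded, \<open>r\<close> integrable and both are linked by the Poisson equation, and the
  weakly continuous curve behind \<open>r\<close> comes from compactness, as limits of time
  averages. The identity \<open>\<integral> r q = \<integral> q - \<integral> |\<nabla>q|^2\<close>
  is what completes the final square.\<close>

lemma C_k_SucI:
  assumes "\<And>x. (f has_derivative f' x) (at x)" "\<And>b. b \<in> Basis \<Longrightarrow> C_k k (\<lambda>x. f' x b)"
  shows "C_k (Suc k) f"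
proof -
  have "frechet_derivative f (at x) = f' x" for x
    using frechet_derivative_at[OF assms(1)] by simp
  then show ?thesis
    using assms by (auto simp: differentiable_def)
qed

lemma C_k_SucD:
  assumes "C_k (Suc k) f"
  shows "(f has_derivative frechet_derivative f (at x)) (at x)"
    and "b \<in> Basis \<Longrightarrow> C_k k (\<lambda>x. frechet_derivative f (at x) b)"
  using assms by (auto simp: frechet_derivative_works)

lemma C_k_less: "C_k (Suc k) f \<Longrightarrow> C_k k f"
proof (induction k arbitrary: f)
  case 0
  then show ?case
    by (auto intro: differentiable_imp_continuous_on simp: differentiable_on_def)
next
  case (Suc k)
  then show ?case by (subst C_k.simps(2)) (metis C_k.simps(2))
qed

lemma C_k_const: "C_k k (\<lambda>x. c)"
proof (induction k arbitrary: c)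
  case (Suc k)
  show ?case by (rule C_k_SucI[where f'="\<lambda>x h. 0"]) (auto intro: Suc)
qed auto

lemma C_k_bounded_linear:
  fixes f :: "'a::euclidean_space \<Rightarrow> real"
  assumes "bounded_linear f" shows "C_k k f"
proof (cases k)
  case 0
  then show ?thesis using assms by (auto intro: linear_continuous_on)
next
  case (Suc k')
  show ?thesis unfolding Suc
    by (rule C_k_SucI[where f'="\<lambda>x. f"]) (auto intro: C_k_const bounded_linear_imp_has_derivative assms)
qed

lemma C_k_add: "C_k k f \<Longrightarrow> C_k k g \<Longrightarrow> C_k k (\<lambda>x. f x + g x)"
proof (induction k arbitrary: f g)
  case 0 then show ?case by (auto intro: continuous_intros)
next
  case (Suc k)
  show ?case
    by (rule C_k_SucI, rule has_derivative_add[OF C_k_SucD(1)[OF Suc.prems(1)] C_k_SucD(1)[OF Suc.prems(2)]])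
       (intro Suc.IH C_k_SucD(2)[OF Suc.prems(1)] C_k_SucD(2)[OF Suc.prems(2)])
qed

text \<open>The product rule keeps the undifferentiated factors; \<open>C_k_less\<close> lowers them
  to the order of the induction hypothesis.\<close>

lemma C_k_mult: "C_k k f \<Longrightarrow> C_k k g \<Longrightarrow> C_k k (\<lambda>x. f x * g x)"
proof (induction k arbitrary: f g)
  case 0 then show ?case by (auto intro: continuous_intros)
next
  case (Suc k)
  show ?case
    by (rule C_k_SucI, rule has_derivative_mult[OF C_k_SucD(1)[OF Suc.prems(1)] C_k_SucD(1)[OF Suc.prems(2)]])
       (intro C_k_add Suc.IH C_k_less[OF Suc.prems(1)] C_k_less[OF Suc.prems(2)]
          C_k_SucD(2)[OF Suc.prems(1)] C_k_SucD(2)[OF Suc.prems(2)])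
qed

text \<open>Chain rule: a derivative of the composition is \<open>h'\<close> at \<open>g x\<close>
  times a derivative of \<open>g\<close>. The hypothesis on all orders of \<open>h\<close> is
  inherited by \<open>h'\<close> unchanged.\<close>

lemma C_k_comp_real:
  fixes g :: "'a::euclidean_space \<Rightarrow> real"
  assumes "\<And>j. C_k j (h :: real \<Rightarrow> real)" and "C_k k g"
  shows "C_k k (\<lambda>x. h (g x))"
  using assms
proof (induction k arbitrary: h g)
  case 0
  have "continuous_on UNIV h" using 0(1)[of 0] by simp
  from continuous_on_compose2[OF this, of UNIV g] 0(2) show ?case by simp
next
  case (Suc k)
  have h1: "C_k j (\<lambda>x. frechet_derivative h (at x) 1)" for j
    using C_k_SucD(2)[OF Suc.prems(1)] by (simp add: Basis_real_def del: C_k.simps)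
  have lin: "frechet_derivative h (at x) y = frechet_derivative h (at x) 1 * y" for x y
  proof -
    have "linear (frechet_derivative h (at x))" by (rule has_derivative_linear[OF C_k_SucD(1)[OF Suc.prems(1)]])
    then have "frechet_derivative h (at x) (y *\<^sub>R 1) = y *\<^sub>R frechet_derivative h (at x) 1"
      by (rule linear_cmul)
    then show ?thesis by (simp add: mult.commute)
  qed
  show ?case
  proof (rule C_k_SucI)
    show "((\<lambda>x. h (g x)) has_derivative (\<lambda>y. frechet_derivative h (at (g x)) (frechet_derivative g (at x) y))) (at x)" for x
      by (rule has_derivative_compose[OF C_k_SucD(1)[OF Suc.prems(2)] C_k_SucD(1)[OF Suc.prems(1)]])
    show "C_k k (\<lambda>x. frechet_derivative h (at (g x)) (frechet_derivative g (at x) b))" if "b \<in> Basis" for b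
      by (subst lin, rule C_k_mult[OF Suc.IH[where h="\<lambda>x. frechet_derivative h (at x) 1" and g=g]])
        (rule h1 C_k_SucD(2)[OF Suc.prems(2) that] C_k_less[OF Suc.prems(2)])+
  qed
qed

lemma C_k_sum: "(\<And>i. i \<in> I \<Longrightarrow> C_k k (f i)) \<Longrightarrow> C_k k (\<lambda>x. \<Sum>i\<in>I. f i x)"
  by (induction I rule: infinite_finite_induct) (auto intro: C_k_add C_k_const simp del: C_k.simps)

lemma C_k_affine:
  fixes g :: "'a::euclidean_space \<Rightarrow> real" and L :: "'b::euclidean_space \<Rightarrow> 'a"
  assumes "C_k k g" "bounded_linear L"
  shows "C_k k (\<lambda>x. g (a + L x))"
  using assms
proof (induction k arbitrary: g)
  case 0
  have "continuous_on UNIV (\<lambda>x. a + L x)"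
    by (intro continuous_intros linear_continuous_on 0)
  from continuous_on_compose2[of UNIV g, OF _ this] 0 show ?case by simp
next
  case (Suc k)
  have "((\<lambda>x. a + L x) has_derivative L) (at x)" for x
    using Suc.prems(2) by (auto intro!: derivative_eq_intros bounded_linear_imp_has_derivative)
  from has_derivative_compose[OF this C_k_SucD(1)[OF Suc.prems(1)]]
  have 1: "((\<lambda>x. g (a + L x)) has_derivative (\<lambda>y. frechet_derivative g (at (a + L x)) (L y))) (at x)" for x .
  \<comment> \<open>\<open>L b\<close> need not be a basis vector, while \<open>C_k\<close> speaks
    of derivatives in basis directions only; so it is expanded in the basis.\<close>
  have 2: "frechet_derivative g (at z) y = (\<Sum>c\<in>Basis. (y \<bullet> c) * frechet_derivative g (at z) c)" for y z
  proof -
    have l: "linear (frechet_derivative g (at z))" by (rule has_derivative_linear[OF C_k_SucD(1)[OF Suc.prems(1)]])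
    have "frechet_derivative g (at z) (\<Sum>c\<in>Basis. (y \<bullet> c) *\<^sub>R c) = (\<Sum>c\<in>Basis. (y \<bullet> c) *\<^sub>R frechet_derivative g (at z) c)"
      by (simp add: linear_sum[OF l] linear_cmul[OF l])
    then show ?thesis by (simp add: euclidean_representation)
  qed
  show ?case
  proof (rule C_k_SucI[OF 1])
    fix b :: 'b
    have "C_k k (\<lambda>x. frechet_derivative g (at (a + L x)) c)" if "c \<in> Basis" for c
      by (rule Suc.IH[where g="\<lambda>z. frechet_derivative g (at z) c"])
        (rule C_k_SucD(2)[OF Suc.prems(1) that] Suc.prems(2))+
    then have "C_k k (\<lambda>x. \<Sum>c\<in>Basis. (L b \<bullet> c) * frechet_derivative g (at (a + L x)) c)"
      by (rule C_k_sum[OF C_k_mult[OF C_k_const]])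
    then show "C_k k (\<lambda>x. frechet_derivative g (at (a + L x)) (L b))"
      by (subst 2)
  qed
qed

lemma C_k_inverse:
  assumes "C_k k g" "\<And>x. g x \<noteq> 0"
  shows "C_k k (\<lambda>x. 1 / g x)"
  using assms
proof (induction k arbitrary: g)
  case 0
  then show ?case by (auto intro!: continuous_intros)
next
  case (Suc k)
  have IH: "C_k k (\<lambda>x. 1 / g x)" by (intro Suc C_k_less[OF Suc.prems(1)])
  have 1: "((\<lambda>x. 1 / g x) has_derivative (\<lambda>y. (-1) * frechet_derivative g (at x) y * ((1 / g x) * (1 / g x)))) (at x)" for x
    using Suc.prems(2)[of x]
    by (auto intro!: derivative_eq_intros C_k_SucD(1)[OF Suc.prems(1)] simp: field_simps)
  show ?case
    by (rule C_k_SucI[OF 1]) (rule C_k_mult[OF C_k_mult[OF C_k_const C_k_SucD(2)[OF Suc.prems(1)]] C_k_mult[OF IH IH]])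
qed

lemma smooth_const: "smooth (\<lambda>x. c)"
  and smooth_add: "smooth f \<Longrightarrow> smooth g \<Longrightarrow> smooth (\<lambda>x. f x + g x)"
  and smooth_mult: "smooth f \<Longrightarrow> smooth g \<Longrightarrow> smooth (\<lambda>x. f x * g x)"
  and smooth_bounded_linear: "bounded_linear f \<Longrightarrow> smooth f"
  and smooth_sum: "(\<And>i. i \<in> I \<Longrightarrow> smooth (h i)) \<Longrightarrow> smooth (\<lambda>x. \<Sum>i\<in>I. h i x)"
  and smooth_inverse: "smooth g \<Longrightarrow> (\<And>x. g x \<noteq> 0) \<Longrightarrow> smooth (\<lambda>x. 1 / g x)"
  unfolding smooth_def
  by (simp_all only: C_k_const C_k_add C_k_mult C_k_bounded_linear) (intro allI C_k_sum C_k_inverse; simp)+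

lemma smooth_diff: "smooth f \<Longrightarrow> smooth g \<Longrightarrow> smooth (\<lambda>x. f x - g x)"
  using smooth_add[of f "\<lambda>x. (-1) * g x"] smooth_mult[OF smooth_const[of "-1"], of g] by simp

lemma smooth_comp_real: "smooth h \<Longrightarrow> smooth g \<Longrightarrow> smooth (\<lambda>x. h (g x))" for h :: "real \<Rightarrow> real"
  unfolding smooth_def using C_k_comp_real[of h _ g] by simp

lemma smooth_affine: "smooth g \<Longrightarrow> bounded_linear L \<Longrightarrow> smooth (\<lambda>x. g (a + L x))"
  unfolding smooth_def using C_k_affine[of _ g L a] by simp

lemma smooth_has_derivative: "smooth f \<Longrightarrow> (f has_derivative frechet_derivative f (at x)) (at x)"
  unfolding smooth_def by (rule C_k_SucD(1)) (erule spec)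

lemma smooth_deriv: "smooth f \<Longrightarrow> b \<in> Basis \<Longrightarrow> smooth (\<lambda>x. frechet_derivative f (at x) b)"
  unfolding smooth_def by (intro allI C_k_SucD(2)) (erule spec)

lemma smooth_continuous: "smooth f \<Longrightarrow> continuous_on UNIV f"
  unfolding smooth_def by (metis C_k.simps(1))

text \<open>For a family whose derivatives are again built from its members, one induction on the
  order raises the regularity of all members at once. No formula for higher derivatives is
  required.\<close>

lemma smooth_real_coinduct:
  fixes F G :: "'i \<Rightarrow> real \<Rightarrow> real"
  assumes D: "\<And>i x. (F i has_real_derivative G i x) (at x)"
    and G: "\<And>i k. (\<And>j. C_k k (F j)) \<Longrightarrow> C_k k (G i)"
  shows "smooth (F i)"
proof -
  have "C_k k (F i)" for k i
  proof (induction k arbitrary: i)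
    case 0
    have "continuous_on UNIV (F i)"
      by (rule DERIV_continuous_on[OF D])
    then show ?case by simp
  next
    case (Suc k)
    show ?case
    proof (rule C_k_SucI)
      show "(F i has_derivative (\<lambda>y. G i x * y)) (at x)" for x
        using D[of i x] by (simp only: has_field_derivative_def)
      have g: "C_k k (G i)" by (rule G) (rule Suc)
      show "C_k k (\<lambda>x. G i x * b)" if "b \<in> Basis" for b
        by (rule C_k_mult[OF g C_k_const])
    qed
  qed
  then show ?thesis unfolding smooth_def by blast
qed

lemma smooth_exp: "smooth (exp :: real \<Rightarrow> real)"
  by (rule smooth_real_coinduct[where F="\<lambda>_::unit. exp" and G="\<lambda>_. exp"]) auto

text \<open>The boolean indexes the two-element family that differentiation maps to itself up to
  sign.\<close>

lemma smooth_sin_cos: "smooth (\<lambda>x::real. if b then sin x else cos x)"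
proof (rule smooth_real_coinduct[where F="\<lambda>b x. if b then sin x else cos x" and
        G="\<lambda>b x. (if b then 1 else -1) * (if \<not> b then sin x else cos x)"])
  show "C_k k (\<lambda>x. (if i then 1 else - 1) * (if \<not> i then sin x else cos x))"
    if "\<And>j. C_k k (\<lambda>x. if j then sin x else cos x)" for i k
    by (intro C_k_mult C_k_const that)
qed (auto intro!: derivative_eq_intros)

lemma smooth_cos: "smooth (cos :: real \<Rightarrow> real)"
  using smooth_sin_cos[of False] by simp

text \<open>The classical smooth function that is flat at 0. It is the source of all cutoffs and
  mollifiers below; being positive exactly on the positive half-line, it also encodes inequalities
  by smooth functions.\<close>

definition flat_exp :: "real \<Rightarrow> real" where
  "flat_exp s = (if s > 0 then exp (- (1 / s)) else 0)"

lemma flat_pos_iff [simp]: "flat_exp s > 0 \<longleftrightarrow> s > 0" and flat_nonneg [simp]: "flat_exp s \<ge> 0"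
  and flat_eq_0 [simp]: "flat_exp s = 0 \<longleftrightarrow> s \<le> 0"
  by (auto simp: flat_exp_def)

text \<open>The functions \<open>exp (-1/s) / s^m\<close>, extended by 0, form a family closed under
  differentiation: member \<open>m\<close> has derivative \<open>F (m + 2) - m * F (m + 1)\<close>.
  At the origin everything rests on the exponential beating each power.\<close>

lemma smooth_flat: "smooth flat_exp"
proof -
  define F where "F m s = (if s > 0 then exp (- (1 / s)) / s ^ m else 0)" for m :: nat and s :: real
  have lim: "((\<lambda>s. F m s) \<longlongrightarrow> 0) (at_right 0)" for m
  proof -
    have "((\<lambda>s::real. exp (- (1 / s)) / s ^ m) \<longlongrightarrow> 0) (at_right 0)"
    proof -
      have "((\<lambda>u::real. u ^ m / exp u) \<longlongrightarrow> 0) at_top"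
        by (rule tendsto_power_div_exp_0)
      from filterlim_compose[OF this filterlim_inverse_at_top_right]
      show ?thesis by (simp add: exp_minus field_simps)
    qed
    then show ?thesis
      by (rule Lim_transform_eventually) (auto simp: F_def eventually_at_right_field intro!: exI[of _ 1])
  qed
  have D: "(F m has_real_derivative (F (m + 2) s - real m * F (m + 1) s)) (at s)" for m s
  proof -
    consider "s > 0" | "s < 0" | "s = 0" by linarith
    then show ?thesis
    proof cases
      case 1
      have "((\<lambda>s. exp (- (1 / s)) / s ^ m) has_real_derivative (F (m + 2) s - real m * F (m + 1) s)) (at s)"
      \<comment> \<open>The power rule produces the exponent \<open>m - 1\<close> with truncated
        subtraction, so \<open>m = 0\<close> is treated apart.\<close>
      proof (cases m)
        case (Suc m')
        have "((\<lambda>s. exp (- (1 / s)) / s ^ m) has_real_derivative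
           (exp (- (1 / s)) * (1 / s\<^sup>2) * s ^ m - exp (- (1 / s)) * (real m * s ^ (m - 1))) / (s ^ m * s ^ m)) (at s)"
          using 1 Suc by (auto intro!: derivative_eq_intros DERIV_power simp: power2_eq_square simp del: power_Suc)
        also have "(exp (- (1 / s)) * (1 / s\<^sup>2) * s ^ m - exp (- (1 / s)) * (real m * s ^ (m - 1))) / (s ^ m * s ^ m)
          = F (m + 2) s - real m * F (m + 1) s"
        proof -
          define a E where "a = s ^ m'" and "E = exp (- (1 / s))"
          have a: "a > 0" using 1 by (simp add: a_def)
          have e: "s ^ m = s * a" "s ^ (m + 2) = s * s * s * a" "s ^ (m + 1) = s * s * a" "s ^ (m - 1) = a"
            using Suc by (simp_all add: a_def)
          have "F (m + 2) s = E / (s * s * s * a)" "F (m + 1) s = E / (s * s * a)"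
            using 1 by (simp_all add: F_def e E_def)
          then show ?thesis
            unfolding e a_def[symmetric] E_def[symmetric] power2_eq_square
            using 1 a by (simp add: divide_simps) (simp add: algebra_simps)
        qed
        finally show ?thesis .
      qed (use 1 in \<open>auto intro!: derivative_eq_intros simp: F_def power2_eq_square\<close>)
      then show ?thesis
        by (rule has_field_derivative_transform_within_open[where S="{0<..}"]) (use 1 in \<open>auto simp: F_def\<close>)
    next
      case 2
      have "((\<lambda>s. 0) has_real_derivative (F (m + 2) s - real m * F (m + 1) s)) (at s)"
        using 2 by (auto simp: F_def)
      then show ?thesis
        by (rule has_field_derivative_transform_within_open[where S="{..<0}"]) (use 2 in \<open>auto simp: F_def\<close>)
    next
      case 3
      \<comment> \<open>From the right the difference quotient at 0 is the next member
        \<open>F (Suc m)\<close>, which tends to 0; from the left it vanishes.\<close>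
      have "((\<lambda>h. F m h / h) \<longlongrightarrow> 0) (at 0)"
      proof (rule filterlim_split_at)
        show "((\<lambda>h. F m h / h) \<longlongrightarrow> 0) (at_left 0)"
          by (rule Lim_transform_eventually[OF tendsto_const])
             (auto simp: F_def eventually_at_left_field intro!: exI[of _ "-1"])
        show "((\<lambda>h. F m h / h) \<longlongrightarrow> 0) (at_right 0)"
          by (rule Lim_transform_eventually[OF lim[of "Suc m"]])
             (auto simp: F_def eventually_at_right_field field_simps intro!: exI[of _ 1])
      qed
      then have "(F m has_real_derivative 0) (at 0)"
        by (simp add: DERIV_def F_def)
      then show ?thesis using 3 by (simp add: F_def)
    qed
  qed
  have "smooth (F 0)"
  proof (rule smooth_real_coinduct[where F=F and G="\<lambda>m s. F (m + 2) s - real m * F (m + 1) s"])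
    show "C_k k (\<lambda>s. F (i + 2) s - real i * F (i + 1) s)" if "\<And>j. C_k k (F j)" for i k
      using C_k_add[OF that C_k_mult[OF C_k_const[of _ "- real i"] that], of "i+2" "i+1"]
      by simp
  qed (rule D)
  moreover have "F 0 = flat_exp" by (auto simp: F_def flat_exp_def fun_eq_iff)
  ultimately show ?thesis by simp
qed

definition step :: "real \<Rightarrow> real" where
  "step s = flat_exp s / (flat_exp s + flat_exp (1 - s))"

text \<open>The numbers \<open>s\<close> and \<open>1 - s\<close> are never both
  non-positive.\<close>

lemma step_denom: "flat_exp s + flat_exp (1 - s) > 0"
  by (cases "s > 0") (auto simp: add_pos_nonneg add_nonneg_pos)

lemma smooth_step: "smooth step"
proof -
  have "smooth (\<lambda>s. flat_exp (1 + - s))"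
    by (rule smooth_affine[OF smooth_flat]) (auto intro: bounded_linear_minus bounded_linear_ident)
  then have "smooth (\<lambda>s. flat_exp s * (1 / (flat_exp s + flat_exp (1 - s))))"
    by (intro smooth_mult smooth_flat smooth_inverse smooth_add) (use step_denom in \<open>auto simp: less_imp_neq\<close>, metis less_irrefl)
  then show ?thesis by (simp add: step_def[abs_def])
qed

lemma step_0 [simp]: "s \<le> 0 \<Longrightarrow> step s = 0" and step_1 [simp]: "s \<ge> 1 \<Longrightarrow> step s = 1"
  and step_nonneg: "0 \<le> step s" and step_le_1: "step s \<le> 1"
proof -
  show "s \<le> 0 \<Longrightarrow> step s = 0" by (simp add: step_def flat_exp_def)
  show "s \<ge> 1 \<Longrightarrow> step s = 1" by (simp add: step_def flat_exp_def)
  show "0 \<le> step s" by (simp add: step_def)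
  show "step s \<le> 1" using step_denom[of s] by (simp add: step_def divide_le_eq_1)
qed

section \<open>Lebesgue measure on the unit cell and on space-time\<close>

abbreviation time_leb :: "real \<Rightarrow> real measure" where
  "time_leb T \<equiv> restrict_space lborel {0..T}"

lemma torus_cell_sets [measurable, simp]: "torus_cell \<in> sets borel"
proof -
  have "torus_cell = (\<Inter>i::'a. {x::real^'a. 0 \<le> x $ i} \<inter> {x. x $ i < 1})"
    by (auto simp: torus_cell_def)
  also have "\<dots> \<in> sets borel"
    by (intro sets.finite_INT sets.Int borel_closed borel_open)
       (auto intro!: closed_Collect_le open_Collect_less continuous_intros)
  finally show ?thesis .
qed

lemma spacetime_sets [measurable, simp]: "spacetime T \<in> sets borel"
  unfolding spacetime_def
  by (subst borel_prod[symmetric]) (intro pair_measureI; simp)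

lemma space_torus_leb [simp]: "space torus_leb = torus_cell"
  and space_torus_borel [simp]: "space torus_borel = torus_cell"
  and space_D_leb [simp]: "space (D_leb T) = spacetime T"
  and space_D_borel [simp]: "space (D_borel T) = spacetime T"
  and space_time_leb [simp]: "space (time_leb T) = {0..T}"
  by (auto simp: space_restrict_space)

lemma sets_D_leb: "sets (D_leb T) = sets (D_borel T)" and sets_torus_leb: "sets torus_leb = sets torus_borel"
  by (auto simp: sets_restrict_space)

lemma restrict_borel_measurable:
  "f \<in> borel_measurable borel \<Longrightarrow> f \<in> borel_measurable (restrict_space borel A)"
  "f \<in> borel_measurable borel \<Longrightarrow> f \<in> borel_measurable (restrict_space lborel A)"
  by (auto intro: measurable_restrict_space1)

text \<open>The half-open cell lies between the open and the closed unit box, and both have volume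
  one.\<close>

lemma emeasure_torus_cell: "emeasure lborel (torus_cell :: (real^'n) set) = 1"
proof -
  have b: "emeasure lborel (cbox (0::real^'n) 1) = 1" "emeasure lborel (box (0::real^'n) 1) = 1"
    by (simp_all add: emeasure_lborel_cbox_eq emeasure_lborel_box_eq Basis_vec_def inner_axis axis_eq_axis prod.UNION_disjoint inner_commute)
  have "emeasure lborel (box (0::real^'n) 1) \<le> emeasure lborel (torus_cell :: (real^'n) set)"
    by (intro emeasure_mono) (auto simp: torus_cell_def mem_box_cart less_imp_le)
  moreover have "emeasure lborel (torus_cell :: (real^'n) set) \<le> emeasure lborel (cbox (0::real^'n) 1)"
    by (intro emeasure_mono) (auto simp: torus_cell_def mem_box_cart less_imp_le)
  ultimately show ?thesis using b by (simp add: antisym)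
qed

lemma prob_space_torus_leb: "prob_space (torus_leb :: (real^'n) measure)"
  by (rule prob_spaceI) (simp add: emeasure_restrict_space emeasure_torus_cell)

lemma sigma_finite_time_leb: "sigma_finite_measure (time_leb T)"
  by (intro sigma_finite_measure_restrict_space sigma_finite_lborel) simp

text \<open>The form in which Fubini applies. \<open>D_leb\<close> is a restriction of Lebesgue
  measure on the whole product space, so its sigma-algebra as well as its values on rectangles have
  to be matched with those of the product.\<close>

lemma D_leb_eq: "D_leb T = (time_leb T \<Otimes>\<^sub>M torus_leb :: (real \<times> (real^'n)) measure)"
proof (rule sym, rule pair_measure_eqI)
  show "sigma_finite_measure (time_leb T)" by (rule sigma_finite_time_leb)
  show "sigma_finite_measure (torus_leb :: (real^'n) measure)"
    by (intro sigma_finite_measure_restrict_space sigma_finite_lborel) simp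
  let ?P = "time_leb T \<Otimes>\<^sub>M (torus_leb :: (real^'n) measure)"
  have sp: "space ?P = spacetime T" by (simp add: space_pair_measure spacetime_def)
  have 1: "(\<lambda>z. z) \<in> measurable (D_leb T) ?P"
  proof (rule measurable_Pair[where f="\<lambda>z. fst z" and g="\<lambda>z. snd z" and ?M1.0="time_leb T", simplified])
    show "fst \<in> measurable (D_leb T) (time_leb T)"
      by (rule measurable_restrict_space2)
         (auto simp: spacetime_def space_restrict_space intro!: restrict_borel_measurable borel_measurable_continuous_onI continuous_intros)
    show "snd \<in> measurable (D_leb T) torus_leb"
      by (rule measurable_restrict_space2)
         (auto simp: spacetime_def space_restrict_space intro!: restrict_borel_measurable borel_measurable_continuous_onI continuous_intros)
  qed
  have 2: "(\<lambda>z. z) \<in> measurable ?P (D_leb T)"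
  proof (rule measurable_restrict_space2)
    have "fst \<in> measurable ?P borel" "snd \<in> measurable ?P borel"
      using measurable_compose[OF measurable_fst restrict_borel_measurable(2)[OF measurable_ident]]
            measurable_compose[OF measurable_snd restrict_borel_measurable(2)[OF measurable_ident]] by auto
    then have "(\<lambda>z. (fst z, snd z)) \<in> measurable ?P (borel \<Otimes>\<^sub>M borel)"
      by (rule measurable_Pair)
    then show "(\<lambda>z. z) \<in> measurable ?P lborel" by (simp add: borel_prod)
  qed (auto simp: space_pair_measure spacetime_def)
  show "sets ?P = sets (D_leb T)"
  proof (intro equalityI subsetI)
    fix A assume A: "A \<in> sets ?P"
    from measurable_sets[OF 1 A] sets.sets_into_space[OF A] show "A \<in> sets (D_leb T)"
      by (simp add: sp Int_absorb2)
  next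
    fix A :: "(real \<times> (real^'n)) set" assume A: "A \<in> sets (D_leb T)"
    from measurable_sets[OF 2 A] sets.sets_into_space[OF A] show "A \<in> sets ?P"
      by (simp add: sp Int_absorb2)
  qed
  fix A B assume A: "A \<in> sets (time_leb T)" and B: "B \<in> sets (torus_leb :: (real^'n) measure)"
  have A': "A \<in> sets lborel" "A \<subseteq> {0..T}" using A sets_restrict_space_iff[of "{0..T}" lborel A] by auto
  have B': "B \<in> sets lborel" "B \<subseteq> torus_cell" using B sets_restrict_space_iff[of torus_cell lborel B] by auto
  have "emeasure (D_leb T) (A \<times> B) = emeasure lborel (A \<times> B)"
    using A' B' spacetime_sets[of T] by (subst emeasure_restrict_space) (auto simp: spacetime_def)
  also have "\<dots> = emeasure (lborel \<Otimes>\<^sub>M lborel) (A \<times> B)" by (simp add: lborel_prod)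
  also have "\<dots> = emeasure lborel A * emeasure lborel B"
    using A' B' by (intro lborel.emeasure_pair_measure_Times) auto
  finally show "emeasure (time_leb T) A * emeasure torus_leb B = emeasure (D_leb T) (A \<times> B)"
    using A' B' by (simp add: emeasure_restrict_space)
qed

lemma pair_sigma_finite_D: "pair_sigma_finite (time_leb T) (torus_leb :: (real^'n) measure)"
proof -
  have "sigma_finite_measure (torus_leb :: (real^'n) measure)"
    by (intro sigma_finite_measure_restrict_space sigma_finite_lborel) simp
  with sigma_finite_time_leb show ?thesis by (simp add: pair_sigma_finite_def)
qed

lemma nn_integral_D_leb:
  "f \<in> borel_measurable (D_leb T) \<Longrightarrow>
    (\<integral>\<^sup>+z. f z \<partial>(D_leb T :: (real \<times> (real^'n)) measure)) = (\<integral>\<^sup>+t. \<integral>\<^sup>+x. f (t, x) \<partial>torus_leb \<partial>time_leb T)"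
proof -
  interpret pair_sigma_finite "time_leb T" "torus_leb :: (real^'n) measure" by (rule pair_sigma_finite_D)
  assume "f \<in> borel_measurable (D_leb T)"
  then show ?thesis unfolding D_leb_eq by (rule M2.nn_integral_fst[symmetric])
qed

lemma integral_D_leb:
  fixes f :: "real \<times> (real^'n) \<Rightarrow> 'b::{banach, second_countable_topology}"
  assumes "integrable (D_leb T) f"
  shows "(LINT z|D_leb T. f z) = (LINT t|time_leb T. LINT x|torus_leb. f (t, x))"
    and "AE t in time_leb T. integrable torus_leb (\<lambda>x. f (t, x))"
    and "integrable (time_leb T) (\<lambda>t. LINT x|torus_leb. f (t, x))"
proof -
  interpret pair_sigma_finite "time_leb T" "torus_leb :: (real^'n) measure" by (rule pair_sigma_finite_D)
  have f: "integrable (time_leb T \<Otimes>\<^sub>M torus_leb) f" using assms by (simp only: D_leb_eq)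
  show "(LINT z|D_leb T. f z) = (LINT t|time_leb T. LINT x|torus_leb. f (t, x))"
    unfolding D_leb_eq by (rule integral_fst'[OF f, symmetric])
  show "AE t in time_leb T. integrable torus_leb (\<lambda>x. f (t, x))" by (rule AE_integrable_fst'[OF f])
  show "integrable (time_leb T) (\<lambda>t. LINT x|torus_leb. f (t, x))" by (rule integrable_fst'[OF f])
qed

lemma emeasure_D_leb: "T \<ge> 0 \<Longrightarrow> emeasure (D_leb T) (spacetime T :: (real \<times> (real^'n)) set) = ennreal T"
proof -
  assume T: "T \<ge> 0"
  interpret prob_space "torus_leb :: (real^'n) measure" by (rule prob_space_torus_leb)
  have "emeasure (D_leb T) (spacetime T :: (real \<times> (real^'n)) set) = (\<integral>\<^sup>+z. 1 \<partial>(D_leb T :: (real \<times> (real^'n)) measure))"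
    by simp
  also have "\<dots> = ennreal T"
    using T emeasure_space_1 by (subst nn_integral_D_leb) (simp_all add: emeasure_restrict_space)
  finally show ?thesis .
qed

lemma finite_measure_D_leb: "T \<ge> 0 \<Longrightarrow> finite_measure (D_leb T :: (real \<times> (real^'n)) measure)"
  by (rule finite_measureI) (simp add: emeasure_D_leb)

lemma finite_measure_time_leb: "finite_measure (time_leb T)"
  by (rule finite_measureI) (cases "T \<ge> 0"; simp add: emeasure_restrict_space)

subsection \<open>Translation invariance on the torus\<close>

definition int_vec :: "real^'n \<Rightarrow> bool" where "int_vec k \<longleftrightarrow> (\<forall>i. k $ i \<in> \<int>)"

text \<open>The projection of the whole space onto the cell. It jumps at the faces of the cell but
  is Borel, and periodic functions are unchanged by it.\<close>

definition torus_rep :: "real^'n \<Rightarrow> real^'n" where "torus_rep x = (\<chi> i. frac (x $ i))"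

lemma zperiodicD: "zperiodic f \<Longrightarrow> int_vec k \<Longrightarrow> f (x + k) = f x"
  by (auto simp: zperiodic_def int_vec_def)

lemma torus_rep_in: "torus_rep x \<in> torus_cell"
  by (auto simp: torus_rep_def torus_cell_def frac_lt_1)

lemma torus_rep_diff: "int_vec (torus_rep x - x)"
  by (auto simp: torus_rep_def int_vec_def frac_def)

lemma torus_rep_id: "x \<in> torus_cell \<Longrightarrow> torus_rep x = x"
  by (auto simp: torus_rep_def torus_cell_def vec_eq_iff frac_eq)

lemma zperiodic_rep: "zperiodic f \<Longrightarrow> f (torus_rep x) = f x"
  using zperiodicD[of f "torus_rep x - x" x] torus_rep_diff[of x] by simp

lemma torus_rep_unique: "x \<in> torus_cell \<Longrightarrow> int_vec (x - y) \<Longrightarrow> x = torus_rep y"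
proof -
  assume x: "x \<in> torus_cell" and k: "int_vec (x - y)"
  have "frac (y $ i) = x $ i" for i
    using x k frac_unique_iff[of "y $ i" "x $ i"] Ints_minus[of "x $ i - y $ i"]
    unfolding torus_cell_def int_vec_def by auto
  then show ?thesis by (simp add: torus_rep_def vec_eq_iff)
qed

lemma measurable_torus_rep [measurable]: "(torus_rep :: real^'n \<Rightarrow> real^'n) \<in> borel_measurable borel"
proof -
  have "(\<lambda>x::real^'n. torus_rep x \<bullet> axis i 1) \<in> borel_measurable borel" for i :: 'n
    unfolding torus_rep_def frac_def
    by (simp add: inner_axis)
  then show ?thesis
    by (subst borel_measurable_euclidean_space) (auto simp: Basis_vec_def)
qed

lemma countable_int_vec: "countable {k :: real^'n::finite. int_vec k}"
proof -
  have "{k :: real^'n. int_vec k} \<subseteq> (\<lambda>f. \<chi> i. real_of_int (f i)) ` UNIV"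
  proof
    fix k :: "real^'n" assume "k \<in> {k. int_vec k}"
    then have "k = (\<chi> i. real_of_int \<lfloor>k $ i\<rfloor>)" by (auto simp: int_vec_def vec_eq_iff)
    then show "k \<in> (\<lambda>f. \<chi> i. real_of_int (f i)) ` UNIV" by (rule image_eqI[where x="\<lambda>i. \<lfloor>k $ i\<rfloor>"]) simp
  qed
  then show ?thesis by (rule countable_subset) auto
qed

text \<open>With countability this gives a bijective enumeration of the lattice by
  \<open>nat\<close>, so that decompositions along the lattice become series.\<close>

lemma infinite_int_vec: "infinite {k :: real^'n::finite. int_vec k}"
proof
  assume "finite {k :: real^'n. int_vec k}"
  moreover have "range (\<lambda>n::nat. vec (real n) :: real^'n) \<subseteq> {k. int_vec k}" by (auto simp: int_vec_def)
  ultimately have "finite (range (\<lambda>n::nat. vec (real n) :: real^'n))" by (rule rev_finite_subset)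
  moreover have "inj (\<lambda>n::nat. vec (real n) :: real^'n)" by (auto simp: inj_def vec_eq_iff)
  ultimately show False by (simp add: finite_image_iff)
qed

lemma suminf_single_nonzero:
  fixes f :: "nat \<Rightarrow> ennreal"
  assumes "\<And>j. j \<noteq> i \<Longrightarrow> f j = 0" shows "(\<Sum>j. f j) = f i"
  using sums_finite[of "{i}" f] assms by (simp add: sums_iff)

text \<open>The cell and its translate by \<open>y\<close> are both fundamental domains of the
  lattice. One is cut along the lattice translates of the other, and moving each piece by a lattice
  vector does not change a periodic integrand.\<close>

lemma nn_integral_torus_translate:
  fixes g :: "real^'n \<Rightarrow> ennreal"
  assumes [measurable]: "g \<in> borel_measurable borel" and per: "zperiodic g"
  shows "(\<integral>\<^sup>+x. g (x + y) \<partial>torus_leb) = (\<integral>\<^sup>+x. g x \<partial>torus_leb)"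
proof -
  define e where "e = from_nat_into {k :: real^'n. int_vec k}"
  have bij: "bij_betw e UNIV {k. int_vec k}"
    unfolding e_def by (intro bij_betw_from_nat_into countable_int_vec infinite_int_vec)
  have e: "int_vec (e j)" for j using bij by (auto simp: bij_betw_def)
  have inj: "e i = e j \<Longrightarrow> i = j" for i j using bij by (auto simp: bij_betw_def inj_def)
  \<comment> \<open>A single term survives, the one at the lattice vector
    \<open>torus_rep x - x\<close>.\<close>
  have ind: "(\<Sum>j. indicator torus_cell (x + e j)) = (1::ennreal)" for x
  proof -
    have "torus_rep x - x \<in> range e" using bij torus_rep_diff by (auto simp: bij_betw_def)
    then obtain i where i: "e i = torus_rep x - x" by (metis imageE)
    have "(\<Sum>j. indicator torus_cell (x + e j)) = (indicator torus_cell (x + e i) :: ennreal)"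
    proof (rule suminf_single_nonzero)
      fix j assume "j \<noteq> i"
      have "x + e j \<notin> torus_cell"
      proof
        assume "x + e j \<in> torus_cell"
        then have "x + e j = torus_rep x" by (rule torus_rep_unique) (simp add: e)
        then have "e j = e i" unfolding i by (metis add_diff_cancel_left')
        then show False using inj \<open>j \<noteq> i\<close> by blast
      qed
      then show "indicator torus_cell (x + e j) = (0::ennreal)" by simp
    qed
    then show ?thesis by (simp add: i torus_rep_in)
  qed
  \<comment> \<open>The same decomposition with the opposite sign: \<open>ind'\<close> inserts the
    pieces, and after each has been shifted by \<open>e j\<close>, \<open>ind\<close> sums them
    up.\<close>
  have ind': "(\<Sum>j. indicator torus_cell (x - e j)) = (1::ennreal)" for x
  proof -
    have "torus_rep x - x \<in> uminus ` range e"
    proof -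
      have "int_vec (x - torus_rep x)" using torus_rep_diff[of x] unfolding int_vec_def
        by (metis Ints_minus minus_diff_eq vector_uminus_component)
      then have "x - torus_rep x \<in> range e" using bij by (auto simp: bij_betw_def)
      then show ?thesis by (metis image_eqI minus_diff_eq)
    qed
    then obtain i where i: "- e i = torus_rep x - x" by auto
    have "(\<Sum>j. indicator torus_cell (x - e j)) = (indicator torus_cell (x - e i) :: ennreal)"
    proof (rule suminf_single_nonzero)
      fix j assume "j \<noteq> i"
      have "x - e j \<notin> torus_cell"
      proof
        assume "x - e j \<in> torus_cell"
        then have xe: "x - e j = torus_rep x"
          by (rule torus_rep_unique) (use e[of j] in \<open>simp add: int_vec_def\<close>)
        then have "e j = x - torus_rep x" using xe[symmetric] by simp
        moreover have "e i = x - torus_rep x" using arg_cong[OF i, of uminus] by simp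
        ultimately have "e j = e i" by simp
        then show False using inj \<open>j \<noteq> i\<close> by blast
      qed
      then show "indicator torus_cell (x - e j) = (0::ennreal)" by simp
    qed
    moreover have "x - e i = torus_rep x" using arg_cong[OF i, of "\<lambda>v. v + x"] by simp
    ultimately show ?thesis by (simp add: torus_rep_in)
  qed
  have shift: "(\<integral>\<^sup>+x. f (c + x) \<partial>lborel) = (\<integral>\<^sup>+x. f x \<partial>lborel)"
    if [measurable]: "f \<in> borel_measurable borel" for f :: "real^'n \<Rightarrow> ennreal" and c
    by (subst (2) lborel_distr_plus[of c, symmetric], subst nn_integral_distr) auto
  have "(\<integral>\<^sup>+x. g (x + y) \<partial>torus_leb) = (\<integral>\<^sup>+x. g (y + x) * indicator torus_cell (y + x - y) \<partial>lborel)"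
    by (subst nn_integral_restrict_space) (auto simp: add.commute)
  also have "\<dots> = (\<integral>\<^sup>+x. g x * indicator torus_cell (x - y) \<partial>lborel)"
    by (rule shift) measurable
  also have "\<dots> = (\<integral>\<^sup>+x. (\<Sum>j. g x * indicator torus_cell (x - y) * indicator torus_cell (x - e j)) \<partial>lborel)"
    by (simp add: ind')
  also have "\<dots> = (\<Sum>j. \<integral>\<^sup>+x. g x * indicator torus_cell (x - y) * indicator torus_cell (x - e j) \<partial>lborel)"
    by (rule nn_integral_suminf) measurable
  also have "\<dots> = (\<Sum>j. \<integral>\<^sup>+x. g (e j + x) * indicator torus_cell (e j + x - y) * indicator torus_cell (e j + x - e j) \<partial>lborel)"
    by (intro suminf_cong shift[symmetric]) measurable
  also have "\<dots> = (\<Sum>j. \<integral>\<^sup>+x. g x * indicator torus_cell (x - y + e j) * indicator torus_cell x \<partial>lborel)"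
    using zperiodicD[OF per e] by (simp add: add.commute algebra_simps)
  also have "\<dots> = (\<integral>\<^sup>+x. (\<Sum>j. g x * indicator torus_cell (x - y + e j) * indicator torus_cell x) \<partial>lborel)"
    by (rule nn_integral_suminf[symmetric]) measurable
  also have "\<dots> = (\<integral>\<^sup>+x. (\<Sum>j. (g x * indicator torus_cell x) * indicator torus_cell (x - y + e j)) \<partial>lborel)"
    by (intro nn_integral_cong suminf_cong) (simp only: ac_simps)
  also have "\<dots> = (\<integral>\<^sup>+x. g x * indicator torus_cell x \<partial>lborel)"
    by (simp add: ind)
  also have "\<dots> = (\<integral>\<^sup>+x. g x \<partial>torus_leb)"
    by (subst nn_integral_restrict_space) auto
  finally show ?thesis .
qed

text \<open>Translation as a measure-preserving map of the cell to itself. In this form it transfers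
  to Bochner integrals without splitting integrands by sign.\<close>

lemma distr_torus_translate:
  "distr torus_leb torus_leb (\<lambda>x. torus_rep (x + y)) = (torus_leb :: (real^'n) measure)" (is "?M = ?N")
proof (rule measure_eqI)
  have m: "(\<lambda>x. torus_rep (x + y)) \<in> measurable torus_leb (torus_leb :: (real^'n) measure)"
    by (rule measurable_restrict_space2) (auto simp: torus_rep_in intro!: restrict_borel_measurable)
  fix A assume A: "A \<in> sets ?M"
  then have A': "A \<in> sets borel" by (auto simp: sets_restrict_space_iff)
  define g :: "real^'n \<Rightarrow> ennreal" where "g x = indicator A (torus_rep x)" for x
  have g: "g \<in> borel_measurable borel" using A' unfolding g_def by measurable
  have per: "zperiodic g"
  proof -
    have "torus_rep (x + k) = torus_rep x" if "\<forall>i. k $ i \<in> \<int>" for x k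
    proof (rule torus_rep_unique[symmetric, OF torus_rep_in])
      show "int_vec (torus_rep x - (x + k))"
        using torus_rep_diff[of x] that Ints_diff unfolding int_vec_def by (fastforce simp: algebra_simps)
    qed
    then show ?thesis unfolding zperiodic_def g_def by metis
  qed
  have "emeasure ?M A = (\<integral>\<^sup>+x. g (x + y) \<partial>torus_leb)"
    using A m by (simp add: nn_integral_distr[symmetric] g_def flip: nn_integral_indicator)
       (subst nn_integral_distr; simp)
  also have "\<dots> = (\<integral>\<^sup>+x. g x \<partial>torus_leb)" by (rule nn_integral_torus_translate[OF g per])
  also have "\<dots> = (\<integral>\<^sup>+x. indicator A x \<partial>torus_leb)"
    by (intro nn_integral_cong) (simp add: g_def torus_rep_id)
  also have "\<dots> = emeasure ?N A" using A by simp
  finally show "emeasure ?M A = emeasure ?N A" .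
qed simp

lemma integral_torus_translate:
  fixes f :: "real^'n \<Rightarrow> real"
  assumes f: "f \<in> borel_measurable borel" and per: "zperiodic f"
  shows "(LINT x|torus_leb. f (x + y)) = (LINT x|torus_leb. f x)"
proof -
  have m: "(\<lambda>x. torus_rep (x + y)) \<in> measurable torus_leb (torus_leb :: (real^'n) measure)"
    by (rule measurable_restrict_space2) (auto simp: torus_rep_in intro!: restrict_borel_measurable)
  have "(LINT x|torus_leb. f x) = (LINT x|distr torus_leb torus_leb (\<lambda>x. torus_rep (x + y)). f x)"
    by (simp add: distr_torus_translate)
  also have "\<dots> = (LINT x|torus_leb. f (torus_rep (x + y)))"
    using f by (intro integral_distr m restrict_borel_measurable)
  also have "\<dots> = (LINT x|torus_leb. f (x + y))"
    by (simp add: zperiodic_rep[OF per])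
  finally show ?thesis by simp
qed

subsection \<open>Smooth periodic functions\<close>

text \<open>The class of test functions freed from compact support in time. Mollified potentials
  belong to it, and its values at t = 0 and t = T are meaningful.\<close>

definition smooth_periodic :: "(real \<times> (real^'n) \<Rightarrow> real) \<Rightarrow> bool" where
  "smooth_periodic \<eta> \<longleftrightarrow> smooth \<eta> \<and> (\<forall>t. zperiodic (\<lambda>x. \<eta> (t, x)))"

lemma test_fun_smooth_periodic: "test_fun T \<eta> \<Longrightarrow> smooth_periodic \<eta>"
  by (auto simp: test_fun_def smooth_periodic_def)

lemma smooth_periodicD: "smooth_periodic \<eta> \<Longrightarrow> smooth \<eta>" "smooth_periodic \<eta> \<Longrightarrow> zperiodic (\<lambda>x. \<eta> (t, x))"
  by (auto simp: smooth_periodic_def)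

lemma zperiodic_comp2: "zperiodic f \<Longrightarrow> zperiodic g \<Longrightarrow> zperiodic (\<lambda>x. h (f x) (g x))"
  by (simp add: zperiodic_def)

lemma zperiodic_comp: "zperiodic f \<Longrightarrow> zperiodic (\<lambda>x. h (f x))"
  by (simp add: zperiodic_def)

lemma smooth_periodic_const: "smooth_periodic (\<lambda>z. c)"
  and smooth_periodic_add: "smooth_periodic f \<Longrightarrow> smooth_periodic g \<Longrightarrow> smooth_periodic (\<lambda>z. f z + g z)"
  and smooth_periodic_mult: "smooth_periodic f \<Longrightarrow> smooth_periodic g \<Longrightarrow> smooth_periodic (\<lambda>z. f z * g z)"
  by (simp_all add: smooth_periodic_def smooth_const smooth_add smooth_diff smooth_mult)
     (simp_all add: zperiodic_def)

lemma smooth_fst: "smooth h \<Longrightarrow> smooth (\<lambda>z :: real \<times> 'a::euclidean_space. h (fst z))" for h :: "real \<Rightarrow> real"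
  by (rule smooth_comp_real[OF _ smooth_bounded_linear]) (auto intro: bounded_linear_fst)

lemma smooth_periodic_fst: "smooth h \<Longrightarrow> smooth_periodic (\<lambda>z. h (fst z))"
  by (simp add: smooth_periodic_def smooth_fst zperiodic_def)

lemma smooth_periodic_snd: "smooth \<theta> \<Longrightarrow> zperiodic \<theta> \<Longrightarrow> smooth_periodic (\<lambda>z. \<theta> (snd z))"
  using smooth_affine[of \<theta> snd 0] by (simp add: smooth_periodic_def bounded_linear_snd)

lemma smooth_slice:
  fixes \<eta> :: "real \<times> 'a::euclidean_space \<Rightarrow> real"
  assumes "smooth \<eta>" shows "smooth (\<lambda>x. \<eta> (t, x))"
proof -
  note assms
  moreover have "bounded_linear (\<lambda>x. (0::real, x::'a))"
    by (intro bounded_linear_Pair bounded_linear_zero bounded_linear_ident)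
  ultimately have "smooth (\<lambda>x. \<eta> ((t, 0) + (0, x)))" by (rule smooth_affine)
  then show ?thesis by simp
qed

lemma d_t_eq: "(f has_derivative f') (at z) \<Longrightarrow> d_t f z = f' (1, 0)"
  and d_x_eq: "(f has_derivative f') (at z) \<Longrightarrow> d_x i f z = f' (0, axis i 1)"
  by (simp_all add: d_t_def d_x_def frechet_derivative_at[symmetric])

lemma smooth_d_t: "smooth f \<Longrightarrow> smooth (d_t f)" and smooth_d_x: "smooth f \<Longrightarrow> smooth (d_x i f)"
  unfolding d_t_def[abs_def] d_x_def[abs_def]
  by (auto intro!: smooth_deriv simp: Basis_prod_def Basis_vec_def Basis_real_def) blast

lemma has_derivative_translate_periodic:
  assumes "smooth_periodic f" "int_vec k"
  shows "frechet_derivative f (at (t, x + k)) = frechet_derivative f (at (t, x))"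
proof -
  have e: "f (z + (0, k)) = f z" for z
    using zperiodicD[OF smooth_periodicD(2)[OF assms(1)] assms(2), of "fst z" "snd z"] by (cases z) simp
  have "((\<lambda>z. f (z + (0, k))) has_derivative frechet_derivative f (at ((t, x) + (0, k)))) (at (t, x))"
    by (rule has_derivative_compose[where f="\<lambda>z. z + (0, k)" and f'="\<lambda>y. y", simplified])
       (auto intro!: derivative_eq_intros smooth_has_derivative[of f] smooth_periodicD assms)
  then show ?thesis by (simp add: e frechet_derivative_at[symmetric])
qed

lemma smooth_periodic_d_t: "smooth_periodic f \<Longrightarrow> smooth_periodic (d_t f)"
  and smooth_periodic_d_x: "smooth_periodic f \<Longrightarrow> smooth_periodic (d_x i f)"
  using has_derivative_translate_periodic[of f]
  by (auto simp: smooth_periodic_def smooth_d_t smooth_d_x zperiodic_def d_t_def d_x_def int_vec_def)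

lemma frechet_derivative_d:
  assumes "smooth f"
  shows "frechet_derivative f (at z) (s, y) = s * d_t f z + y \<bullet> grad_x f z"
proof -
  have l: "linear (frechet_derivative f (at z))"
    by (rule has_derivative_linear[OF smooth_has_derivative[OF assms]])
  have "(s, y) = s *\<^sub>R (1, 0) + (\<Sum>i\<in>UNIV. (y $ i) *\<^sub>R (0, axis i 1))"
  proof -
    have "(\<Sum>i\<in>UNIV. (y $ i) *\<^sub>R (axis i 1)) = y"
      using basis_expansion[of y] by (simp add: scalar_mult_eq_scaleR)
    then show ?thesis by (simp add: prod_eq_iff fst_sum snd_sum)
  qed
  then have "frechet_derivative f (at z) (s, y) = frechet_derivative f (at z) (s *\<^sub>R (1, 0) + (\<Sum>i\<in>UNIV. (y $ i) *\<^sub>R (0, axis i 1)))"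
    by simp
  also have "\<dots> = s * d_t f z + (\<Sum>i\<in>UNIV. y $ i * d_x i f z)"
    by (simp add: linear_add[OF l] linear_sum[OF l] linear_cmul[OF l] d_t_def d_x_def del: scaleR_Pair)
  finally show ?thesis by (simp add: inner_vec_def grad_x_def)
qed

lemma smooth_has_derivative_d:
  "smooth f \<Longrightarrow> (f has_derivative (\<lambda>y. fst y * d_t f z + snd y \<bullet> grad_x f z)) (at z)"
proof -
  assume f: "smooth f"
  have "frechet_derivative f (at z) = (\<lambda>y. fst y * d_t f z + snd y \<bullet> grad_x f z)"
    using frechet_derivative_d[OF f] by (auto simp: fun_eq_iff)
  with smooth_has_derivative[OF f, of z] show ?thesis by simp
qed

lemma inner_axis_grad [simp]: "axis i 1 \<bullet> grad_x f z = d_x i f z"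
  by (simp add: grad_x_def inner_axis')

lemma d_t_mult: "smooth f \<Longrightarrow> smooth g \<Longrightarrow> d_t (\<lambda>z. f z * g z) z = d_t f z * g z + f z * d_t g z"
  and d_x_mult: "smooth f \<Longrightarrow> smooth g \<Longrightarrow> d_x i (\<lambda>z. f z * g z) z = d_x i f z * g z + f z * d_x i g z"
  by (auto dest!: smooth_has_derivative_d[of _ z] simp: d_t_eq[OF has_derivative_mult] d_x_eq[OF has_derivative_mult])

lemma grad_x_mult: "smooth f \<Longrightarrow> smooth g \<Longrightarrow> grad_x (\<lambda>z. f z * g z) z = g z *\<^sub>R grad_x f z + f z *\<^sub>R grad_x g z"
  by (simp add: grad_x_def vec_eq_iff d_x_mult)

lemma smooth_real_DERIV: "smooth h \<Longrightarrow> (h has_real_derivative deriv h t) (at t)" for h :: "real \<Rightarrow> real"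
  using smooth_has_derivative[of h t]
  by (simp add: DERIV_deriv_iff_real_differentiable differentiable_def) blast

lemma smooth_real_deriv: "smooth h \<Longrightarrow> smooth (deriv h)" for h :: "real \<Rightarrow> real"
proof -
  assume h: "smooth h"
  have "frechet_derivative h (at t) = (\<lambda>y. deriv h t * y)" for t
    using smooth_real_DERIV[OF h, of t] by (simp add: has_field_derivative_def frechet_derivative_at[symmetric])
  with smooth_deriv[OF h, of 1] show ?thesis by simp
qed

lemma has_derivative_fst_comp:
  fixes h :: "real \<Rightarrow> real"
  assumes "smooth h"
  shows "((\<lambda>z::real \<times> (real^'n). h (fst z)) has_derivative (\<lambda>y. deriv h (fst z) * fst y)) (at z)"
  by (rule has_derivative_compose[where f=fst and g=h])
     (auto intro: derivative_intros simp: smooth_real_DERIV[OF assms, unfolded has_field_derivative_def])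

lemma d_t_fst: "smooth h \<Longrightarrow> d_t (\<lambda>z. h (fst z)) z = deriv h (fst z)"
  and d_x_fst: "smooth h \<Longrightarrow> d_x i (\<lambda>z. h (fst z)) z = 0"
  and grad_x_fst: "smooth h \<Longrightarrow> grad_x (\<lambda>z. h (fst z)) z = 0" for h :: "real \<Rightarrow> real"
  by (simp_all add: d_t_eq[OF has_derivative_fst_comp] d_x_eq[OF has_derivative_fst_comp] grad_x_def vec_eq_iff)

lemma continuous_smooth_slice: "smooth f \<Longrightarrow> continuous_on S f"
  using smooth_continuous continuous_on_subset by blast

lemma cont_D_smooth_periodic: "smooth_periodic f \<Longrightarrow> cont_D T f"
  by (auto simp: cont_D_def smooth_periodic_def continuous_smooth_slice)

lemma cont_D_grad: "smooth_periodic f \<Longrightarrow> cont_D T (grad_x f)"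
proof -
  assume f: "smooth_periodic f"
  have "cont_D T (d_x i f)" for i by (intro cont_D_smooth_periodic smooth_periodic_d_x f)
  then show ?thesis
    by (auto simp: cont_D_def grad_x_def[abs_def] zperiodic_def intro!: continuous_intros)
qed

lemma cont_D_measurable:
  fixes f :: "real \<times> (real^'n) \<Rightarrow> 'b::{second_countable_topology, metric_space}"
  assumes "cont_D T f"
  shows "f \<in> borel_measurable (D_borel T)" "f \<in> borel_measurable (D_leb T)"
proof -
  have "continuous_on (spacetime T) f"
    using assms by (auto simp: cont_D_def spacetime_def intro: continuous_on_subset)
  then show "f \<in> borel_measurable (D_borel T)"
    by (rule borel_measurable_continuous_on_restrict)
  then show "f \<in> borel_measurable (D_leb T)"
    by (simp cong: measurable_cong_sets add: sets_D_leb)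
qed

text \<open>Periodicity brings each point into the closed unit cube, and that cube times
  \<open>[0,T]\<close> is compact.\<close>

lemma cont_D_bounded:
  fixes f :: "real \<times> (real^'n) \<Rightarrow> 'b::real_normed_vector"
  assumes "cont_D T f"
  obtains B where "B > 0" "\<And>t x. t \<in> {0..T} \<Longrightarrow> norm (f (t, x)) \<le> B"
proof -
  have "compact ({0..T} \<times> cbox (0::real^'n) 1)" by (intro compact_Times compact_Icc compact_cbox)
  moreover have "continuous_on ({0..T} \<times> cbox (0::real^'n) 1) f"
    using assms by (auto simp: cont_D_def intro: continuous_on_subset)
  ultimately have "bounded (f ` ({0..T} \<times> cbox 0 1))" by (metis compact_continuous_image compact_imp_bounded)
  then obtain B where B: "B > 0" "\<And>z. z \<in> {0..T} \<times> cbox 0 1 \<Longrightarrow> norm (f z) \<le> B"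
    unfolding bounded_pos by auto
  have "norm (f (t, x)) \<le> B" if "t \<in> {0..T}" for t x
  proof -
    have "zperiodic (\<lambda>x. f (t, x))" using assms that by (simp add: cont_D_def)
    from zperiodic_rep[OF this, of x] have "f (t, x) = f (t, torus_rep x)" by simp
    moreover have "torus_rep x \<in> cbox 0 1"
      using torus_rep_in[of x] by (auto simp: torus_cell_def mem_box_cart less_imp_le)
    ultimately show ?thesis using B(2)[of "(t, torus_rep x)"] that by simp
  qed
  with B(1) show ?thesis by (rule that)
qed

text \<open>Uniformity over unbounded space follows by moving both points with the same lattice
  vector into one fixed compact cube.\<close>

lemma cont_D_uniform:
  fixes f :: "real \<times> (real^'n) \<Rightarrow> real"
  assumes "cont_D T f" "e > 0"
  obtains d where "d > 0" "\<And>s t x y. s \<in> {0..T} \<Longrightarrow> t \<in> {0..T} \<Longrightarrow> \<bar>s - t\<bar> < d \<Longrightarrow> dist x y < d \<Longrightarrow> \<bar>f (s, x) - f (t, y)\<bar> < e"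
proof -
  \<comment> \<open>The vector that puts \<open>x\<close> in the cell need not put \<open>y\<close>
    there. The cube with corners -1 and 2 leaves a margin of one on every side.\<close>
  let ?K = "{0..T} \<times> cbox (- 1) (2::real^'n)"
  have "compact ?K" by (intro compact_Times compact_Icc compact_cbox)
  moreover have "continuous_on ?K f"
    using assms by (auto simp: cont_D_def intro: continuous_on_subset)
  ultimately have "uniformly_continuous_on ?K f" by (simp add: compact_uniformly_continuous)
  then obtain d where d: "d > 0" "\<And>z w. z \<in> ?K \<Longrightarrow> w \<in> ?K \<Longrightarrow> dist w z < d \<Longrightarrow> dist (f w) (f z) < e"
    using \<open>e > 0\<close> unfolding uniformly_continuous_on_def by meson
  \<comment> \<open>Half of \<open>d\<close> goes to the time distance and half to the space
    distance; the cap at 1 keeps \<open>y\<close> inside the enlarged cube.\<close>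
  define d' where "d' = min (d / 2) 1"
  show ?thesis
  proof (rule that)
    show "d' > 0" using d by (simp add: d'_def)
    fix s t and x y :: "real^'n"
    assume st: "s \<in> {0..T}" "t \<in> {0..T}" "\<bar>s - t\<bar> < d'" and xy: "dist x y < d'"
    define k where "k = torus_rep x - x"
    have k: "int_vec k" unfolding k_def by (rule torus_rep_diff)
    have e: "f (s, x) = f (s, x + k)" "f (t, y) = f (t, y + k)"
      using assms st zperiodicD[OF _ k, of "\<lambda>x. f (s, x)" x] zperiodicD[OF _ k, of "\<lambda>x. f (t, x)" y]
      by (auto simp: cont_D_def)
    have x: "x + k \<in> torus_cell" by (simp add: k_def torus_rep_in)
    have c: "\<bar>(x + k) $ i - (y + k) $ i\<bar> \<le> dist x y" for i
      using component_le_norm_cart[of "x - y" i] by (simp add: dist_norm)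
    have xi: "0 \<le> (x + k) $ i" "(x + k) $ i < 1" for i using x by (auto simp: torus_cell_def)
    have 1: "(s, x + k) \<in> ?K"
      unfolding mem_Times_iff mem_box_cart
    proof (intro conjI allI; simp only: fst_conv snd_conv)
      show "s \<in> {0..T}" by fact
      fix i
      from xi[of i] show "(- 1 :: real^'n) $ i \<le> (x + k) $ i" "(x + k) $ i \<le> (2 :: real^'n) $ i"
        by auto
    qed
    have 2: "(t, y + k) \<in> ?K"
      unfolding mem_Times_iff mem_box_cart
    proof (intro conjI allI; simp only: fst_conv snd_conv)
      show "t \<in> {0..T}" by fact
      fix i
      from xi[of i] c[of i] xy show "(- 1 :: real^'n) $ i \<le> (y + k) $ i" "(y + k) $ i \<le> (2 :: real^'n) $ i"
        by (auto simp: d'_def)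
    qed
    have "dist (s, x + k) (t, y + k) \<le> \<bar>s - t\<bar> + dist x y"
      using norm_Pair_le[of "s - t" "x - y"] by (simp add: dist_norm)
    also have "\<dots> < d" using st xy by (simp add: d'_def)
    finally show "\<bar>f (s, x) - f (t, y)\<bar> < e"
      using d(2)[OF 2 1] by (simp add: e dist_real_def)
  qed
qed

lemma (in finite_measure) integrable_bounded:
  fixes f :: "'a \<Rightarrow> 'b::{banach, second_countable_topology}"
  assumes "f \<in> borel_measurable M" "\<And>x. x \<in> space M \<Longrightarrow> norm (f x) \<le> B"
  shows "integrable M f"
  using assms by (intro integrable_const_bound[of _ B]) auto

lemma integrable_cont_D:
  fixes f :: "real \<times> (real^'n) \<Rightarrow> 'b::{banach, second_countable_topology}"
  assumes "cont_D T f" "finite_measure M" "sets M = sets (D_borel T)"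
  shows "integrable M f"
proof -
  obtain B where "B > 0" "\<And>t x. t \<in> {0..T} \<Longrightarrow> norm (f (t, x)) \<le> B"
    using cont_D_bounded[OF assms(1)] by blast
  moreover have "space M = spacetime T" using sets_eq_imp_space_eq[OF assms(3)] by simp
  moreover have "f \<in> borel_measurable M"
    using cont_D_measurable(1)[OF assms(1)] by (simp cong: measurable_cong_sets add: assms(3))
  ultimately show ?thesis
    by (intro finite_measure.integrable_bounded[OF assms(2), of _ B]) (auto simp: spacetime_def)
qed

lemma cont_torus_cont_D: "cont_torus \<theta> \<Longrightarrow> cont_D T (\<lambda>z. \<theta> (snd z))"
proof -
  assume \<theta>: "cont_torus \<theta>"
  have "continuous_on S (\<lambda>z. \<theta> (snd z))" for S :: "(real \<times> (real^'a)) set"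
    by (rule continuous_on_compose2[of UNIV \<theta>]) (use \<theta> in \<open>auto simp: cont_torus_def intro!: continuous_intros\<close>)
  then show ?thesis using \<theta> by (simp add: cont_D_def cont_torus_def)
qed

lemma cont_torus_smooth: "smooth \<theta> \<Longrightarrow> zperiodic \<theta> \<Longrightarrow> cont_torus \<theta>"
  by (simp add: cont_torus_def smooth_continuous)

lemma cont_torus_slice: "smooth_periodic f \<Longrightarrow> cont_torus (\<lambda>x. f (t, x))"
  by (intro cont_torus_smooth smooth_slice smooth_periodicD)

lemma cont_D_slice: "cont_D T f \<Longrightarrow> t \<in> {0..T} \<Longrightarrow> cont_torus (\<lambda>x. f (t, x))"
  unfolding cont_D_def cont_torus_def
  by (auto intro!: continuous_on_compose2[of _ f UNIV "\<lambda>x. (t, x)"] continuous_intros)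

lemma cont_torus_measurable: "cont_torus \<theta> \<Longrightarrow> \<theta> \<in> borel_measurable borel"
  by (auto simp: cont_torus_def intro: borel_measurable_continuous_onI)

lemma cont_torus_bounded:
  assumes "cont_torus \<theta>" obtains B where "B > 0" "\<And>x. \<bar>\<theta> x\<bar> \<le> B"
proof -
  obtain B where B: "B > 0" "\<And>t x. t \<in> {0..1} \<Longrightarrow> norm (\<theta> (snd (t::real, x))) \<le> B"
    using cont_D_bounded[OF cont_torus_cont_D[OF assms]] by blast
  have "\<bar>\<theta> x\<bar> \<le> B" for x using B(2)[of 0 x] by simp
  with B(1) show ?thesis by (rule that)
qed

lemma integrable_cont_torus:
  fixes M :: "(real^'n) measure"
  assumes "cont_torus \<theta>" "finite_measure M" "sets M = sets torus_borel"
  shows "integrable M \<theta>"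
proof -
  obtain B where "\<And>x. \<bar>\<theta> x\<bar> \<le> B" by (rule cont_torus_bounded[OF assms(1)]) blast
  moreover have "\<theta> \<in> borel_measurable M"
    using restrict_borel_measurable(1)[OF cont_torus_measurable[OF assms(1)]]
    by (simp cong: measurable_cong_sets add: assms(3))
  ultimately show ?thesis
    by (intro finite_measure.integrable_bounded[OF assms(2), of _ B]) auto
qed

subsection \<open>Integration by parts on the torus\<close>

text \<open>Difference quotients have integral zero by translation invariance. By the mean value
  theorem each of them is a value of the derivative, so the bound of the derivative dominates them
  in the limit.\<close>

lemma integral_torus_d_x:
  fixes g :: "real \<times> (real^'n) \<Rightarrow> real"
  assumes g: "smooth_periodic g"
  shows "(LINT x|torus_leb. d_x i g (t, x)) = 0"
proof -
  interpret prob_space "torus_leb :: (real^'n) measure" by (rule prob_space_torus_leb)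
  define G where "G x = g (t, x)" for x
  have G: "cont_torus G" unfolding G_def[abs_def] by (rule cont_torus_slice[OF g])
  obtain B where B: "\<And>x. \<bar>d_x i g (t, x)\<bar> \<le> B"
    by (rule cont_torus_bounded[OF cont_torus_slice[OF smooth_periodic_d_x[OF g, of i], of t]]) blast
  have der: "((\<lambda>s. G (x + s *\<^sub>R axis i 1)) has_real_derivative d_x i g (t, x + s *\<^sub>R axis i 1)) (at s)" for x s
  proof -
    have 1: "((\<lambda>s. (t, x + s *\<^sub>R axis i 1)) has_derivative (\<lambda>h. (0, h *\<^sub>R axis i 1))) (at s)"
      by (auto intro!: derivative_eq_intros)
    have "((\<lambda>s. g (t, x + s *\<^sub>R axis i 1)) has_derivative (\<lambda>h. h * d_x i g (t, x + s *\<^sub>R axis i 1))) (at s)"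
      using has_derivative_compose[OF 1 smooth_has_derivative_d[OF smooth_periodicD(1)[OF g]]]
      by simp
    moreover have "(\<lambda>h. h * d_x i g (t, x + s *\<^sub>R axis i 1)) = (*) (d_x i g (t, x + s *\<^sub>R axis i 1))"
      by (auto simp: fun_eq_iff)
    ultimately show ?thesis unfolding has_field_derivative_def G_def by simp
  qed
  define s where "s n = 1 / real (Suc n)" for n
  define F where "F n x = (G (x + s n *\<^sub>R axis i 1) - G x) / s n" for n x
  have s: "s n > 0" for n by (simp add: s_def)
  have slim: "s \<longlonglongrightarrow> 0" unfolding s_def using LIMSEQ_inverse_real_of_nat by (simp add: inverse_eq_divide)
  have Gm: "G \<in> borel_measurable borel" by (rule cont_torus_measurable[OF G])
  have per: "zperiodic G" using G by (simp add: cont_torus_def)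
  have Gi: "integrable torus_leb G"
    by (rule integrable_cont_torus[OF G finite_measure_axioms sets_torus_leb])
  have Gs: "cont_torus (\<lambda>x. G (x + y))" for y
  proof -
    have "zperiodic (\<lambda>x. G (x + y))" using per unfolding zperiodic_def by (metis add.commute add.left_commute)
    moreover have "continuous_on UNIV (\<lambda>x. G (x + y))"
      using G by (auto simp: cont_torus_def intro!: continuous_on_compose2[of UNIV G] continuous_intros)
    ultimately show ?thesis by (simp add: cont_torus_def)
  qed
  have Gsi: "integrable torus_leb (\<lambda>x. G (x + y))" for y
    by (rule integrable_cont_torus[OF Gs finite_measure_axioms sets_torus_leb])
  have F0: "(LINT x|torus_leb. F n x) = 0" for n
    unfolding F_def using Gi Gsi integral_torus_translate[OF Gm per] by simp
  have "(\<lambda>n. LINT x|torus_leb. F n x) \<longlonglongrightarrow> (LINT x|torus_leb. d_x i g (t, x))"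
  proof (rule integral_dominated_convergence[where w="\<lambda>_. B"])
    show "(\<lambda>x. d_x i g (t, x)) \<in> borel_measurable torus_leb"
      by (intro restrict_borel_measurable cont_torus_measurable cont_torus_slice smooth_periodic_d_x g)
    show "F n \<in> borel_measurable torus_leb" for n
      unfolding F_def[abs_def] using Gi Gsi by (intro borel_measurable_integrable) auto
    show "AE x in torus_leb. (\<lambda>n. F n x) \<longlonglongrightarrow> d_x i g (t, x)"
    proof (rule AE_I2)
      fix x
      have "((\<lambda>h. (G (x + h *\<^sub>R axis i 1) - G x) / h) \<longlongrightarrow> d_x i g (t, x)) (at 0)"
        using der[of x 0] by (simp add: DERIV_def)
      moreover have "filterlim s (at 0) sequentially"
        using slim s by (auto simp: filterlim_at intro!: always_eventually) (metis less_irrefl)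
      ultimately show "(\<lambda>n. F n x) \<longlonglongrightarrow> d_x i g (t, x)"
        unfolding F_def by (rule filterlim_compose)
    qed
    show "AE x in torus_leb. norm (F n x) \<le> B" for n
    proof (rule AE_I2)
      fix x
      obtain z where "G (x + s n *\<^sub>R axis i 1) - G (x + 0 *\<^sub>R axis i 1) = (s n - 0) * d_x i g (t, x + z *\<^sub>R axis i 1)"
        using MVT2[OF s[of n], of "\<lambda>s. G (x + s *\<^sub>R axis i 1)" "\<lambda>z. d_x i g (t, x + z *\<^sub>R axis i 1)"] der by blast
      then have "F n x = d_x i g (t, x + z *\<^sub>R axis i 1)" using s[of n] by (simp add: F_def field_simps)
      then show "norm (F n x) \<le> B" using B by simp
    qed
  qed simp
  then show ?thesis using F0 by (simp add: LIMSEQ_const_iff)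
qed

lemma integral_D_d_x:
  fixes g :: "real \<times> (real^'n) \<Rightarrow> real"
  assumes g: "smooth_periodic g" and T: "T \<ge> 0"
  shows "(LINT z|D_leb T. d_x i g z) = 0"
proof -
  have "integrable (D_leb T) (d_x i g)"
    by (rule integrable_cont_D[OF cont_D_smooth_periodic[OF smooth_periodic_d_x[OF g]] finite_measure_D_leb[OF T] sets_D_leb])
  then show ?thesis by (simp add: integral_D_leb(1) integral_torus_d_x[OF g])
qed

lemma integrable_smooth_periodic:
  fixes g :: "real \<times> (real^'n) \<Rightarrow> real"
  assumes "smooth_periodic g" "T \<ge> 0" shows "integrable (D_leb T) g"
  by (rule integrable_cont_D[OF cont_D_smooth_periodic[OF assms(1)] finite_measure_D_leb[OF assms(2)] sets_D_leb])

lemma integral_by_parts_D: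
  fixes f g :: "real \<times> (real^'n) \<Rightarrow> real"
  assumes f: "smooth_periodic f" and g: "smooth_periodic g" and T: "T \<ge> 0"
  shows "(LINT z|D_leb T. f z * d_x i g z) = - (LINT z|D_leb T. d_x i f z * g z)"
proof -
  have "(LINT z|D_leb T. d_x i (\<lambda>z. f z * g z) z) = 0"
    by (intro integral_D_d_x smooth_periodic_mult f g T)
  also have "d_x i (\<lambda>z. f z * g z) = (\<lambda>z. d_x i f z * g z + f z * d_x i g z)"
    using f g by (auto simp: d_x_mult smooth_periodicD)
  also have "(LINT z|D_leb T. d_x i f z * g z + f z * d_x i g z) =
     (LINT z|D_leb T. d_x i f z * g z) + (LINT z|D_leb T. f z * d_x i g z)"
    by (intro Bochner_Integration.integral_add integrable_smooth_periodic smooth_periodic_mult smooth_periodic_d_x f g T)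
  finally show ?thesis by simp
qed

lemma Green_D:
  fixes f g :: "real \<times> (real^'n) \<Rightarrow> real"
  assumes f: "smooth_periodic f" and g: "smooth_periodic g" and T: "T \<ge> 0"
  shows "(LINT z|D_leb T. f z * lap_x g z) = - (LINT z|D_leb T. grad_x f z \<bullet> grad_x g z)"
proof -
  have "(LINT z|D_leb T. f z * lap_x g z) = (LINT z|D_leb T. (\<Sum>i\<in>UNIV. f z * d_x i (d_x i g) z))"
    by (simp add: lap_x_def sum_distrib_left)
  also have "\<dots> = (\<Sum>i\<in>UNIV. LINT z|D_leb T. f z * d_x i (d_x i g) z)"
    by (intro Bochner_Integration.integral_sum integrable_smooth_periodic smooth_periodic_mult smooth_periodic_d_x f g T)
  also have "\<dots> = (\<Sum>i\<in>UNIV. - (LINT z|D_leb T. d_x i f z * d_x i g z))"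
    by (intro sum.cong refl integral_by_parts_D smooth_periodic_d_x f g T)
  also have "\<dots> = - (LINT z|D_leb T. (\<Sum>i\<in>UNIV. d_x i f z * d_x i g z))"
    unfolding sum_negf
    by (subst Bochner_Integration.integral_sum)
       (auto intro!: integrable_smooth_periodic smooth_periodic_mult smooth_periodic_d_x f g T)
  finally show ?thesis by (simp add: grad_x_def inner_vec_def)
qed

subsection \<open>Cutoffs in time\<close>

lemma deriv_step_outside: "u < 0 \<or> u > 1 \<Longrightarrow> deriv step u = 0"
proof (erule disjE)
  assume "u < 0"
  then have "(step has_real_derivative 0) (at u)"
    using has_field_derivative_transform_within_open[OF DERIV_const, of "{..<0}" u 0 step] by simp
  then show ?thesis by (rule DERIV_imp_deriv)
next
  assume "u > 1"
  then have "(step has_real_derivative 0) (at u)"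
    using has_field_derivative_transform_within_open[OF DERIV_const, of "{1<..}" u 1 step] by simp
  then show ?thesis by (rule DERIV_imp_deriv)
qed

lemma continuous_deriv_step: "continuous_on UNIV (deriv step)"
  by (intro smooth_continuous smooth_real_deriv smooth_step)

lemma deriv_step_bounded: obtains B where "B > 0" "\<And>u. \<bar>deriv step u\<bar> \<le> B * indicator {0..1} u"
proof -
  have "bounded (deriv step ` {0..1})"
    by (intro compact_imp_bounded compact_continuous_image compact_Icc continuous_on_subset[OF continuous_deriv_step]) auto
  then obtain B where B: "B > 0" "\<And>u. u \<in> {0..1} \<Longrightarrow> \<bar>deriv step u\<bar> \<le> B"
    unfolding bounded_pos by auto
  have "\<bar>deriv step u\<bar> \<le> B * indicator {0..1} u" for u
    using B(2)[of u] deriv_step_outside[of u] by (cases "u \<in> {0..1}") auto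
  with B(1) show ?thesis by (rule that)
qed

lemma integral_deriv_step: "(LINT u|lborel. deriv step u) = 1"
proof -
  have "(LINT u|lborel. deriv step u * indicator {0..1} u) = step 1 - step 0"
    using continuous_deriv_step
    by (intro integral_FTC_Icc_real) (auto intro: smooth_real_DERIV smooth_step simp: continuous_on_eq_continuous_at)
  moreover have "deriv step u * indicator {0..1} u = deriv step u" for u
    using deriv_step_outside[of u] by (cases "u \<in> {0..1}") auto
  ultimately show ?thesis by simp
qed

text \<open>After rescaling, the derivative of a cutoff becomes the fixed function
  \<open>deriv step\<close>, of total integral one and supported in \<open>[0,1]\<close>, so the
  integral samples \<open>H\<close> ever closer to \<open>c\<close>. The offset in
  \<open>u + 1\<close> matches cutoffs whose ramp starts one width away from the end.\<close>

lemma tendsto_integral_deriv_step: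
  fixes H :: "real \<Rightarrow> real"
  assumes H: "H \<in> borel_measurable borel" "\<And>t. \<bar>H t\<bar> \<le> C"
    and lim: "\<And>u. u \<in> {0..1} \<Longrightarrow> (\<lambda>n. H (c + d n * (u + 1))) \<longlonglongrightarrow> l"
  shows "(\<lambda>n. LINT u|lborel. deriv step u * H (c + d n * (u + 1))) \<longlonglongrightarrow> l"
proof -
  obtain B where B: "B > 0" "\<And>u. \<bar>deriv step u\<bar> \<le> B * indicator {0..1} u" by (rule deriv_step_bounded) blast
  have C: "C \<ge> 0" using H(2)[of 0] by linarith
  have [measurable]: "deriv step \<in> borel_measurable borel"
    by (rule borel_measurable_continuous_onI[OF continuous_deriv_step])
  note [measurable] = H(1)
  have "(\<lambda>n. LINT u|lborel. deriv step u * H (c + d n * (u + 1))) \<longlonglongrightarrow> (LINT u|lborel. deriv step u * l)"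
  proof (rule integral_dominated_convergence[where w="\<lambda>u. B * C * indicator {0..1} u"])
    show "AE u in lborel. (\<lambda>n. deriv step u * H (c + d n * (u + 1))) \<longlonglongrightarrow> deriv step u * l"
    proof (rule AE_I2)
      fix u show "(\<lambda>n. deriv step u * H (c + d n * (u + 1))) \<longlonglongrightarrow> deriv step u * l"
      proof (cases "u \<in> {0..1}")
        case True then show ?thesis by (intro tendsto_mult_left lim)
      next
        case False then show ?thesis using deriv_step_outside[of u] by auto
      qed
    qed
    show "AE u in lborel. norm (deriv step u * H (c + d n * (u + 1))) \<le> B * C * indicator {0..1} u" for n
    proof (rule AE_I2)
      fix u
      have "\<bar>deriv step u\<bar> * \<bar>H (c + d n * (u + 1))\<bar> \<le> (B * indicator {0..1} u) * C"
        by (intro mult_mono B H(2)) (use B C in \<open>auto simp: indicator_def\<close>)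
      then show "norm (deriv step u * H (c + d n * (u + 1))) \<le> B * C * indicator {0..1} u"
        by (simp add: abs_mult mult_ac)
    qed
  qed (simp_all, measurable)
  then show ?thesis by (simp add: integral_deriv_step)
qed

lemma smooth_affine_real: "smooth h \<Longrightarrow> smooth (\<lambda>t. h (a + k * t))" for h :: "real \<Rightarrow> real"
  by (rule smooth_affine) (auto intro: bounded_linear_mult_right)

text \<open>The last property is the one that produces boundary terms: the derivatives of the
  cutoffs tend to a unit mass at \<open>a\<close> minus a unit mass at \<open>b\<close>.\<close>

lemma cutoff_exists:
  fixes a b T :: real
  assumes ab: "0 \<le> a" "a < b" "b \<le> T"
  obtains \<zeta> :: "nat \<Rightarrow> real \<Rightarrow> real" where
    "\<And>n. smooth (\<zeta> n)" "\<And>n t. 0 \<le> \<zeta> n t" "\<And>n t. \<zeta> n t \<le> 1"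
    "\<And>n. \<exists>a' b'. a < a' \<and> a' < b' \<and> b' < b \<and> (\<forall>t. t \<notin> {a'..b'} \<longrightarrow> \<zeta> n t = 0)"
    "\<And>t. (\<lambda>n. \<zeta> n t) \<longlonglongrightarrow> indicator {a<..<b} t"
    "\<And>h :: real \<Rightarrow> real. continuous_on {a..b} h \<Longrightarrow> (\<lambda>n. LINT t|time_leb T. deriv (\<zeta> n) t * h t) \<longlonglongrightarrow> h a - h b"
proof -
  \<comment> \<open>The ramps lie at distances between \<open>1 / K n\<close> and
    \<open>2 / K n\<close> from the ends. The summand \<open>4 / (b - a)\<close> keeps them disjoint
    for every \<open>n\<close>, and the summand \<open>n\<close> lets them collapse onto the
    ends.\<close>
  define K where "K n = 4 / (b - a) + real n" for n
  have K: "K n > 0" "K n * (b - a) \<ge> 4" for n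
  proof -
    show "K n > 0" using ab by (auto simp: K_def intro!: add_pos_nonneg)
    have "b - a \<noteq> 0" using ab by simp
    then have "4 / (b - a) * (b - a) = 4" by (rule nonzero_eq_divide_eq[THEN iffD1, OF _ refl, symmetric, THEN sym])
    then have "K n * (b - a) = 4 + real n * (b - a)" by (simp only: K_def distrib_right)
    then show "K n * (b - a) \<ge> 4" using ab by simp
  qed
  \<comment> \<open>The \<open>- 1\<close> delays each ramp by one width, which makes the support
    compact inside the open interval.\<close>
  define \<zeta> where "\<zeta> n t = step (K n * (t - a) - 1) * step (K n * (b - t) - 1)" for n t
  have s1: "smooth (\<lambda>t. step (K n * (t - a) - 1))" for n
    using smooth_affine_real[OF smooth_step, of "- K n * a - 1" "K n"] by (simp add: algebra_simps)
  have s2: "smooth (\<lambda>t. step (K n * (b - t) - 1))" for n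
    using smooth_affine_real[OF smooth_step, of "K n * b - 1" "- K n"] by (simp add: algebra_simps)
  \<comment> \<open>Wherever the derivative of one factor is nonzero the other factor equals 1,
    because the arguments of the two steps add up to at least 2.\<close>
  have dchi: "deriv (\<zeta> n) t = K n * deriv step (K n * (t - a) - 1) - K n * deriv step (K n * (b - t) - 1)" for n t
  proof -
    have sd: "(step has_real_derivative deriv step u) (at u)" for u by (rule smooth_real_DERIV[OF smooth_step])
    have d1: "((\<lambda>t. step (K n * (t - a) - 1)) has_real_derivative deriv step (K n * (t - a) - 1) * K n) (at t)"
      by (rule DERIV_chain2[OF sd]) (auto intro!: derivative_eq_intros)
    have d2: "((\<lambda>t. step (K n * (b - t) - 1)) has_real_derivative deriv step (K n * (b - t) - 1) * (- K n)) (at t)"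
      by (rule DERIV_chain2[OF sd]) (auto intro!: derivative_eq_intros)
    have "deriv (\<zeta> n) t = deriv step (K n * (t - a) - 1) * K n * step (K n * (b - t) - 1)
       + deriv step (K n * (b - t) - 1) * (- K n) * step (K n * (t - a) - 1)"
      unfolding \<zeta>_def[abs_def] by (rule DERIV_imp_deriv[OF DERIV_mult[OF d1 d2]])
    moreover have sum: "(K n * (t - a) - 1) + (K n * (b - t) - 1) = K n * (b - a) - 2"
      by (simp add: algebra_simps)
    have "deriv step (K n * (t - a) - 1) * step (K n * (b - t) - 1) = deriv step (K n * (t - a) - 1)"
      using deriv_step_outside[of "K n * (t - a) - 1"] K(2)[of n] sum
      by (cases "K n * (t - a) - 1 > 1") (auto intro!: step_1)
    moreover have "deriv step (K n * (b - t) - 1) * step (K n * (t - a) - 1) = deriv step (K n * (b - t) - 1)"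
      using deriv_step_outside[of "K n * (b - t) - 1"] K(2)[of n] sum
      by (cases "K n * (b - t) - 1 > 1") (auto intro!: step_1)
    ultimately show ?thesis by (metis (no_types, lifting) mult.assoc mult.commute mult_minus_right uminus_add_conv_diff add.commute)
  qed
  show ?thesis
  proof (rule that[of \<zeta>])
    show "smooth (\<zeta> n)" for n unfolding \<zeta>_def[abs_def] by (intro smooth_mult s1 s2)
    show "0 \<le> \<zeta> n t" for n t by (simp add: \<zeta>_def step_nonneg)
    show "\<zeta> n t \<le> 1" for n t unfolding \<zeta>_def by (intro mult_le_one step_nonneg step_le_1)
    show "\<exists>a' b'. a < a' \<and> a' < b' \<and> b' < b \<and> (\<forall>t. t \<notin> {a'..b'} \<longrightarrow> \<zeta> n t = 0)" for n
    proof (intro exI conjI allI impI)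
      show "a < a + 1 / K n" "b - 1 / K n < b" using K by auto
      have "1 / K n \<le> (b - a) / 4" using K(1,2)[of n] by (simp add: field_simps)
      then show "a + 1 / K n < b - 1 / K n" using ab by argo
      fix t assume "t \<notin> {a + 1 / K n..b - 1 / K n}"
      then have "K n * (t - a) - 1 \<le> 0 \<or> K n * (b - t) - 1 \<le> 0" using K(1)[of n] by (auto simp: field_simps)
      then show "\<zeta> n t = 0" by (auto simp: \<zeta>_def)
    qed
    show "(\<lambda>n. \<zeta> n t) \<longlonglongrightarrow> indicator {a<..<b} t" for t
    proof (cases "t \<in> {a<..<b}")
      case True
      define m where "m = min (t - a) (b - t)"
      have m: "m > 0" using True by (simp add: m_def)
      obtain N :: nat where N: "real N \<ge> 2 / m" using real_arch_simple by blast
      have "\<zeta> n t = 1" if "n \<ge> N" for n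
      proof -
        have "K n \<ge> 2 / m" using N that ab by (simp add: K_def add_increasing)
        then have Km: "K n * m \<ge> 2" using m by (simp add: field_simps)
        have "K n * m \<le> K n * (t - a)" "K n * m \<le> K n * (b - t)"
          using K(1)[of n] by (auto simp: m_def intro!: mult_left_mono)
        with Km show ?thesis by (simp add: \<zeta>_def)
      qed
      then have "\<forall>\<^sub>F n in sequentially. \<zeta> n t = indicator {a<..<b} t"
        using True by (auto simp: eventually_sequentially intro!: exI[of _ N])
      then show ?thesis by (rule tendsto_eventually)
    next
      case False
      have "\<zeta> n t = 0" for n
      proof -
        have "K n * (t - a) \<le> 0 \<or> K n * (b - t) \<le> 0"
          using False K(1)[of n] by (auto simp: mult_le_0_iff)
        then show ?thesis by (auto simp: \<zeta>_def)
      qed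
      then show ?thesis using False by simp
    qed
    fix h :: "real \<Rightarrow> real" assume h: "continuous_on {a..b} h"
    \<comment> \<open>Only the values of \<open>h\<close> on \<open>[a,b]\<close> are controlled, so
      \<open>h\<close> is extended by zero before the substitution on the whole line.\<close>
    define H where "H t = indicator {a..b} t * h t" for t
    have Hm [measurable]: "H \<in> borel_measurable borel"
      using borel_measurable_continuous_on_indicator[OF _ h] by (simp add: H_def[abs_def])
    obtain C where C: "\<And>t. \<bar>H t\<bar> \<le> C"
    proof -
      have "bounded (h ` {a..b})" by (intro compact_imp_bounded compact_continuous_image h compact_Icc)
      then obtain C where C: "C > 0" "\<And>t. t \<in> {a..b} \<Longrightarrow> \<bar>h t\<bar> \<le> C" unfolding bounded_pos by auto
      have "\<bar>H t\<bar> \<le> C" for t using C by (auto simp: H_def indicator_def)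
      then show ?thesis by (rule that)
    qed
    have Klim: "(\<lambda>n. 1 / K n) \<longlonglongrightarrow> 0"
    proof -
      have "filterlim K at_top sequentially"
        unfolding K_def by (intro filterlim_tendsto_add_at_top[OF tendsto_const] filterlim_real_sequentially)
      then show ?thesis using tendsto_inverse_0_at_top by (simp add: inverse_eq_divide)
    qed
    have Kle: "1 / K n * (u + 1) \<le> b - a" "0 \<le> 1 / K n * (u + 1)" if "u \<in> {0..1}" for n u
      using K[of n] that by (auto simp: field_simps)
    have lim1: "(\<lambda>n. LINT u|lborel. deriv step u * H (a + 1 / K n * (u + 1))) \<longlonglongrightarrow> h a"
    proof (rule tendsto_integral_deriv_step[OF Hm C])
      fix u :: real assume u: "u \<in> {0..1}"
      have "(\<lambda>n. a + 1 / K n * (u + 1)) \<longlonglongrightarrow> a + 0 * (u + 1)"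
        by (intro tendsto_add tendsto_mult tendsto_minus tendsto_const Klim)
      then have "(\<lambda>n. a + 1 / K n * (u + 1)) \<longlonglongrightarrow> a" by simp
      from continuous_on_tendsto_compose[OF h this] have "(\<lambda>n. h (a + 1 / K n * (u + 1))) \<longlonglongrightarrow> h a"
        using Kle[OF u] ab by (auto simp: algebra_simps)
      moreover have "H (a + 1 / K n * (u + 1)) = h (a + 1 / K n * (u + 1))" for n
        using Kle[OF u, of n] unfolding H_def by (simp add: indicator_def algebra_simps)
      ultimately show "(\<lambda>n. H (a + 1 / K n * (u + 1))) \<longlonglongrightarrow> h a" by simp
    qed
    have lim2: "(\<lambda>n. LINT u|lborel. deriv step u * H (b + (- (1 / K n)) * (u + 1))) \<longlonglongrightarrow> h b"
    proof (rule tendsto_integral_deriv_step[OF Hm C])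
      fix u :: real assume u: "u \<in> {0..1}"
      have "(\<lambda>n. b + (- (1 / K n)) * (u + 1)) \<longlonglongrightarrow> b + (- 0) * (u + 1)"
        by (intro tendsto_add tendsto_mult tendsto_minus tendsto_const Klim)
      then have "(\<lambda>n. b + (- (1 / K n)) * (u + 1)) \<longlonglongrightarrow> b" by simp
      from continuous_on_tendsto_compose[OF h this] have "(\<lambda>n. h (b + (- (1 / K n)) * (u + 1))) \<longlonglongrightarrow> h b"
        using Kle[OF u] ab by (auto simp: algebra_simps)
      moreover have "H (b + (- (1 / K n)) * (u + 1)) = h (b + (- (1 / K n)) * (u + 1))" for n
        using Kle[OF u, of n] unfolding H_def by (simp add: indicator_def algebra_simps)
      ultimately show "(\<lambda>n. H (b + (- (1 / K n)) * (u + 1))) \<longlonglongrightarrow> h b" by simp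
    qed
    have [measurable]: "deriv step \<in> borel_measurable borel"
      by (rule borel_measurable_continuous_onI[OF continuous_deriv_step])
    obtain B where B: "B > 0" "\<And>u. \<bar>deriv step u\<bar> \<le> B * indicator {0..1} u" by (rule deriv_step_bounded) blast
    have int: "integrable lborel (\<lambda>t. deriv step (g t) * H t)" if [measurable]: "g \<in> borel_measurable borel" for g
    proof (rule Bochner_Integration.integrable_bound[where f="\<lambda>t. B * C * indicator {a..b} t"])
      show "AE t in lborel. norm (deriv step (g t) * H t) \<le> norm (B * C * indicator {a..b} t)"
      proof (rule AE_I2)
        fix t
        have b1: "\<bar>deriv step (g t)\<bar> \<le> B"
          using B(2)[of "g t"] B(1) by (cases "0 \<le> g t \<and> g t \<le> 1") auto
        have C0: "0 \<le> C" using C[of t] by linarith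
        have "\<bar>deriv step (g t)\<bar> * \<bar>H t\<bar> \<le> B * C" if "t \<in> {a..b}"
          using b1 C[of t] B(1) by (intro mult_mono) auto
        then show "norm (deriv step (g t) * H t) \<le> norm (B * C * indicator {a..b} t)"
          using C0 B(1) by (cases "t \<in> {a..b}") (auto simp: abs_mult H_def indicator_def)
      qed
      have "emeasure lborel {a..b} < \<infinity>" using ab by simp
      then show "integrable lborel (\<lambda>t. B * C * indicator {a..b} t)" by simp
    qed measurable
    have "(LINT t|time_leb T. deriv (\<zeta> n) t * h t) =
       (LINT u|lborel. deriv step u * H (a + 1 / K n * (u + 1))) - (LINT u|lborel. deriv step u * H (b + (- (1 / K n)) * (u + 1)))" for n
    proof -
      have out: "deriv (\<zeta> n) t = 0" if "t \<notin> {a..b}" for t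
      proof -
        have "K n * (t - a) - 1 < 0 \<and> K n * (b - t) - 1 > 1 \<or> K n * (b - t) - 1 < 0 \<and> K n * (t - a) - 1 > 1"
        proof -
          have "K n * (t - a) + K n * (b - t) \<ge> 4" using K(2)[of n] by (simp add: algebra_simps)
          moreover have "K n * (t - a) < 0 \<or> K n * (b - t) < 0"
            using that K(1)[of n] by (auto simp: mult_less_0_iff)
          ultimately show ?thesis by linarith
        qed
        then show ?thesis unfolding dchi using deriv_step_outside by auto
      qed
      have "(LINT t|time_leb T. deriv (\<zeta> n) t * h t) = (LINT t|lborel. indicator {0..T} t *\<^sub>R (deriv (\<zeta> n) t * h t))"
        by (subst integral_restrict_space) auto
      also have "\<dots> = (LINT t|lborel. K n * (deriv step (K n * (t - a) - 1) * H t) - K n * (deriv step (K n * (b - t) - 1) * H t))"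
      proof (rule Bochner_Integration.integral_cong[OF refl])
        fix t
        have "indicator {0..T} t *\<^sub>R (deriv (\<zeta> n) t * h t) = deriv (\<zeta> n) t * H t"
          using out[of t] ab by (cases "t \<in> {a..b}") (auto simp: H_def)
        also have "\<dots> = K n * (deriv step (K n * (t - a) - 1) * H t) - K n * (deriv step (K n * (b - t) - 1) * H t)"
          unfolding dchi by (simp add: algebra_simps)
        finally show "indicator {0..T} t *\<^sub>R (deriv (\<zeta> n) t * h t) = K n * (deriv step (K n * (t - a) - 1) * H t) - K n * (deriv step (K n * (b - t) - 1) * H t)" .
      qed
      also have "\<dots> = K n * (LINT t|lborel. deriv step (K n * (t - a) - 1) * H t) - K n * (LINT t|lborel. deriv step (K n * (b - t) - 1) * H t)"
        by (subst Bochner_Integration.integral_diff) (auto intro!: int)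
      \<comment> \<open>Substitution \<open>t = a + (u + 1) / K n\<close>, whose Jacobian cancels
        the slope \<open>K n\<close>; at the other end the orientation is reversed.\<close>
      also have "(LINT t|lborel. deriv step (K n * (t - a) - 1) * H t) = 1 / K n * (LINT u|lborel. deriv step u * H (a + 1 / K n * (u + 1)))"
        using K(1)[of n] by (subst lborel_integral_real_affine[where c="1 / K n" and t="a + 1 / K n"]) (auto simp: algebra_simps add_divide_distrib diff_divide_distrib)
      also have "(LINT t|lborel. deriv step (K n * (b - t) - 1) * H t) = 1 / K n * (LINT u|lborel. deriv step u * H (b + (- (1 / K n)) * (u + 1)))"
        using K(1)[of n] by (subst lborel_integral_real_affine[where c="- (1 / K n)" and t="b - 1 / K n"]) (auto simp: algebra_simps add_divide_distrib diff_divide_distrib)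
      finally show ?thesis using K(1)[of n] by simp
    qed
    then show "(\<lambda>n. LINT t|time_leb T. deriv (\<zeta> n) t * h t) \<longlonglongrightarrow> h a - h b"
      using tendsto_diff[OF lim1 lim2] by simp
  qed
qed

subsection \<open>Density of test functions\<close>

definition supp_in :: "real \<Rightarrow> (real \<Rightarrow> real) \<Rightarrow> bool" where
  "supp_in T \<zeta> \<longleftrightarrow> (\<exists>a b. 0 < a \<and> a < b \<and> b < T \<and> (\<forall>t. t \<notin> {a..b} \<longrightarrow> \<zeta> t = 0))"

lemma test_fun_mult: "test_fun T \<eta> \<Longrightarrow> smooth_periodic f \<Longrightarrow> test_fun T (\<lambda>z. \<eta> z * f z)"
  unfolding test_fun_def smooth_periodic_def
  by (auto intro: smooth_mult zperiodic_comp2[of _ _ "(*)"]) (metis mult_zero_left)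

lemma test_fun_cutoff: "smooth \<zeta> \<Longrightarrow> supp_in T \<zeta> \<Longrightarrow> smooth_periodic f \<Longrightarrow> test_fun T (\<lambda>z. \<zeta> (fst z) * f z)"
proof -
  assume \<zeta>: "smooth \<zeta>" "supp_in T \<zeta>" and f: "smooth_periodic f"
  obtain a b where "0 < a" "a < b" "b < T" "\<And>t. t \<notin> {a..b} \<Longrightarrow> \<zeta> t = 0"
    using \<zeta>(2) unfolding supp_in_def by blast
  then have "\<exists>a b. 0 < a \<and> a < b \<and> b < T \<and> (\<forall>t x. t \<notin> {a..b} \<longrightarrow> \<zeta> (fst (t, x)) * f (t, x) = 0)"
    by (intro exI[of _ a] exI[of _ b]) auto
  moreover have "smooth_periodic (\<lambda>z. \<zeta> (fst z) * f z)" by (intro smooth_periodic_mult smooth_periodic_fst \<zeta> f)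
  ultimately show ?thesis unfolding test_fun_def smooth_periodic_def by blast
qed

lemma test_fun_product:
  "smooth \<zeta> \<Longrightarrow> supp_in T \<zeta> \<Longrightarrow> smooth \<theta> \<Longrightarrow> zperiodic \<theta> \<Longrightarrow> test_fun T (\<lambda>z. \<zeta> (fst z) * \<theta> (snd z))"
  by (intro test_fun_cutoff smooth_periodic_snd)

lemma test_fun_add:
  assumes "test_fun T f" "test_fun T g" shows "test_fun T (\<lambda>z. f z + g z)"
proof -
  obtain a b where ab: "0 < a" "a < b" "b < T" "\<And>t x. t \<notin> {a..b} \<Longrightarrow> f (t, x) = 0"
    using assms(1) unfolding test_fun_def by blast
  obtain a' b' where ab': "0 < a'" "a' < b'" "b' < T" "\<And>t x. t \<notin> {a'..b'} \<Longrightarrow> g (t, x) = 0"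
    using assms(2) unfolding test_fun_def by blast
  have "f (t, x) + g (t, x) = 0" if "t \<notin> {min a a'..max b b'}" for t x
  proof -
    have "t \<notin> {a..b}" "t \<notin> {a'..b'}" using that by (auto simp: min_def max_def split: if_splits)
    then show ?thesis using ab(4) ab'(4) by simp
  qed
  moreover have "0 < min a a'" "min a a' < max b b'" "max b b' < T" using ab ab' by auto
  ultimately have "\<exists>a b. 0 < a \<and> a < b \<and> b < T \<and> (\<forall>t x. t \<notin> {a..b} \<longrightarrow> f (t, x) + g (t, x) = 0)"
    by blast
  moreover have "smooth_periodic (\<lambda>z. f z + g z)"
    using assms by (intro smooth_periodic_add test_fun_smooth_periodic)
  ultimately show ?thesis unfolding test_fun_def smooth_periodic_def by blast
qed

lemma test_fun_scale: "test_fun T f \<Longrightarrow> test_fun T (\<lambda>z. c * f z)"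
  using test_fun_mult[of T f "\<lambda>_. c"] by (simp add: smooth_periodic_const mult.commute)

text \<open>Positivity sets of products: \<open>exp_cut\<close> applied to the two factors turns
  such a set into a bounded pointwise limit of product test functions, so integrals of test
  functions determine its measure.\<close>

definition test_rect :: "real \<Rightarrow> (real \<Rightarrow> real) \<Rightarrow> (real^'n \<Rightarrow> real) \<Rightarrow> (real \<times> (real^'n)) set" where
  "test_rect T \<zeta> \<theta> = {z \<in> spacetime T. 0 < \<zeta> (fst z) \<and> 0 < \<theta> (snd z)}"

definition test_rects :: "real \<Rightarrow> (real \<times> (real^'n)) set set" where
  "test_rects T = {test_rect T \<zeta> \<theta> | \<zeta> \<theta>. smooth \<zeta> \<and> (\<forall>t. 0 \<le> \<zeta> t) \<and> supp_in T \<zeta> \<and> smooth \<theta> \<and> (\<forall>x. 0 \<le> \<theta> x) \<and> zperiodic \<theta>}"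

lemma test_rects_Pow: "test_rects T \<subseteq> Pow (spacetime T)"
  by (auto simp: test_rects_def test_rect_def)

text \<open>Multiplying the defining functions intersects their positivity sets, because all factors
  are non-negative. This is the hypothesis of the pi-lambda theorem.\<close>

lemma Int_stable_test_rects: "Int_stable (test_rects T :: (real \<times> (real^'n)) set set)"
proof (rule Int_stableI)
  fix A B :: "(real \<times> (real^'n)) set" assume "A \<in> test_rects T" "B \<in> test_rects T"
  then obtain \<zeta> \<theta> \<zeta>' \<theta>' where A: "A = test_rect T \<zeta> \<theta>" "smooth \<zeta>" "\<And>t. 0 \<le> \<zeta> t" "supp_in T \<zeta>" "smooth \<theta>" "\<And>x. 0 \<le> \<theta> x" "zperiodic \<theta>"
    and B: "B = test_rect T \<zeta>' \<theta>'" "smooth \<zeta>'" "\<And>t. 0 \<le> \<zeta>' t" "supp_in T \<zeta>'" "smooth \<theta>'" "\<And>x. 0 \<le> \<theta>' x" "zperiodic \<theta>'"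
    unfolding test_rects_def by blast
  have pos: "0 < \<zeta> t * \<zeta>' t \<longleftrightarrow> 0 < \<zeta> t \<and> 0 < \<zeta>' t" "0 < \<theta> x * \<theta>' x \<longleftrightarrow> 0 < \<theta> x \<and> 0 < \<theta>' x" for t x
    using A(3)[of t] B(3)[of t] A(6)[of x] B(6)[of x] by (auto simp: zero_less_mult_iff)
  have "A \<inter> B = test_rect T (\<lambda>t. \<zeta> t * \<zeta>' t) (\<lambda>x. \<theta> x * \<theta>' x)"
    by (auto simp: A(1) B(1) test_rect_def pos)
  moreover have "supp_in T (\<lambda>t. \<zeta> t * \<zeta>' t)" using A(4) unfolding supp_in_def by (metis mult_zero_left)
  ultimately show "A \<inter> B \<in> test_rects T"
    using A B unfolding test_rects_def
    by (auto intro!: exI[of _ "\<lambda>t. \<zeta> t * \<zeta>' t"] exI[of _ "\<lambda>x. \<theta> x * \<theta>' x"] smooth_mult zperiodic_comp2[of _ _ "(*)"])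
qed

text \<open>For \<open>0 \<le> s < 1\<close> and \<open>y\<close> in \<open>[0, 1)\<close>, \<open>cos (2\<pi>y - \<pi>s) < cos (\<pi>s)\<close> holds exactly if \<open>y > s\<close>.\<close>

definition coord_fun :: "'n \<Rightarrow> real \<Rightarrow> real^'n \<Rightarrow> real" where
  "coord_fun i s x = flat_exp (cos (pi * s) - cos (2 * pi * x $ i - pi * s))"

text \<open>The last claim rewrites the difference of cosines as
  \<open>2 * sin (pi * y) * sin (pi * (y - s))\<close>. The first sine is positive for
  \<open>0 < y < 1\<close>, the second has the sign of \<open>y - s\<close>; at \<open>y = 0\<close>
  both sides are false because \<open>s\<close> is non-negative.\<close>

lemma coord_fun:
  "smooth (coord_fun i s)" "zperiodic (coord_fun i s)" "0 \<le> coord_fun i s x"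
  "x \<in> torus_cell \<Longrightarrow> 0 \<le> s \<Longrightarrow> s < 1 \<Longrightarrow> 0 < coord_fun i s x \<longleftrightarrow> s < x $ i"
proof -
  have "smooth (\<lambda>x::real^'a. 2 * pi * x $ i - pi * s)"
    by (intro smooth_diff smooth_mult smooth_const smooth_bounded_linear[OF bounded_linear_vec_nth])
  then have "smooth (\<lambda>x::real^'a. cos (pi * s) - cos (2 * pi * x $ i - pi * s))"
    by (rule smooth_diff[OF smooth_const smooth_comp_real[OF smooth_cos]])
  then show "smooth (coord_fun i s)"
    unfolding coord_fun_def[abs_def] by (rule smooth_comp_real[OF smooth_flat])
  have "cos (2 * pi * (x + k) $ i - pi * s) = cos (2 * pi * x $ i - pi * s)" if k: "\<forall>i. k $ i \<in> \<int>" for x k :: "real^'a"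
  proof -
    obtain m where m: "k $ i = of_int m" using k[rule_format, of i] by (auto elim: Ints_cases)
    have "2 * pi * (x + k) $ i - pi * s = (2 * pi * x $ i - pi * s) + 2 * pi * of_int m"
      by (simp add: m algebra_simps)
    moreover have "cos (y + 2 * pi * of_int m) = cos y" for y
      by (subst cos_add) simp
    ultimately show ?thesis by (simp only:)
  qed
  then show "zperiodic (coord_fun i s)" unfolding zperiodic_def coord_fun_def by metis
  show "0 \<le> coord_fun i s x" by (simp add: coord_fun_def)
  assume x: "x \<in> torus_cell" and s: "0 \<le> s" "s < 1"
  define y where "y = x $ i"
  have y: "0 \<le> y" "y < 1" using x by (auto simp: y_def torus_cell_def)
  have "cos (pi * s) - cos (2 * pi * y - pi * s) = 2 * sin (pi * y) * sin (pi * (y - s))"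
  proof -
    have "cos (pi * s) = cos (pi * y - pi * (y - s))" "cos (2 * pi * y - pi * s) = cos (pi * y + pi * (y - s))"
      by (simp_all add: algebra_simps)
    then show ?thesis by (simp only: cos_diff cos_add)
  qed
  moreover have "0 < 2 * sin (pi * y) * sin (pi * (y - s)) \<longleftrightarrow> s < y"
  proof (cases "y = 0")
    case False
    have "sin (pi * y) > 0" using False y by (intro sin_gt_zero) auto
    then have "0 < 2 * sin (pi * y) * sin (pi * (y - s)) \<longleftrightarrow> 0 < sin (pi * (y - s))"
      by (simp add: zero_less_mult_iff)
    also have "\<dots> \<longleftrightarrow> s < y"
    proof
      assume "s < y" then show "0 < sin (pi * (y - s))" using y s by (intro sin_gt_zero) auto
    next
      assume p: "0 < sin (pi * (y - s))"
      show "s < y"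
      proof (rule ccontr)
        assume "\<not> s < y"
        then have "0 \<le> sin (pi * (s - y))" using y s by (intro sin_ge_zero) auto
        moreover have "sin (pi * (s - y)) = - sin (pi * (y - s))"
          using sin_minus[of "pi * (y - s)"] by (simp add: algebra_simps)
        ultimately show False using p by simp
      qed
    qed
    finally show ?thesis .
  qed (use s in simp)
  ultimately show "0 < coord_fun i s x \<longleftrightarrow> s < x $ i"
    by (simp add: coord_fun_def y_def)
qed

text \<open>For a function with values in \<open>[0, m[\<close> the other superlevel sets are empty
  or everything.\<close>

lemma sigma_coord_measurable:
  fixes S :: "'a measure" and c :: "'a \<Rightarrow> real"
  assumes "\<And>s. 0 \<le> s \<Longrightarrow> s < m \<Longrightarrow> {z \<in> space S. s < c z} \<in> sets S" "\<And>z. z \<in> space S \<Longrightarrow> 0 \<le> c z \<and> c z < m"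
  shows "c \<in> borel_measurable S"
proof (subst borel_measurable_iff_greater, intro allI)
  fix s
  consider "s < 0" | "0 \<le> s" "s < m" | "s \<ge> m" by linarith
  then show "{z \<in> space S. s < c z} \<in> sets S"
  proof cases
    case 1 then have "{z \<in> space S. s < c z} = space S" using assms(2) by force
    then show ?thesis by simp
  next
    case 2 then show ?thesis by (intro assms)
  next
    case 3 then have "{z \<in> space S. s < c z} = {}" using assms(2) by force
    then show ?thesis by (simp only: sets.empty_sets)
  qed
qed

text \<open>Test functions vanish near t = 0 and t = T, so their positivity sets can only generate
  the Borel sets of the open strip. Superlevel sets of time and of each space coordinate
  suffice.\<close>

lemma sigma_test_rects:
  fixes A :: "(real \<times> (real^'n)) set"
  assumes T: "T > 0" and A: "A \<in> sets (D_borel T)"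
  shows "A \<inter> {0<..<T} \<times> UNIV \<in> sigma_sets (spacetime T) (test_rects T)"
proof -
  define S where "S = sigma (spacetime T) (test_rects T :: (real \<times> (real^'n)) set set)"
  have spS: "space S = spacetime T" and setsS: "sets S = sigma_sets (spacetime T) (test_rects T)"
    by (simp_all add: S_def test_rects_Pow space_measure_of_conv)
  have strip: "{z \<in> spacetime T. s < fst z \<and> fst z < T \<and> 0 < \<theta> (snd z)} \<in> sets S"
    if s: "0 \<le> s" and \<theta>: "smooth \<theta>" "\<And>x. 0 \<le> \<theta> x" "zperiodic \<theta>" for s and \<theta> :: "real^'n \<Rightarrow> real"
  proof -
    \<comment> \<open>Positive exactly between \<open>s + 1 / Suc n\<close> and
      \<open>T - 1 / Suc n\<close>; the union over \<open>n\<close> exhausts the times between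
      \<open>s\<close> and \<open>T\<close>.\<close>
    define \<zeta> where "\<zeta> n t = flat_exp (t - (s + 1 / real (Suc n))) * flat_exp ((T - 1 / real (Suc n)) - t)" for n t
    have "smooth (\<zeta> n)" for n
    proof -
      have "smooth (\<lambda>t. flat_exp (- (s + 1 / real (Suc n)) + 1 * t))" "smooth (\<lambda>t. flat_exp ((T - 1 / real (Suc n)) + (-1) * t))"
        by (rule smooth_affine_real[OF smooth_flat])+
      from smooth_mult[OF this] show ?thesis by (simp add: \<zeta>_def[abs_def] algebra_simps)
    qed
    moreover have "0 \<le> \<zeta> n t" for n t by (simp add: \<zeta>_def)
    moreover have "supp_in T (\<zeta> n)" for n
    proof -
      have p: "0 < 1 / real (Suc n)" by simp
      \<comment> \<open>For small \<open>n\<close> that interval may be empty. The bounds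
        \<open>T / 3\<close> and \<open>2 * T / 3\<close> then still give a genuine interval that
        contains the support.\<close>
      have z: "\<zeta> n t = 0" if "t \<notin> {min (s + 1 / real (Suc n)) (T / 3)..max (T - 1 / real (Suc n)) (2 * T / 3)}" for t
        using that by (auto simp: \<zeta>_def)
      then show ?thesis unfolding supp_in_def
      proof (intro exI conjI allI impI)
        show "0 < min (s + 1 / real (Suc n)) (T / 3)" using s T p by linarith
        show "min (s + 1 / real (Suc n)) (T / 3) < max (T - 1 / real (Suc n)) (2 * T / 3)" using T by linarith
        show "max (T - 1 / real (Suc n)) (2 * T / 3) < T" using T p by linarith
      qed (rule z)
    qed
    ultimately have "test_rect T (\<zeta> n) \<theta> \<in> test_rects T" for n
      unfolding test_rects_def using \<theta> by blast
    then have "(\<Union>n. test_rect T (\<zeta> n) \<theta>) \<in> sets S"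
      unfolding setsS by (intro sigma_sets.Union sigma_sets.Basic)
    moreover have "(\<Union>n. test_rect T (\<zeta> n) \<theta>) = {z \<in> spacetime T. s < fst z \<and> fst z < T \<and> 0 < \<theta> (snd z)}"
    proof (intro equalityI subsetI)
      fix z assume "z \<in> (\<Union>n. test_rect T (\<zeta> n) \<theta>)"
      then obtain n where "z \<in> spacetime T" "0 < \<zeta> n (fst z)" "0 < \<theta> (snd z)" by (auto simp: test_rect_def)
      moreover have "0 < 1 / real (Suc n)" by simp
      moreover have "s + 1 / real (Suc n) < fst z \<and> fst z < T - 1 / real (Suc n)"
        using \<open>0 < \<zeta> n (fst z)\<close> unfolding \<zeta>_def
        by (metis diff_gt_0_iff_gt flat_nonneg flat_pos_iff not_less zero_less_mult_iff)
      ultimately have "z \<in> spacetime T" "s < fst z" "fst z < T" "0 < \<theta> (snd z)" by linarith+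
      then show "z \<in> {z \<in> spacetime T. s < fst z \<and> fst z < T \<and> 0 < \<theta> (snd z)}" by simp
    next
      fix z assume z: "z \<in> {z \<in> spacetime T. s < fst z \<and> fst z < T \<and> 0 < \<theta> (snd z)}"
      then have "0 < min (fst z - s) (T - fst z)" by auto
      then obtain n where "1 / real (Suc n) < min (fst z - s) (T - fst z)" using nat_approx_posE by blast
      then have "0 < \<zeta> n (fst z)" by (auto simp: \<zeta>_def zero_less_mult_iff)
      then show "z \<in> (\<Union>n. test_rect T (\<zeta> n) \<theta>)" using z by (auto simp: test_rect_def)
    qed
    ultimately show ?thesis by simp
  qed
  let ?O = "{z \<in> spacetime T. 0 < fst z \<and> fst z < T}"
  have O: "?O \<in> sets S" using strip[of 0 "\<lambda>_. 1"] by (simp add: smooth_const zperiodic_def)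
  \<comment> \<open>The end slices collapse to one point, because the generated sigma-algebra cannot
    separate points on them. Inside the strip \<open>Z\<close> is the identity.\<close>
  define Z where "Z z = (if z \<in> ?O then z else (0, 0 :: real^'n))" for z :: "real \<times> (real^'n)"
  have Zt: "(\<lambda>z. fst (Z z)) \<in> borel_measurable S"
  proof (rule sigma_coord_measurable[where m=T])
    fix s assume s: "0 \<le> s" "s < T"
    have "{z \<in> space S. s < fst (Z z)} = {z \<in> spacetime T. s < fst z \<and> fst z < T \<and> 0 < (1::real)}"
      using s by (auto simp: Z_def spS)
    then show "{z \<in> space S. s < fst (Z z)} \<in> sets S" using strip[OF s(1), of "\<lambda>_. 1"] by (simp add: smooth_const zperiodic_def)
  qed (use T in \<open>auto simp: Z_def\<close>)
  have Zx: "(\<lambda>z. snd (Z z) $ i) \<in> borel_measurable S" for i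
  proof (rule sigma_coord_measurable[where m=1])
    fix s :: real assume s: "0 \<le> s" "s < 1"
    have "{z \<in> space S. s < snd (Z z) $ i} = {z \<in> spacetime T. 0 < fst z \<and> fst z < T \<and> 0 < coord_fun i s (snd z)}"
      using s by (auto simp: Z_def spS coord_fun(4) spacetime_def)
    then show "{z \<in> space S. s < snd (Z z) $ i} \<in> sets S" using strip[of 0 "coord_fun i s"] by (simp add: coord_fun)
  qed (auto simp: Z_def spS spacetime_def torus_cell_def)
  have "Z \<in> borel_measurable S"
    by (subst borel_measurable_euclidean_space)
       (use Zt Zx in \<open>auto simp: Basis_prod_def Basis_vec_def inner_prod_def inner_axis\<close>)
  moreover obtain B where B: "B \<in> sets borel" "A = B \<inter> spacetime T"
    using A by (auto simp: sets_restrict_space)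
  ultimately have "Z -` B \<inter> space S \<inter> ?O \<in> sets S" using O by (intro sets.Int measurable_sets)
  moreover have "Z -` B \<inter> space S \<inter> ?O = A \<inter> {0<..<T} \<times> UNIV"
    by (auto simp: Z_def spS B(2) spacetime_def)
  ultimately show ?thesis by (simp add: setsS)
qed

lemma Int_stable_torus_rects:
  "Int_stable {{x \<in> torus_cell. 0 < \<theta> x} | \<theta>. smooth \<theta> \<and> (\<forall>x. 0 \<le> \<theta> x) \<and> zperiodic (\<theta> :: real^'n \<Rightarrow> real)}"
proof (rule Int_stableI, clarify)
  fix \<theta> \<theta>' :: "real^'n \<Rightarrow> real"
  assume A: "smooth \<theta>" "\<forall>x. 0 \<le> \<theta> x" "zperiodic \<theta>" "smooth \<theta>'" "\<forall>x. 0 \<le> \<theta>' x" "zperiodic \<theta>'"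
  have "0 < \<theta> x * \<theta>' x \<longleftrightarrow> 0 < \<theta> x \<and> 0 < \<theta>' x" for x
    using A(2,5) by (auto simp: zero_less_mult_iff dest!: spec[of _ x])
  then have "{x \<in> torus_cell. 0 < \<theta> x} \<inter> {x \<in> torus_cell. 0 < \<theta>' x} = {x \<in> torus_cell. 0 < \<theta> x * \<theta>' x}"
    by auto
  with A show "\<exists>\<theta>''. {x \<in> torus_cell. 0 < \<theta> x} \<inter> {x \<in> torus_cell. 0 < \<theta>' x} = {x \<in> torus_cell. 0 < \<theta>'' x}
      \<and> smooth \<theta>'' \<and> (\<forall>x. 0 \<le> \<theta>'' x) \<and> zperiodic \<theta>''"
    by (intro exI[of _ "\<lambda>x. \<theta> x * \<theta>' x"] conjI smooth_mult zperiodic_comp2[of _ _ "(*)"]) auto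
qed

text \<open>In space there are no ends, and already the positivity sets of \<open>coord_fun\<close>
  generate. The lemma serves to verify measurability of a curve of measures on smooth functions
  only.\<close>

lemma sets_torus_borel_generated:
  "sets (torus_borel :: (real^'n) measure) =
    sigma_sets torus_cell {{x \<in> torus_cell. 0 < \<theta> x} | \<theta>. smooth \<theta> \<and> (\<forall>x. 0 \<le> \<theta> x) \<and> zperiodic \<theta>}" (is "_ = sigma_sets _ ?G")
proof (rule antisym)
  have "?G \<subseteq> sets torus_borel"
  proof clarify
    fix \<theta> :: "real^'n \<Rightarrow> real" assume "smooth \<theta>" "\<forall>x. 0 \<le> \<theta> x" "zperiodic \<theta>"
    then have "\<theta> \<in> borel_measurable torus_borel"
      by (intro restrict_borel_measurable cont_torus_measurable cont_torus_smooth)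
    then have "{x \<in> space torus_borel. 0 < \<theta> x} \<in> sets torus_borel" by measurable
    then show "{x \<in> torus_cell. 0 < \<theta> x} \<in> sets torus_borel" by simp
  qed
  then show "sigma_sets torus_cell ?G \<subseteq> sets torus_borel"
    using sets.sigma_sets_subset[of ?G "torus_borel :: (real^'n) measure"] by simp
  define S where "S = sigma torus_cell ?G"
  have P: "?G \<subseteq> Pow torus_cell" by auto
  have spS: "space S = torus_cell" and setsS: "sets S = sigma_sets torus_cell ?G"
    by (simp_all add: S_def P space_measure_of_conv)
  have "(\<lambda>x. x $ i) \<in> borel_measurable S" for i
  proof (rule sigma_coord_measurable[where m=1])
    fix s :: real assume s: "0 \<le> s" "s < 1"
    have "{x \<in> space S. s < x $ i} = {x \<in> torus_cell. 0 < coord_fun i s x}"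
      using s by (auto simp: spS coord_fun(4))
    also have "\<dots> \<in> sets S" unfolding setsS by (rule sigma_sets.Basic) (use coord_fun(1,2)[of i s] coord_fun(3)[of i s] in blast)
    finally show "{x \<in> space S. s < x $ i} \<in> sets S" .
  qed (auto simp: spS torus_cell_def)
  then have "(\<lambda>x. x) \<in> borel_measurable S"
    by (subst borel_measurable_euclidean_space) (auto simp: Basis_vec_def inner_axis)
  then have "B \<inter> torus_cell \<in> sets S" if "B \<in> sets borel" for B :: "(real^'n) set"
    using measurable_sets[of "\<lambda>x. x" S borel B] that by (simp add: spS)
  then show "sets torus_borel \<subseteq> sigma_sets torus_cell ?G"
    by (auto simp: sets_restrict_space setsS Int_commute)
qed

lemma cont_D_test_fun: "test_fun T \<eta> \<Longrightarrow> cont_D T \<eta>"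
  by (intro cont_D_smooth_periodic test_fun_smooth_periodic)

text \<open>A smooth approximation of the indicator of the positive half-line for non-negative
  arguments. It vanishes at 0, so applying it to a function does not enlarge the support.\<close>

definition exp_cut :: "nat \<Rightarrow> real \<Rightarrow> real" where "exp_cut n y = 1 - exp (- real n * y)"

lemma exp_cut:
  assumes "y \<ge> 0"
  shows "0 \<le> exp_cut n y" "exp_cut n y \<le> 1" "(\<lambda>n. exp_cut n y) \<longlonglongrightarrow> indicator {0<..} y"
proof -
  show "0 \<le> exp_cut n y" "exp_cut n y \<le> 1" using assms by (auto simp: exp_cut_def)
  show "(\<lambda>n. exp_cut n y) \<longlonglongrightarrow> indicator {0<..} y"
  proof (cases "y = 0")
    case False
    then have y: "y > 0" using assms by simp
    have "filterlim (\<lambda>n. - real n * y) at_bot sequentially"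
      using filterlim_tendsto_pos_mult_at_top[OF tendsto_const y filterlim_real_sequentially]
      by (simp add: filterlim_uminus_at_bot mult.commute)
    from filterlim_compose[OF exp_at_bot this] have "(\<lambda>n. 1 - exp (- real n * y)) \<longlonglongrightarrow> 1 - 0"
      by (intro tendsto_diff tendsto_const)
    then show ?thesis using y by (simp add: exp_cut_def)
  qed (simp add: exp_cut_def)
qed

lemma smooth_exp_cut: "smooth g \<Longrightarrow> smooth (\<lambda>z. exp_cut n (g z))"
proof -
  assume g: "smooth g"
  have "smooth (\<lambda>z. 1 - exp (- real n * g z))"
    by (rule smooth_diff[OF smooth_const smooth_comp_real[OF smooth_exp smooth_mult[OF smooth_const g]]])
  then show ?thesis by (simp add: exp_cut_def)
qed

lemma supp_in_exp_cut: "supp_in T \<zeta> \<Longrightarrow> supp_in T (\<lambda>t. exp_cut n (\<zeta> t))"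
  unfolding supp_in_def by (fastforce simp: exp_cut_def)

lemma test_rect_indicator_lim:
  assumes "\<And>t. 0 \<le> \<zeta> t" "\<And>x. 0 \<le> \<theta> x" "z \<in> spacetime T"
  shows "(\<lambda>n. exp_cut n (\<zeta> (fst z)) * exp_cut n (\<theta> (snd z))) \<longlonglongrightarrow> indicator (test_rect T \<zeta> \<theta>) z"
proof -
  have "(\<lambda>n. exp_cut n (\<zeta> (fst z)) * exp_cut n (\<theta> (snd z))) \<longlonglongrightarrow> indicator {0<..} (\<zeta> (fst z)) * indicator {0<..} (\<theta> (snd z))"
    by (intro tendsto_mult exp_cut assms)
  then show ?thesis using assms(3)
    by (cases "0 < \<zeta> (fst z)"; cases "0 < \<theta> (snd z)"; simp add: test_rect_def)
qed

lemma time_cutoffs: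
  assumes "T > 0"
  obtains \<zeta> :: "nat \<Rightarrow> real \<Rightarrow> real" where
    "\<And>n. smooth (\<zeta> n)" "\<And>n t. 0 \<le> \<zeta> n t" "\<And>n t. \<zeta> n t \<le> 1" "\<And>n. supp_in T (\<zeta> n)"
    "\<And>t. (\<lambda>n. \<zeta> n t) \<longlonglongrightarrow> indicator {0<..<T} t"
    "\<And>h :: real \<Rightarrow> real. continuous_on {0..T} h \<Longrightarrow> (\<lambda>n. LINT t|time_leb T. deriv (\<zeta> n) t * h t) \<longlonglongrightarrow> h 0 - h T"
proof (rule cutoff_exists[of 0 T T])
  fix \<zeta> :: "nat \<Rightarrow> real \<Rightarrow> real"
  assume z: "\<And>n. smooth (\<zeta> n)" "\<And>n t. 0 \<le> \<zeta> n t" "\<And>n t. \<zeta> n t \<le> 1"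
    "\<And>n. \<exists>a' b'. 0 < a' \<and> a' < b' \<and> b' < T \<and> (\<forall>t. t \<notin> {a'..b'} \<longrightarrow> \<zeta> n t = 0)"
    "\<And>t. (\<lambda>n. \<zeta> n t) \<longlonglongrightarrow> indicator {0<..<T} t"
    "\<And>h :: real \<Rightarrow> real. continuous_on {0..T} h \<Longrightarrow> (\<lambda>n. LINT t|time_leb T. deriv (\<zeta> n) t * h t) \<longlonglongrightarrow> h 0 - h T"
  show thesis by (rule that[OF z(1-3) _ z(5,6)]) (use z(4) in \<open>simp_all add: supp_in_def\<close>)
qed (use assms in auto)

text \<open>The L1 closure of \<open>E\<close> contains the indicators of a pi-system, hence by the
  pi-lambda theorem those of all Borel sets in the open strip, hence all integrable functions. The
  end slices must be null because products with compact support in time vanish on them.\<close>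

theorem test_functions_dense:
  fixes M :: "(real \<times> (real^'n)) measure" and E :: "(real \<times> (real^'n) \<Rightarrow> real) set"
  assumes T: "T > 0" and M: "finite_measure M" "sets M = sets (D_borel T)"
    and ends: "AE z in M. 0 < fst z \<and> fst z < T"
    and E: "\<And>\<zeta> \<theta>. smooth \<zeta> \<Longrightarrow> supp_in T \<zeta> \<Longrightarrow> smooth \<theta> \<Longrightarrow> zperiodic \<theta> \<Longrightarrow> (\<lambda>z. \<zeta> (fst z) * \<theta> (snd z)) \<in> E"
      "\<And>f g. f \<in> E \<Longrightarrow> g \<in> E \<Longrightarrow> (\<lambda>z. f z + g z) \<in> E" "\<And>f c. f \<in> E \<Longrightarrow> (\<lambda>z. c * f z) \<in> E"
      "\<And>f. f \<in> E \<Longrightarrow> integrable M f"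
    and f: "integrable M f" and e: "e > 0"
  shows "\<exists>\<eta>\<in>E. (LINT z|M. \<bar>f z - \<eta> z\<bar>) < e"
proof -
  interpret finite_measure M by fact
  \<comment> \<open>Membership in the L1 closure of \<open>E\<close>; it is stable under linear
    combinations and dominated limits.\<close>
  define P where "P f \<longleftrightarrow> integrable M f \<and> (\<forall>e>0. \<exists>\<eta>\<in>E. (LINT z|M. \<bar>f z - \<eta> z\<bar>) < e)" for f :: "real \<times> (real^'n) \<Rightarrow> real"
  have spM: "space M = spacetime T" using sets_eq_imp_space_eq[OF M(2)] by simp
  have Pint: "P f \<Longrightarrow> integrable M f" for f by (simp add: P_def)
  have PE: "P \<eta>" if "\<eta> \<in> E" for \<eta> unfolding P_def
    using that E(4) by (auto intro!: bexI[of _ \<eta>])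
  have Plim: "P f" if Pg: "\<And>n. P (g n)" and "(\<lambda>n. LINT z|M. \<bar>f z - g n z\<bar>) \<longlonglongrightarrow> 0" and "integrable M f" for f g
    unfolding P_def
  proof (intro conjI allI impI that)
    fix e :: real assume "e > 0"
    then have "\<forall>\<^sub>F n in sequentially. (LINT z|M. \<bar>f z - g n z\<bar>) < e / 2"
      using order_tendstoD(2)[OF that(2), of "e / 2"] by simp
    then obtain n where n: "(LINT z|M. \<bar>f z - g n z\<bar>) < e / 2"
      by (meson eventually_happens sequentially_bot)
    obtain \<eta> where \<eta>: "\<eta> \<in> E" "(LINT z|M. \<bar>g n z - \<eta> z\<bar>) < e / 2"
      using Pg[of n] \<open>e > 0\<close> unfolding P_def by (meson half_gt_zero)
    note [simp] = Pint[OF that(1)] E(4)[OF \<eta>(1)] that(3)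
    have "(LINT z|M. \<bar>f z - \<eta> z\<bar>) \<le> (LINT z|M. \<bar>f z - g n z\<bar> + \<bar>g n z - \<eta> z\<bar>)"
      by (intro integral_mono) auto
    also have "\<dots> = (LINT z|M. \<bar>f z - g n z\<bar>) + (LINT z|M. \<bar>g n z - \<eta> z\<bar>)"
      by (intro Bochner_Integration.integral_add) auto
    also have "\<dots> < e" using n \<eta>(2) by simp
    finally show "\<exists>\<eta>\<in>E. (LINT z|M. \<bar>f z - \<eta> z\<bar>) < e" using \<eta>(1) by blast
  qed
  have Plim': "P f" if "\<And>n. P (g n)" "AE z in M. (\<lambda>n. g n z) \<longlonglongrightarrow> f z" "\<And>n. AE z in M. \<bar>g n z\<bar> \<le> w z"
    "integrable M w" "integrable M f" for f g w
  proof (rule Plim[OF that(1)])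
    have "(\<lambda>n. LINT z|M. \<bar>f z - g n z\<bar>) \<longlonglongrightarrow> (LINT z|M. 0)"
    proof (rule integral_dominated_convergence[where w="\<lambda>z. \<bar>f z\<bar> + w z"])
      show "AE z in M. (\<lambda>n. \<bar>f z - g n z\<bar>) \<longlonglongrightarrow> 0"
        using that(2)
      proof eventually_elim
        case (elim z)
        have "(\<lambda>n. \<bar>f z - g n z\<bar>) \<longlonglongrightarrow> \<bar>f z - f z\<bar>" by (intro tendsto_intros elim)
        then show ?case by simp
      qed
      show "AE z in M. norm \<bar>f z - g n z\<bar> \<le> \<bar>f z\<bar> + w z" for n
        using that(3)[of n] by eventually_elim auto
      show "(\<lambda>z. \<bar>f z - g n z\<bar>) \<in> borel_measurable M" for n
        using Pint[OF that(1)[of n]] that(5) by measurable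
      show "integrable M (\<lambda>z. \<bar>f z\<bar> + w z)" using that(4,5) by auto
    qed simp
    then show "(\<lambda>n. LINT z|M. \<bar>f z - g n z\<bar>) \<longlonglongrightarrow> 0" by simp
  qed (rule that(5))
  have Padd: "P (\<lambda>z. f z + g z)" if Pfg: "P f" "P g" for f g
    unfolding P_def
  proof (intro conjI allI impI)
    show "integrable M (\<lambda>z. f z + g z)" using Pint that by auto
    fix e :: real assume "e > 0"
    then obtain \<eta> \<eta>' where \<eta>: "\<eta> \<in> E" "(LINT z|M. \<bar>f z - \<eta> z\<bar>) < e / 2" "\<eta>' \<in> E" "(LINT z|M. \<bar>g z - \<eta>' z\<bar>) < e / 2"
      using Pfg unfolding P_def by (meson half_gt_zero)
    note [simp] = Pint[OF that(1)] Pint[OF that(2)] E(4)[OF \<eta>(1)] E(4)[OF \<eta>(3)]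
    have "(LINT z|M. \<bar>(f z + g z) - (\<eta> z + \<eta>' z)\<bar>) \<le> (LINT z|M. \<bar>f z - \<eta> z\<bar> + \<bar>g z - \<eta>' z\<bar>)"
      by (intro integral_mono) auto
    also have "\<dots> = (LINT z|M. \<bar>f z - \<eta> z\<bar>) + (LINT z|M. \<bar>g z - \<eta>' z\<bar>)"
      by (intro Bochner_Integration.integral_add) auto
    also have "\<dots> < e" using \<eta> by simp
    finally show "\<exists>\<eta>\<in>E. (LINT z|M. \<bar>(f z + g z) - \<eta> z\<bar>) < e"
      using E(2)[OF \<eta>(1,3)] by (intro bexI[of _ "\<lambda>z. \<eta> z + \<eta>' z"])
  qed
  have Pscale: "P (\<lambda>z. c * f z)" if Pf: "P f" for f c
    unfolding P_def
  proof (intro conjI allI impI)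
    show "integrable M (\<lambda>z. c * f z)" using Pint that by auto
    fix e :: real assume "e > 0"
    then have "e / (\<bar>c\<bar> + 1) > 0" by simp
    then obtain \<eta> where \<eta>: "\<eta> \<in> E" "(LINT z|M. \<bar>f z - \<eta> z\<bar>) < e / (\<bar>c\<bar> + 1)"
      using Pf unfolding P_def by blast
    have "(LINT z|M. \<bar>c * f z - c * \<eta> z\<bar>) = \<bar>c\<bar> * (LINT z|M. \<bar>f z - \<eta> z\<bar>)"
      by (subst integral_mult_right_zero[symmetric]) (simp flip: abs_mult add: right_diff_distrib)
    also have "\<dots> \<le> (\<bar>c\<bar> + 1) * (LINT z|M. \<bar>f z - \<eta> z\<bar>)" by (intro mult_right_mono) auto
    also have "\<dots> < e" using \<eta>(2) by (simp add: field_simps add_pos_nonneg)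
    finally show "\<exists>\<eta>\<in>E. (LINT z|M. \<bar>c * f z - \<eta> z\<bar>) < e"
      using E(3)[OF \<eta>(1)] by (intro bexI[of _ "\<lambda>z. c * \<eta> z"])
  qed
  have P0: "P (\<lambda>_. 0)"
  proof -
    have "supp_in T (\<lambda>_. 0)" unfolding supp_in_def
      by (rule exI[of _ "T / 3"], rule exI[of _ "T / 2"]) (use T in auto)
    from PE[OF E(1)[OF smooth_const this smooth_const, of 0]] show ?thesis by (simp add: zperiodic_def)
  qed
  have Pdiff: "P (\<lambda>z. f z - g z)" if "P f" "P g" for f g
    using Padd[OF that(1) Pscale[OF that(2), of "-1"]] by simp
  obtain \<zeta>1 where \<zeta>1: "\<And>n. smooth (\<zeta>1 n)" "\<And>n t. 0 \<le> \<zeta>1 n t" "\<And>n t. \<zeta>1 n t \<le> 1" "\<And>n. supp_in T (\<zeta>1 n)"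
     "\<And>t. (\<lambda>n. \<zeta>1 n t) \<longlonglongrightarrow> indicator {0<..<T} t"
    by (rule time_cutoffs[OF T]) (rule that)
  \<comment> \<open>Constants are limits of time cutoffs, and \<open>ends\<close> makes this limit
    valid almost everywhere. Complements in the pi-lambda argument depend on it.\<close>
  have P1: "P (\<lambda>_. 1)"
  proof (rule Plim'[where g="\<lambda>n z. \<zeta>1 n (fst z) * 1" and w="\<lambda>_. 1"])
    show "P (\<lambda>z. \<zeta>1 n (fst z) * 1)" for n
      using PE[OF E(1)[OF \<zeta>1(1) \<zeta>1(4) smooth_const, of 1]] by (simp add: zperiodic_def)
    show "AE z in M. (\<lambda>n. \<zeta>1 n (fst z) * 1) \<longlonglongrightarrow> 1"
      using ends
    proof eventually_elim
      case (elim z)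
      then show ?case using \<zeta>1(5)[of "fst z"] by simp
    qed
  qed (use \<zeta>1 in auto)
  have sets: "P (indicator A)" if "A \<in> sigma_sets (spacetime T) (test_rects T)" for A
    using Int_stable_test_rects test_rects_Pow that
  proof (induction rule: sigma_sets_induct_disjoint)
    case (basic A)
    then obtain \<zeta> \<theta> where A: "A = test_rect T \<zeta> \<theta>" "smooth \<zeta>" "\<And>t. 0 \<le> \<zeta> t" "supp_in T \<zeta>" "smooth \<theta>" "\<And>x. 0 \<le> \<theta> x" "zperiodic \<theta>"
      unfolding test_rects_def by blast
    have z: "zperiodic (\<lambda>x. exp_cut n (\<theta> x))" for n by (rule zperiodic_comp[OF A(7)])
    define g where "g n z = exp_cut n (\<zeta> (fst z)) * exp_cut n (\<theta> (snd z))" for n z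
    have PEg: "P (g n)" for n
      unfolding g_def by (intro PE E(1) smooth_exp_cut supp_in_exp_cut A z)
    have lim: "\<And>z. z \<in> spacetime T \<Longrightarrow> (\<lambda>n. g n z) \<longlonglongrightarrow> indicator A z"
      unfolding g_def A(1) by (intro test_rect_indicator_lim A)
    have m: "(indicator A :: _ \<Rightarrow> real) \<in> borel_measurable M"
      by (rule borel_measurable_LIMSEQ_real[OF _ borel_measurable_integrable[OF Pint[OF PEg]]]) (use lim spM in auto)
    show ?case
    proof (rule Plim'[OF PEg, where w="\<lambda>_. 1"])
      show "AE z in M. (\<lambda>n. g n z) \<longlonglongrightarrow> indicator A z" using lim spM by auto
      show "AE z in M. \<bar>g n z\<bar> \<le> 1" for n
        unfolding g_def abs_mult using exp_cut[OF A(3)] exp_cut[OF A(6)] by (intro AE_I2 mult_le_one) auto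
      show "integrable M (indicator A :: _ \<Rightarrow> real)" using m by (intro integrable_bounded[of _ 1]) (auto simp: indicator_def)
    qed simp
  next
    case empty
    then show ?case using P0 by (simp add: indicator_def[abs_def])
  next
    case (compl A)
    have "(LINT z|M. \<bar>indicator (spacetime T - A) z - (1 - indicator A z)\<bar>) = (0::real)"
      by (intro integral_eq_zero_AE AE_I2) (auto simp: spM indicator_def)
    moreover have "integrable M (indicator (spacetime T - A) :: _ \<Rightarrow> real)"
      using Pint[OF Pdiff[OF P1 compl(2)]]
      by (rule Bochner_Integration.integrable_cong[THEN iffD1, rotated -1]) (auto simp: spM indicator_def)
    ultimately show ?case by (intro Plim[OF Pdiff[OF P1 compl(2)]]) auto
  next
    case (union A)
    define g where "g n z = (\<Sum>i<n. indicator (A i) z :: real)" for n z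
    have g: "P (g n)" for n
      unfolding g_def by (induction n) (auto intro: P0 Padd union)
    have geq: "g n z = indicator (\<Union>i<n. A i) z" for n z
      unfolding g_def using union(1) by (subst indicator_UN_disjoint) (auto simp: disjoint_family_on_def)
    have lim: "(\<lambda>n. g n z) \<longlonglongrightarrow> indicator (\<Union>i. A i) z" for z
      unfolding geq by (rule LIMSEQ_indicator_UN)
    have m: "(indicator (\<Union>i. A i) :: _ \<Rightarrow> real) \<in> borel_measurable M"
      by (rule borel_measurable_LIMSEQ_real[OF _ borel_measurable_integrable[OF Pint[OF g]]]) (use lim in auto)
    show ?case
    proof (rule Plim'[OF g, where w="\<lambda>_. 1"])
      show "AE z in M. (\<lambda>n. g n z) \<longlonglongrightarrow> indicator (\<Union>i. A i) z" using lim by auto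
      show "AE z in M. \<bar>g n z\<bar> \<le> 1" for n unfolding geq by (auto simp: indicator_def)
      show "integrable M (indicator (\<Union>i. A i) :: _ \<Rightarrow> real)" using m by (intro integrable_bounded[of _ 1]) (auto simp: indicator_def)
    qed simp
  qed
  \<comment> \<open>A Borel set and its part in the open strip differ only on the end slices, which
    are null.\<close>
  have sets': "P (indicator A)" if A: "A \<in> sets M" for A
  proof (rule Plim[where g="\<lambda>_::nat. indicator (A \<inter> {0<..<T} \<times> UNIV)"])
    show "P (indicator (A \<inter> {0<..<T} \<times> UNIV))"
      by (rule sets[OF sigma_test_rects[OF T]]) (use A M in simp)
    have "(LINT z|M. \<bar>indicator A z - indicator (A \<inter> {0<..<T} \<times> UNIV) z\<bar>) = (0::real)"
      by (rule integral_eq_zero_AE) (use ends in eventually_elim, auto simp: indicator_def)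
    then show "(\<lambda>n::nat. LINT z|M. \<bar>indicator A z - indicator (A \<inter> {0<..<T} \<times> UNIV) z :: real\<bar>) \<longlonglongrightarrow> 0" by simp
    show "integrable M (indicator A :: _ \<Rightarrow> real)" using A by (intro integrable_bounded[of _ 1]) (auto simp: indicator_def)
  qed
  have "P f" using f
  proof (induction rule: integrable_induct)
    case (base A c)
    then show ?case using Pscale[OF sets'[OF base(1)], of c] by (simp add: mult.commute)
  next
    case (add f g)
    then show ?case by (intro Padd)
  next
    case (lim f s)
    show ?case
    proof (rule Plim'[where g=s and w="\<lambda>z. 2 * \<bar>f z\<bar>"])
      show "P (s n)" for n by (rule lim)
      show "AE z in M. (\<lambda>n. s n z) \<longlonglongrightarrow> f z" by (intro AE_I2 lim)
      show "AE z in M. \<bar>s n z\<bar> \<le> 2 * \<bar>f z\<bar>" for n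
        using lim(3)[of _ n] by (intro AE_I2) simp
      show "integrable M f" by (rule lim)
      then show "integrable M (\<lambda>z. 2 * \<bar>f z\<bar>)" by auto
    qed
  qed
  then show ?thesis using e by (simp add: P_def)
qed

lemma integrable_test_fun:
  fixes M :: "(real \<times> (real^'n)) measure"
  assumes "finite_measure M" "sets M = sets (D_borel T)" "test_fun T \<eta>"
  shows "integrable M \<eta>"
  by (rule integrable_cont_D[OF cont_D_test_fun[OF assms(3)] assms(1,2)])

lemma AE_zero_if_test_integrals_zero:
  fixes M :: "(real \<times> (real^'n)) measure" and f :: "real \<times> (real^'n) \<Rightarrow> real"
  assumes T: "T > 0" and M: "sets M = sets (D_borel T)"
    and ends: "AE z in M. 0 < fst z \<and> fst z < T"
    and f: "integrable M f" and zero: "\<And>\<eta>. test_fun T \<eta> \<Longrightarrow> (LINT z|M. f z * \<eta> z) = 0"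
  shows "AE z in M. f z = 0"
proof -
  define N where "N = density M (\<lambda>z. ennreal \<bar>f z\<bar>)"
  have [measurable]: "f \<in> borel_measurable M" using f by auto
  have setsN: "sets N = sets (D_borel T)" by (simp add: N_def M)
  have "emeasure N (space N) = (\<integral>\<^sup>+z. ennreal \<bar>f z\<bar> \<partial>M)"
    unfolding N_def by (subst emeasure_density) (auto intro!: nn_integral_cong)
  also have "\<dots> < \<infinity>" using f by (simp add: integrable_iff_bounded)
  finally have finN: "finite_measure N" by (intro finite_measureI) auto
  have endsN: "AE z in N. 0 < fst z \<and> fst z < T"
    unfolding N_def by (subst AE_density) (use ends in auto)
  have Nint: "integral\<^sup>L N g = (LINT z|M. \<bar>f z\<bar> * g z)" if "g \<in> borel_measurable M" for g :: "_ \<Rightarrow> real"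
    unfolding N_def using that by (subst integral_density) auto
  have sgn: "integrable N (\<lambda>z. sgn (f z))"
    by (rule finite_measure.integrable_bounded[OF finN, of _ 1]) (auto simp: N_def sgn_real_def)
  have "(LINT z|M. \<bar>f z\<bar>) \<le> e" if "e > 0" for e
  proof -
    have "\<exists>\<eta>\<in>{\<eta>. test_fun T \<eta>}. (LINT z|N. \<bar>sgn (f z) - \<eta> z\<bar>) < e"
      by (rule test_functions_dense[OF T finN setsN endsN])
         (use integrable_test_fun[OF finN setsN] in \<open>auto intro: sgn that test_fun_product test_fun_add test_fun_scale\<close>)
    then obtain \<eta> where \<eta>: "test_fun T \<eta>" "(LINT z|N. \<bar>sgn (f z) - \<eta> z\<bar>) < e" by blast
    have \<eta>m [measurable]: "\<eta> \<in> borel_measurable M"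
      using cont_D_measurable(1)[OF cont_D_test_fun[OF \<eta>(1)]] by (simp cong: measurable_cong_sets add: M)
    obtain B where B: "B > 0" "\<And>t x. t \<in> {0..T} \<Longrightarrow> norm (\<eta> (t, x)) \<le> B"
      using cont_D_bounded[OF cont_D_test_fun[OF \<eta>(1)]] by metis
    have spM: "space M = spacetime T" using sets_eq_imp_space_eq[OF M] by simp
    have fe: "integrable M (\<lambda>z. f z * \<eta> z)"
    proof (rule Bochner_Integration.integrable_bound[where f="\<lambda>z. B * f z"])
      show "AE z in M. norm (f z * \<eta> z) \<le> norm (B * f z)"
      proof (rule AE_I2)
        fix z assume "z \<in> space M"
        then have "\<bar>\<eta> z\<bar> \<le> B" using B(2)[of "fst z" "snd z"] by (auto simp: spM spacetime_def)
        then show "norm (f z * \<eta> z) \<le> norm (B * f z)"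
          using B(1) by (simp add: abs_mult mult.commute[of "\<bar>f z\<bar>"] mult_right_mono)
      qed
    qed (use f in auto)
    have "(LINT z|M. \<bar>f z\<bar>) = (LINT z|M. \<bar>f z\<bar> - f z * \<eta> z)"
      using zero[OF \<eta>(1)] f fe by (subst Bochner_Integration.integral_diff) auto
    also have "\<dots> \<le> (LINT z|M. \<bar>f z\<bar> * \<bar>sgn (f z) - \<eta> z\<bar>)"
    proof (rule integral_mono)
      show "integrable M (\<lambda>z. \<bar>f z\<bar> - f z * \<eta> z)" using f fe by auto
      have "integrable N (\<lambda>z. \<bar>sgn (f z) - \<eta> z\<bar>)"
        using sgn integrable_test_fun[OF finN setsN \<eta>(1)] by auto
      then show "integrable M (\<lambda>z. \<bar>f z\<bar> * \<bar>sgn (f z) - \<eta> z\<bar>)"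
        unfolding N_def by (subst (asm) integrable_density) auto
      fix z
      have "\<bar>f z\<bar> - f z * \<eta> z = f z * (sgn (f z) - \<eta> z)"
        by (simp add: right_diff_distrib abs_sgn)
      also have "\<dots> \<le> \<bar>f z\<bar> * \<bar>sgn (f z) - \<eta> z\<bar>" unfolding abs_mult[symmetric] by (rule abs_ge_self)
      finally show "\<bar>f z\<bar> - f z * \<eta> z \<le> \<bar>f z\<bar> * \<bar>sgn (f z) - \<eta> z\<bar>" .
    qed
    also have "\<dots> = (LINT z|N. \<bar>sgn (f z) - \<eta> z\<bar>)" by (subst Nint) auto
    finally show ?thesis using \<eta>(2) by simp
  qed
  then have "(LINT z|M. \<bar>f z\<bar>) \<le> 0" by (rule field_le_epsilon[of _ 0, simplified])
  then have "(LINT z|M. \<bar>f z\<bar>) = 0" by (simp add: order_antisym)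
  then show ?thesis using f by (simp add: integral_nonneg_eq_0_iff_AE)
qed

text \<open>Uniqueness by the pi-lambda theorem on positivity sets of products. Product test
  functions are enough, and the end slices, invisible to them, are null for both measures.\<close>

lemma measure_eq_if_test_integrals_eq:
  fixes M N :: "(real \<times> (real^'n)) measure"
  assumes T: "T > 0" and M: "finite_measure M" "sets M = sets (D_borel T)" and N: "finite_measure N" "sets N = sets (D_borel T)"
    and ends: "AE z in M. 0 < fst z \<and> fst z < T" "AE z in N. 0 < fst z \<and> fst z < T"
    and eq: "\<And>\<zeta> \<theta>. smooth \<zeta> \<Longrightarrow> supp_in T \<zeta> \<Longrightarrow> smooth \<theta> \<Longrightarrow> zperiodic \<theta> \<Longrightarrow>
      (LINT z|M. \<zeta> (fst z) * \<theta> (snd z)) = (LINT z|N. \<zeta> (fst z) * \<theta> (snd z))"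
  shows "M = N"
proof -
  interpret M: finite_measure M by fact
  interpret N: finite_measure N by fact
  have spM: "space M = spacetime T" "space N = spacetime T"
    using sets_eq_imp_space_eq[OF M(2)] sets_eq_imp_space_eq[OF N(2)] by simp_all
  have lim: "measure M A = measure N A"
    if A: "A \<in> sets M" and g: "\<And>n. smooth (\<zeta> n)" "\<And>n. supp_in T (\<zeta> n)" "\<And>n. smooth (\<theta> n)" "\<And>n. zperiodic (\<theta> n)"
      and b: "\<And>n t. \<bar>\<zeta> n t\<bar> \<le> 1" "\<And>n x. \<bar>\<theta> n x\<bar> \<le> 1"
      and l: "\<And>z. z \<in> spacetime T \<Longrightarrow> 0 < fst z \<Longrightarrow> fst z < T \<Longrightarrow> (\<lambda>n. \<zeta> n (fst z) * \<theta> n (snd z)) \<longlonglongrightarrow> indicator A z"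
    for A \<zeta> and \<theta> :: "nat \<Rightarrow> real^'n \<Rightarrow> real"
  proof -
    have "(\<lambda>n. LINT z|K. \<zeta> n (fst z) * \<theta> n (snd z)) \<longlonglongrightarrow> measure K A"
      if K: "finite_measure K" "sets K = sets (D_borel T)" "AE z in K. 0 < fst z \<and> fst z < T" for K
    proof -
      interpret K: finite_measure K by fact
      have spK: "space K = spacetime T" using sets_eq_imp_space_eq[OF K(2)] by simp
      have [measurable]: "A \<in> sets K" using A M K by simp
      have "(\<lambda>n. LINT z|K. \<zeta> n (fst z) * \<theta> n (snd z)) \<longlonglongrightarrow> (LINT z|K. indicator A z)"
      proof (rule integral_dominated_convergence[where w="\<lambda>_. 1"])
        show "AE z in K. (\<lambda>n. \<zeta> n (fst z) * \<theta> n (snd z)) \<longlonglongrightarrow> indicator A z"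
          using K(3) AE_space by eventually_elim (use l spK in auto)
        show "(\<lambda>z. \<zeta> n (fst z) * \<theta> n (snd z)) \<in> borel_measurable K" for n
          using integrable_test_fun[OF K(1,2) test_fun_product[OF g]] by (rule borel_measurable_integrable)
      qed (auto simp: abs_mult intro!: mult_le_one b)
      then show ?thesis by simp
    qed
    from this[OF M ends(1)] this[OF N ends(2)] show ?thesis
      unfolding eq[OF g] by (rule LIMSEQ_unique)
  qed
  obtain \<zeta>1 where \<zeta>1: "\<And>n. smooth (\<zeta>1 n)" "\<And>n t. 0 \<le> \<zeta>1 n t" "\<And>n t. \<zeta>1 n t \<le> 1" "\<And>n. supp_in T (\<zeta>1 n)"
     "\<And>t. (\<lambda>n. \<zeta>1 n t) \<longlonglongrightarrow> indicator {0<..<T} t"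
    by (rule time_cutoffs[OF T]) (rule that)
  \<comment> \<open>Equality of total masses, required for complements, comes from cutoffs that
    increase the visible time interval to the open strip.\<close>
  have total: "measure M (spacetime T) = measure N (spacetime T)"
  proof (rule lim[where \<zeta>=\<zeta>1 and \<theta>="\<lambda>_ _. 1"])
    show "(\<lambda>n. \<zeta>1 n (fst z) * 1) \<longlonglongrightarrow> indicator (spacetime T) z" if "z \<in> spacetime T" "0 < fst z" "fst z < T" for z
      using \<zeta>1(5)[of "fst z"] that by simp
  qed (use \<zeta>1 spM sets.top[of M] in \<open>auto simp: smooth_const zperiodic_def\<close>)
  have sub: "sigma_sets (spacetime T) (test_rects T) \<subseteq> sets M"
  proof -
    have "test_rects T \<subseteq> sets M"
    proof
      fix A :: "(real \<times> (real^'n)) set" assume "A \<in> test_rects T"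
      then obtain \<zeta> \<theta> where A: "A = test_rect T \<zeta> \<theta>" "smooth \<zeta>" "smooth \<theta>" "zperiodic \<theta>"
        unfolding test_rects_def by blast
      have "(\<lambda>z. \<zeta> (fst z)) \<in> borel_measurable M" "(\<lambda>z. \<theta> (snd z)) \<in> borel_measurable M"
        by (rule borel_measurable_integrable, rule integrable_cont_D[OF _ M], rule cont_D_smooth_periodic,
            rule smooth_periodic_fst smooth_periodic_snd, (rule A)+)+
      then have "{z \<in> space M. 0 < \<zeta> (fst z) \<and> 0 < \<theta> (snd z)} \<in> sets M" by measurable
      then show "A \<in> sets M" by (simp add: A(1) test_rect_def spM)
    qed
    then show ?thesis using sets.sigma_sets_subset[of _ M] spM by simp
  qed
  have sets: "measure M A = measure N A" if "A \<in> sigma_sets (spacetime T) (test_rects T)" for A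
    using Int_stable_test_rects test_rects_Pow that
  proof (induction rule: sigma_sets_induct_disjoint)
    case (basic A)
    then obtain \<zeta> \<theta> where A: "A = test_rect T \<zeta> \<theta>" "smooth \<zeta>" "\<And>t. 0 \<le> \<zeta> t" "supp_in T \<zeta>" "smooth \<theta>" "\<And>x. 0 \<le> \<theta> x" "zperiodic \<theta>"
      unfolding test_rects_def by blast
    have z: "zperiodic (\<lambda>x. exp_cut n (\<theta> x))" for n by (rule zperiodic_comp[OF A(7)])
    show ?case
    proof (rule lim[where \<zeta>="\<lambda>n t. exp_cut n (\<zeta> t)" and \<theta>="\<lambda>n x. exp_cut n (\<theta> x)"])
      show "A \<in> sets M" using sub basic by (auto intro: sigma_sets.Basic)
      show "(\<lambda>n. exp_cut n (\<zeta> (fst z)) * exp_cut n (\<theta> (snd z))) \<longlonglongrightarrow> indicator A z" if "z \<in> spacetime T" for z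
        unfolding A(1) by (intro test_rect_indicator_lim A that)
    qed (use exp_cut[OF A(3)] exp_cut[OF A(6)] in \<open>auto intro!: smooth_exp_cut supp_in_exp_cut A z\<close>)
  next
    case (compl A)
    then have "A \<in> sets M" "A \<in> sets N" using sub M N by auto
    then show ?case using compl total M.finite_measure_compl[of A] N.finite_measure_compl[of A] by (simp add: spM)
  next
    case (union A)
    then have r: "range A \<subseteq> sets M" "range A \<subseteq> sets N" using sub M N by auto
    show ?case
      using M.finite_measure_UNION[OF r(1) union(1)] N.finite_measure_UNION[OF r(2) union(1)] union(3)
      by (simp add: sums_iff)
  qed simp
  show ?thesis
  proof (rule measure_eqI)
    show "sets M = sets N" using M N by simp
    fix A assume A: "A \<in> sets M"
    let ?A = "A \<inter> {0<..<T} \<times> UNIV"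
    have A': "?A \<in> sigma_sets (spacetime T) (test_rects T)"
      by (rule sigma_test_rects[OF T]) (use A M in simp)
    have AM: "?A \<in> sets M" using A' sub by blast
    have "emeasure M A = emeasure M ?A"
      by (rule emeasure_eq_AE) (use ends A AM in auto)
    also have "\<dots> = emeasure N ?A"
      using sets[OF A'] by (simp add: M.emeasure_eq_measure N.emeasure_eq_measure)
    also have "\<dots> = emeasure N A"
      by (rule emeasure_eq_AE) (use ends A AM M N in auto)
    finally show "emeasure M A = emeasure N A" .
  qed
qed

subsection \<open>Integration against vector measures with a density\<close>

text \<open>The supremum is attained at the part of \<open>A\<close> where \<open>f\<close> is
  positive, which is the Hahn decomposition made explicit. \<open>ennreal\<close> sends negative
  values to 0, so the density on the right is the positive part of \<open>f\<close>.\<close>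

lemma pos_variation_density:
  assumes f: "integrable M f" and setsN: "sets N = sets M"
  shows "pos_variation N (\<lambda>A. LINT z:A|M. f z) = density M (\<lambda>z. ennreal (f z))"
proof -
  have [measurable]: "f \<in> borel_measurable M" using f by auto
  have spN: "space N = space M" using sets_eq_imp_space_eq[OF setsN] .
  have sup: "(SUP B\<in>{B \<in> sets N. B \<subseteq> A}. ennreal (LINT z:B|M. f z)) = emeasure (density M (\<lambda>z. ennreal (f z))) A"
    if A: "A \<in> sets M" for A
  proof (rule antisym)
    show "(SUP B\<in>{B \<in> sets N. B \<subseteq> A}. ennreal (LINT z:B|M. f z)) \<le> emeasure (density M (\<lambda>z. ennreal (f z))) A"
    proof (rule SUP_least, clarsimp simp: setsN)
      fix B assume B: "B \<in> sets M" "B \<subseteq> A"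
      have mx: "integrable M (\<lambda>z. indicator B z * max 0 (f z))"
        using integrable_mult_indicator[OF B(1), of "\<lambda>z. max 0 (f z)"] f by simp
      have "ennreal (LINT z:B|M. f z) \<le> ennreal (LINT z:B|M. max 0 (f z))"
        unfolding set_lebesgue_integral_def using f B
        by (intro ennreal_leI integral_mono integrable_mult_indicator integrable_max) (auto simp: indicator_def)
      also have "\<dots> = (\<integral>\<^sup>+z. ennreal (indicator B z * max 0 (f z)) \<partial>M)"
        unfolding set_lebesgue_integral_def using mx by (subst nn_integral_eq_integral) auto
      also have "\<dots> \<le> (\<integral>\<^sup>+z. ennreal (f z) * indicator A z \<partial>M)"
        using B by (intro nn_integral_mono) (auto simp: indicator_def ennreal_max_0' max_def ennreal_neg)
      also have "\<dots> = emeasure (density M (\<lambda>z. ennreal (f z))) A"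
        using A by (simp add: emeasure_density)
      finally show "ennreal (LINT z:B|M. f z) \<le> emeasure (density M (\<lambda>z. ennreal (f z))) A" .
    qed
    define B where "B = A \<inter> {z \<in> space M. 0 < f z}"
    have B: "B \<in> sets M" "B \<subseteq> A" using A by (auto simp: B_def)
    have "emeasure (density M (\<lambda>z. ennreal (f z))) A = (\<integral>\<^sup>+z. ennreal (indicator B z * f z) \<partial>M)"
      using A by (subst emeasure_density) (auto intro!: nn_integral_cong simp: B_def indicator_def ennreal_neg)
    also have "\<dots> = ennreal (LINT z:B|M. f z)"
      unfolding set_lebesgue_integral_def using integrable_mult_indicator[OF B(1) f]
      by (subst nn_integral_eq_integral) (auto simp: B_def indicator_def)
    also have "\<dots> \<le> (SUP B\<in>{B \<in> sets N. B \<subseteq> A}. ennreal (LINT z:B|M. f z))"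
      using B by (intro SUP_upper) (auto simp: setsN)
    finally show "emeasure (density M (\<lambda>z. ennreal (f z))) A \<le> (SUP B\<in>{B \<in> sets N. B \<subseteq> A}. ennreal (LINT z:B|M. f z))" .
  qed
  have "pos_variation N (\<lambda>A. LINT z:A|M. f z) = measure_of (space M) (sets M) (emeasure (density M (\<lambda>z. ennreal (f z))))"
    unfolding pos_variation_def setsN spN
    by (rule measure_of_eq[OF sets.space_closed]) (simp add: sets.sigma_sets_eq sup[unfolded setsN])
  also have "\<dots> = density M (\<lambda>z. ennreal (f z))"
    using measure_of_of_measure[of "density M (\<lambda>z. ennreal (f z))"] by simp
  finally show ?thesis .
qed

text \<open>The two Jordan parts are the densities \<open>max 0 f\<close> and
  \<open>max 0 (- f)\<close>, and their difference is \<open>f\<close>.\<close>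

lemma signed_integral_density:
  fixes f g :: "'a \<Rightarrow> real"
  assumes f: "integrable M f" and setsN: "sets N = sets M" and g: "g \<in> borel_measurable M"
    and fg: "integrable M (\<lambda>z. f z * g z)"
  shows "signed_integral N (\<lambda>A. LINT z:A|M. f z) g = (LINT z|M. f z * g z)"
proof -
  have [measurable]: "f \<in> borel_measurable M" "g \<in> borel_measurable M" using f g by auto
  have "(\<lambda>A. - (LINT z:A|M. f z)) = (\<lambda>A. LINT z:A|M. - f z)"
    unfolding set_lebesgue_integral_def by (auto simp: fun_eq_iff)
  then have "signed_integral N (\<lambda>A. LINT z:A|M. f z) g =
      (LINT z|density M (\<lambda>z. ennreal (f z)). g z) - (LINT z|density M (\<lambda>z. ennreal (- f z)). g z)"
    using f setsN unfolding signed_integral_def by (simp add: pos_variation_density)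
  also have "(LINT z|density M (\<lambda>z. ennreal (f z)). g z) = (LINT z|density M (\<lambda>z. ennreal (max 0 (f z))). g z)"
    by (simp add: ennreal_max_0')
  also have "\<dots> = (LINT z|M. max 0 (f z) * g z)"
    by (subst integral_density) auto
  also have "(LINT z|density M (\<lambda>z. ennreal (- f z)). g z) = (LINT z|density M (\<lambda>z. ennreal (max 0 (- f z))). g z)"
    by (simp add: ennreal_max_0')
  also have "\<dots> = (LINT z|M. max 0 (- f z) * g z)"
    by (subst integral_density) auto
  also have "(LINT z|M. max 0 (f z) * g z) - (LINT z|M. max 0 (- f z) * g z) = (LINT z|M. max 0 (f z) * g z - max 0 (- f z) * g z)"
    by (rule Bochner_Integration.integral_diff[symmetric];
        rule Bochner_Integration.integrable_bound[OF fg]; (measurable; fail)?; auto simp: abs_mult max_def intro!: AE_I2)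
  also have "\<dots> = (LINT z|M. f z * g z)"
    by (intro Bochner_Integration.integral_cong) (auto simp: max_def)
  finally show ?thesis .
qed

lemma set_integral_vec_nth:
  fixes v :: "'a \<Rightarrow> real^'n"
  assumes "integrable M v" "A \<in> sets M"
  shows "(LINT z:A|M. v z) $ i = (LINT z:A|M. v z $ i)"
proof -
  have "integrable M (\<lambda>z. indicator A z *\<^sub>R v z)" using assms by (intro integrable_mult_indicator)
  from integral_bounded_linear[OF bounded_linear_vec_nth this, of i] show ?thesis
    by (simp add: set_lebesgue_integral_def)
qed

lemma integrable_vec_nth: "integrable M v \<Longrightarrow> integrable M (\<lambda>z. v z $ i)" for v :: "'a \<Rightarrow> real^'n"
  by (rule integrable_bounded_linear[OF bounded_linear_vec_nth])

text \<open>A set function may take arbitrary values outside the sigma-algebra, and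
  \<open>measure_of\<close> ignores them. This permits replacing \<open>J\<close> by its density
  formula on measurable sets alone.\<close>

lemma signed_integral_cong:
  assumes "\<And>A. A \<in> sets N \<Longrightarrow> \<nu> A = \<nu>' A"
  shows "signed_integral N \<nu> g = signed_integral N \<nu>' g"
proof -
  have "pos_variation N \<kappa> = pos_variation N \<kappa>'" if "\<And>A. A \<in> sets N \<Longrightarrow> \<kappa> A = \<kappa>' A" for \<kappa> \<kappa>'
    unfolding pos_variation_def
    by (rule measure_of_eq[OF sets.space_closed]) (use that in \<open>auto simp: sets.sigma_sets_eq intro!: SUP_cong\<close>)
  then show ?thesis using assms unfolding signed_integral_def by metis
qed

text \<open>The bridge from the pairing through Jordan decompositions to an ordinary integral;
  afterwards the flux enters only through its velocity.\<close>

lemma integral_dot_density: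
  fixes v m :: "real \<times> (real^'n) \<Rightarrow> real^'n"
  assumes v: "integrable M v" and setsM: "sets M = sets (D_borel T)"
    and J: "\<And>A. A \<in> sets M \<Longrightarrow> J A = (LINT z:A|M. v z)"
    and M: "finite_measure M" and m: "cont_D T m"
  shows "integral_dot T m J = (LINT z|M. v z \<bullet> m z)" and "integrable M (\<lambda>z. v z \<bullet> m z)"
proof -
  have spM: "space M = spacetime T" using sets_eq_imp_space_eq[OF setsM] by simp
  obtain B where B: "B > 0" "\<And>t x. t \<in> {0..T} \<Longrightarrow> norm (m (t, x)) \<le> B" using cont_D_bounded[OF m] by blast
  have mi: "(\<lambda>z. m z $ i) \<in> borel_measurable M" for i
    using integrable_vec_nth[OF integrable_cont_D[OF m M setsM]] by (rule borel_measurable_integrable)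
  have vmi: "integrable M (\<lambda>z. v z $ i * m z $ i)" for i
  proof (rule Bochner_Integration.integrable_bound[where f="\<lambda>z. B * (v z $ i)"])
    show "integrable M (\<lambda>z. B * (v z $ i))" using integrable_vec_nth[OF v] by auto
    show "(\<lambda>z. v z $ i * m z $ i) \<in> borel_measurable M"
      using borel_measurable_integrable[OF integrable_vec_nth[OF v]] mi by measurable
    show "AE z in M. norm (v z $ i * m z $ i) \<le> norm (B * v z $ i)"
    proof (rule AE_I2)
      fix z assume "z \<in> space M"
      then have "\<bar>m z $ i\<bar> \<le> B"
        using B(2)[of "fst z" "snd z"] component_le_norm_cart[of "m z" i] by (auto simp: spM spacetime_def)
      then show "norm (v z $ i * m z $ i) \<le> norm (B * v z $ i)"
        using B(1) by (simp add: abs_mult mult.commute mult_right_mono)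
    qed
  qed
  have "signed_integral (D_borel T) (\<lambda>A. J A $ i) (\<lambda>z. m z $ i) = (LINT z|M. v z $ i * m z $ i)" for i
  proof -
    have "signed_integral (D_borel T) (\<lambda>A. J A $ i) (\<lambda>z. m z $ i) = signed_integral (D_borel T) (\<lambda>A. LINT z:A|M. v z $ i) (\<lambda>z. m z $ i)"
      by (rule signed_integral_cong) (use J setsM set_integral_vec_nth[OF v] in auto)
    also have "\<dots> = (LINT z|M. v z $ i * m z $ i)"
      by (rule signed_integral_density[OF integrable_vec_nth[OF v] setsM[symmetric] mi vmi])
    finally show ?thesis .
  qed
  then have "integral_dot T m J = (\<Sum>i\<in>UNIV. LINT z|M. v z $ i * m z $ i)"
    by (simp add: integral_dot_def)
  also have "\<dots> = (LINT z|M. v z \<bullet> m z)"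
    using vmi by (subst Bochner_Integration.integral_sum[symmetric]) (auto simp: inner_vec_def)
  finally show "integral_dot T m J = (LINT z|M. v z \<bullet> m z)" .
  show "integrable M (\<lambda>z. v z \<bullet> m z)"
    unfolding inner_vec_def using vmi by auto
qed

subsection \<open>Weak limits of probability measures on the torus\<close>

text \<open>Digit expansions in a base with gaps give an injective Borel code \<open>torus_cell \<rightarrow> real\<close> with a
  continuous left inverse, so that Helly's theorem on the line applies to the codes.\<close>

lemma digit_gap:
  fixes d :: "nat \<Rightarrow> real" and P :: nat
  assumes P: "P \<ge> 1" and d: "\<And>j. \<bar>d j\<bar> \<le> real P - 1" "\<And>j. j < N \<Longrightarrow> d j = 0" "\<bar>d N\<bar> \<ge> 1"
  shows "(1 / (2 * real P)) ^ N / 2 \<le> \<bar>\<Sum>j. d j * (1 / (2 * real P)) ^ j\<bar>"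
proof -
  define w where "w = 1 / (2 * real P)"
  have w: "0 < w" "w < 1" using P by (auto simp: w_def)
  have gs: "summable (\<lambda>j. w ^ j)" using w by (intro summable_geometric) auto
  have sum: "summable (\<lambda>j. d (j + k) * w ^ j)" for k
  proof (rule summable_comparison_test')
    show "summable (\<lambda>j. (real P - 1) * w ^ j)" using gs by (rule summable_mult)
    show "norm (d (j + k) * w ^ j) \<le> (real P - 1) * w ^ j" for j
      using d(1)[of "j + k"] w by (simp add: abs_mult mult_right_mono)
  qed
  have "(\<Sum>j. d j * w ^ j) = (\<Sum>j. d (j + N) * w ^ (j + N)) + (\<Sum>j<N. d j * w ^ j)"
    using sum[of 0] by (intro suminf_split_initial_segment) simp
  also have "(\<Sum>j<N. d j * w ^ j) = 0" using d(2) by simp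
  also have "(\<Sum>j. d (j + N) * w ^ (j + N)) = w ^ N * (\<Sum>j. d (j + N) * w ^ j)"
    using suminf_mult[OF sum[of N], of "w ^ N"] by (simp add: power_add mult_ac)
  finally have 1: "(\<Sum>j. d j * w ^ j) = w ^ N * (\<Sum>j. d (j + N) * w ^ j)" by simp
  have 2: "(\<Sum>j. d (j + N) * w ^ j) = (\<Sum>j. d (Suc j + N) * w ^ Suc j) + d N"
    using suminf_split_head[OF sum[of N]] by simp
  \<comment> \<open>With \<open>w = 1 / (2 P)\<close> the geometric tail is at most
    \<open>(P - 1) / (2 P - 1)\<close>, hence at most 1/2, whereas the leading digit is at least 1
    in absolute value. This is why the base is twice the number of digits.\<close>
  have 3: "\<bar>\<Sum>j. d (Suc j + N) * w ^ Suc j\<bar> \<le> 1 / 2"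
  proof -
    have "\<bar>\<Sum>j. d (Suc j + N) * w ^ Suc j\<bar> \<le> (\<Sum>j. (real P - 1) * w * w ^ j)"
    proof (rule order_trans[OF summable_rabs suminf_le])
      show s: "summable (\<lambda>j. (real P - 1) * w * w ^ j)" using gs by (rule summable_mult)
      show le: "\<bar>d (Suc j + N) * w ^ Suc j\<bar> \<le> (real P - 1) * w * w ^ j" for j
        using d(1)[of "Suc j + N"] w by (simp add: abs_mult mult_right_mono)
      show "summable (\<lambda>j. \<bar>d (Suc j + N) * w ^ Suc j\<bar>)"
        by (rule summable_comparison_test'[OF s]) (use le in simp)
      then show "summable (\<lambda>j. \<bar>d (Suc j + N) * w ^ Suc j\<bar>)" .
    qed
    also have "\<dots> = (real P - 1) * w * (1 / (1 - w))"
      using w by (subst suminf_mult[OF gs]) (simp add: suminf_geometric)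
    also have "\<dots> \<le> 1 / 2"
      using P by (simp add: w_def divide_simps)
    finally show ?thesis .
  qed
  have "1 / 2 \<le> \<bar>\<Sum>j. d (j + N) * w ^ j\<bar>" using 2 3 d(3) by linarith
  then have "w ^ N * (1 / 2) \<le> w ^ N * \<bar>\<Sum>j. d (j + N) * w ^ j\<bar>" using w by (intro mult_left_mono) auto
  then show ?thesis unfolding w_def[symmetric] 1 using w by (simp add: abs_mult)
qed

lemma floor_double: "\<lfloor>2 * z\<rfloor> = 2 * \<lfloor>z\<rfloor> + (if odd \<lfloor>2 * z\<rfloor> then 1 else 0)" for z :: real
proof -
  have "\<lfloor>2 * z\<rfloor> = 2 * \<lfloor>z\<rfloor> \<or> \<lfloor>2 * z\<rfloor> = 2 * \<lfloor>z\<rfloor> + 1" by linarith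
  then show ?thesis by auto
qed

text \<open>Digit \<open>j\<close> of the code packs the \<open>j\<close>-th binary digits of all
  coordinates into one number below \<open>P\<close>. Codes that are close share their leading
  digits, so their points share a small dyadic cube: the inverse is uniformly continuous although
  \<open>enc\<close> itself jumps.\<close>

lemma torus_code:
  obtains enc :: "real^'n \<Rightarrow> real" and C :: "real \<Rightarrow> real^'n" and K :: real
  where "enc \<in> borel_measurable borel" "continuous_on UNIV C" "\<And>x. x \<in> torus_cell \<Longrightarrow> C (enc x) = x"
    "\<And>x. \<bar>enc x\<bar> \<le> K"
proof -
  obtain code :: "('n \<Rightarrow> bool) \<Rightarrow> nat" and P where code: "inj code" "range code = {i. i < P}"
    using finite_imp_inj_to_nat_seg[of "UNIV :: ('n \<Rightarrow> bool) set"] by auto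
  have codeP: "code b < P" for b using code(2) by auto
  have P: "P \<ge> 1" using codeP[of undefined] by simp
  define w where "w = 1 / (2 * real P)"
  have w: "0 < w" "w < 1" using P by (auto simp: w_def)
  have gs: "summable (\<lambda>j. w ^ j)" using w by (intro summable_geometric) auto
  \<comment> \<open>The parity of the floor of \<open>2^(j+1) * x_i\<close> is the binary digit of
    weight \<open>2^-(j+1)\<close> of the coordinate.\<close>
  define bits where "bits j x = (\<lambda>i. odd \<lfloor>2 ^ Suc j * x $ i\<rfloor>)" for j :: nat and x :: "real^'n"
  define enc where "enc x = (\<Sum>j. real (code (bits j x)) * w ^ j)" for x
  have le: "norm (real (code (bits j x)) * w ^ j) \<le> real P * w ^ j" for j x
    using codeP[of "bits j x"] w by (simp add: abs_mult mult_right_mono less_imp_le)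
  have sum: "summable (\<lambda>j. real (code (bits j x)) * w ^ j)" for x
    by (rule summable_comparison_test'[OF summable_mult[OF gs, of "real P"]]) (rule le)
  have bound: "\<bar>enc x\<bar> \<le> (\<Sum>j. real P * w ^ j)" for x
  proof -
    have s: "summable (\<lambda>j. norm (real (code (bits j x)) * w ^ j))"
      by (rule summable_comparison_test'[OF summable_mult[OF gs, of "real P"]]) (use le in simp)
    have "norm (enc x) \<le> (\<Sum>j. norm (real (code (bits j x)) * w ^ j))"
      unfolding enc_def by (rule summable_norm[OF s])
    also have "\<dots> \<le> (\<Sum>j. real P * w ^ j)"
      by (rule suminf_le[OF le s summable_mult[OF gs]])
    finally show ?thesis by simp
  qed
  have bits_meas: "(\<lambda>x. real (code (bits j x))) \<in> borel_measurable borel" for j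
  proof -
    have "{x. bits j x = b} \<in> sets borel" for b
    proof -
      have "{x. bits j x = b} = (\<Inter>i. (\<lambda>x. \<lfloor>2 ^ Suc j * x $ i\<rfloor>) -` {k. odd k = b i} \<inter> space borel)"
        by (auto simp: bits_def fun_eq_iff)
      also have "\<dots> \<in> sets borel"
      proof (intro sets.finite_INT)
        fix i
        have "(\<lambda>x::real^'n. 2 ^ Suc j * x $ i) \<in> borel_measurable borel"
          by (intro borel_measurable_continuous_onI continuous_intros)
        then have "(\<lambda>x::real^'n. \<lfloor>2 ^ Suc j * x $ i\<rfloor>) \<in> measurable borel (count_space UNIV)"
          by (rule measurable_compose[OF _ measurable_real_floor])
        then show "(\<lambda>x::real^'n. \<lfloor>2 ^ Suc j * x $ i\<rfloor>) -` {k. odd k = b i} \<inter> space borel \<in> sets borel"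
          by (rule measurable_sets) simp
      qed auto
      finally show ?thesis .
    qed
    then have "(\<lambda>x. \<Sum>b\<in>UNIV. real (code b) * indicator {x. bits j x = b} x) \<in> borel_measurable borel"
      by (intro borel_measurable_sum borel_measurable_times borel_measurable_const borel_measurable_indicator)
    moreover have "(\<Sum>b\<in>UNIV. real (code b) * indicator {x. bits j x = b} x) = real (code (bits j x))" for x
      by (subst sum.remove[of _ "bits j x"]) (auto intro!: sum.neutral)
    ultimately show ?thesis by simp
  qed
  have meas: "enc \<in> borel_measurable borel"
  proof (rule borel_measurable_LIMSEQ_real)
    show "(\<lambda>n. \<Sum>j<n. real (code (bits j x)) * w ^ j) \<longlonglongrightarrow> enc x" for x
      unfolding enc_def by (rule summable_LIMSEQ[OF sum])
    show "(\<lambda>x. \<Sum>j<n. real (code (bits j x)) * w ^ j) \<in> borel_measurable borel" for n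
      using bits_meas by (intro borel_measurable_sum borel_measurable_times) auto
  qed
  \<comment> \<open>Otherwise \<open>digit_gap\<close> at the first differing position
    \<open>m\<close>, which is at most \<open>N\<close>, would separate the codes by at least
    \<open>w^m / 2\<close>, hence by \<open>w^N / 2\<close>.\<close>
  have agree: "bits j x = bits j y" if "\<bar>enc x - enc y\<bar> < w ^ N / 2" "j \<le> N" for x y N j
  proof (rule ccontr)
    assume ne: "bits j x \<noteq> bits j y"
    define m where "m = (LEAST j. bits j x \<noteq> bits j y)"
    have m: "bits m x \<noteq> bits m y" unfolding m_def using ne by (rule LeastI)
    have ml: "i < m \<Longrightarrow> bits i x = bits i y" for i unfolding m_def using not_less_Least by blast
    have mj: "m \<le> N" unfolding m_def using ne that(2) by (meson Least_le order_trans)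
    define d where "d i = real (code (bits i x)) - real (code (bits i y))" for i
    have "(1 / (2 * real P)) ^ m / 2 \<le> \<bar>\<Sum>j. d j * (1 / (2 * real P)) ^ j\<bar>"
    proof (rule digit_gap[OF P])
      show "\<bar>d j\<bar> \<le> real P - 1" for j using codeP[of "bits j x"] codeP[of "bits j y"] by (auto simp: d_def)
      show "d i = 0" if "i < m" for i using ml[OF that] by (simp add: d_def)
      have "code (bits m x) \<noteq> code (bits m y)" using m code(1) by (auto dest: injD)
      then show "\<bar>d m\<bar> \<ge> 1" by (auto simp: d_def)
    qed
    also have "(\<Sum>j. d j * (1 / (2 * real P)) ^ j) = enc x - enc y"
      unfolding enc_def d_def w_def[symmetric] left_diff_distrib by (rule suminf_diff[symmetric, OF sum sum])
    finally have "w ^ m / 2 \<le> \<bar>enc x - enc y\<bar>" by (simp add: w_def)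
    moreover have "w ^ N \<le> w ^ m" using w mj by (intro power_decreasing) auto
    ultimately show False using that(1) by simp
  qed
  \<comment> \<open>Digits are accumulated one doubling at a time. In the cell the integer parts at
    level 0 are both zero.\<close>
  have floors: "\<lfloor>2 ^ J * x $ i\<rfloor> = \<lfloor>2 ^ J * y $ i\<rfloor>"
    if xy: "x \<in> torus_cell" "y \<in> torus_cell" and b: "\<And>j. j < J \<Longrightarrow> bits j x = bits j y" for x y J i
    using b
  proof (induction J)
    case 0
    have "\<lfloor>x $ i\<rfloor> = 0" "\<lfloor>y $ i\<rfloor> = 0" using xy by (auto simp: torus_cell_def floor_eq_iff)
    then show ?case by simp
  next
    case (Suc J)
    have "bits J x = bits J y" by (rule Suc.prems) simp
    then have "odd \<lfloor>2 * (2 ^ J * x $ i)\<rfloor> = odd \<lfloor>2 * (2 ^ J * y $ i)\<rfloor>"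
      unfolding bits_def by (auto simp: fun_eq_iff mult.assoc)
    moreover have "\<lfloor>2 ^ J * x $ i\<rfloor> = \<lfloor>2 ^ J * y $ i\<rfloor>" by (rule Suc.IH) (simp add: Suc.prems)
    ultimately have "\<lfloor>2 * (2 ^ J * x $ i)\<rfloor> = \<lfloor>2 * (2 ^ J * y $ i)\<rfloor>"
      using floor_double[of "2 ^ J * x $ i"] floor_double[of "2 ^ J * y $ i"] by simp
    then show ?case by (simp add: mult.assoc)
  qed
  have unif: "\<exists>d>0. \<forall>x\<in>torus_cell. \<forall>y\<in>torus_cell. \<bar>enc x - enc y\<bar> < d \<longrightarrow> dist x y < e" if "e > 0" for e
  proof -
    have "(\<lambda>J. real CARD('n) * (1 / 2) ^ J) \<longlonglongrightarrow> real CARD('n) * 0" by (intro tendsto_intros LIMSEQ_realpow_zero) auto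
    then have "\<forall>\<^sub>F J in sequentially. real CARD('n) * (1 / 2) ^ J < e" using \<open>e > 0\<close> by (intro order_tendstoD) auto
    then obtain J where J: "real CARD('n) * (1 / 2) ^ J < e" by (auto simp: eventually_sequentially)
    show ?thesis
    proof (intro exI[of _ "w ^ J / 2"] conjI ballI impI)
      show "0 < w ^ J / 2" using w by simp
      fix x y :: "real^'n" assume xy: "x \<in> torus_cell" "y \<in> torus_cell" and d: "\<bar>enc x - enc y\<bar> < w ^ J / 2"
      have fl: "\<lfloor>2 ^ J * x $ i\<rfloor> = \<lfloor>2 ^ J * y $ i\<rfloor>" for i
        by (rule floors[OF xy]) (use agree[OF d] in simp)
      have "\<bar>(x - y) $ i\<bar> \<le> (1 / 2) ^ J" for i
      proof -
        have "\<bar>2 ^ J * x $ i - 2 ^ J * y $ i\<bar> < 1" using fl[of i] by linarith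
        then have "2 ^ J * \<bar>x $ i - y $ i\<bar> \<le> 1" by (simp flip: right_diff_distrib add: abs_mult)
        then show ?thesis by (simp add: field_simps power_divide)
      qed
      then have "(\<Sum>i\<in>UNIV. \<bar>(x - y) $ i\<bar>) \<le> (\<Sum>i\<in>(UNIV :: 'n set). (1 / 2) ^ J)" by (intro sum_mono)
      then have "norm (x - y) \<le> real CARD('n) * (1 / 2) ^ J"
        using norm_le_l1_cart[of "x - y"] by simp
      then show "dist x y < e" using J by (simp add: dist_norm)
    qed
  qed
  have inj: "x = y" if "x \<in> torus_cell" "y \<in> torus_cell" "enc x = enc y" for x y
  proof (rule ccontr)
    assume "x \<noteq> y"
    then have "dist x y > 0" by simp
    from unif[OF this] obtain d where d: "d > 0" "\<forall>x'\<in>torus_cell. \<forall>y'\<in>torus_cell. \<bar>enc x' - enc y'\<bar> < d \<longrightarrow> dist x' y' < dist x y"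
      by (elim exE conjE)
    from d(2)[rule_format, OF that(1,2)] d(1) that(3) show False by simp
  qed
  \<comment> \<open>The inverse on the set of codes is uniformly continuous, so it extends to the
    closure, and from this closed set to the whole line by Tietze.\<close>
  define g where "g = inv_into torus_cell enc"
  have g: "g (enc x) = x" if "x \<in> torus_cell" for x
    unfolding g_def using that inj by (intro inv_into_f_f) (auto simp: inj_on_def)
  have "uniformly_continuous_on (enc ` torus_cell) g"
    unfolding uniformly_continuous_on_def
  proof (intro allI impI)
    fix e :: real assume "0 < e"
    from unif[OF this] obtain d where d: "d > 0" "\<forall>x\<in>torus_cell. \<forall>y\<in>torus_cell. \<bar>enc x - enc y\<bar> < d \<longrightarrow> dist x y < e"
      by (elim exE conjE)
    show "\<exists>d>0. \<forall>x\<in>enc ` torus_cell. \<forall>x'\<in>enc ` torus_cell. dist x' x < d \<longrightarrow> dist (g x') (g x) < e"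
      using d by (intro exI[of _ d]) (auto simp: g dist_real_def)
  qed
  then obtain h where h: "uniformly_continuous_on (closure (enc ` torus_cell)) h" "\<And>r. r \<in> enc ` torus_cell \<Longrightarrow> g r = h r"
    by (rule uniformly_continuous_on_extension_on_closure) blast
  have "continuous_on (closure (enc ` torus_cell)) h" using h(1) by (rule uniformly_continuous_imp_continuous)
  then obtain C where C: "continuous_on UNIV C" "\<And>r. r \<in> closure (enc ` torus_cell) \<Longrightarrow> C r = h r"
    by (rule Tietze_unbounded[where U=UNIV]) auto
  show ?thesis
  proof (rule that[OF meas C(1) _ bound])
    fix x :: "real^'n" assume x: "x \<in> torus_cell"
    have "enc x \<in> closure (enc ` torus_cell)" using x closure_subset[of "enc ` torus_cell"] by blast
    then show "C (enc x) = x" using C(2) h(2)[of "enc x"] g[OF x] x by simp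
  qed
qed

text \<open>The codes are uniformly bounded, hence their laws are tight. The limit law may charge
  points that are not codes, where \<open>C\<close> can leave the cell; \<open>torus_rep\<close>
  brings them back without affecting periodic integrands.\<close>

lemma torus_weak_limit:
  fixes \<nu> :: "nat \<Rightarrow> (real^'n) measure"
  assumes prob: "\<And>k. prob_space (\<nu> k)" and sets: "\<And>k. sets (\<nu> k) = sets torus_borel"
  obtains r \<nu>' where "strict_mono r" "prob_space \<nu>'" "sets \<nu>' = sets torus_borel"
    "\<And>\<eta>. cont_torus \<eta> \<Longrightarrow> (\<lambda>k. LINT x|\<nu> (r k). \<eta> x) \<longlonglongrightarrow> (LINT x|\<nu>'. \<eta> x)"
proof -
  obtain enc :: "real^'n \<Rightarrow> real" and C K where enc: "enc \<in> borel_measurable borel" "continuous_on UNIV C"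
    "\<And>x. x \<in> torus_cell \<Longrightarrow> C (enc x) = x" "\<And>x. \<bar>enc x\<bar> \<le> K" by (rule torus_code) (rule that)
  have sp: "space (\<nu> k) = torus_cell" for k using sets_eq_imp_space_eq[OF sets[of k]] by simp
  have encm: "enc \<in> borel_measurable (\<nu> k)" for k
    using restrict_borel_measurable(1)[OF enc(1)] by (simp cong: measurable_cong_sets add: sets)
  define \<kappa> where "\<kappa> k = distr (\<nu> k) borel enc" for k
  have rd: "real_distribution (\<kappa> k)" for k
    unfolding \<kappa>_def by (rule prob_space.real_distribution_distr[OF prob encm])
  have "tight \<kappa>"
    unfolding tight_def
  proof (intro conjI allI impI rd)
    fix \<epsilon> :: real assume "\<epsilon> > 0"
    have K0: "K \<ge> 0" using enc(4)[of 0] by linarith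
    have "measure (\<kappa> k) {-K - 1<..K + 1} = 1" for k
    proof -
      have "measure (\<kappa> k) {-K - 1<..K + 1} = measure (\<nu> k) (enc -` {-K - 1<..K + 1} \<inter> space (\<nu> k))"
        unfolding \<kappa>_def using encm by (intro measure_distr) auto
      also have "enc -` {-K - 1<..K + 1} \<inter> space (\<nu> k) = space (\<nu> k)"
      proof -
        have "enc x \<in> {-K - 1<..K + 1}" for x using enc(4)[of x] by auto
        then show ?thesis by auto
      qed
      finally show ?thesis using prob_space.prob_space[OF prob] by simp
    qed
    then show "\<exists>a b. a < b \<and> (\<forall>k. 1 - \<epsilon> < measure (\<kappa> k) {a<..b})"
      using \<open>\<epsilon> > 0\<close> K0 by (intro exI[of _ "-K - 1"] exI[of _ "K + 1"]) auto
  qed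
  from tight_imp_convergent_subsubsequence[OF this strict_mono_id]
  obtain r M where r: "strict_mono r" and M: "real_distribution M" and conv: "weak_conv_m (\<kappa> \<circ> id \<circ> r) M" by blast
  define p where "p y = torus_rep (C y)" for y
  have pm: "p \<in> measurable M torus_borel"
  proof (rule measurable_restrict_space2)
    have "C \<in> borel_measurable borel" by (rule borel_measurable_continuous_onI[OF enc(2)])
    then have "p \<in> borel_measurable borel" unfolding p_def[abs_def] by (rule measurable_compose[OF _ measurable_torus_rep])
    then show "p \<in> borel_measurable M"
      using M by (simp cong: measurable_cong_sets add: real_distribution.events_eq_borel)
  qed (simp add: p_def torus_rep_in)
  show ?thesis
  proof (rule that[OF r])
    show "prob_space (distr M torus_borel p)"
      using M pm by (intro prob_space.prob_space_distr) (auto simp: real_distribution_def)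
    show "sets (distr M torus_borel p) = sets torus_borel" by simp
    fix \<eta> :: "real^'n \<Rightarrow> real" assume \<eta>: "cont_torus \<eta>"
    obtain B where B: "\<And>x. \<bar>\<eta> x\<bar> \<le> B" using cont_torus_bounded[OF \<eta>] by blast
    have \<eta>m: "\<eta> \<in> borel_measurable borel" by (rule cont_torus_measurable[OF \<eta>])
    \<comment> \<open>The function tested on the line is \<open>\<eta>\<close> after
      \<open>C\<close>. It is continuous, and composed with \<open>enc\<close> it gives back
      \<open>\<eta>\<close> on the cell, so the jumps of \<open>enc\<close> do no harm.\<close>
    have cc: "continuous_on UNIV (\<lambda>y. \<eta> (C y))"
      using \<eta> enc(2) by (intro continuous_on_compose2[of UNIV \<eta> UNIV C]) (auto simp: cont_torus_def)
    have "(\<lambda>n. integral\<^sup>L ((\<kappa> \<circ> id \<circ> r) n) (\<lambda>y. \<eta> (C y))) \<longlonglongrightarrow> integral\<^sup>L M (\<lambda>y. \<eta> (C y))"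
    proof (rule weak_conv_imp_bdd_ae_continuous_conv[OF _ M conv])
      show "real_distribution ((\<kappa> \<circ> id \<circ> r) n)" for n using rd by simp
      have "{x. \<not> isCont (\<lambda>y. \<eta> (C y)) x} = {}" using cc by (auto simp: continuous_on_eq_continuous_at)
      then show "emeasure M {x. \<not> isCont (\<lambda>y. \<eta> (C y)) x} = 0" by simp
      show "norm (\<eta> (C x)) \<le> B" for x using B by simp
      show "(\<lambda>y. \<eta> (C y)) \<in> borel_measurable borel" by (rule borel_measurable_continuous_onI[OF cc])
    qed
    moreover have "integral\<^sup>L ((\<kappa> \<circ> id \<circ> r) n) (\<lambda>y. \<eta> (C y)) = (LINT x|\<nu> (r n). \<eta> x)" for n
    proof -
      have "integral\<^sup>L ((\<kappa> \<circ> id \<circ> r) n) (\<lambda>y. \<eta> (C y)) = (LINT x|\<nu> (r n). \<eta> (C (enc x)))"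
        unfolding \<kappa>_def comp_def id_def
        by (rule integral_distr[OF encm borel_measurable_continuous_onI[OF cc]])
      also have "\<dots> = (LINT x|\<nu> (r n). \<eta> x)"
        by (intro Bochner_Integration.integral_cong) (auto simp: sp enc(3))
      finally show ?thesis .
    qed
    moreover have "integral\<^sup>L M (\<lambda>y. \<eta> (C y)) = (LINT x|distr M torus_borel p. \<eta> x)"
    proof -
      have "(LINT x|distr M torus_borel p. \<eta> x) = (LINT y|M. \<eta> (p y))"
        by (rule integral_distr[OF pm restrict_borel_measurable(1)[OF \<eta>m]])
      also have "\<dots> = integral\<^sup>L M (\<lambda>y. \<eta> (C y))"
        using \<eta> by (simp add: p_def zperiodic_rep cont_torus_def)
      finally show ?thesis by simp
    qed
    ultimately show "(\<lambda>k. LINT x|\<nu> (r k). \<eta> x) \<longlonglongrightarrow> (LINT x|distr M torus_borel p. \<eta> x)" by simp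
  qed
qed

subsection \<open>Convolution with a smooth kernel\<close>

text \<open>A class closed under all partial derivatives, which allows regularity of convolutions to
  be proved by induction over the kernel.\<close>

definition kernel :: "(real \<times> (real^'n) \<Rightarrow> real) \<Rightarrow> bool" where
  "kernel K \<longleftrightarrow> smooth_periodic K \<and> (\<exists>R. \<forall>u x. \<bar>u\<bar> > R \<longrightarrow> K (u, x) = 0)"

lemma kernel_smooth: "kernel K \<Longrightarrow> smooth K"
  by (simp add: kernel_def smooth_periodic_def)

lemma frechet_derivative_zero_outside:
  assumes "\<And>u x. \<bar>u\<bar> > R \<Longrightarrow> K (u :: real, x) = 0" "\<bar>u\<bar> > R"
  shows "frechet_derivative K (at (u, x :: real^'n)) = (\<lambda>_. 0 :: real)"
proof -
  have "((\<lambda>_. 0) has_derivative (\<lambda>_. 0)) (at (u, x))" by simp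
  then have "(K has_derivative (\<lambda>_. 0)) (at (u, x))"
  proof (rule has_derivative_transform_within_open)
    show "open ({u. \<bar>u\<bar> > R} \<times> (UNIV :: (real^'n) set))"
      by (intro open_Times open_UNIV open_Collect_less continuous_on_const continuous_on_rabs continuous_on_id)
  qed (use assms in auto)
  then show ?thesis by (rule frechet_derivative_at[symmetric])
qed

lemma kernel_d_t: "kernel K \<Longrightarrow> kernel (d_t K)" and kernel_d_x: "kernel K \<Longrightarrow> kernel (d_x i K)"
  unfolding kernel_def
  by (auto intro!: smooth_periodic_d_t smooth_periodic_d_x)
     (metis d_t_def d_x_def frechet_derivative_zero_outside)+

lemma kernel_bounded:
  assumes "kernel K" obtains B where "B > 0" "\<And>z. \<bar>K z\<bar> \<le> B"
proof -
  obtain R where R: "\<And>u x. \<bar>u\<bar> > R \<Longrightarrow> K (u, x) = 0" using assms unfolding kernel_def by blast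
  have c: "continuous_on UNIV K" by (intro smooth_continuous kernel_smooth assms)
  \<comment> \<open>Shifting time by \<open>R\<close> brings the support into
    \<open>[0, 2 R]\<close>, where the bound for continuous periodic functions applies.\<close>
  have "cont_D (2 * R) (\<lambda>z. K (fst z - R, snd z))"
    unfolding cont_D_def
  proof (intro conjI ballI)
    show "continuous_on ({0..2 * R} \<times> UNIV) (\<lambda>z. K (fst z - R, snd z))"
      by (rule continuous_on_compose2[OF c]) (auto intro!: continuous_intros)
    show "zperiodic (\<lambda>x. K (fst (t, x) - R, snd (t, x)))" for t
      using assms by (simp add: kernel_def smooth_periodic_def)
  qed
  from cont_D_bounded[OF this] obtain B where B: "B > 0" "\<And>t x. t \<in> {0..2 * R} \<Longrightarrow> norm (K (fst (t, x) - R, snd (t, x))) \<le> B"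
    by blast
  have "\<bar>K (u, x)\<bar> \<le> B" for u x
  proof (cases "\<bar>u\<bar> > R")
    case True then show ?thesis using R B(1) by simp
  next
    case False
    then have "u + R \<in> {0..2 * R}" by auto
    from B(2)[OF this, of x] show ?thesis by simp
  qed
  then have "\<bar>K z\<bar> \<le> B" for z by (cases z) auto
  with B(1) show ?thesis by (rule that)
qed

lemma kernel_derivative_bound:
  fixes K :: "real \<times> (real^'n) \<Rightarrow> real"
  assumes "kernel K" obtains B where "B > 0" "\<And>z h. \<bar>fst h * d_t K z + snd h \<bullet> grad_x K z\<bar> \<le> B * norm h"
proof -
  obtain B1 where B1: "B1 > 0" "\<And>z. \<bar>d_t K z\<bar> \<le> B1" using kernel_bounded[OF kernel_d_t[OF assms]] by blast
  have "\<forall>i. \<exists>B. \<forall>z. \<bar>d_x i K z\<bar> \<le> B" using kernel_bounded[OF kernel_d_x[OF assms]] by metis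
  then obtain B2 where B2: "\<And>i z. \<bar>d_x i K z\<bar> \<le> B2 i" by metis
  define B where "B = B1 + (\<Sum>i\<in>UNIV. B2 i)"
  have B20: "B2 i \<ge> 0" for i using B2[of i undefined] by linarith
  show ?thesis
  proof (rule that[of B])
    show "B > 0" unfolding B_def using B1(1) B20 by (intro add_pos_nonneg sum_nonneg)
    fix z h :: "real \<times> (real^'n)"
    have "norm (grad_x K z) \<le> (\<Sum>i\<in>UNIV. B2 i)"
      by (rule order_trans[OF norm_le_l1_cart sum_mono]) (simp add: grad_x_def B2)
    then have "\<bar>snd h \<bullet> grad_x K z\<bar> \<le> norm h * (\<Sum>i\<in>UNIV. B2 i)"
      using norm_snd_le[of "snd h" "fst h"] by (intro order_trans[OF Cauchy_Schwarz_ineq2 mult_mono]) auto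
    moreover have "\<bar>fst h * d_t K z\<bar> \<le> norm h * B1"
      using norm_fst_le[of "fst h" "snd h"] B1 unfolding abs_mult by (intro mult_mono) auto
    ultimately show "\<bar>fst h * d_t K z + snd h \<bullet> grad_x K z\<bar> \<le> B * norm h"
      by (simp add: B_def algebra_simps)
  qed
qed

text \<open>The kernel is taken at \<open>z - w\<close> with \<open>z\<close> the integration
  variable. Thus a bump kernel is a test function in \<open>z\<close>, to which weak derivatives
  apply directly; differentiating in \<open>w\<close> costs a sign.\<close>

definition conv :: "real \<Rightarrow> (real \<times> (real^'n) \<Rightarrow> real) \<Rightarrow> (real \<times> (real^'n) \<Rightarrow> real) \<Rightarrow> real \<times> (real^'n) \<Rightarrow> real" where
  "conv T f K w = (LINT z|D_leb T. f z * K (z - w))"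

lemma kernel_shift_measurable: "kernel K \<Longrightarrow> (\<lambda>z. K (z - w)) \<in> borel_measurable (D_leb T)"
  by (intro restrict_borel_measurable borel_measurable_continuous_onI
       continuous_on_compose2[OF smooth_continuous[OF kernel_smooth]]) (auto intro!: continuous_intros)

lemma integrable_mult_kernel:
  fixes f :: "real \<times> (real^'n) \<Rightarrow> real"
  assumes f: "integrable (D_leb T) f" and K: "kernel K"
  shows "integrable (D_leb T) (\<lambda>z. f z * K (z - w))"
proof -
  obtain B where B: "B > 0" "\<And>z. \<bar>K z\<bar> \<le> B" using kernel_bounded[OF K] by blast
  show ?thesis
  proof (rule Bochner_Integration.integrable_bound[where f="\<lambda>z. B * f z"])
    show "(\<lambda>z. f z * K (z - w)) \<in> borel_measurable (D_leb T)"
      using f kernel_shift_measurable[OF K] by (intro borel_measurable_times) auto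
    show "AE z in D_leb T. norm (f z * K (z - w)) \<le> norm (B * f z)"
    proof (rule AE_I2)
      fix z show "norm (f z * K (z - w)) \<le> norm (B * f z)"
        using mult_right_mono[OF B(2)[of "z - w"], of "\<bar>f z\<bar>"] B(1) by (simp add: abs_mult mult.commute)
    qed
  qed (use f in auto)
qed

text \<open>Differentiation under the integral. The remainder of the kernel divided by
  \<open>norm h\<close> tends to 0 pointwise and is bounded by \<open>2 * B\<close>, so a multiple
  of \<open>|f|\<close> dominates.\<close>

lemma conv_has_derivative:
  fixes f :: "real \<times> (real^'n) \<Rightarrow> real"
  assumes f: "integrable (D_leb T) f" and K: "kernel K"
  shows "(conv T f K has_derivative (\<lambda>h. - (fst h * conv T f (d_t K) w + (\<Sum>i\<in>UNIV. snd h $ i * conv T f (d_x i K) w)))) (at w)"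
proof -
  have sm: "smooth K" by (rule kernel_smooth[OF K])
  obtain B where B: "B > 0" "\<And>z h. \<bar>fst h * d_t K z + snd h \<bullet> grad_x K z\<bar> \<le> B * norm h"
    using kernel_derivative_bound[OF K] by blast
  define L where "L h = - (fst h * conv T f (d_t K) w + (\<Sum>i\<in>UNIV. snd h $ i * conv T f (d_x i K) w))" for h :: "real \<times> (real^'n)"
  have der: "(K has_derivative (\<lambda>y. fst y * d_t K z + snd y \<bullet> grad_x K z)) (at z)" for z
    by (rule smooth_has_derivative_d[OF sm])
  have lip: "\<bar>K x - K y\<bar> \<le> B * norm (x - y)" for x y
  proof -
    have "norm (K x - K y) \<le> B * norm (x - y)"
      by (rule differentiable_bound[OF convex_UNIV has_derivative_at_withinI[OF der]])
         (simp_all add: onorm_le B del: real_norm_def, simp_all add: onorm_le B)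
    then show ?thesis by simp
  qed
  \<comment> \<open>The first-order remainder of \<open>K\<close> at \<open>z - w\<close> in the
    direction \<open>- h\<close>.\<close>
  define e where "e z h = K (z - w - h) - K (z - w) + (fst h * d_t K (z - w) + snd h \<bullet> grad_x K (z - w))" for z h
  have Leq: "conv T f K (w + h) - conv T f K w - L h = (LINT z|D_leb T. f z * e z h)" for h
  proof -
    note I = integrable_mult_kernel[OF f K] integrable_mult_kernel[OF f kernel_d_t[OF K]] integrable_mult_kernel[OF f kernel_d_x[OF K]]
    have "(LINT z|D_leb T. f z * e z h) = (LINT z|D_leb T. f z * K (z - (w + h)) - f z * K (z - w)
        + (fst h * (f z * d_t K (z - w)) + (\<Sum>i\<in>UNIV. snd h $ i * (f z * d_x i K (z - w)))))"
      by (intro Bochner_Integration.integral_cong refl)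
         (simp add: e_def inner_vec_def grad_x_def sum_distrib_left algebra_simps)
    also have "\<dots> = conv T f K (w + h) - conv T f K w + (fst h * conv T f (d_t K) w + (\<Sum>i\<in>UNIV. snd h $ i * conv T f (d_x i K) w))"
      unfolding conv_def
      by (subst Bochner_Integration.integral_add Bochner_Integration.integral_diff Bochner_Integration.integral_sum;
          (intro Bochner_Integration.integrable_add Bochner_Integration.integrable_diff Bochner_Integration.integrable_sum integrable_mult_right I)?)+ simp
    finally show ?thesis by (simp add: L_def)
  qed
  have e_bound: "\<bar>e z h\<bar> \<le> 2 * B * norm h" for z h
    using lip[of "z - w - h" "z - w"] B(2)[of h "z - w"] by (simp add: e_def)
  have e_lim: "((\<lambda>h. e z h / norm h) \<longlongrightarrow> 0) (at 0)" for z
  proof -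
    have "((\<lambda>h. K (z - w - h)) has_derivative (\<lambda>y. - (fst y * d_t K (z - w) + snd y \<bullet> grad_x K (z - w)))) (at 0)"
    proof -
      have 1: "((\<lambda>h. z - w - h) has_derivative (\<lambda>y. - y)) (at 0)" by (auto intro!: derivative_eq_intros)
      have "(K has_derivative (\<lambda>y. fst y * d_t K (z - w) + snd y \<bullet> grad_x K (z - w))) (at (z - w - 0))"
        using der[of "z - w"] by simp
      from has_derivative_compose[OF 1 this] show ?thesis by simp
    qed
    then have "((\<lambda>h. (K (z - w - h) - K (z - w - 0) - (- (fst h * d_t K (z - w) + snd h \<bullet> grad_x K (z - w)))) /\<^sub>R norm h) \<longlongrightarrow> 0) (at 0)"
      unfolding has_derivative_def by simp
    moreover have "(\<lambda>h. (K (z - w - h) - K (z - w - 0) - (- (fst h * d_t K (z - w) + snd h \<bullet> grad_x K (z - w)))) /\<^sub>R norm h)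
        = (\<lambda>h. e z h / norm h)"
      by (rule ext) (simp add: e_def divide_inverse mult.commute)
    ultimately show ?thesis by (simp only:)
  qed
  have em: "(\<lambda>z. e z h) \<in> borel_measurable (D_leb T)" for h
  proof -
    have "(\<lambda>z. K (z - (w + h)) - K (z - w) + (fst h * d_t K (z - w) + (\<Sum>i\<in>UNIV. snd h $ i * d_x i K (z - w)))) \<in> borel_measurable (D_leb T)"
      by (intro borel_measurable_add borel_measurable_diff borel_measurable_times borel_measurable_sum borel_measurable_const
           kernel_shift_measurable K kernel_d_t kernel_d_x)
    then show ?thesis by (simp add: e_def inner_vec_def grad_x_def algebra_simps)
  qed
  have q: "((\<lambda>h. (conv T f K (w + h) - conv T f K w - L h) / norm h) \<longlongrightarrow> 0) (at 0)"
    unfolding tendsto_at_iff_sequentially comp_def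
  proof (intro allI impI)
    fix X :: "nat \<Rightarrow> real \<times> (real^'n)" assume X: "\<forall>i. X i \<in> UNIV - {0}" "X \<longlonglongrightarrow> 0"
    have "(\<lambda>i. LINT z|D_leb T. f z * (e z (X i) / norm (X i))) \<longlonglongrightarrow> (LINT z|D_leb T. f z * 0)"
    proof (rule integral_dominated_convergence[where w="\<lambda>z. 2 * B * \<bar>f z\<bar>"])
      show "AE z in D_leb T. (\<lambda>i. f z * (e z (X i) / norm (X i))) \<longlonglongrightarrow> f z * 0"
        using e_lim X unfolding tendsto_at_iff_sequentially comp_def by (intro AE_I2 tendsto_mult tendsto_const) blast
      show "AE z in D_leb T. norm (f z * (e z (X i) / norm (X i))) \<le> 2 * B * \<bar>f z\<bar>" for i
      proof (rule AE_I2)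
        fix z
        have "\<bar>e z (X i)\<bar> / norm (X i) \<le> 2 * B" using e_bound[of z "X i"] X(1) by (simp add: field_simps)
        from mult_left_mono[OF this, of "\<bar>f z\<bar>"] show "norm (f z * (e z (X i) / norm (X i))) \<le> 2 * B * \<bar>f z\<bar>"
          by (simp add: abs_mult mult.commute)
      qed
      show "(\<lambda>z. f z * (e z (X i) / norm (X i))) \<in> borel_measurable (D_leb T)" for i
        using f em by (intro borel_measurable_times borel_measurable_divide) auto
    qed (use f in auto)
    then show "(\<lambda>i. (conv T f K (w + X i) - conv T f K w - L (X i)) / norm (X i)) \<longlonglongrightarrow> 0"
      unfolding Leq by simp
  qed
  have "((\<lambda>h. norm (conv T f K (w + h) - conv T f K w - L h) / norm h) \<longlongrightarrow> 0) (at 0)"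
    using tendsto_rabs_zero[OF q] by (simp only: abs_divide abs_norm_cancel real_norm_def)
  moreover have "bounded_linear L"
    unfolding L_def
    by (intro bounded_linear_minus bounded_linear_add bounded_linear_sum bounded_linear_mult_const bounded_linear_fst
        bounded_linear_compose[OF bounded_linear_vec_nth bounded_linear_snd])
  ultimately have "(conv T f K has_derivative L) (at w)"
    unfolding has_derivative_at by simp
  then show ?thesis by (simp add: L_def[abs_def])
qed

text \<open>All derivatives fall on the kernel, and derivatives of kernels are kernels; the
  induction therefore runs over all kernels simultaneously.\<close>

lemma smooth_conv:
  fixes f :: "real \<times> (real^'n) \<Rightarrow> real"
  assumes f: "integrable (D_leb T) f" and K: "kernel K"
  shows "smooth (conv T f K)"
proof -
  have "C_k k (conv T f K)" if "kernel K" for k K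
    using that
  proof (induction k arbitrary: K)
    case 0
    have "continuous_on UNIV (conv T f K)"
      using conv_has_derivative[OF f 0] by (intro has_derivative_continuous_on) auto
    then show ?case by simp
  next
    case (Suc k)
    show ?case
    proof (rule C_k_SucI[OF conv_has_derivative[OF f Suc.prems]])
      fix b :: "real \<times> (real^'n)" assume b: "b \<in> Basis"
      have c1: "C_k k (conv T f (d_t K))" by (intro Suc.IH kernel_d_t Suc.prems)
      have c2: "C_k k (conv T f (d_x i K))" for i by (intro Suc.IH kernel_d_x Suc.prems)
      have "C_k k (\<lambda>x. (- 1) * (fst b * conv T f (d_t K) x + (\<Sum>i\<in>UNIV. snd b $ i * conv T f (d_x i K) x)))"
        by (rule C_k_mult[OF C_k_const C_k_add[OF C_k_mult[OF C_k_const c1] C_k_sum[OF C_k_mult[OF C_k_const c2]]]])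
      then show "C_k k (\<lambda>x. - (fst b * conv T f (d_t K) x + (\<Sum>i\<in>UNIV. snd b $ i * conv T f (d_x i K) x)))" by simp
    qed
  qed
  then show ?thesis using K by (simp add: smooth_def)
qed

lemma d_t_conv:
  fixes f :: "real \<times> (real^'n) \<Rightarrow> real"
  assumes "integrable (D_leb T) f" "kernel K" shows "d_t (conv T f K) w = - conv T f (d_t K) w"
  using d_t_eq[OF conv_has_derivative[OF assms, of w]] by simp

lemma d_x_conv:
  fixes f :: "real \<times> (real^'n) \<Rightarrow> real"
  assumes "integrable (D_leb T) f" "kernel K" shows "d_x i (conv T f K) w = - conv T f (d_x i K) w"
proof -
  have "(\<Sum>j\<in>UNIV. axis i 1 $ j * conv T f (d_x j K) w) = conv T f (d_x i K) w"
    by (subst sum.remove[of _ i]) (auto simp: axis_def intro!: sum.neutral)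
  then show ?thesis using d_x_eq[OF conv_has_derivative[OF assms, of w], of i] by simp
qed

text \<open>\<open>f\<close> is integrated over the cell only, and periodicity is due to the kernel
  alone.\<close>

lemma conv_periodic: "kernel K \<Longrightarrow> zperiodic (\<lambda>x. conv T f K (t, x))"
  unfolding zperiodic_def
proof (intro allI impI)
  fix x k :: "real^'a" assume K: "kernel K" and k: "\<forall>i. k $ i \<in> \<int>"
  have "K (z - (t, x + k)) = K (z - (t, x))" for z
  proof -
    have "K (fst z - t, (snd z - x - k) + k) = K (fst z - t, snd z - x - k)"
      using zperiodicD[OF smooth_periodicD(2)] K k unfolding kernel_def int_vec_def by blast
    then show ?thesis by (cases z) (simp add: algebra_simps)
  qed
  then show "conv T f K (t, x + k) = conv T f K (t, x)" by (simp add: conv_def)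
qed

subsection \<open>The mollifier\<close>

definition bump_t :: "real \<Rightarrow> real \<Rightarrow> real" where
  "bump_t d u = flat_exp (d\<^sup>2 - u * u) / (LINT u|lborel. flat_exp (d\<^sup>2 - u * u))"

text \<open>A smooth periodic substitute for the squared distance to the lattice: non-negative, and
  zero exactly at integer vectors.\<close>

definition lattice_gap :: "real^'n \<Rightarrow> real" where
  "lattice_gap x = (\<Sum>i\<in>UNIV. 1 - cos (2 * pi * x $ i))"

definition bump_x :: "real \<Rightarrow> real^'n \<Rightarrow> real" where
  "bump_x d x = flat_exp (d\<^sup>2 - lattice_gap x) / (LINT x|(torus_leb :: (real^'n) measure). flat_exp (d\<^sup>2 - lattice_gap x))"

definition bump :: "real \<Rightarrow> real \<times> (real^'n) \<Rightarrow> real" where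
  "bump d z = bump_t d (fst z) * bump_x d (snd z)"

lemma smooth_lattice_gap: "smooth (lattice_gap :: real^'n \<Rightarrow> real)"
proof -
  have "smooth (\<lambda>x::real^'n. 1 - cos (2 * pi * x $ i))" for i
  proof -
    have "smooth (\<lambda>x::real^'n. 2 * pi * x $ i)"
      by (rule smooth_mult[OF smooth_const smooth_bounded_linear[OF bounded_linear_vec_nth]])
    from smooth_diff[OF smooth_const smooth_comp_real[OF smooth_cos this]] show ?thesis .
  qed
  from smooth_sum[of UNIV, OF this] show ?thesis by (simp add: lattice_gap_def[abs_def])
qed

lemma cos_int_shift: "k \<in> \<int> \<Longrightarrow> cos (2 * pi * (y + k)) = cos (2 * pi * y)"
proof -
  assume "k \<in> \<int>"
  then obtain m where "k = of_int m" by (auto elim: Ints_cases)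
  then have "2 * pi * (y + k) = 2 * pi * y + 2 * pi * of_int m" by (simp add: algebra_simps)
  moreover have "cos (2 * pi * y + 2 * pi * of_int m) = cos (2 * pi * y)" by (subst cos_add) simp
  ultimately show ?thesis by (simp only:)
qed

lemma lattice_gap_periodic: "zperiodic lattice_gap"
  by (simp add: zperiodic_def lattice_gap_def cos_int_shift)

lemma lattice_gap_minus: "lattice_gap (- x) = lattice_gap x"
  by (simp add: lattice_gap_def)

lemma smooth_bump_t0: "smooth (\<lambda>u. flat_exp (d\<^sup>2 - u * u))"
  by (rule smooth_comp_real[OF smooth_flat smooth_diff[OF smooth_const smooth_mult]])
     (rule smooth_bounded_linear[OF bounded_linear_ident])+

lemma smooth_bump_x0: "smooth (\<lambda>x. flat_exp (d\<^sup>2 - lattice_gap x))"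
  by (rule smooth_comp_real[OF smooth_flat smooth_diff[OF smooth_const smooth_lattice_gap]])

text \<open>Guarantees non-zero normalising constants of the mollifiers: a vanishing integral would
  force the function to vanish almost everywhere, but its positivity set in \<open>U\<close> is open
  and non-empty.\<close>

lemma integral_pos_open:
  fixes g :: "'a::euclidean_space \<Rightarrow> real"
  assumes c: "continuous_on UNIV g" and i: "integrable lborel (\<lambda>x. indicator S x * g x)" and nn: "\<And>x. 0 \<le> g x"
    and U: "open U" "x0 \<in> U" "U \<subseteq> S" "g x0 > 0"
  shows "(LINT x|lborel. indicator S x * g x) > 0"
proof -
  have n: "0 \<le> (LINT x|lborel. indicator S x * g x)" by (intro Bochner_Integration.integral_nonneg) (simp add: nn)
  have "(LINT x|lborel. indicator S x * g x) \<noteq> 0"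
  proof
    assume "(LINT x|lborel. indicator S x * g x) = 0"
    then have "AE x in lborel. indicator S x * g x = 0"
      using i nn by (subst (asm) integral_nonneg_eq_0_iff_AE) auto
    then obtain N where N: "\<And>x. x \<in> space lborel - N \<Longrightarrow> indicator S x * g x = 0" "N \<in> null_sets lborel"
      by (rule AE_E3) blast
    define V where "V = U \<inter> {x. 0 < g x}"
    have "V \<subseteq> N"
    proof
      fix x assume "x \<in> V"
      then have "indicator S x * g x \<noteq> 0" using U(3) by (auto simp: V_def)
      then show "x \<in> N" using N(1)[of x] by auto
    qed
    moreover have "open V" unfolding V_def by (intro open_Int U open_Collect_less continuous_on_const c)
    moreover have "V \<noteq> {}" using U by (auto simp: V_def)
    ultimately have "\<not> negligible V" by (simp add: open_not_negligible)
    moreover have "negligible N" using N(2) by (simp add: negligible_iff_null_sets null_sets_completionI)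
    ultimately show False using negligible_subset \<open>V \<subseteq> N\<close> by blast
  qed
  with n show ?thesis by simp
qed

lemma bump_t0_outside: "d > 0 \<Longrightarrow> \<bar>u\<bar> \<ge> d \<Longrightarrow> flat_exp (d\<^sup>2 - u * u) = 0"
  using power_mono[of d "\<bar>u\<bar>" 2] by (simp add: power2_eq_square)

lemma integrable_bump_t0: "d > 0 \<Longrightarrow> integrable lborel (\<lambda>u. flat_exp (d\<^sup>2 - u * u))"
proof -
  assume d: "d > 0"
  have "integrable lborel (\<lambda>u. indicator {-d..d} u *\<^sub>R flat_exp (d\<^sup>2 - u * u))"
    by (intro borel_integrable_compact continuous_on_subset[OF smooth_continuous[OF smooth_bump_t0]]) auto
  moreover have "indicator {-d..d} u *\<^sub>R flat_exp (d\<^sup>2 - u * u) = flat_exp (d\<^sup>2 - u * u)" for u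
  proof (cases "u \<in> {-d..d}")
    case False
    then have "flat_exp (d\<^sup>2 - u * u) = 0" by (intro bump_t0_outside d) auto
    then show ?thesis by simp
  qed simp
  ultimately show ?thesis by (simp only:)
qed

lemma bump_t0_pos: "d > 0 \<Longrightarrow> (LINT u|lborel. flat_exp (d\<^sup>2 - u * u)) > 0"
  using integral_pos_open[of "\<lambda>u. flat_exp (d\<^sup>2 - u * u)" UNIV UNIV 0] integrable_bump_t0[of d]
  by (simp add: smooth_continuous[OF smooth_bump_t0])

lemma cont_torus_bump_x0: "cont_torus (\<lambda>x::real^'n. flat_exp (d\<^sup>2 - lattice_gap x))"
  by (rule cont_torus_smooth[OF smooth_bump_x0 zperiodic_comp[OF lattice_gap_periodic]])

lemma integrable_torus_cont: "cont_torus \<theta> \<Longrightarrow> integrable (torus_leb :: (real^'n) measure) \<theta>"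
  using prob_space_torus_leb by (intro integrable_cont_torus sets_torus_leb) (auto simp: prob_space_def)

lemma bump_x0_pos:
  assumes d: "d > 0" shows "(LINT x|(torus_leb :: (real^'n) measure). flat_exp (d\<^sup>2 - lattice_gap x)) > 0"
proof -
  let ?g = "\<lambda>x::real^'n. flat_exp (d\<^sup>2 - lattice_gap x)"
  have eq: "(LINT x|torus_leb. ?g x) = (LINT x|lborel. indicator torus_cell x * ?g x)"
    by (subst integral_restrict_space) auto
  have i: "integrable lborel (\<lambda>x. indicator torus_cell x * ?g x)"
    using integrable_torus_cont[OF cont_torus_bump_x0[of d]] by (subst (asm) integrable_restrict_space) auto
  \<comment> \<open>The peak at 0 sits on the boundary of the cell. A point slightly further along
    the diagonal is interior and still has a positive value by continuity.\<close>
  have "isCont (\<lambda>s. lattice_gap (vec s :: real^'n)) 0"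
    unfolding lattice_gap_def by (simp add: vec_def)
  moreover have "lattice_gap (vec 0 :: real^'n) = 0" by (simp add: lattice_gap_def)
  ultimately have "((\<lambda>s. lattice_gap (vec s :: real^'n)) \<longlongrightarrow> 0) (at 0)" by (simp add: isCont_def)
  from tendsto_mono[OF at_le[OF subset_UNIV] this]
  have "((\<lambda>s. lattice_gap (vec s :: real^'n)) \<longlongrightarrow> 0) (at_right 0)" .
  from order_tendstoD(2)[OF this, of "d\<^sup>2"] d
  have "\<forall>\<^sub>F s in at_right 0. lattice_gap (vec s :: real^'n) < d\<^sup>2" by simp
  then obtain b where b: "b > 0" "\<And>s. 0 < s \<Longrightarrow> s < b \<Longrightarrow> lattice_gap (vec s :: real^'n) < d\<^sup>2"
    unfolding eventually_at_right_field by auto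
  define s where "s = min (b / 2) (1 / 2)"
  have s: "0 < s" "s < 1" "s < b" using b(1) by (auto simp: s_def)
  have "(LINT x|lborel. indicator torus_cell x * ?g x) > 0"
  proof (rule integral_pos_open[OF smooth_continuous[OF smooth_bump_x0] i])
    show "open (box 0 (1 :: real^'n))" by (rule open_box)
    show "vec s \<in> box 0 (1 :: real^'n)" using s by (simp add: mem_box_cart)
    show "box 0 1 \<subseteq> (torus_cell :: (real^'n) set)" by (auto simp: mem_box_cart torus_cell_def less_imp_le)
    show "flat_exp (d\<^sup>2 - lattice_gap (vec s :: real^'n)) > 0" using b(2)[OF s(1,3)] by simp
  qed simp
  then show ?thesis using eq by simp
qed

lemma bump_t_nonneg: "d > 0 \<Longrightarrow> 0 \<le> bump_t d u"
  using bump_t0_pos[of d] by (simp add: bump_t_def)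

lemma bump_x_nonneg: "d > 0 \<Longrightarrow> 0 \<le> bump_x d (x :: real^'n)"
  using bump_x0_pos[where 'n='n, of d] by (simp add: bump_x_def)

lemma bump_nonneg: "d > 0 \<Longrightarrow> 0 \<le> bump d z"
  by (simp add: bump_def bump_t_nonneg bump_x_nonneg)

lemma bump_t_outside: "d > 0 \<Longrightarrow> \<bar>u\<bar> \<ge> d \<Longrightarrow> bump_t d u = 0"
  by (simp only: bump_t_def bump_t0_outside div_0)

lemma smooth_bump: "smooth_periodic (bump d)"
proof -
  have "smooth_periodic (\<lambda>z. flat_exp (d\<^sup>2 - fst z * fst z) * flat_exp (d\<^sup>2 - lattice_gap (snd z)))"
    by (rule smooth_periodic_mult[OF smooth_periodic_fst[OF smooth_bump_t0] smooth_periodic_snd[OF smooth_bump_x0 zperiodic_comp[OF lattice_gap_periodic]]])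
  from smooth_periodic_mult[OF smooth_periodic_const[of "1 / ((LINT u|lborel. flat_exp (d\<^sup>2 - u * u)) *
      (LINT x|(torus_leb :: (real^'a) measure). flat_exp (d\<^sup>2 - lattice_gap x)))"] this]
  show ?thesis by (simp add: bump_def[abs_def] bump_t_def bump_x_def)
qed

lemma kernel_bump: "d > 0 \<Longrightarrow> kernel (bump d)"
  unfolding kernel_def by (auto simp: smooth_bump bump_def bump_t_outside intro!: exI[of _ d])

lemma integral_bump_t: "d > 0 \<Longrightarrow> integrable lborel (bump_t d)" "d > 0 \<Longrightarrow> (LINT u|lborel. bump_t d u) = 1"
  using bump_t0_pos[of d] integrable_bump_t0[of d] by (simp_all add: bump_t_def[abs_def])

lemma cont_torus_bump_x: "cont_torus (bump_x d :: real^'n \<Rightarrow> real)"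
  using cont_torus_bump_x0[where 'n='n, of d] unfolding bump_x_def[abs_def] cont_torus_def
  by (auto simp: zperiodic_def divide_inverse intro: continuous_on_mult_right)

lemma integral_bump_x: "d > 0 \<Longrightarrow> (LINT x|torus_leb. bump_x d (x - y :: real^'n)) = 1"
proof -
  assume d: "d > 0"
  have c: "cont_torus (bump_x d :: real^'n \<Rightarrow> real)" by (rule cont_torus_bump_x)
  have "(LINT x|torus_leb. bump_x d (x + (- y) :: real^'n)) = (LINT x|torus_leb. bump_x d (x :: real^'n))"
    by (rule integral_torus_translate) (use c in \<open>auto simp: cont_torus_def intro: cont_torus_measurable[OF c]\<close>)
  also have "\<dots> = 1" using bump_x0_pos[OF d, where 'n='n] by (simp add: bump_x_def)
  finally show ?thesis by simp
qed

lemma bump_x_minus: "bump_x d (x - y) = bump_x d (y - x)"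
  using lattice_gap_minus[of "x - y"] by (simp add: bump_x_def)

lemma time_leb_integral:
  fixes f :: "real \<Rightarrow> real"
  assumes "\<And>t. t \<notin> {0..T} \<Longrightarrow> f t = 0" shows "(LINT t|time_leb T. f t) = (LINT t|lborel. f t)"
proof -
  have "(LINT t|time_leb T. f t) = (LINT t|lborel. indicator {0..T} t *\<^sub>R f t)"
    by (subst integral_restrict_space) auto
  also have "\<dots> = (LINT t|lborel. f t)" using assms by (intro Bochner_Integration.integral_cong) (auto simp: indicator_def)
  finally show ?thesis .
qed

text \<open>A centre at distance at least \<open>d\<close> from both ends keeps the time support
  inside \<open>[0,T]\<close>, so no mass is lost. In space nothing is lost on a torus.\<close>

lemma integral_bump:
  fixes x :: "real^'n"
  assumes d: "d > 0" and s: "d \<le> s" "s \<le> T - d"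
  shows "(LINT z|D_leb T. bump d (z - (s, x))) = 1" and "integrable (D_leb T) (\<lambda>z. bump d (z - (s, x)))"
proof -
  have T: "T \<ge> 0" using assms by linarith
  have i: "integrable (D_leb T) (\<lambda>z. 1 * bump d (z - (s, x)))"
    by (rule integrable_mult_kernel[OF _ kernel_bump[OF d]])
       (intro finite_measure.integrable_bounded[OF finite_measure_D_leb[OF T], of _ 1], auto)
  then show "integrable (D_leb T) (\<lambda>z. bump d (z - (s, x)))" by simp
  have "(LINT z|D_leb T. bump d (z - (s, x))) = (LINT t|time_leb T. bump_t d (t - s))"
    using i by (simp add: integral_D_leb(1) bump_def integral_bump_x[OF d])
  also have "\<dots> = (LINT t|lborel. bump_t d (t - s))"
    using s by (intro time_leb_integral bump_t_outside d) auto
  also have "\<dots> = 1"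
    using lborel_integral_real_affine[of 1 "\<lambda>t. bump_t d (t - s)" s] integral_bump_t(2)[OF d] by simp
  finally show "(LINT z|D_leb T. bump d (z - (s, x))) = 1" .
qed

text \<open>Mollification at scale \<open>\<delta>\<close>, after an affine change of time that maps \<open>[0,T]\<close> into
  \<open>[2\<delta>, T - 2\<delta>]\<close>: the result is smooth up to \<open>t = 0\<close> and \<open>t = T\<close>, and weak derivatives in the
  interior become classical derivatives on the whole of \<open>[0,T]\<close>.\<close>

definition mscale :: "real \<Rightarrow> nat \<Rightarrow> real" where "mscale T k = T / (8 * real (Suc k))"

text \<open>The constant equals \<open>1 - 4 * mscale T k / T\<close>: of the length
  \<open>T\<close> a margin of two mollification radii is removed at either end.\<close>

definition dilation :: "nat \<Rightarrow> real" where "dilation k = 1 - 1 / (2 * real (Suc k))"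

definition shrink :: "real \<Rightarrow> nat \<Rightarrow> real \<Rightarrow> real" where "shrink T k t = 2 * mscale T k + dilation k * t"

definition moll :: "real \<Rightarrow> nat \<Rightarrow> (real \<times> (real^'n) \<Rightarrow> real) \<Rightarrow> real \<times> (real^'n) \<Rightarrow> real" where
  "moll T k f z = conv T f (bump (mscale T k)) (shrink T k (fst z), snd z)"

lemma scale_pos: "T > 0 \<Longrightarrow> mscale T k > 0"
  by (simp add: mscale_def)

lemma dilation_bounds: "1 / 2 \<le> dilation k" "dilation k \<le> 1" "dilation k > 0"
  by (auto simp: dilation_def field_simps)

lemma scale_tendsto: "mscale T \<longlonglongrightarrow> 0"
proof -
  have "(\<lambda>k. T / 8 * (1 / real (Suc k))) \<longlonglongrightarrow> T / 8 * 0"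
    using LIMSEQ_inverse_real_of_nat by (intro tendsto_mult tendsto_const) (simp add: inverse_eq_divide)
  then show ?thesis by (simp add: mscale_def[abs_def])
qed

lemma dilation_tendsto: "dilation \<longlonglongrightarrow> 1"
proof -
  have "(\<lambda>k. 1 - 1 / 2 * (1 / real (Suc k))) \<longlonglongrightarrow> 1 - 1 / 2 * 0"
    using LIMSEQ_inverse_real_of_nat by (intro tendsto_intros) (simp add: inverse_eq_divide)
  then show ?thesis by (simp add: dilation_def[abs_def])
qed

lemma shrink_bounds:
  assumes T: "T > 0" and t: "t \<in> {0..T}"
  shows "2 * mscale T k \<le> shrink T k t" "shrink T k t \<le> T - 2 * mscale T k" "\<bar>shrink T k t - t\<bar> \<le> 2 * mscale T k"
proof -
  have dT: "dilation k * T = T - 4 * mscale T k" by (simp add: dilation_def mscale_def field_simps)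
  have "0 \<le> dilation k * t" "dilation k * t \<le> dilation k * T"
    using t dilation_bounds[of k] by (auto intro!: mult_left_mono)
  then show "2 * mscale T k \<le> shrink T k t" "shrink T k t \<le> T - 2 * mscale T k"
    using dT by (auto simp: shrink_def)
  have e: "(1 - dilation k) * t \<le> (1 - dilation k) * T" "0 \<le> (1 - dilation k) * t"
    using t dilation_bounds[of k] by (auto intro!: mult_left_mono)
  have "(1 - dilation k) * T = 4 * mscale T k" using dT by (simp add: algebra_simps)
  then show "\<bar>shrink T k t - t\<bar> \<le> 2 * mscale T k"
    using e by (simp add: shrink_def algebra_simps abs_le_iff)
qed

lemma smooth_shift: "smooth g \<Longrightarrow> smooth (\<lambda>z. g (z - w))" for g :: "real \<times> (real^'n) \<Rightarrow> real"
  using smooth_affine[of g "\<lambda>z. z" "- w"] by (simp add: bounded_linear_ident)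

lemma smooth_has_derivative_shift:
  "smooth g \<Longrightarrow> ((\<lambda>z. g (z - w)) has_derivative (\<lambda>y. fst y * d_t g (z - w) + snd y \<bullet> grad_x g (z - w))) (at z)"
proof -
  assume g: "smooth g"
  have 1: "((\<lambda>z. z - w) has_derivative (\<lambda>y. y)) (at z)" by (auto intro!: derivative_eq_intros)
  from has_derivative_compose[OF 1 smooth_has_derivative_d[OF g]] show ?thesis .
qed

lemma d_t_shift: "smooth g \<Longrightarrow> d_t (\<lambda>z. g (z - w)) z = d_t g (z - w)"
  and d_x_shift: "smooth g \<Longrightarrow> d_x i (\<lambda>z. g (z - w)) z = d_x i g (z - w)"
  by (simp_all add: d_t_eq[OF smooth_has_derivative_shift] d_x_eq[OF smooth_has_derivative_shift])

lemma lap_x_shift: "smooth g \<Longrightarrow> lap_x (\<lambda>z. g (z - w)) z = lap_x g (z - w)"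
proof -
  assume g: "smooth g"
  have "d_x i (\<lambda>z. g (z - w)) = (\<lambda>z. d_x i g (z - w))" for i using d_x_shift[OF g] by blast
  then show ?thesis by (simp add: lap_x_def d_x_shift smooth_d_x g)
qed

text \<open>The time support reaches at most \<open>mscale T k\<close> from the contracted time,
  which is at least twice that far from both ends. So the shifted bump is an admissible test
  function even for t = 0 and t = T.\<close>

lemma test_fun_bump:
  assumes T: "T > 0" and t: "t \<in> {0..T}"
  shows "test_fun T (\<lambda>z. bump (mscale T k) (z - (shrink T k t, x)))"
  unfolding test_fun_def
proof (intro conjI allI)
  let ?d = "mscale T k" and ?s = "shrink T k t"
  have d: "?d > 0" by (rule scale_pos[OF T])
  show "smooth (\<lambda>z. bump ?d (z - (?s, x)))"
    by (rule smooth_shift[OF smooth_periodicD(1)[OF smooth_bump]])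
  show "zperiodic (\<lambda>y. bump ?d ((u, y) - (?s, x)))" for u
  proof -
    have p: "zperiodic (\<lambda>y. bump ?d (u - ?s, y :: real^'a))" by (rule smooth_periodicD(2)[OF smooth_bump])
    show ?thesis unfolding zperiodic_def
    proof (intro allI impI)
      fix y j :: "real^'a" assume "\<forall>i. j $ i \<in> \<int>"
      then have "bump ?d (u - ?s, (y - x) + j) = bump ?d (u - ?s, y - x)" using zperiodicD[OF p] by (simp add: int_vec_def)
      then show "bump ?d ((u, y + j) - (?s, x)) = bump ?d ((u, y) - (?s, x))" by (simp add: algebra_simps)
    qed
  qed
  show "\<exists>a b. 0 < a \<and> a < b \<and> b < T \<and> (\<forall>t x'. t \<notin> {a..b} \<longrightarrow> bump ?d ((t, x') - (?s, x)) = 0)"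
  proof (intro exI conjI allI impI)
    show "0 < ?s - ?d" "?s - ?d < ?s + ?d" "?s + ?d < T"
      using shrink_bounds[OF T t, of k] d by auto
    fix u x' assume "u \<notin> {?s - ?d..?s + ?d}"
    then have "bump_t ?d (u - ?s) = 0" by (intro bump_t_outside[OF d]) auto
    then show "bump ?d ((u, x') - (?s, x)) = 0" by (simp add: bump_def)
  qed
qed

lemma moll_eq: "moll T k f (t, x) = (LINT z|D_leb T. f z * bump (mscale T k) (z - (shrink T k t, x)))"
  by (simp add: moll_def conv_def)

lemma shrink_affine: "(shrink T k (fst z), snd z) = (2 * mscale T k, 0) + (dilation k * fst z, snd z :: real^'n)"
  by (simp add: shrink_def prod_eq_iff)

lemma bounded_linear_dilation: "bounded_linear (\<lambda>z :: real \<times> (real^'n). (dilation k * fst z, snd z))"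
  by (intro bounded_linear_Pair bounded_linear_const_mult bounded_linear_fst bounded_linear_snd)

lemma smooth_periodic_moll:
  fixes f :: "real \<times> (real^'n) \<Rightarrow> real"
  assumes T: "T > 0" and f: "integrable (D_leb T) f"
  shows "smooth_periodic (moll T k f)"
  unfolding smooth_periodic_def
proof
  show "smooth (moll T k f)"
    using smooth_affine[OF smooth_conv[OF f kernel_bump[OF scale_pos[OF T]]] bounded_linear_dilation, of k "(2 * mscale T k, 0)" k]
    by (simp add: moll_def[abs_def] shrink_affine)
  show "\<forall>t. zperiodic (\<lambda>x. moll T k f (t, x))"
    by (simp add: moll_def conv_periodic[OF kernel_bump[OF scale_pos[OF T]]])
qed

lemma moll_has_derivative:
  fixes f :: "real \<times> (real^'n) \<Rightarrow> real" and k :: nat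
  assumes T: "T > 0" and f: "integrable (D_leb T) f"
  defines "F \<equiv> conv T f (bump (mscale T k))"
  shows "(moll T k f has_derivative (\<lambda>y. (dilation k * fst y) * d_t F (shrink T k (fst z), snd z)
     + snd y \<bullet> grad_x F (shrink T k (fst z), snd z))) (at z)"
proof -
  have "((\<lambda>z. (2 * mscale T k, 0) + (dilation k * fst z, snd z)) has_derivative (\<lambda>y. 0 + (dilation k * fst y, snd y))) (at z)"
    by (intro has_derivative_add has_derivative_const bounded_linear_imp_has_derivative bounded_linear_dilation)
  then have 1: "((\<lambda>z. (shrink T k (fst z), snd z)) has_derivative (\<lambda>y. (dilation k * fst y, snd y))) (at z)"
    by (simp add: shrink_affine)
  have "smooth F" unfolding F_def by (rule smooth_conv[OF f kernel_bump[OF scale_pos[OF T]]])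
  from has_derivative_compose[OF 1 smooth_has_derivative_d[OF this]] show ?thesis
    by (simp add: moll_def[abs_def] F_def)
qed

lemma d_x_moll_conv:
  fixes f :: "real \<times> (real^'n) \<Rightarrow> real"
  assumes T: "T > 0" and f: "integrable (D_leb T) f"
  shows "d_x i (moll T k f) z = - conv T f (d_x i (bump (mscale T k))) (shrink T k (fst z), snd z)"
  using d_x_eq[OF moll_has_derivative[OF T f, of k z], of i] d_x_conv[OF f kernel_bump[OF scale_pos[OF T]]] by simp

lemma d_t_moll_conv:
  fixes f :: "real \<times> (real^'n) \<Rightarrow> real"
  assumes T: "T > 0" and f: "integrable (D_leb T) f"
  shows "d_t (moll T k f) z = - dilation k * conv T f (d_t (bump (mscale T k))) (shrink T k (fst z), snd z)"
  using d_t_eq[OF moll_has_derivative[OF T f, of k z]] d_t_conv[OF f kernel_bump[OF scale_pos[OF T]]] by simp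

text \<open>The sign from differentiating in the centre of the kernel cancels the sign in the
  definition of the weak gradient. By \<open>test_fun_bump\<close> this is valid up to both
  ends.\<close>

lemma d_x_moll:
  fixes f :: "real \<times> (real^'n) \<Rightarrow> real"
  assumes T: "T > 0" and f: "integrable (D_leb T) f" and g: "has_weak_grad T f g" and t: "t \<in> {0..T}"
  shows "d_x i (moll T k f) (t, x) = moll T k (\<lambda>z. g z $ i) (t, x)"
proof -
  have sb: "smooth (bump (mscale T k) :: real \<times> (real^'n) \<Rightarrow> real)" by (rule smooth_periodicD(1)[OF smooth_bump])
  have "(LINT z|D_leb T. f z * d_x i (\<lambda>z. bump (mscale T k) (z - (shrink T k t, x))) z)
      = - (LINT z|D_leb T. g z $ i * bump (mscale T k) (z - (shrink T k t, x)))"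
    using g test_fun_bump[OF T t, of k x] unfolding has_weak_grad_def by blast
  then show ?thesis
    by (simp add: d_x_moll_conv[OF T f] moll_eq conv_def d_x_shift[OF sb])
qed

lemma grad_x_moll:
  fixes f :: "real \<times> (real^'n) \<Rightarrow> real"
  assumes "T > 0" "integrable (D_leb T) f" "has_weak_grad T f g" "t \<in> {0..T}"
  shows "grad_x (moll T k f) (t, x) $ i = moll T k (\<lambda>z. g z $ i) (t, x)"
  by (simp add: grad_x_def d_x_moll[OF assms])

text \<open>The contraction of time contributes its factor \<open>dilation k\<close> by the chain
  rule. Its deviation from 1 is the error term of the mollified Hamilton-Jacobi inequality.\<close>

lemma d_t_moll:
  fixes f :: "real \<times> (real^'n) \<Rightarrow> real"
  assumes T: "T > 0" and f: "integrable (D_leb T) f" and h: "has_weak_dt T f h" and t: "t \<in> {0..T}"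
  shows "d_t (moll T k f) (t, x) = dilation k * moll T k h (t, x)"
proof -
  have sb: "smooth (bump (mscale T k) :: real \<times> (real^'n) \<Rightarrow> real)" by (rule smooth_periodicD(1)[OF smooth_bump])
  have "(LINT z|D_leb T. f z * d_t (\<lambda>z. bump (mscale T k) (z - (shrink T k t, x))) z)
      = - (LINT z|D_leb T. h z * bump (mscale T k) (z - (shrink T k t, x)))"
    using h test_fun_bump[OF T t, of k x] unfolding has_weak_dt_def by blast
  then show ?thesis
    by (simp add: d_t_moll_conv[OF T f] moll_eq conv_def d_t_shift[OF sb])
qed

lemma integral_bump_shrink:
  fixes x :: "real^'n"
  assumes T: "T > 0" and t: "t \<in> {0..T}"
  shows "(LINT z|D_leb T. bump (mscale T k) (z - (shrink T k t, x))) = 1"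
    and "integrable (D_leb T) (\<lambda>z. bump (mscale T k) (z - (shrink T k t, x)))"
  using shrink_bounds[OF T t, of k] scale_pos[OF T, of k]
  by (intro integral_bump; simp)+

text \<open>Two derivatives in the centre of the kernel bring two signs, which cancel, and the
  Laplacian acts on a test function. The \<open>- 1\<close> survives because the kernel has mass
  one.\<close>

lemma lap_x_moll:
  fixes q r :: "real \<times> (real^'n) \<Rightarrow> real"
  assumes T: "T > 0" and q: "integrable (D_leb T) q"
    and P: "poisson T q (\<lambda>\<eta>. LINT z|D_leb T. r z * \<eta> z)" and t: "t \<in> {0..T}"
  shows "lap_x (moll T k q) (t, x) = moll T k r (t, x) - 1"
proof -
  have kb: "kernel (bump (mscale T k) :: real \<times> (real^'n) \<Rightarrow> real)" by (rule kernel_bump[OF scale_pos[OF T]])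
  have sb: "smooth (bump (mscale T k) :: real \<times> (real^'n) \<Rightarrow> real)" by (rule kernel_smooth[OF kb])
  let ?B = "bump (mscale T k) :: real \<times> (real^'n) \<Rightarrow> real" and ?s = "shrink T k t"
  have 2: "d_x i (d_x i (moll T k q)) (t, x) = conv T q (d_x i (d_x i ?B)) (?s, x)" for i
  proof -
    have "((\<lambda>z. (2 * mscale T k, 0) + (dilation k * fst z, snd z)) has_derivative (\<lambda>y. 0 + (dilation k * fst y, snd y))) (at (t, x))"
      by (intro has_derivative_add has_derivative_const bounded_linear_imp_has_derivative bounded_linear_dilation)
    then have 1: "((\<lambda>z. (shrink T k (fst z), snd z)) has_derivative (\<lambda>y. (dilation k * fst y, snd y))) (at (t, x))"
      by (simp add: shrink_affine)
    let ?G = "conv T q (d_x i ?B)"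
    have "smooth ?G" by (rule smooth_conv[OF q kernel_d_x[OF kb]])
    from has_derivative_minus[OF has_derivative_compose[OF 1 smooth_has_derivative_d[OF this]]]
    have "((\<lambda>z. - ?G (shrink T k (fst z), snd z)) has_derivative
        (\<lambda>y. - (fst (dilation k * fst y, snd y) * d_t ?G (shrink T k (fst (t, x)), snd (t, x)) + snd (dilation k * fst y, snd y) \<bullet> grad_x ?G (shrink T k (fst (t, x)), snd (t, x))))) (at (t, x))" .
    from d_x_eq[OF this, of i] have "d_x i (\<lambda>z. - ?G (shrink T k (fst z), snd z)) (t, x) = - d_x i ?G (?s, x)"
      by simp
    moreover have "d_x i (moll T k q) = (\<lambda>z. - ?G (shrink T k (fst z), snd z))"
      by (rule ext) (rule d_x_moll_conv[OF T q])
    ultimately show ?thesis using d_x_conv[OF q kernel_d_x[OF kb], of i i] by simp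
  qed
  have "lap_x (moll T k q) (t, x) = (\<Sum>i\<in>UNIV. conv T q (d_x i (d_x i ?B)) (?s, x))"
    by (simp add: lap_x_def 2)
  also have "\<dots> = (LINT z|D_leb T. q z * lap_x ?B (z - (?s, x)))"
    unfolding conv_def lap_x_def sum_distrib_left
    by (rule Bochner_Integration.integral_sum[symmetric]) (intro integrable_mult_kernel q kernel_d_x kb)
  also have "\<dots> = (LINT z|D_leb T. q z * lap_x (\<lambda>z. ?B (z - (?s, x))) z)"
    by (simp add: lap_x_shift[OF sb])
  also have "\<dots> = (LINT z|D_leb T. r z * ?B (z - (?s, x))) - (LINT z|D_leb T. ?B (z - (?s, x)))"
    using P test_fun_bump[OF T t, of k x] unfolding poisson_def by blast
  finally show ?thesis by (simp add: moll_eq integral_bump_shrink[OF T t])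
qed

lemma integrable_mult_bump:
  fixes f :: "real \<times> (real^'n) \<Rightarrow> real"
  shows "T > 0 \<Longrightarrow> integrable (D_leb T) f \<Longrightarrow> integrable (D_leb T) (\<lambda>z. f z * bump (mscale T k) (z - w))"
  by (rule integrable_mult_kernel[OF _ kernel_bump[OF scale_pos]])

lemma moll_add:
  fixes f g :: "real \<times> (real^'n) \<Rightarrow> real"
  assumes "T > 0" "integrable (D_leb T) f" "integrable (D_leb T) g"
  shows "moll T k (\<lambda>z. f z + g z) z = moll T k f z + moll T k g z"
    and "moll T k (\<lambda>z. f z - g z) z = moll T k f z - moll T k g z"
  unfolding moll_def conv_def distrib_right left_diff_distrib
  using integrable_mult_bump[OF assms(1,2)] integrable_mult_bump[OF assms(1,3)] by simp_all

lemma moll_mono: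
  fixes f g :: "real \<times> (real^'n) \<Rightarrow> real"
  assumes "T > 0" "integrable (D_leb T) f" "integrable (D_leb T) g" "AE z in D_leb T. f z \<le> g z"
  shows "moll T k f z \<le> moll T k g z"
  unfolding moll_def conv_def
  using assms(4)
  by (intro integral_mono_AE integrable_mult_bump assms)
     (auto intro!: mult_right_mono bump_nonneg scale_pos assms)

lemma moll_const:
  assumes "T > 0" "t \<in> {0..T}" shows "moll T k (\<lambda>_. c) (t, x :: real^'n) = c"
  using integral_bump_shrink[OF assms, of k x] by (simp add: moll_eq)

lemma integrable_D_bounded:
  fixes f :: "real \<times> (real^'n) \<Rightarrow> 'b::{banach, second_countable_topology}"
  assumes T: "T > 0" and "f \<in> borel_measurable (D_leb T)" "AE z in D_leb T. norm (f z) \<le> C"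
  shows "integrable (D_leb T) f"
proof -
  interpret finite_measure "D_leb T :: (real \<times> (real^'n)) measure" using T by (intro finite_measure_D_leb) simp
  show ?thesis using assms by (intro integrable_const_bound[of _ C]) auto
qed

text \<open>Mollification is an average with a probability density, so it is monotone and fixes
  constants.\<close>

lemma moll_bounded:
  fixes f :: "real \<times> (real^'n) \<Rightarrow> real"
  assumes T: "T > 0" and f: "f \<in> borel_measurable (D_leb T)" and C: "AE z in D_leb T. \<bar>f z\<bar> \<le> C" and t: "t \<in> {0..T}"
  shows "\<bar>moll T k f (t, x)\<bar> \<le> C"
proof -
  have fi: "integrable (D_leb T) f" by (rule integrable_D_bounded[OF T f]) (use C in simp)
  have ci: "integrable (D_leb T) (\<lambda>_. c)" for c :: real by (rule integrable_D_bounded[OF T, of _ "\<bar>c\<bar>"]) auto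
  have "moll T k f (t, x) \<le> moll T k (\<lambda>_. C) (t, x)"
    by (rule moll_mono[OF T fi ci]) (use C in auto)
  moreover have "moll T k (\<lambda>_. - C) (t, x) \<le> moll T k f (t, x)"
    by (rule moll_mono[OF T ci fi]) (use C in \<open>auto elim!: eventually_mono\<close>)
  ultimately show ?thesis by (simp add: moll_const[OF T t])
qed

text \<open>The nearest lattice vector works. Distances to it are at most 1/2, where the cosine of
  \<open>2 * pi * y\<close> is decreasing in \<open>y\<close>, so a small gap forces small distances
  in every coordinate.\<close>

lemma lattice_near:
  assumes s: "0 < s" "s \<le> 1 / 2" and g: "lattice_gap v < 1 - cos (2 * pi * s)"
  obtains k where "int_vec k" "\<And>i. \<bar>v $ i - k $ i\<bar> < s"
proof -
  define k where "k = (\<chi> i. real_of_int (round (v $ i)))"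
  have "\<bar>v $ i - k $ i\<bar> < s" for i
  proof (rule ccontr)
    define y where "y = \<bar>v $ i - k $ i\<bar>"
    assume "\<not> \<bar>v $ i - k $ i\<bar> < s"
    then have y: "s \<le> y" "y \<le> 1 / 2"
      using of_int_round_abs_le[of "v $ i"] by (auto simp: y_def k_def abs_minus_commute)
    have "cos (2 * pi * y) \<le> cos (2 * pi * s)"
      using y s by (intro cos_monotone_0_pi_le) auto
    moreover have "cos (2 * pi * y) = cos (2 * pi * v $ i)"
    proof -
      have "cos (2 * pi * y) = cos (2 * pi * (v $ i - k $ i))"
        unfolding y_def by (cases "v $ i - k $ i \<ge> 0") (simp_all, metis cos_minus minus_diff_eq mult_minus_right)
      also have "\<dots> = cos (2 * pi * (v $ i + (- k $ i)))" by simp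
      also have "\<dots> = cos (2 * pi * v $ i)" by (rule cos_int_shift) (simp add: k_def)
      finally show ?thesis .
    qed
    moreover have "1 - cos (2 * pi * v $ i) \<le> lattice_gap v"
      unfolding lattice_gap_def by (rule member_le_sum) auto
    ultimately show False using g by simp
  qed
  then show ?thesis by (intro that[of k]) (auto simp: int_vec_def k_def)
qed

text \<open>The kernel charges only points close to the centre modulo the lattice. Uniform
  continuity of the periodic function bounds the oscillation there, and the kernel has mass
  one.\<close>

lemma moll_uniform:
  fixes g :: "real \<times> (real^'n) \<Rightarrow> real"
  assumes T: "T > 0" and g: "cont_D T g" and e: "e > 0"
  shows "\<forall>\<^sub>F k in sequentially. \<forall>t\<in>{0..T}. \<forall>x. \<bar>moll T k g (t, x) - g (t, x)\<bar> \<le> e"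
proof -
  obtain d where d: "d > 0" "\<And>s t x y. s \<in> {0..T} \<Longrightarrow> t \<in> {0..T} \<Longrightarrow> \<bar>s - t\<bar> < d \<Longrightarrow> dist x y < d \<Longrightarrow> \<bar>g (s, x) - g (t, y)\<bar> < e"
    using cont_D_uniform[OF g e] by blast
  \<comment> \<open>Closeness \<open>s\<close> in each coordinate gives distance at most
    \<open>CARD('n) * s\<close>, which is at most \<open>d / 2\<close>. The cap 1/2 is the range of
    validity of \<open>lattice_near\<close>.\<close>
  define s where "s = min (d / (2 * real CARD('n))) (1 / 2)"
  have s: "0 < s" "s \<le> 1 / 2" using d(1) by (auto simp: s_def)
  have sn: "real CARD('n) * s < d"
  proof -
    have "real CARD('n) * s \<le> real CARD('n) * (d / (2 * real CARD('n)))"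
      by (intro mult_left_mono) (auto simp: s_def)
    also have "\<dots> < d" using d(1) by simp
    finally show ?thesis .
  qed
  define c where "c = 1 - cos (2 * pi * s)"
  have "cos (2 * pi * s) < cos 0" using s by (intro cos_monotone_0_pi) auto
  then have c: "c > 0" by (simp add: c_def)
  have "\<forall>\<^sub>F k in sequentially. 3 * mscale T k < d"
    using tendsto_mult[OF tendsto_const scale_tendsto, of 3 T] d(1) by (intro order_tendstoD(2)) auto
  moreover have "\<forall>\<^sub>F k in sequentially. (mscale T k)\<^sup>2 < c"
    using tendsto_power[OF scale_tendsto, of T 2] c by (intro order_tendstoD(2)) auto
  ultimately show ?thesis
  proof eventually_elim
    case (elim k)
    show ?case
    proof (intro ballI allI)
      fix t and x :: "real^'n" assume t: "t \<in> {0..T}"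
      let ?b = "\<lambda>z. bump (mscale T k) (z - (shrink T k t, x))"
      have dpos: "mscale T k > 0" by (rule scale_pos[OF T])
      have gi: "integrable (D_leb T) g"
        using T by (intro integrable_cont_D[OF g _ sets_D_leb] finite_measure_D_leb) simp
      have i1: "integrable (D_leb T) (\<lambda>z. g z * ?b z)" by (rule integrable_mult_bump[OF T gi])
      note i2 = integral_bump_shrink[OF T t, of k x]
      have near: "\<bar>g z - g (t, x)\<bar> \<le> e" if z: "z \<in> spacetime T" and nz: "?b z \<noteq> 0" for z
      proof -
        obtain u y where uy: "z = (u, y)" by (cases z)
        have u: "u \<in> {0..T}" using z by (auto simp: uy spacetime_def)
        have "\<bar>u - shrink T k t\<bar> < mscale T k"
        proof (rule ccontr)
          assume "\<not> \<bar>u - shrink T k t\<bar> < mscale T k"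
          then have "bump_t (mscale T k) (u - shrink T k t) = 0" by (intro bump_t_outside dpos) simp
          then show False using nz by (simp add: uy bump_def)
        qed
        \<comment> \<open>One \<open>mscale\<close> is the kernel radius, two more come from the
          contraction of time.\<close>
        then have ut: "\<bar>u - t\<bar> < d" using shrink_bounds(3)[OF T t, of k] elim(1) by linarith
        have "lattice_gap (y - x) < (mscale T k)\<^sup>2"
        proof (rule ccontr)
          assume "\<not> lattice_gap (y - x) < (mscale T k)\<^sup>2"
          then have "bump_x (mscale T k) (y - x) = 0" by (simp add: bump_x_def)
          then show False using nz by (simp add: uy bump_def)
        qed
        then have "lattice_gap (y - x) < 1 - cos (2 * pi * s)" using elim(2) by (simp add: c_def)
        then obtain j where j: "int_vec j" "\<And>i. \<bar>(y - x) $ i - j $ i\<bar> < s" by (rule lattice_near[OF s]) blast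
        have "norm ((y - j) - x) \<le> (\<Sum>i\<in>UNIV. \<bar>((y - j) - x) $ i\<bar>)" by (rule norm_le_l1_cart)
        also have "\<dots> \<le> (\<Sum>i\<in>(UNIV :: 'n set). s)"
          using j(2) by (intro sum_mono) (simp add: algebra_simps less_imp_le)
        finally have "dist (y - j) x < d" using sn by (simp add: dist_norm)
        then have "\<bar>g (u, y - j) - g (t, x)\<bar> < e" by (intro d(2) u t ut)
        moreover have "g (u, (y - j) + j) = g (u, y - j)"
          using g u zperiodicD[OF _ j(1), of "\<lambda>x. g (u, x)" "y - j"] by (simp add: cont_D_def)
        ultimately show ?thesis by (simp add: uy)
      qed
      have "\<bar>moll T k g (t, x) - g (t, x)\<bar> = \<bar>LINT z|D_leb T. g z * ?b z - g (t, x) * ?b z\<bar>"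
        using i1 i2 by (simp add: moll_eq)
      also have "\<dots> \<le> (LINT z|D_leb T. \<bar>g z * ?b z - g (t, x) * ?b z\<bar>)" by (rule integral_abs_bound)
      also have "\<dots> \<le> (LINT z|D_leb T. e * ?b z)"
      proof (rule integral_mono)
        fix z :: "real \<times> (real^'n)" assume "z \<in> space (D_leb T)"
        then have z: "z \<in> spacetime T" by simp
        have b: "0 \<le> ?b z" by (rule bump_nonneg[OF dpos])
        have "\<bar>g z * ?b z - g (t, x) * ?b z\<bar> = \<bar>g z - g (t, x)\<bar> * ?b z"
          using b by (simp add: abs_mult flip: left_diff_distrib)
        also have "\<dots> \<le> e * ?b z" using near[OF z] b by (cases "?b z = 0") (auto intro: mult_right_mono)
        finally show "\<bar>g z * ?b z - g (t, x) * ?b z\<bar> \<le> e * ?b z" .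
      qed (use i1 i2 in auto)
      also have "\<dots> = e" using i2 by simp
      finally show "\<bar>moll T k g (t, x) - g (t, x)\<bar> \<le> e" .
    qed
  qed
qed

lemma integrable_moll:
  fixes f :: "real \<times> (real^'n) \<Rightarrow> real"
  assumes T: "T > 0" and f: "integrable (D_leb T) f"
  shows "integrable (D_leb T) (moll T k f)"
  using T by (intro integrable_smooth_periodic smooth_periodic_moll f) auto

text \<open>Integration over the centre \<open>w\<close> instead of \<open>z\<close>. The space
  factor has mass one by symmetry; the time factor is divided by \<open>dilation k\<close>, which is
  at least 1/2.\<close>

lemma nn_integral_bump_adjoint:
  fixes z :: "real \<times> (real^'n)"
  assumes T: "T > 0"
  shows "(\<integral>\<^sup>+w. ennreal (bump (mscale T k) (z - (shrink T k (fst w), snd w))) \<partial>D_leb T) \<le> 2"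
proof -
  let ?d = "mscale T k"
  have d: "?d > 0" by (rule scale_pos[OF T])
  have cb: "continuous_on UNIV (bump ?d :: real \<times> (real^'n) \<Rightarrow> real)" by (intro smooth_continuous smooth_periodicD(1)[OF smooth_bump])
  have cm: "(\<lambda>w :: real \<times> (real^'n). bump ?d (z - (shrink T k (fst w), snd w))) \<in> borel_measurable borel"
    by (intro borel_measurable_continuous_onI continuous_on_compose2[OF cb])
       (auto intro!: continuous_intros simp: shrink_def)
  have ct: "continuous_on UNIV (bump_t ?d)"
    unfolding bump_t_def[abs_def] divide_inverse by (intro continuous_on_mult_right smooth_continuous smooth_bump_t0)
  then have bm: "bump_t ?d \<in> borel_measurable borel" by (rule borel_measurable_continuous_onI)
  have bm': "(\<lambda>t. bump_t ?d (a + b * t)) \<in> borel_measurable borel" for a b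
    using bm by measurable
  have xi: "(\<integral>\<^sup>+x. ennreal (bump_x ?d (snd z - x)) \<partial>torus_leb) = 1"
  proof -
    have "integrable torus_leb (\<lambda>x. bump_x ?d (x - snd z))"
      using not_integrable_integral_eq integral_bump_x[OF d, of "snd z"] by fastforce
    then have "(\<integral>\<^sup>+x. ennreal (bump_x ?d (x - snd z)) \<partial>torus_leb) = ennreal 1"
      using bump_x_nonneg[OF d] by (subst nn_integral_eq_integral) (auto simp: integral_bump_x[OF d])
    then show ?thesis by (simp add: bump_x_minus[of _ _ "snd z"])
  qed
  have "(\<integral>\<^sup>+w. ennreal (bump ?d (z - (shrink T k (fst w), snd w))) \<partial>D_leb T)
      = (\<integral>\<^sup>+t. \<integral>\<^sup>+x. ennreal (bump ?d (z - (shrink T k t, x))) \<partial>torus_leb \<partial>time_leb T)"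
    by (subst nn_integral_D_leb) (auto intro!: measurable_compose[OF _ measurable_ennreal] restrict_borel_measurable cm)
  also have "\<dots> = (\<integral>\<^sup>+t. ennreal (bump_t ?d (fst z - shrink T k t)) \<partial>time_leb T)"
  proof (rule nn_integral_cong)
    fix t
    have "continuous_on UNIV (bump_x ?d :: real^'n \<Rightarrow> real)"
      using cont_torus_bump_x[where 'n='n, of ?d] by (simp add: cont_torus_def)
    then have "continuous_on UNIV (\<lambda>x. bump_x ?d (snd z - x))"
      by (rule continuous_on_compose2[where f="\<lambda>x. snd z - x"]) (auto intro!: continuous_intros)
    then have m: "(\<lambda>x. ennreal (bump_x ?d (snd z - x))) \<in> borel_measurable torus_leb"
      by (intro measurable_compose[OF _ measurable_ennreal] restrict_borel_measurable borel_measurable_continuous_onI)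
    have "(\<integral>\<^sup>+x. ennreal (bump ?d (z - (shrink T k t, x))) \<partial>torus_leb)
        = (\<integral>\<^sup>+x. ennreal (bump_t ?d (fst z - shrink T k t)) * ennreal (bump_x ?d (snd z - x)) \<partial>torus_leb)"
      by (simp add: bump_def ennreal_mult bump_t_nonneg[OF d] bump_x_nonneg[OF d])
    also have "\<dots> = ennreal (bump_t ?d (fst z - shrink T k t))"
      by (simp only: nn_integral_cmult[OF m] xi mult_1_right)
    finally show "(\<integral>\<^sup>+x. ennreal (bump ?d (z - (shrink T k t, x))) \<partial>torus_leb) = ennreal (bump_t ?d (fst z - shrink T k t))" .
  qed
  also have "\<dots> \<le> (\<integral>\<^sup>+t. ennreal (bump_t ?d (fst z - shrink T k t)) \<partial>lborel)"
    by (subst nn_integral_restrict_space) (auto intro!: nn_integral_mono simp: indicator_def)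
  also have "\<dots> = (\<integral>\<^sup>+t. ennreal (bump_t ?d ((fst z - 2 * ?d) + (- dilation k) * t)) \<partial>lborel)"
    by (simp add: shrink_def algebra_simps)
  also have "\<dots> = ennreal (1 / dilation k)"
  proof -
    have "ennreal 1 = (\<integral>\<^sup>+u. ennreal (bump_t ?d u) \<partial>lborel)"
      using integral_bump_t[OF d] bump_t_nonneg[OF d] by (subst nn_integral_eq_integral) auto
    also have "\<dots> = ennreal \<bar>- dilation k\<bar> * (\<integral>\<^sup>+t. ennreal (bump_t ?d ((fst z - 2 * ?d) + (- dilation k) * t)) \<partial>lborel)"
      using bm dilation_bounds[of k] by (intro nn_integral_real_affine) auto
    finally have "ennreal (dilation k) * (\<integral>\<^sup>+t. ennreal (bump_t ?d ((fst z - 2 * ?d) + (- dilation k) * t)) \<partial>lborel) = ennreal 1"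
      using dilation_bounds[of k] by simp
    then have "ennreal (1 / dilation k) * (ennreal (dilation k) * (\<integral>\<^sup>+t. ennreal (bump_t ?d ((fst z - 2 * ?d) + (- dilation k) * t)) \<partial>lborel)) = ennreal (1 / dilation k)"
      by simp
    then show ?thesis
      using dilation_bounds[of k] by (simp add: mult.assoc[symmetric] ennreal_mult[symmetric])
  qed
  also have "\<dots> \<le> ennreal 2" using dilation_bounds[of k] by (intro ennreal_leI) (simp add: field_simps)
  finally show ?thesis by simp
qed

text \<open>Tonelli exchanges the two integrations, and the adjoint kernel has mass at most 2. The
  constant only has to be independent of \<open>k\<close>.\<close>

lemma moll_L1_bound:
  fixes f :: "real \<times> (real^'n) \<Rightarrow> real"
  assumes T: "T > 0" and f: "integrable (D_leb T) f"
  shows "(LINT z|D_leb T. \<bar>moll T k f z\<bar>) \<le> 2 * (LINT z|D_leb T. \<bar>f z\<bar>)"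
proof -
  let ?D = "D_leb T :: (real \<times> (real^'n)) measure"
  let ?b = "\<lambda>z w. bump (mscale T k) (z - (shrink T k (fst w), snd w))"
  have d: "mscale T k > 0" by (rule scale_pos[OF T])
  interpret finite_measure ?D using T by (intro finite_measure_D_leb) simp
  interpret pair_sigma_finite ?D ?D by standard
  have [measurable]: "f \<in> borel_measurable ?D" using f by auto
  have cb: "continuous_on UNIV (bump (mscale T k) :: real \<times> (real^'n) \<Rightarrow> real)" by (intro smooth_continuous smooth_periodicD(1)[OF smooth_bump])
  have bm [measurable]: "(\<lambda>p. ?b (fst p) (snd p)) \<in> borel_measurable (?D \<Otimes>\<^sub>M ?D)"
  proof -
    have "(\<lambda>p :: (real \<times> (real^'n)) \<times> (real \<times> (real^'n)). ?b (fst p) (snd p)) \<in> borel_measurable (borel \<Otimes>\<^sub>M borel)"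
      unfolding borel_prod
    proof (rule borel_measurable_continuous_onI)
      have "continuous_on UNIV (\<lambda>p :: (real \<times> (real^'n)) \<times> (real \<times> (real^'n)). fst p - (shrink T k (fst (snd p)), snd (snd p)))"
        unfolding shrink_def by (intro continuous_intros)
      from continuous_on_compose2[OF cb this]
      show "continuous_on UNIV (\<lambda>p :: (real \<times> (real^'n)) \<times> (real \<times> (real^'n)). ?b (fst p) (snd p))" by simp
    qed
    moreover have "(\<lambda>p. (fst p, snd p)) \<in> measurable (?D \<Otimes>\<^sub>M ?D) (borel \<Otimes>\<^sub>M borel)"
      using measurable_compose[OF measurable_fst restrict_borel_measurable(2)[OF measurable_ident]]
            measurable_compose[OF measurable_snd restrict_borel_measurable(2)[OF measurable_ident]]
      by (intro measurable_Pair) auto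
    ultimately show ?thesis using measurable_compose by fastforce
  qed
  have mi: "integrable ?D (moll T k f)" by (rule integrable_moll[OF T f])
  have "ennreal (LINT w|?D. \<bar>moll T k f w\<bar>) = (\<integral>\<^sup>+w. ennreal \<bar>moll T k f w\<bar> \<partial>?D)"
    using mi by (subst nn_integral_eq_integral) auto
  also have "\<dots> \<le> (\<integral>\<^sup>+w. \<integral>\<^sup>+z. ennreal \<bar>f z\<bar> * ennreal (?b z w) \<partial>?D \<partial>?D)"
  proof (rule nn_integral_mono)
    fix w
    have "ennreal \<bar>moll T k f w\<bar> \<le> (\<integral>\<^sup>+z. ennreal (norm (f z * ?b z w)) \<partial>?D)"
      unfolding moll_def conv_def using integral_norm_bound_ennreal[OF integrable_mult_bump[OF T f]] by simp
    also have "\<dots> = (\<integral>\<^sup>+z. ennreal \<bar>f z\<bar> * ennreal (?b z w) \<partial>?D)"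
      by (intro nn_integral_cong) (simp add: abs_mult ennreal_mult bump_nonneg[OF d])
    finally show "ennreal \<bar>moll T k f w\<bar> \<le> (\<integral>\<^sup>+z. ennreal \<bar>f z\<bar> * ennreal (?b z w) \<partial>?D)" .
  qed
  also have "\<dots> = (\<integral>\<^sup>+z. \<integral>\<^sup>+w. ennreal \<bar>f z\<bar> * ennreal (?b z w) \<partial>?D \<partial>?D)"
    by (rule Fubini') (use bm in measurable)
  also have "\<dots> \<le> (\<integral>\<^sup>+z. 2 * ennreal \<bar>f z\<bar> \<partial>?D)"
  proof (rule nn_integral_mono)
    fix z assume z: "z \<in> space ?D"
    have "(\<lambda>w. ?b z w) \<in> borel_measurable ?D"
      using measurable_compose[OF measurable_Pair1'[OF z] bm] by simp
    then have "(\<integral>\<^sup>+w. ennreal \<bar>f z\<bar> * ennreal (?b z w) \<partial>?D) = ennreal \<bar>f z\<bar> * (\<integral>\<^sup>+w. ennreal (?b z w) \<partial>?D)"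
      by (intro nn_integral_cmult) simp
    also have "\<dots> \<le> ennreal \<bar>f z\<bar> * 2" by (intro mult_left_mono nn_integral_bump_adjoint[OF T]) simp
    finally show "(\<integral>\<^sup>+w. ennreal \<bar>f z\<bar> * ennreal (?b z w) \<partial>?D) \<le> 2 * ennreal \<bar>f z\<bar>" by (simp add: mult.commute)
  qed
  also have "\<dots> = 2 * ennreal (LINT z|?D. \<bar>f z\<bar>)"
    using f by (subst nn_integral_cmult) (auto simp: nn_integral_eq_integral)
  also have "\<dots> = ennreal (2 * (LINT z|?D. \<bar>f z\<bar>))" by (simp add: ennreal_mult')
  finally show ?thesis by (subst (asm) ennreal_le_iff) auto
qed

lemma D_leb_ends:
  assumes "T > 0" shows "AE z in D_leb T :: (real \<times> (real^'n)) measure. 0 < fst z \<and> fst z < T"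
proof -
  interpret pair_sigma_finite "time_leb T" "torus_leb :: (real^'n) measure" by (rule pair_sigma_finite_D)
  have "AE t in lborel. t \<noteq> 0 \<and> t \<noteq> T" using AE_lborel_singleton[of 0] AE_lborel_singleton[of T] by auto
  then have 1: "AE t in time_leb T. 0 < t \<and> t < T"
    by (subst AE_restrict_space_iff) (auto simp: less_le)
  have "AE z in time_leb T \<Otimes>\<^sub>M (torus_leb :: (real^'n) measure). 0 < fst z \<and> fst z < T"
  proof (rule AE_pair_measure)
    show "{z \<in> space (time_leb T \<Otimes>\<^sub>M (torus_leb :: (real^'n) measure)). 0 < fst z \<and> fst z < T} \<in> sets (time_leb T \<Otimes>\<^sub>M torus_leb)"
    proof -
      have "fst \<in> borel_measurable (time_leb T \<Otimes>\<^sub>M (torus_leb :: (real^'n) measure))"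
        using measurable_compose[OF measurable_fst restrict_borel_measurable(2)[OF measurable_ident]] by auto
      then show ?thesis by measurable
    qed
    show "AE t in time_leb T. AE x in (torus_leb :: (real^'n) measure). 0 < fst (t, x) \<and> fst (t, x) < T"
      using 1 by eventually_elim auto
  qed
  then show ?thesis by (simp only: D_leb_eq)
qed

lemma test_functions_dense_D:
  fixes f :: "real \<times> (real^'n) \<Rightarrow> real"
  assumes T: "T > 0" and f: "integrable (D_leb T) f" and e: "e > 0"
  obtains \<eta> where "test_fun T \<eta>" "(LINT z|D_leb T. \<bar>f z - \<eta> z\<bar>) < e"
proof -
  have "\<exists>\<eta>\<in>{\<eta>. test_fun T \<eta>}. (LINT z|D_leb T. \<bar>f z - \<eta> z\<bar>) < e"
    by (rule test_functions_dense[OF T _ sets_D_leb D_leb_ends[OF T] _ _ _ _ f e])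
       (use T finite_measure_D_leb[of T, where 'n='n] integrable_test_fun[OF _ sets_D_leb] in
         \<open>auto intro: test_fun_product test_fun_add test_fun_scale\<close>)
  then show ?thesis using that by blast
qed

text \<open>Test functions are mollified with uniform convergence, and the uniform L1 bound controls
  the difference to a dense approximation.\<close>

lemma moll_L1_tendsto:
  fixes f :: "real \<times> (real^'n) \<Rightarrow> real"
  assumes T: "T > 0" and f: "integrable (D_leb T) f"
  shows "(\<lambda>k. LINT z|D_leb T. \<bar>moll T k f z - f z\<bar>) \<longlonglongrightarrow> 0"
proof (rule tendstoI)
  let ?D = "D_leb T :: (real \<times> (real^'n)) measure"
  interpret finite_measure ?D using T by (intro finite_measure_D_leb) simp
  fix e :: real assume e: "e > 0"
  \<comment> \<open>The error is counted once as it stands and twice after mollification, together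
    \<open>e / 2\<close>. The uniform error \<open>e / (4 * T)\<close> on a space of mass
    \<open>T\<close> adds \<open>e / 4\<close>.\<close>
  obtain \<eta> where \<eta>: "test_fun T \<eta>" "(LINT z|?D. \<bar>f z - \<eta> z\<bar>) < e / 6"
    using test_functions_dense_D[OF T f, of "e / 6"] e by auto
  have \<eta>i: "integrable ?D \<eta>" using integrable_test_fun[OF finite_measure_axioms sets_D_leb \<eta>(1)] .
  have fei: "integrable ?D (\<lambda>z. f z - \<eta> z)" using f \<eta>i by auto
  have "e / (4 * T) > 0" using e T by simp
  from moll_uniform[OF T cont_D_test_fun[OF \<eta>(1)] this]
  show "\<forall>\<^sub>F k in sequentially. dist (LINT z|?D. \<bar>moll T k f z - f z\<bar>) 0 < e"
  proof eventually_elim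
    case (elim k)
    have "(LINT z|?D. \<bar>moll T k f z - f z\<bar>) \<le> (LINT z|?D. \<bar>moll T k (\<lambda>z. f z - \<eta> z) z\<bar> + (e / (4 * T) + \<bar>f z - \<eta> z\<bar>))"
    proof (rule integral_mono)
      fix z assume "z \<in> space ?D"
      then have "z \<in> spacetime T" by simp
      then have "\<bar>moll T k \<eta> z - \<eta> z\<bar> \<le> e / (4 * T)" using elim by (auto simp: spacetime_def)
      then show "\<bar>moll T k f z - f z\<bar> \<le> \<bar>moll T k (\<lambda>z. f z - \<eta> z) z\<bar> + (e / (4 * T) + \<bar>f z - \<eta> z\<bar>)"
        by (simp add: moll_add[OF T f \<eta>i])
    qed (use integrable_moll[OF T f] integrable_moll[OF T fei] f \<eta>i in auto)
    also have "\<dots> = (LINT z|?D. \<bar>moll T k (\<lambda>z. f z - \<eta> z) z\<bar>) + (LINT z|?D. e / (4 * T)) + (LINT z|?D. \<bar>f z - \<eta> z\<bar>)"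
      using integrable_moll[OF T fei] fei by simp
    also have "\<dots> \<le> 2 * (LINT z|?D. \<bar>f z - \<eta> z\<bar>) + e / 4 + (LINT z|?D. \<bar>f z - \<eta> z\<bar>)"
    proof -
      have "measure ?D (spacetime T) = T" using emeasure_D_leb[of T, where 'n='n] T by (simp add: measure_def)
      then have "(LINT z|?D. e / (4 * T)) = e / 4" using T by simp
      then show ?thesis using moll_L1_bound[OF T fei, of k] by simp
    qed
    also have "\<dots> < e" using \<eta>(2) e by simp
    finally show ?case by (simp add: abs_of_nonneg Bochner_Integration.integral_nonneg)
  qed
qed

text \<open>Convergence of bounded functions against a merely integrable weight. The mollifications
  share the bound \<open>C\<close>, so \<open>g\<close> may be replaced by a bounded test function,
  after which L1 convergence suffices.\<close>

lemma moll_weak_tendsto: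
  fixes f g :: "real \<times> (real^'n) \<Rightarrow> real"
  assumes T: "T > 0" and f: "f \<in> borel_measurable (D_leb T)" "AE z in D_leb T. \<bar>f z\<bar> \<le> C"
    and g: "integrable (D_leb T) g"
  shows "(\<lambda>k. LINT z|D_leb T. g z * moll T k f z) \<longlonglongrightarrow> (LINT z|D_leb T. g z * f z)"
    and "integrable (D_leb T) (\<lambda>z. g z * f z)" and "integrable (D_leb T) (\<lambda>z. g z * moll T k f z)"
proof -
  let ?D = "D_leb T :: (real \<times> (real^'n)) measure"
  interpret finite_measure ?D using T by (intro finite_measure_D_leb) simp
  have fi: "integrable ?D f" by (rule integrable_D_bounded[OF T f(1)]) (use f(2) in simp)
  have mb: "\<bar>moll T k f z\<bar> \<le> C" if "z \<in> spacetime T" for k z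
    using moll_bounded[OF T f, of "fst z" k "snd z"] that by (auto simp: spacetime_def)
  have bi: "integrable ?D (\<lambda>z. g z * h z)" if "integrable ?D g" "h \<in> borel_measurable ?D" "AE z in ?D. \<bar>h z\<bar> \<le> C" for g h
  proof (rule Bochner_Integration.integrable_bound[where f="\<lambda>z. C * g z"])
    show "AE z in ?D. norm (g z * h z) \<le> norm (C * g z)"
      using that(3)
    proof eventually_elim
      case (elim z)
      then have "\<bar>h z\<bar> \<le> \<bar>C\<bar>" by linarith
      from mult_right_mono[OF this, of "\<bar>g z\<bar>"] show ?case by (simp add: abs_mult mult.commute)
    qed
  qed (use that in auto)
  have mm: "moll T k f \<in> borel_measurable ?D" for k using integrable_moll[OF T fi] by auto
  have mC: "AE z in ?D. \<bar>moll T k f z\<bar> \<le> C" for k using mb by (intro AE_I2) simp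
  show gf: "integrable ?D (\<lambda>z. g z * f z)" by (rule bi[OF g f])
  show gm: "integrable ?D (\<lambda>z. g z * moll T k f z)" for k by (rule bi[OF g mm mC])
  have C0: "C \<ge> 0" using mb[of "(0, 0)" 0] T by (auto simp: spacetime_def torus_cell_def)
  show "(\<lambda>k. LINT z|?D. g z * moll T k f z) \<longlonglongrightarrow> (LINT z|?D. g z * f z)"
  proof (rule tendstoI)
    fix e :: real assume e: "e > 0"
    \<comment> \<open>Two functions bounded by \<open>C\<close> differ by at most
      \<open>2 * C\<close>, so this choice costs at most \<open>e / 2\<close>; the
      \<open>+ 1\<close> covers \<open>C = 0\<close>.\<close>
    have "e / (4 * C + 1) > 0" using e C0 by (simp add: add_nonneg_pos)
    then obtain \<eta> where \<eta>: "test_fun T \<eta>" "(LINT z|?D. \<bar>g z - \<eta> z\<bar>) < e / (4 * C + 1)"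
      using test_functions_dense_D[OF T g] by metis
    obtain B where B: "B > 0" "\<And>t x. t \<in> {0..T} \<Longrightarrow> norm (\<eta> (t, x)) \<le> B"
      using cont_D_bounded[OF cont_D_test_fun[OF \<eta>(1)]] by metis
    have \<eta>i: "integrable ?D \<eta>" using integrable_test_fun[OF finite_measure_axioms sets_D_leb \<eta>(1)] .
    have "\<forall>\<^sub>F k in sequentially. (LINT z|?D. \<bar>moll T k f z - f z\<bar>) < e / (2 * B)"
      using moll_L1_tendsto[OF T fi] e B(1) by (intro order_tendstoD(2)) auto
    then show "\<forall>\<^sub>F k in sequentially. dist (LINT z|?D. g z * moll T k f z) (LINT z|?D. g z * f z) < e"
    proof eventually_elim
      case (elim k)
      have gei: "integrable ?D (\<lambda>z. \<bar>g z - \<eta> z\<bar>)" using g \<eta>i by auto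
      have mfi: "integrable ?D (\<lambda>z. \<bar>moll T k f z - f z\<bar>)" using integrable_moll[OF T fi] fi by auto
      have "\<bar>(LINT z|?D. g z * moll T k f z) - (LINT z|?D. g z * f z)\<bar> = \<bar>LINT z|?D. g z * (moll T k f z - f z)\<bar>"
        using gm gf by (simp add: right_diff_distrib)
      also have "\<dots> \<le> (LINT z|?D. \<bar>g z * (moll T k f z - f z)\<bar>)" by (rule integral_abs_bound)
      also have "\<dots> \<le> (LINT z|?D. 2 * C * \<bar>g z - \<eta> z\<bar> + B * \<bar>moll T k f z - f z\<bar>)"
      proof (rule integral_mono_AE)
        show "integrable ?D (\<lambda>z. \<bar>g z * (moll T k f z - f z)\<bar>)"
          using gm gf by (simp add: right_diff_distrib)
        show "integrable ?D (\<lambda>z. 2 * C * \<bar>g z - \<eta> z\<bar> + B * \<bar>moll T k f z - f z\<bar>)" using gei mfi by auto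
        show "AE z in ?D. \<bar>g z * (moll T k f z - f z)\<bar> \<le> 2 * C * \<bar>g z - \<eta> z\<bar> + B * \<bar>moll T k f z - f z\<bar>"
          using f(2) AE_space
        proof eventually_elim
          case (elim z)
          have zD: "z \<in> spacetime T" using elim by simp
          then have eb: "\<bar>\<eta> z\<bar> \<le> B" using B(2)[of "fst z" "snd z"] by (auto simp: spacetime_def)
          have db: "\<bar>moll T k f z - f z\<bar> \<le> 2 * C" using mb[OF zD, of k] elim by linarith
          have "g z * (moll T k f z - f z) = (g z - \<eta> z) * (moll T k f z - f z) + \<eta> z * (moll T k f z - f z)"
            by (simp add: algebra_simps)
          then have "\<bar>g z * (moll T k f z - f z)\<bar> \<le> \<bar>g z - \<eta> z\<bar> * \<bar>moll T k f z - f z\<bar> + \<bar>\<eta> z\<bar> * \<bar>moll T k f z - f z\<bar>"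
            by (metis abs_mult abs_triangle_ineq)
          also have "\<dots> \<le> \<bar>g z - \<eta> z\<bar> * (2 * C) + B * \<bar>moll T k f z - f z\<bar>"
            using eb db by (intro add_mono mult_left_mono mult_right_mono) auto
          finally show ?case by (simp add: mult_ac)
        qed
      qed
      also have "\<dots> = 2 * C * (LINT z|?D. \<bar>g z - \<eta> z\<bar>) + B * (LINT z|?D. \<bar>moll T k f z - f z\<bar>)"
        using gei mfi by simp
      also have "\<dots> < e / 2 + e / 2"
      proof (rule add_le_less_mono)
        have "2 * C * (LINT z|?D. \<bar>g z - \<eta> z\<bar>) \<le> 2 * C * (e / (4 * C + 1))"
          using \<eta>(2) C0 by (intro mult_left_mono) auto
        also have "\<dots> \<le> e / 2" using C0 e by (simp add: field_simps add_nonneg_pos)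
        finally show "2 * C * (LINT z|?D. \<bar>g z - \<eta> z\<bar>) \<le> e / 2" .
        have "B * (LINT z|?D. \<bar>moll T k f z - f z\<bar>) < B * (e / (2 * B))"
          using elim B(1) by (intro mult_strict_left_mono) auto
        then show "B * (LINT z|?D. \<bar>moll T k f z - f z\<bar>) < e / 2" using B(1) by simp
      qed
      finally show ?case by (simp add: dist_real_def)
    qed
  qed
qed

subsection \<open>Weakly-* continuous curves of probability measures\<close>

text \<open>The function is extended constantly in time and mollified there; any time slice of the
  result serves.\<close>

lemma cont_torus_approx:
  fixes \<theta> :: "real^'n \<Rightarrow> real"
  assumes \<theta>: "cont_torus \<theta>" and e: "e > 0"
  obtains \<eta> where "smooth \<eta>" "zperiodic \<eta>" "\<And>x. \<bar>\<eta> x - \<theta> x\<bar> \<le> e"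
proof -
  let ?g = "\<lambda>z :: real \<times> (real^'n). \<theta> (snd z)"
  have g: "cont_D 1 ?g" by (rule cont_torus_cont_D[OF \<theta>])
  have gi: "integrable (D_leb 1) ?g" by (rule integrable_cont_D[OF g finite_measure_D_leb sets_D_leb]) simp
  from moll_uniform[OF _ g e] obtain k where k: "\<forall>t\<in>{0..1}. \<forall>x. \<bar>moll 1 k ?g (t, x) - ?g (t, x)\<bar> \<le> e"
    by (auto simp: eventually_sequentially)
  have s: "smooth_periodic (moll 1 k ?g)" by (rule smooth_periodic_moll[OF _ gi]) simp
  show ?thesis
    by (rule that[of "\<lambda>x. moll 1 k ?g (0, x)"])
       (use k in \<open>auto intro: smooth_slice smooth_periodicD[OF s]\<close>)
qed

definition curve :: "real \<Rightarrow> (real \<Rightarrow> (real^'n) measure) \<Rightarrow> bool" where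
  "curve T \<mu> \<longleftrightarrow> (\<forall>t\<in>{0..T}. prob_space (\<mu> t) \<and> sets (\<mu> t) = sets torus_borel) \<and>
     (\<forall>\<eta>. cont_torus \<eta> \<longrightarrow> continuous_on {0..T} (\<lambda>t. LINT x|\<mu> t. \<eta> x))"

text \<open>The measure \<open>\<mu> t (dx) dt\<close> as a monadic bind over time, each
  \<open>\<mu> t\<close> being placed on its time slice. Disintegration formulas for integrals then
  follow from those for \<open>bind\<close>.\<close>

definition curve_measure :: "real \<Rightarrow> (real \<Rightarrow> (real^'n) measure) \<Rightarrow> (real \<times> (real^'n)) measure" where
  "curve_measure T \<mu> = time_leb T \<bind> (\<lambda>t. distr (\<mu> t) (D_borel T) (Pair t))"

lemma curveD:
  assumes "curve T \<mu>" "t \<in> {0..T}"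
  shows "prob_space (\<mu> t)" "sets (\<mu> t) = sets torus_borel" "space (\<mu> t) = torus_cell" "finite_measure (\<mu> t)"
proof -
  show 1: "prob_space (\<mu> t)" and 2: "sets (\<mu> t) = sets torus_borel" using assms by (auto simp: curve_def)
  show "space (\<mu> t) = torus_cell" using sets_eq_imp_space_eq[OF 2] by simp
  show "finite_measure (\<mu> t)" using 1 by (simp add: prob_space_def)
qed

text \<open>Weak continuity controls only integrals of continuous functions. Measures of positivity
  sets are limits of such integrals through \<open>exp_cut\<close>, and these sets form an
  intersection-stable generator.\<close>

lemma curve_measurable:
  fixes \<mu> :: "real \<Rightarrow> (real^'n) measure"
  assumes c: "curve T \<mu>"
  shows "\<mu> \<in> measurable (time_leb T) (subprob_algebra torus_borel)"
proof (rule measurable_subprob_algebra_generated[OF sets_torus_borel_generated Int_stable_torus_rects])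
  fix t assume t: "t \<in> space (time_leb T)"
  show "subprob_space (\<mu> t)" using curveD(1)[OF c] t by (intro prob_space_imp_subprob_space) simp
  show "sets (\<mu> t) = sets torus_borel" using curveD(2)[OF c] t by simp
next
  have "emeasure (\<mu> t) torus_cell = 1" if "t \<in> {0..T}" for t
    using prob_space.emeasure_space_1[OF curveD(1)[OF c that]] curveD(3)[OF c that] by simp
  then have "(\<lambda>t. emeasure (\<mu> t) torus_cell) \<in> borel_measurable (time_leb T) \<longleftrightarrow> (\<lambda>t. 1 :: ennreal) \<in> borel_measurable (time_leb T)"
    by (intro measurable_cong) simp
  then show "(\<lambda>t. emeasure (\<mu> t) torus_cell) \<in> borel_measurable (time_leb T)" by simp
next
  fix A assume "A \<in> {{x \<in> torus_cell. 0 < \<theta> x} | \<theta>. smooth \<theta> \<and> (\<forall>x. 0 \<le> \<theta> x) \<and> zperiodic (\<theta> :: real^'n \<Rightarrow> real)}"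
  then obtain \<theta> :: "real^'n \<Rightarrow> real" where A: "A = {x \<in> torus_cell. 0 < \<theta> x}" "smooth \<theta>" "\<And>x. 0 \<le> \<theta> x" "zperiodic \<theta>" by blast
  have ct: "cont_torus (\<lambda>x. exp_cut n (\<theta> x))" for n
    by (rule cont_torus_smooth[OF smooth_exp_cut[OF A(2)] zperiodic_comp[OF A(4)]])
  have lim: "(\<lambda>n. LINT x|\<mu> t. exp_cut n (\<theta> x)) \<longlonglongrightarrow> measure (\<mu> t) A" if t: "t \<in> {0..T}" for t
  proof -
    interpret prob_space "\<mu> t" by (rule curveD(1)[OF c t])
    have "\<theta> \<in> borel_measurable torus_borel"
      by (intro restrict_borel_measurable cont_torus_measurable cont_torus_smooth A)
    then have "{x \<in> space torus_borel. 0 < \<theta> x} \<in> sets torus_borel" by measurable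
    then have As [measurable]: "A \<in> sets (\<mu> t)" by (simp add: curveD(2)[OF c t] A(1))
    have "(\<lambda>n. LINT x|\<mu> t. exp_cut n (\<theta> x)) \<longlonglongrightarrow> (LINT x|\<mu> t. indicator A x)"
    proof (rule integral_dominated_convergence[where w="\<lambda>_. 1"])
      show "(\<lambda>x. exp_cut n (\<theta> x)) \<in> borel_measurable (\<mu> t)" for n
        using integrable_cont_torus[OF ct finite_measure_axioms curveD(2)[OF c t]] by auto
      show "AE x in \<mu> t. (\<lambda>n. exp_cut n (\<theta> x)) \<longlonglongrightarrow> indicator A x"
      proof (rule AE_I2)
        fix x assume "x \<in> space (\<mu> t)"
        then have "indicator A x = (indicator {0<..} (\<theta> x) :: real)"
          by (auto simp: A(1) curveD(3)[OF c t] indicator_def)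
        then show "(\<lambda>n. exp_cut n (\<theta> x)) \<longlonglongrightarrow> indicator A x" using exp_cut(3)[OF A(3)] by simp
      qed
    qed (use exp_cut[OF A(3)] in auto)
    then show ?thesis by simp
  qed
  have "(\<lambda>t. measure (\<mu> t) A) \<in> borel_measurable (time_leb T)"
  proof (rule borel_measurable_LIMSEQ_real)
    show "(\<lambda>t. LINT x|\<mu> t. exp_cut n (\<theta> x)) \<in> borel_measurable (time_leb T)" for n
    proof -
      have "continuous_on {0..T} (\<lambda>t. LINT x|\<mu> t. exp_cut n (\<theta> x))" using c ct by (simp add: curve_def)
      then have "(\<lambda>t. LINT x|\<mu> t. exp_cut n (\<theta> x)) \<in> borel_measurable (restrict_space borel {0..T})"
        by (rule borel_measurable_continuous_on_restrict)
      then show ?thesis by (simp cong: measurable_cong_sets add: sets_restrict_space)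
    qed
  qed (use lim in simp)
  then have "(\<lambda>t. ennreal (measure (\<mu> t) A)) \<in> borel_measurable (time_leb T)" by simp
  moreover have "(\<lambda>t. emeasure (\<mu> t) A) \<in> borel_measurable (time_leb T) \<longleftrightarrow> (\<lambda>t. ennreal (measure (\<mu> t) A)) \<in> borel_measurable (time_leb T)"
    by (intro measurable_cong finite_measure.emeasure_eq_measure curveD(4)[OF c]) simp
  ultimately show "(\<lambda>t. emeasure (\<mu> t) A) \<in> borel_measurable (time_leb T)" by blast
qed auto

lemma Pair_measurable_D: "t \<in> {0..T} \<Longrightarrow> Pair t \<in> measurable torus_borel (D_borel T)"
  by (rule measurable_restrict_space2)
     (auto simp: spacetime_def intro!: restrict_borel_measurable borel_measurable_continuous_onI continuous_intros)

lemma curve_kernel_measurable: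
  fixes \<mu> :: "real \<Rightarrow> (real^'n) measure"
  assumes c: "curve T \<mu>"
  shows "(\<lambda>t. distr (\<mu> t) (D_borel T) (Pair t)) \<in> measurable (time_leb T) (subprob_algebra (D_borel T))"
proof (rule measurable_distr2[OF _ curve_measurable[OF c]])
  have "(\<lambda>z. z) \<in> measurable (D_leb T :: (real \<times> (real^'n)) measure) (D_borel T)"
    by (simp cong: measurable_cong_sets add: sets_D_leb)
  then have "(\<lambda>z. z) \<in> measurable (time_leb T \<Otimes>\<^sub>M (torus_leb :: (real^'n) measure)) (D_borel T)"
    by (simp only: D_leb_eq)
  moreover have "sets (time_leb T \<Otimes>\<^sub>M torus_borel) = sets (time_leb T \<Otimes>\<^sub>M (torus_leb :: (real^'n) measure))"
    by (intro sets_pair_measure_cong sets_torus_leb[symmetric] refl)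
  ultimately show "case_prod Pair \<in> measurable (time_leb T \<Otimes>\<^sub>M (torus_borel :: (real^'n) measure)) (D_borel T)"
    by (simp cong: measurable_cong_sets add: case_prod_beta')
qed

lemma sets_curve_measure: "curve T \<mu> \<Longrightarrow> T \<ge> 0 \<Longrightarrow> sets (curve_measure T \<mu>) = sets (D_borel T)"
  unfolding curve_measure_def
  by (rule sets_bind) auto

lemma emeasure_curve_measure:
  fixes \<mu> :: "real \<Rightarrow> (real^'n) measure"
  assumes c: "curve T \<mu>" and T: "T \<ge> 0" and A: "A \<in> sets (D_borel T)"
  shows "emeasure (curve_measure T \<mu>) A = (\<integral>\<^sup>+t\<in>{0..T}. emeasure (\<mu> t) (Pair t -` A) \<partial>lborel)"
proof -
  have As: "A \<subseteq> spacetime T" using sets.sets_into_space[OF A] by simp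
  have "emeasure (curve_measure T \<mu>) A = (\<integral>\<^sup>+t. emeasure (distr (\<mu> t) (D_borel T) (Pair t)) A \<partial>time_leb T)"
    unfolding curve_measure_def by (rule emeasure_bind[OF _ curve_kernel_measurable[OF c] A]) (use T in simp)
  also have "\<dots> = (\<integral>\<^sup>+t. emeasure (\<mu> t) (Pair t -` A) \<partial>time_leb T)"
  proof (rule nn_integral_cong)
    fix t assume "t \<in> space (time_leb T)"
    then have t: "t \<in> {0..T}" by simp
    have "Pair t \<in> measurable (\<mu> t) (D_borel T)"
      using Pair_measurable_D[OF t] by (simp cong: measurable_cong_sets add: curveD(2)[OF c t])
    moreover have "Pair t -` A \<inter> space (\<mu> t) = Pair t -` A"
      using As by (auto simp: curveD(3)[OF c t] spacetime_def)
    ultimately show "emeasure (distr (\<mu> t) (D_borel T) (Pair t)) A = emeasure (\<mu> t) (Pair t -` A)"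
      using A by (simp add: emeasure_distr)
  qed
  also have "\<dots> = (\<integral>\<^sup>+t\<in>{0..T}. emeasure (\<mu> t) (Pair t -` A) \<partial>lborel)"
    by (subst nn_integral_restrict_space) auto
  finally show ?thesis .
qed

text \<open>The curve determines its space-time measure, so an admissible \<open>\<rho>\<close> may
  be replaced by \<open>curve_measure\<close> throughout.\<close>

lemma wstar_curve_iff:
  fixes \<mu> :: "real \<Rightarrow> (real^'n) measure"
  assumes T: "T \<ge> 0"
  shows "wstar_curve T \<rho> \<mu> \<longleftrightarrow> curve T \<mu> \<and> \<rho> = curve_measure T \<mu>"
proof
  assume w: "wstar_curve T \<rho> \<mu>"
  then have c: "curve T \<mu>" by (simp add: wstar_curve_def curve_def)
  have "\<rho> = curve_measure T \<mu>"
  proof (rule measure_eqI)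
    show s: "sets \<rho> = sets (curve_measure T \<mu>)" using w sets_curve_measure[OF c T] by (simp add: wstar_curve_def)
    fix A assume "A \<in> sets \<rho>"
    then show "emeasure \<rho> A = emeasure (curve_measure T \<mu>) A"
      using w s sets_curve_measure[OF c T] by (simp add: emeasure_curve_measure[OF c T] wstar_curve_def)
  qed
  with c show "curve T \<mu> \<and> \<rho> = curve_measure T \<mu>" by simp
next
  assume "curve T \<mu> \<and> \<rho> = curve_measure T \<mu>"
  then have c: "curve T \<mu>" and r: "\<rho> = curve_measure T \<mu>" by auto
  have "\<forall>A\<in>sets \<rho>. emeasure \<rho> A = (\<integral>\<^sup>+t\<in>{0..T}. emeasure (\<mu> t) (Pair t -` A) \<partial>lborel)"
    unfolding r sets_curve_measure[OF c T] by (intro ballI emeasure_curve_measure[OF c T])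
  then show "wstar_curve T \<rho> \<mu>"
    using c sets_curve_measure[OF c T] unfolding wstar_curve_def curve_def r by blast
qed

lemma nn_integral_curve_measure:
  fixes \<mu> :: "real \<Rightarrow> (real^'n) measure"
  assumes c: "curve T \<mu>" and f: "f \<in> borel_measurable (D_borel T)"
  shows "(\<integral>\<^sup>+z. f z \<partial>curve_measure T \<mu>) = (\<integral>\<^sup>+t. \<integral>\<^sup>+x. f (t, x) \<partial>\<mu> t \<partial>time_leb T)"
proof -
  have "(\<integral>\<^sup>+z. f z \<partial>curve_measure T \<mu>) = (\<integral>\<^sup>+t. \<integral>\<^sup>+z. f z \<partial>distr (\<mu> t) (D_borel T) (Pair t) \<partial>time_leb T)"
    unfolding curve_measure_def by (rule nn_integral_bind[OF f curve_kernel_measurable[OF c]])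
  also have "\<dots> = (\<integral>\<^sup>+t. \<integral>\<^sup>+x. f (t, x) \<partial>\<mu> t \<partial>time_leb T)"
  proof (rule nn_integral_cong)
    fix t assume "t \<in> space (time_leb T)"
    then have t: "t \<in> {0..T}" by simp
    have "Pair t \<in> measurable (\<mu> t) (D_borel T)"
      using Pair_measurable_D[OF t] by (simp cong: measurable_cong_sets add: curveD(2)[OF c t])
    then show "(\<integral>\<^sup>+z. f z \<partial>distr (\<mu> t) (D_borel T) (Pair t)) = (\<integral>\<^sup>+x. f (t, x) \<partial>\<mu> t)"
      using f by (subst nn_integral_distr) auto
  qed
  finally show ?thesis .
qed

lemma emeasure_curve_measure_space:
  fixes \<mu> :: "real \<Rightarrow> (real^'n) measure"
  assumes c: "curve T \<mu>" and T: "T \<ge> 0"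
  shows "emeasure (curve_measure T \<mu>) (spacetime T) = ennreal T"
proof -
  have "emeasure (curve_measure T \<mu>) (spacetime T) = (\<integral>\<^sup>+z. 1 \<partial>curve_measure T \<mu>)"
    using sets_eq_imp_space_eq[OF sets_curve_measure[OF c T]] by simp
  also have "\<dots> = (\<integral>\<^sup>+t. \<integral>\<^sup>+x. 1 \<partial>\<mu> t \<partial>time_leb T)" by (rule nn_integral_curve_measure[OF c]) simp
  also have "\<dots> = (\<integral>\<^sup>+t. 1 \<partial>time_leb T)"
    using prob_space.emeasure_space_1[OF curveD(1)[OF c]] by (intro nn_integral_cong) simp
  finally show ?thesis using T by (simp add: emeasure_restrict_space)
qed

lemma finite_curve_measure:
  fixes \<mu> :: "real \<Rightarrow> (real^'n) measure"
  assumes c: "curve T \<mu>" and T: "T \<ge> 0"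
  shows "finite_measure (curve_measure T \<mu>)"
  using emeasure_curve_measure_space[OF c T] sets_eq_imp_space_eq[OF sets_curve_measure[OF c T]]
  by (intro finite_measureI) simp

text \<open>The time marginal is Lebesgue measure, even if the slices are singular. This makes
  density and uniqueness by test functions applicable.\<close>

lemma curve_measure_ends:
  fixes \<mu> :: "real \<Rightarrow> (real^'n) measure"
  assumes c: "curve T \<mu>" and T: "T > 0"
  shows "AE z in curve_measure T \<mu>. 0 < fst z \<and> fst z < T"
proof -
  have T': "T \<ge> 0" using T by simp
  have sp: "space (curve_measure T \<mu>) = spacetime T" using sets_eq_imp_space_eq[OF sets_curve_measure[OF c T']] by simp
  let ?N = "{z \<in> spacetime T. \<not> (0 < fst z \<and> fst z < T)} :: (real \<times> (real^'n)) set"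
  have m: "fst \<in> borel_measurable (D_borel T :: (real \<times> (real^'n)) measure)"
    by (intro restrict_borel_measurable borel_measurable_continuous_onI continuous_intros)
  have "{z \<in> space (D_borel T). \<not> (0 < fst z \<and> fst z < T)} \<in> sets (D_borel T :: (real \<times> (real^'n)) measure)"
    using m by measurable
  then have N: "?N \<in> sets (D_borel T)" by simp
  have "emeasure (curve_measure T \<mu>) ?N = (\<integral>\<^sup>+t\<in>{0..T}. emeasure (\<mu> t) (Pair t -` ?N) \<partial>lborel)"
    by (rule emeasure_curve_measure[OF c T' N])
  also have "\<dots> = (\<integral>\<^sup>+t. 0 \<partial>(lborel :: real measure))"
  proof (rule nn_integral_cong_AE)
    have "AE t in lborel. t \<noteq> 0 \<and> t \<noteq> T" using AE_lborel_singleton[of 0] AE_lborel_singleton[of T] by auto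
    then show "AE t in lborel. emeasure (\<mu> t) (Pair t -` ?N) * indicator {0..T} t = 0"
    proof eventually_elim
      case (elim t)
      have "Pair t -` ?N = {}" if "t \<in> {0..T}" using elim that by auto
      then show ?case by (auto simp: indicator_def)
    qed
  qed
  finally have "emeasure (curve_measure T \<mu>) ?N = 0" by simp
  then show ?thesis
    using N sets_curve_measure[OF c T'] by (intro AE_I'[of ?N]) (auto simp: null_sets_def sp)
qed

text \<open>Integrand and measure both move with \<open>t\<close>. Uniform continuity of
  \<open>F\<close> freezes the integrand at time \<open>s\<close>, at a cost independent of the
  measure since all have mass one; weak continuity does the rest.\<close>

lemma continuous_curve_integral:
  fixes \<mu> :: "real \<Rightarrow> (real^'n) measure" and F :: "real \<times> (real^'n) \<Rightarrow> real"
  assumes c: "curve T \<mu>" and F: "cont_D T F"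
  shows "continuous_on {0..T} (\<lambda>t. LINT x|\<mu> t. F (t, x))"
  unfolding continuous_on_iff
proof (intro ballI allI impI)
  fix s e :: real assume s: "s \<in> {0..T}" and e: "e > 0"
  obtain d where d: "d > 0" "\<And>s t x y. s \<in> {0..T} \<Longrightarrow> t \<in> {0..T} \<Longrightarrow> \<bar>s - t\<bar> < d \<Longrightarrow> dist x y < d \<Longrightarrow> \<bar>F (s, x) - F (t, y)\<bar> < e / 2"
    using cont_D_uniform[OF F, of "e / 2"] e by (metis half_gt_zero)
  have "continuous_on {0..T} (\<lambda>t. LINT x|\<mu> t. F (s, x))"
    using c cont_D_slice[OF F s] by (simp add: curve_def)
  then obtain d' where d': "d' > 0" "\<And>t. t \<in> {0..T} \<Longrightarrow> dist t s < d' \<Longrightarrow> dist (LINT x|\<mu> t. F (s, x)) (LINT x|\<mu> s. F (s, x)) < e / 2"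
    using s e unfolding continuous_on_iff by (metis half_gt_zero)
  show "\<exists>d>0. \<forall>t\<in>{0..T}. dist t s < d \<longrightarrow> dist (LINT x|\<mu> t. F (t, x)) (LINT x|\<mu> s. F (s, x)) < e"
  proof (intro exI[of _ "min d d'"] conjI ballI impI)
    show "0 < min d d'" using d(1) d'(1) by simp
    fix t assume t: "t \<in> {0..T}" and dt: "dist t s < min d d'"
    interpret prob_space "\<mu> t" by (rule curveD(1)[OF c t])
    have i: "integrable (\<mu> t) (\<lambda>x. F (u, x))" if "u \<in> {0..T}" for u
      by (rule integrable_cont_torus[OF cont_D_slice[OF F that] curveD(4,2)[OF c t]])
    have "\<bar>(LINT x|\<mu> t. F (t, x)) - (LINT x|\<mu> t. F (s, x))\<bar> = \<bar>LINT x|\<mu> t. F (t, x) - F (s, x)\<bar>"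
      using i t s by simp
    also have "\<dots> \<le> (LINT x|\<mu> t. \<bar>F (t, x) - F (s, x)\<bar>)" by (rule integral_abs_bound)
    also have "\<dots> \<le> (LINT x|\<mu> t. e / 2)"
      using i t s dt d by (intro integral_mono) (auto simp: dist_real_def less_imp_le)
    also have "\<dots> = e / 2" using prob_space by simp
    finally have "dist (LINT x|\<mu> t. F (t, x)) (LINT x|\<mu> t. F (s, x)) \<le> e / 2" by (simp add: dist_real_def)
    moreover have "dist (LINT x|\<mu> t. F (s, x)) (LINT x|\<mu> s. F (s, x)) < e / 2" using d' t dt by simp
    ultimately show "dist (LINT x|\<mu> t. F (t, x)) (LINT x|\<mu> s. F (s, x)) < e"
      using dist_triangle[of "LINT x|\<mu> t. F (t, x)" "LINT x|\<mu> s. F (s, x)" "LINT x|\<mu> t. F (s, x)"] by simp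
  qed
qed

lemma integrable_time_continuous:
  fixes h :: "real \<Rightarrow> real"
  assumes "continuous_on {0..T} h" shows "integrable (time_leb T) h"
proof -
  have "integrable lborel (\<lambda>t. indicator {0..T} t *\<^sub>R h t)" by (rule borel_integrable_compact[OF compact_Icc assms])
  then show ?thesis by (subst integrable_restrict_space) auto
qed

lemma cont_D_add_const: "cont_D T F \<Longrightarrow> cont_D T (\<lambda>z. F z + c)" for F :: "real \<times> (real^'n) \<Rightarrow> real"
  by (auto simp: cont_D_def zperiodic_def intro!: continuous_intros)

lemma integral_curve_measure:
  fixes \<mu> :: "real \<Rightarrow> (real^'n) measure" and F :: "real \<times> (real^'n) \<Rightarrow> real"
  assumes c: "curve T \<mu>" and T: "T \<ge> 0" and F: "cont_D T F"
  shows "(LINT z|curve_measure T \<mu>. F z) = (LINT t|time_leb T. LINT x|\<mu> t. F (t, x))"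
proof -
  have pos: "(LINT z|curve_measure T \<mu>. G z) = (LINT t|time_leb T. LINT x|\<mu> t. G (t, x))"
    if G: "cont_D T G" "\<And>t x. t \<in> {0..T} \<Longrightarrow> 0 \<le> G (t, x)" for G :: "real \<times> (real^'n) \<Rightarrow> real"
  proof -
    have Gi: "integrable (curve_measure T \<mu>) G"
      by (rule integrable_cont_D[OF G(1) finite_curve_measure[OF c T] sets_curve_measure[OF c T]])
    have sp: "space (curve_measure T \<mu>) = spacetime T" using sets_eq_imp_space_eq[OF sets_curve_measure[OF c T]] by simp
    have nn: "0 \<le> (LINT x|\<mu> t. G (t, x))" if "t \<in> {0..T}" for t using G(2) that by (intro Bochner_Integration.integral_nonneg) simp
    have "ennreal (LINT z|curve_measure T \<mu>. G z) = (\<integral>\<^sup>+z. ennreal (G z) \<partial>curve_measure T \<mu>)"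
      using Gi G(2) sp by (subst nn_integral_eq_integral) (auto simp: spacetime_def intro!: AE_I2)
    also have "\<dots> = (\<integral>\<^sup>+t. \<integral>\<^sup>+x. ennreal (G (t, x)) \<partial>\<mu> t \<partial>time_leb T)"
      by (rule nn_integral_curve_measure[OF c]) (use cont_D_measurable(1)[OF G(1)] in simp)
    also have "\<dots> = (\<integral>\<^sup>+t. ennreal (LINT x|\<mu> t. G (t, x)) \<partial>time_leb T)"
    proof (rule nn_integral_cong)
      fix t assume "t \<in> space (time_leb T)"
      then have t: "t \<in> {0..T}" by simp
      show "(\<integral>\<^sup>+x. ennreal (G (t, x)) \<partial>\<mu> t) = ennreal (LINT x|\<mu> t. G (t, x))"
        using integrable_cont_torus[OF cont_D_slice[OF G(1) t] curveD(4,2)[OF c t]] G(2)[OF t]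
        by (intro nn_integral_eq_integral) auto
    qed
    also have "\<dots> = ennreal (LINT t|time_leb T. LINT x|\<mu> t. G (t, x))"
      using integrable_time_continuous[OF continuous_curve_integral[OF c G(1)]] nn
      by (intro nn_integral_eq_integral) (auto intro!: AE_I2)
    finally show ?thesis
      using nn G(2) sp by (subst (asm) ennreal_inj) (auto intro!: Bochner_Integration.integral_nonneg simp: spacetime_def)
  qed
  \<comment> \<open>Adding the bound makes the integrand non-negative, the case settled above; both
    sides grow by \<open>B * T\<close>.\<close>
  obtain B where B: "B > 0" "\<And>t x. t \<in> {0..T} \<Longrightarrow> norm (F (t, x)) \<le> B" using cont_D_bounded[OF F] by metis
  have "0 \<le> F (t, x) + B" if "t \<in> {0..T}" for t x using B(2)[OF that, of x] by simp
  from pos[OF cont_D_add_const[OF F] this]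
  have 1: "(LINT z|curve_measure T \<mu>. F z + B) = (LINT t|time_leb T. LINT x|\<mu> t. F (t, x) + B)" .
  interpret M: finite_measure "curve_measure T \<mu>" by (rule finite_curve_measure[OF c T])
  have Fi: "integrable (curve_measure T \<mu>) F"
    by (rule integrable_cont_D[OF F finite_curve_measure[OF c T] sets_curve_measure[OF c T]])
  have "measure (curve_measure T \<mu>) (space (curve_measure T \<mu>)) = T"
    using emeasure_curve_measure_space[OF c T] sets_eq_imp_space_eq[OF sets_curve_measure[OF c T]] T by (simp add: measure_def)
  then have "(LINT z|curve_measure T \<mu>. F z + B) = (LINT z|curve_measure T \<mu>. F z) + B * T"
    using Fi by simp
  moreover have "(LINT t|time_leb T. LINT x|\<mu> t. F (t, x) + B) = (LINT t|time_leb T. (LINT x|\<mu> t. F (t, x)) + B)"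
  proof (rule Bochner_Integration.integral_cong[OF refl])
    fix t assume "t \<in> space (time_leb T)"
    then have t: "t \<in> {0..T}" by simp
    interpret P: prob_space "\<mu> t" by (rule curveD(1)[OF c t])
    show "(LINT x|\<mu> t. F (t, x) + B) = (LINT x|\<mu> t. F (t, x)) + B"
      using integrable_cont_torus[OF cont_D_slice[OF F t] curveD(4,2)[OF c t]] P.prob_space by simp
  qed
  moreover have "(LINT t|time_leb T. (LINT x|\<mu> t. F (t, x)) + B) = (LINT t|time_leb T. LINT x|\<mu> t. F (t, x)) + B * T"
  proof -
    have "measure (time_leb T) {0..T} = T" using T by (simp add: measure_restrict_space)
    moreover have "integrable (time_leb T) (\<lambda>_. B)" by (rule finite_measure.integrable_const[OF finite_measure_time_leb])
    ultimately show ?thesis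
      using integrable_time_continuous[OF continuous_curve_integral[OF c F]]
      by (subst Bochner_Integration.integral_add) auto
  qed
  ultimately show ?thesis using 1 by simp
qed

text \<open>Multiplied by time cutoffs, \<open>\<Psi>\<close> becomes a test function. In the limit
  the derivative of the cutoff yields the difference of end values, which are well defined because
  the curve is weakly continuous.\<close>

lemma continuity_boundary:
  fixes \<mu> :: "real \<Rightarrow> (real^'n) measure" and v :: "real \<times> (real^'n) \<Rightarrow> real^'n"
  assumes c: "curve T \<mu>" and T: "T > 0" and v: "integrable (curve_measure T \<mu>) v"
    and eq: "\<And>\<eta>. test_fun T \<eta> \<Longrightarrow> (LINT z|curve_measure T \<mu>. d_t \<eta> z + v z \<bullet> grad_x \<eta> z) = 0"
    and \<Psi>: "smooth_periodic \<Psi>"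
  shows "(LINT z|curve_measure T \<mu>. d_t \<Psi> z + v z \<bullet> grad_x \<Psi> z) = (LINT x|\<mu> T. \<Psi> (T, x)) - (LINT x|\<mu> 0. \<Psi> (0, x))"
proof -
  let ?M = "curve_measure T \<mu>"
  have T': "T \<ge> 0" using T by simp
  note fin = finite_curve_measure[OF c T'] and sets = sets_curve_measure[OF c T']
  obtain \<zeta> where \<zeta>: "\<And>n. smooth (\<zeta> n)" "\<And>n t. 0 \<le> \<zeta> n t" "\<And>n t. \<zeta> n t \<le> 1" "\<And>n. supp_in T (\<zeta> n)"
    "\<And>t. (\<lambda>n. \<zeta> n t) \<longlonglongrightarrow> indicator {0<..<T} t"
    "\<And>h :: real \<Rightarrow> real. continuous_on {0..T} h \<Longrightarrow> (\<lambda>n. LINT t|time_leb T. deriv (\<zeta> n) t * h t) \<longlonglongrightarrow> h 0 - h T"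
    by (rule time_cutoffs[OF T]) (rule that)
  define h where "h t = (LINT x|\<mu> t. \<Psi> (t, x))" for t
  define G where "G z = d_t \<Psi> z + v z \<bullet> grad_x \<Psi> z" for z
  have sm: "smooth \<Psi>" by (rule smooth_periodicD(1)[OF \<Psi>])
  have Gi: "integrable ?M G"
    unfolding G_def
    using integrable_cont_D[OF cont_D_smooth_periodic[OF smooth_periodic_d_t[OF \<Psi>]] fin sets]
      integral_dot_density(2)[OF v sets _ fin cont_D_grad[OF \<Psi>], of "\<lambda>A. LINT z:A|?M. v z"] by auto
  have sz: "smooth_periodic (\<lambda>z. deriv (\<zeta> n) (fst z) * \<Psi> z)" "smooth_periodic (\<lambda>z :: real \<times> (real^'n). \<zeta> n (fst z))" for n
    by (intro smooth_periodic_mult smooth_periodic_fst smooth_real_deriv \<zeta> \<Psi>)+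
  have zm: "(\<lambda>z. \<zeta> n (fst z)) \<in> borel_measurable ?M" for n
    using integrable_cont_D[OF cont_D_smooth_periodic[OF sz(2)] fin sets] by auto
  have zGi: "integrable ?M (\<lambda>z. \<zeta> n (fst z) * G z)" for n
    by (rule Bochner_Integration.integrable_bound[OF Gi])
       (use Gi zm \<zeta>(2,3) in \<open>auto simp: abs_mult intro!: AE_I2 mult_left_le_one_le\<close>)
  have 1: "(LINT t|time_leb T. deriv (\<zeta> n) t * h t) + (LINT z|?M. \<zeta> n (fst z) * G z) = 0" for n
  proof -
    have "0 = (LINT z|?M. d_t (\<lambda>z. \<zeta> n (fst z) * \<Psi> z) z + v z \<bullet> grad_x (\<lambda>z. \<zeta> n (fst z) * \<Psi> z) z)"
      by (rule eq[symmetric]) (intro test_fun_cutoff \<zeta> \<Psi>)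
    also have "\<dots> = (LINT z|?M. deriv (\<zeta> n) (fst z) * \<Psi> z + \<zeta> n (fst z) * G z)"
      using \<zeta>(1)[of n] sm
      by (simp add: d_t_mult grad_x_mult smooth_fst d_t_fst grad_x_fst G_def algebra_simps)
    also have "\<dots> = (LINT z|?M. deriv (\<zeta> n) (fst z) * \<Psi> z) + (LINT z|?M. \<zeta> n (fst z) * G z)"
      by (rule Bochner_Integration.integral_add[OF integrable_cont_D[OF cont_D_smooth_periodic[OF sz(1)] fin sets] zGi])
    also have "(LINT z|?M. deriv (\<zeta> n) (fst z) * \<Psi> z) = (LINT t|time_leb T. deriv (\<zeta> n) t * h t)"
      by (simp add: integral_curve_measure[OF c T' cont_D_smooth_periodic[OF sz(1)]] h_def)
    finally show ?thesis by simp
  qed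
  have "(\<lambda>n. LINT z|?M. \<zeta> n (fst z) * G z) \<longlonglongrightarrow> (LINT z|?M. G z)"
  proof (rule integral_dominated_convergence[where w="\<lambda>z. \<bar>G z\<bar>"])
    show "AE z in ?M. (\<lambda>n. \<zeta> n (fst z) * G z) \<longlonglongrightarrow> G z"
      using curve_measure_ends[OF c T]
    proof eventually_elim
      case (elim z)
      then have "(\<lambda>n. \<zeta> n (fst z) * G z) \<longlonglongrightarrow> 1 * G z"
        using \<zeta>(5)[of "fst z"] by (intro tendsto_mult tendsto_const) simp
      then show ?case by simp
    qed
    show "AE z in ?M. norm (\<zeta> n (fst z) * G z) \<le> \<bar>G z\<bar>" for n
      using \<zeta>(2,3) by (intro AE_I2) (auto simp: abs_mult intro!: mult_left_le_one_le)
  qed (use Gi zGi in auto)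
  moreover have "(\<lambda>n. LINT t|time_leb T. deriv (\<zeta> n) t * h t) \<longlonglongrightarrow> h 0 - h T"
    by (rule \<zeta>(6)) (unfold h_def, rule continuous_curve_integral[OF c cont_D_smooth_periodic[OF \<Psi>]])
  ultimately have "(\<lambda>n. 0 :: real) \<longlonglongrightarrow> (h 0 - h T) + (LINT z|?M. G z)"
    using tendsto_add[of "\<lambda>n. LINT t|time_leb T. deriv (\<zeta> n) t * h t" _ _ "\<lambda>n. LINT z|?M. \<zeta> n (fst z) * G z"] 1 by simp
  then have "(h 0 - h T) + (LINT z|?M. G z) = 0" by (simp add: LIMSEQ_const_iff)
  then show ?thesis by (simp add: G_def h_def)
qed

subsection \<open>The curve carried by a solution of the continuity equation\<close>

lemma integrable_in_Linf_L1:
  fixes r :: "real \<times> (real^'n) \<Rightarrow> real"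
  assumes r: "in_Linf_L1 T r"
  shows "integrable (D_leb T) r"
proof -
  have m [measurable]: "r \<in> borel_measurable (D_leb T)" using r by (simp add: in_Linf_L1_def)
  obtain C where C: "AE t in time_leb T. integrable torus_leb (\<lambda>x. r (t, x)) \<and> (LINT x|torus_leb. \<bar>r (t, x)\<bar>) \<le> C"
    using r by (auto simp: in_Linf_L1_def)
  have "(\<integral>\<^sup>+z. ennreal (norm (r z)) \<partial>D_leb T) = (\<integral>\<^sup>+t. \<integral>\<^sup>+x. ennreal (norm (r (t, x))) \<partial>torus_leb \<partial>time_leb T)"
    by (rule nn_integral_D_leb) measurable
  also have "\<dots> \<le> (\<integral>\<^sup>+t. ennreal C \<partial>time_leb T)"
  proof (rule nn_integral_mono_AE)
    show "AE t in time_leb T. (\<integral>\<^sup>+x. ennreal (norm (r (t, x))) \<partial>torus_leb) \<le> ennreal C"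
      using C
    proof eventually_elim
      case (elim t)
      then have "(\<integral>\<^sup>+x. ennreal (norm (r (t, x))) \<partial>torus_leb) = ennreal (LINT x|torus_leb. \<bar>r (t, x)\<bar>)"
        by (subst nn_integral_eq_integral) auto
      then show ?case using elim by (simp add: ennreal_leI)
    qed
  qed
  also have "\<dots> < \<infinity>"
    using finite_measure.emeasure_finite[OF finite_measure_time_leb, of T]
    by (simp add: ennreal_mult_less_top less_top[symmetric] ennreal_mult_eq_top_iff)
  finally show ?thesis using m by (intro integrableI_bounded) auto
qed

lemma integral_density_D:
  fixes r g :: "real \<times> (real^'n) \<Rightarrow> real"
  assumes "r \<in> borel_measurable (D_leb T)" "AE z in D_leb T. 0 \<le> r z" "g \<in> borel_measurable (D_leb T)"
  shows "(LINT z|density (D_leb T) (\<lambda>z. ennreal (r z)). g z) = (LINT z|D_leb T. r z * g z)"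
    and "integrable (density (D_leb T) (\<lambda>z. ennreal (r z))) g \<longleftrightarrow> integrable (D_leb T) (\<lambda>z. r z * g z)"
  using integral_density[OF assms(3,1,2)] integrable_density[OF assms(3,1,2)] by simp_all

lemma finite_density_D:
  fixes r :: "real \<times> (real^'n) \<Rightarrow> real"
  assumes "integrable (D_leb T) r"
  shows "finite_measure (density (D_leb T) (\<lambda>z. ennreal (r z)))"
proof (rule finite_measureI)
  have [measurable]: "r \<in> borel_measurable (D_leb T)" using assms by auto
  have "emeasure (density (D_leb T) (\<lambda>z. ennreal (r z))) (spacetime T) = (\<integral>\<^sup>+z. ennreal (r z) \<partial>D_leb T)"
    using sets.top[of "D_leb T :: (real \<times> (real^'n)) measure"]
    by (subst emeasure_density) (auto intro!: nn_integral_cong)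
  also have "\<dots> \<le> (\<integral>\<^sup>+z. ennreal (norm (r z)) \<partial>D_leb T)" by (intro nn_integral_mono ennreal_leI) simp
  also have "\<dots> < \<infinity>" using assms by (simp add: integrable_iff_bounded)
  finally show "emeasure (density (D_leb T) (\<lambda>z. ennreal (r z))) (space (density (D_leb T) (\<lambda>z. ennreal (r z)))) \<noteq> \<infinity>"
    by simp
qed

text \<open>A density is known only at almost every time, so its value at \<open>t\<close> is
  recovered from averages over shrinking windows. The windows open to the right and are scaled by
  \<open>T - t\<close> to stay within \<open>[0,T]\<close>.\<close>

lemma averages_tendsto:
  fixes h :: "real \<Rightarrow> real"
  assumes h: "continuous_on {0..T} h" and t: "0 \<le> t" "t < T"
  defines "d \<equiv> \<lambda>k::nat. (T - t) / real (Suc k)"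
  shows "(\<lambda>k. LINT s|time_leb T. indicator {t..t + d k} s / d k * h s) \<longlonglongrightarrow> h t"
proof (rule tendstoI)
  fix e :: real assume e: "e > 0"
  have d: "d k > 0" "t + d k \<le> T" for k
  proof -
    show "d k > 0" using t by (simp add: d_def)
    have "d k \<le> (T - t) / 1" unfolding d_def using t by (intro divide_left_mono) auto
    then show "t + d k \<le> T" by simp
  qed
  have dlim: "d \<longlonglongrightarrow> 0"
  proof -
    have "(\<lambda>k. (T - t) * (1 / real (Suc k))) \<longlonglongrightarrow> (T - t) * 0"
      using LIMSEQ_inverse_real_of_nat by (intro tendsto_mult tendsto_const) (simp add: inverse_eq_divide)
    then show ?thesis by (simp add: d_def)
  qed
  obtain a where a: "a > 0" "\<And>s. s \<in> {0..T} \<Longrightarrow> dist s t < a \<Longrightarrow> dist (h s) (h t) < e / 2"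
    using h e t unfolding continuous_on_iff by (metis atLeastAtMost_iff half_gt_zero less_imp_le)
  have ind: "(LINT s|time_leb T. indicator {t..t + d k} s / d k) = 1" for k
  proof -
    have "(LINT s|time_leb T. indicator {t..t + d k} s / d k) = measure (time_leb T) ({t..t + d k} \<inter> {0..T}) / d k"
      by simp
    also have "{t..t + d k} \<inter> {0..T} = {t..t + d k}" using t d(2)[of k] by auto
    also have "measure (time_leb T) {t..t + d k} = d k"
      using t d[of k] by (subst measure_restrict_space) auto
    finally show ?thesis using d(1)[of k] by simp
  qed
  have i0: "integrable (time_leb T) (\<lambda>s. indicator {t..t + d k} s / d k * g s)" if g: "continuous_on {0..T} g" for g :: "real \<Rightarrow> real" and k
  proof -
    have "integrable (time_leb T) (\<lambda>s. indicator ({t..t + d k} \<inter> {0..T}) s *\<^sub>R g s)"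
      by (intro integrable_mult_indicator integrable_time_continuous g) (auto simp: sets_restrict_space_iff)
    then have "integrable (time_leb T) (\<lambda>s. (1 / d k) * (indicator ({t..t + d k} \<inter> {0..T}) s *\<^sub>R g s))" by auto
    then show ?thesis
      by (rule Bochner_Integration.integrable_cong[THEN iffD1, rotated -1]) (auto simp: indicator_def)
  qed
  from order_tendstoD(2)[OF dlim a(1)]
  show "\<forall>\<^sub>F k in sequentially. dist (LINT s|time_leb T. indicator {t..t + d k} s / d k * h s) (h t) < e"
  proof eventually_elim
    case (elim k)
    have ih: "integrable (time_leb T) (\<lambda>s. indicator {t..t + d k} s / d k * h s)" by (rule i0[OF h])
    have ic: "integrable (time_leb T) (\<lambda>s. indicator {t..t + d k} s / d k * c)" for c by (rule i0) simp
    have "\<bar>(LINT s|time_leb T. indicator {t..t + d k} s / d k * h s) - h t\<bar>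
       = \<bar>LINT s|time_leb T. indicator {t..t + d k} s / d k * h s - indicator {t..t + d k} s / d k * h t\<bar>"
      using ih ic ind[of k] by (subst Bochner_Integration.integral_diff) auto
    also have "\<dots> \<le> (LINT s|time_leb T. \<bar>indicator {t..t + d k} s / d k * h s - indicator {t..t + d k} s / d k * h t\<bar>)"
      by (rule integral_abs_bound)
    also have "\<dots> \<le> (LINT s|time_leb T. indicator {t..t + d k} s / d k * (e / 2))"
    proof (rule integral_mono)
      fix s assume s: "s \<in> space (time_leb T)"
      show "\<bar>indicator {t..t + d k} s / d k * h s - indicator {t..t + d k} s / d k * h t\<bar> \<le> indicator {t..t + d k} s / d k * (e / 2)"
      proof (cases "s \<in> {t..t + d k}")
        case True
        then have "dist s t < a" using elim by (simp add: dist_real_def)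
        then have "\<bar>h s - h t\<bar> \<le> e / 2" using a(2)[of s] s by (simp add: dist_real_def less_imp_le)
        moreover have "\<bar>indicator {t..t + d k} s / d k * h s - indicator {t..t + d k} s / d k * h t\<bar> = \<bar>h s - h t\<bar> / d k"
          using True d(1)[of k] by (simp flip: diff_divide_distrib)
        moreover have "\<bar>h s - h t\<bar> / d k \<le> e / 2 / d k"
          using calculation(1) d(1)[of k] by (intro divide_right_mono) auto
        ultimately show ?thesis using True d(1)[of k] by (simp add: mult.commute)
      qed simp
    next
      show "integrable (time_leb T) (\<lambda>s. indicator {t..t + d k} s / d k * (e / 2))" by (rule ic)
      show "integrable (time_leb T) (\<lambda>s. \<bar>indicator {t..t + d k} s / d k * h s - indicator {t..t + d k} s / d k * h t\<bar>)"
        by (intro integrable_abs Bochner_Integration.integrable_diff ih ic)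
    qed
    also have "\<dots> = (LINT s|time_leb T. indicator {t..t + d k} s / d k) * (e / 2)" by (rule integral_mult_left_zero)
    also have "\<dots> = e / 2" using ind[of k] by simp
    finally show ?case using e by (simp add: dist_real_def)
  qed
qed

text \<open>Traces are given for one smooth function at a time. Measures realising all these values
  at a fixed time are obtained as weak limits of forward time averages of \<open>r\<close>.\<close>

lemma density_curve:
  fixes r :: "real \<times> (real^'n) \<Rightarrow> real" and v :: "real \<times> (real^'n) \<Rightarrow> real^'n"
  assumes T: "T > 0" and r: "in_Linf_L1 T r" and nn: "AE z in D_leb T. 0 \<le> r z"
    and cont: "weak_continuity T r v" and tr: "has_traces T r \<rho>0 \<rho>T"
    and p0: "prob_space \<rho>0" "sets \<rho>0 = sets torus_borel" and pT: "prob_space \<rho>T" "sets \<rho>T = sets torus_borel"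
  obtains \<mu> where "curve T \<mu>" "curve_measure T \<mu> = density (D_leb T) (\<lambda>z. ennreal (r z))" "\<mu> 0 = \<rho>0" "\<mu> T = \<rho>T"
proof -
  let ?R = "density (D_leb T) (\<lambda>z. ennreal (r z))"
  have T': "T \<ge> 0" using T by simp
  have ri: "integrable (D_leb T) r" by (rule integrable_in_Linf_L1[OF r])
  have rm [measurable]: "r \<in> borel_measurable (D_leb T)" using ri by auto
  \<comment> \<open>The continuous version of the integral of \<open>r\<close> against
    \<open>\<theta>\<close>. Its exceptional null set depends on \<open>\<theta>\<close>, so the
    slice \<open>r (t, _)\<close> itself cannot serve as the measure at time
    \<open>t\<close>.\<close>
  define H where "H \<theta> = (SOME h. continuous_on {0..T} h \<and>
        (AE t in time_leb T. (LINT x|torus_leb. r (t, x) * \<theta> x) = h t) \<and>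
        h 0 = (LINT x|\<rho>0. \<theta> x) \<and> h T = (LINT x|\<rho>T. \<theta> x))" for \<theta> :: "real^'n \<Rightarrow> real"
  have H: "continuous_on {0..T} (H \<theta>)" "AE t in time_leb T. (LINT x|torus_leb. r (t, x) * \<theta> x) = H \<theta> t"
    "H \<theta> 0 = (LINT x|\<rho>0. \<theta> x)" "H \<theta> T = (LINT x|\<rho>T. \<theta> x)" if "smooth \<theta>" "zperiodic \<theta>" for \<theta>
  proof -
    have "\<exists>h. continuous_on {0..T} h \<and> (AE t in time_leb T. (LINT x|torus_leb. r (t, x) * \<theta> x) = h t) \<and>
        h 0 = (LINT x|\<rho>0. \<theta> x) \<and> h T = (LINT x|\<rho>T. \<theta> x)"
      using tr that unfolding has_traces_def by blast
    from someI_ex[OF this] show "continuous_on {0..T} (H \<theta>)" "AE t in time_leb T. (LINT x|torus_leb. r (t, x) * \<theta> x) = H \<theta> t"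
      "H \<theta> 0 = (LINT x|\<rho>0. \<theta> x)" "H \<theta> T = (LINT x|\<rho>T. \<theta> x)" unfolding H_def by blast+
  qed
  have rg: "integrable (D_leb T) (\<lambda>z. r z * g z)" if "g \<in> borel_measurable (D_leb T)" "\<And>z. z \<in> spacetime T \<Longrightarrow> \<bar>g z\<bar> \<le> B" for g B
  proof (rule Bochner_Integration.integrable_bound[where f="\<lambda>z. B * r z"])
    show "AE z in D_leb T. norm (r z * g z) \<le> norm (B * r z)"
    proof (rule AE_I2)
      fix z assume "z \<in> space (D_leb T :: (real \<times> (real^'n)) measure)"
      then have "z \<in> spacetime T" by simp
      then have "\<bar>g z\<bar> \<le> \<bar>B\<bar>" using that(2)[of z] by linarith
      from mult_left_mono[OF this, of "\<bar>r z\<bar>"] show "norm (r z * g z) \<le> norm (B * r z)" by (simp add: abs_mult mult.commute)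
    qed
  qed (use ri that in auto)
  have product: "(LINT z|D_leb T. r z * (g (fst z) * \<theta> (snd z))) = (LINT t|time_leb T. g t * H \<theta> t)"
    if g: "g \<in> borel_measurable borel" "\<And>t. \<bar>g t\<bar> \<le> B" and \<theta>: "smooth \<theta>" "zperiodic \<theta>" for g :: "real \<Rightarrow> real" and \<theta> B
  proof -
    obtain B' where B': "B' > 0" "\<And>x. \<bar>\<theta> x\<bar> \<le> B'" using cont_torus_bounded[OF cont_torus_smooth[OF \<theta>]] by metis
    have m1: "(\<lambda>z::real \<times> (real^'n). g (fst z)) \<in> borel_measurable borel"
      by (rule measurable_compose[OF _ g(1)]) (auto intro!: borel_measurable_continuous_onI continuous_intros)
    have m2: "(\<lambda>z::real \<times> (real^'n). \<theta> (snd z)) \<in> borel_measurable borel"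
      by (rule measurable_compose[OF _ cont_torus_measurable[OF cont_torus_smooth[OF \<theta>]]])
         (auto intro!: borel_measurable_continuous_onI continuous_intros)
    have i: "integrable (D_leb T) (\<lambda>z. r z * (g (fst z) * \<theta> (snd z)))"
    proof (rule rg)
      show "(\<lambda>z. g (fst z) * \<theta> (snd z)) \<in> borel_measurable (D_leb T)"
        using m1 m2 by (intro restrict_borel_measurable borel_measurable_times)
      have "0 \<le> B" using g(2)[of 0] by linarith
      then show "\<bar>g (fst z) * \<theta> (snd z)\<bar> \<le> B * B'" for z :: "real \<times> (real^'n)"
        unfolding abs_mult by (intro mult_mono g(2) B'(2)) auto
    qed
    have "(LINT z|D_leb T. r z * (g (fst z) * \<theta> (snd z))) = (LINT t|time_leb T. LINT x|torus_leb. r (t, x) * (g t * \<theta> x))"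
      by (simp add: integral_D_leb(1)[OF i])
    also have "\<dots> = (LINT t|time_leb T. g t * H \<theta> t)"
    proof (rule Bochner_Integration.integral_cong_AE)
      show "(\<lambda>t. LINT x|torus_leb. r (t, x) * (g t * \<theta> x)) \<in> borel_measurable (time_leb T)"
        using integral_D_leb(3)[OF i] by auto
      have "H \<theta> \<in> borel_measurable (time_leb T)" using integrable_time_continuous[OF H(1)[OF \<theta>]] by auto
      then show "(\<lambda>t. g t * H \<theta> t) \<in> borel_measurable (time_leb T)"
        using restrict_borel_measurable(2)[OF g(1)] by measurable
      show "AE t in time_leb T. (LINT x|torus_leb. r (t, x) * (g t * \<theta> x)) = g t * H \<theta> t"
        using H(2)[OF \<theta>]
      proof eventually_elim
        case (elim t)
        have "(LINT x|torus_leb. r (t, x) * (g t * \<theta> x)) = (LINT x|torus_leb. g t * (r (t, x) * \<theta> x))"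
          by (simp add: mult_ac)
        then show ?case using elim by simp
      qed
    qed
    finally show ?thesis .
  qed
  have one: "smooth (\<lambda>_::real^'n. 1 :: real)" "zperiodic (\<lambda>_::real^'n. 1 :: real)" by (simp_all add: smooth_const zperiodic_def)
  \<comment> \<open>The continuity equation tested with functions of time alone says that the total
    mass has zero derivative; letting cutoffs fill \<open>[0,t]\<close> yields equality with the
    mass of \<open>\<rho>0\<close>.\<close>
  have mass: "H (\<lambda>_. 1) t = 1" if t: "t \<in> {0..T}" for t
  proof -
    have H0: "H (\<lambda>_. 1) 0 = 1" using H(3)[OF one] prob_space.prob_space[OF p0(1)] by simp
    show ?thesis
    proof (cases "t = 0")
      case False
      then have t0: "0 < t" "t \<le> T" using t by auto
      obtain \<zeta> :: "nat \<Rightarrow> real \<Rightarrow> real" where \<zeta>: "\<And>n. smooth (\<zeta> n)"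
        "\<And>n. \<exists>a' b'. 0 < a' \<and> a' < b' \<and> b' < t \<and> (\<forall>s. s \<notin> {a'..b'} \<longrightarrow> \<zeta> n s = 0)"
        "\<And>h :: real \<Rightarrow> real. continuous_on {0..t} h \<Longrightarrow> (\<lambda>n. LINT s|time_leb T. deriv (\<zeta> n) s * h s) \<longlonglongrightarrow> h 0 - h t"
      proof (rule cutoff_exists[of 0 t T])
        fix \<zeta> :: "nat \<Rightarrow> real \<Rightarrow> real"
        assume z: "\<And>n. smooth (\<zeta> n)" "\<And>n t. 0 \<le> \<zeta> n t" "\<And>n t. \<zeta> n t \<le> 1"
          "\<And>n. \<exists>a' b'. 0 < a' \<and> a' < b' \<and> b' < t \<and> (\<forall>s. s \<notin> {a'..b'} \<longrightarrow> \<zeta> n s = 0)"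
          "\<And>s. (\<lambda>n. \<zeta> n s) \<longlonglongrightarrow> indicator {0<..<t} s"
          "\<And>h :: real \<Rightarrow> real. continuous_on {0..t} h \<Longrightarrow> (\<lambda>n. LINT s|time_leb T. deriv (\<zeta> n) s * h s) \<longlonglongrightarrow> h 0 - h t"
        show thesis by (rule that[OF z(1) z(4) z(6)])
      qed (use t0 in auto)
      have supp: "supp_in T (\<zeta> n)" for n
        using \<zeta>(2)[of n] t0 unfolding supp_in_def by (meson order_less_le_trans)
      have "(LINT s|time_leb T. deriv (\<zeta> n) s * H (\<lambda>_. 1) s) = 0" for n
      proof -
        have tf: "test_fun T (\<lambda>z::real \<times> (real^'n). \<zeta> n (fst z))"
          using test_fun_product[OF \<zeta>(1) supp one] by simp
        have cd: "continuous_on UNIV (deriv (\<zeta> n))" by (intro smooth_continuous smooth_real_deriv \<zeta>)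
        have dz: "deriv (\<zeta> n) s = 0" if "s \<notin> {0..T}" for s
        proof -
          obtain a b where ab: "0 < a" "b < T" "\<And>s. s \<notin> {a..b} \<Longrightarrow> \<zeta> n s = 0" using supp[of n] unfolding supp_in_def by blast
          have "open (- {a..b})" by auto
          moreover have "s \<in> - {a..b}" using that ab by auto
          ultimately have "(\<zeta> n has_real_derivative 0) (at s)"
            using has_field_derivative_transform_within_open[OF DERIV_const, of "- {a..b}" s 0 "\<zeta> n"] ab(3) by simp
          then show ?thesis by (rule DERIV_imp_deriv)
        qed
        obtain B where B: "\<And>s. s \<in> {0..T} \<Longrightarrow> \<bar>deriv (\<zeta> n) s\<bar> \<le> B"
        proof -
          have "bounded (deriv (\<zeta> n) ` {0..T})"
            by (intro compact_imp_bounded compact_continuous_image compact_Icc continuous_on_subset[OF cd]) auto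
          then obtain B where "\<forall>y\<in>deriv (\<zeta> n) ` {0..T}. norm y \<le> B" unfolding bounded_iff by blast
          then show ?thesis by (intro that[of B]) simp
        qed
        have "\<bar>deriv (\<zeta> n) s\<bar> \<le> max B 0" for s using B[of s] dz[of s] by (cases "s \<in> {0..T}") auto
        from product[OF borel_measurable_continuous_onI[OF cd] this one]
        have "(LINT s|time_leb T. deriv (\<zeta> n) s * H (\<lambda>_. 1) s) = (LINT z|D_leb T. r z * deriv (\<zeta> n) (fst z))" by simp
        also have "\<dots> = (LINT z|D_leb T. r z * (d_t (\<lambda>z. \<zeta> n (fst z)) z + v z \<bullet> grad_x (\<lambda>z. \<zeta> n (fst z)) z))"
          by (simp add: d_t_fst[OF \<zeta>(1)] grad_x_fst[OF \<zeta>(1)])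
        also have "\<dots> = 0" using cont tf unfolding weak_continuity_def by blast
        finally show ?thesis .
      qed
      moreover have "(\<lambda>n. LINT s|time_leb T. deriv (\<zeta> n) s * H (\<lambda>_. 1) s) \<longlonglongrightarrow> H (\<lambda>_. 1) 0 - H (\<lambda>_. 1) t"
        using H(1)[OF one] t0 by (intro \<zeta>(3)) (auto intro: continuous_on_subset)
      ultimately have "H (\<lambda>_. 1) 0 - H (\<lambda>_. 1) t = 0" by (simp add: LIMSEQ_const_iff)
      then show ?thesis using H0 by simp
    qed (use H0 in simp)
  qed
  \<comment> \<open>The last two clauses fix the end measures literally as the data; this is
    consistent because \<open>H\<close> takes the prescribed values there.\<close>
  define Q where "Q t \<nu> \<longleftrightarrow> prob_space \<nu> \<and> sets \<nu> = sets torus_borel \<and> (\<forall>\<theta>. smooth \<theta> \<and> zperiodic \<theta> \<longrightarrow> (LINT x|\<nu>. \<theta> x) = H \<theta> t)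
      \<and> (t = 0 \<longrightarrow> \<nu> = \<rho>0) \<and> (t = T \<longrightarrow> \<nu> = \<rho>T)" for t and \<nu> :: "(real^'n) measure"
  have "\<exists>\<nu>. Q t \<nu>" if t: "t \<in> {0..T}" for t
  proof -
    consider "t = 0" | "t = T" | "0 < t" "t < T" using t by fastforce
    then show ?thesis
    proof cases
      case 1 then show ?thesis using p0 H(3) T by (intro exI[of _ \<rho>0]) (auto simp: Q_def)
    next
      case 2 then show ?thesis using pT H(4) T by (intro exI[of _ \<rho>T]) (auto simp: Q_def)
    next
      case 3
      define d where "d k = (T - t) / real (Suc k)" for k
      have d: "d k > 0" for k using 3 by (simp add: d_def)
      \<comment> \<open>The density of the average of \<open>r\<close> over the window
        \<open>[t, t + d k]\<close>. Its space marginal is a probability measure because the mass is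
        constantly 1.\<close>
      define w where "w k z = r z * (indicator {t..t + d k} (fst z) / d k)" for k and z :: "real \<times> (real^'n)"
      have gm: "(\<lambda>s. indicator {t..t + d k} s / d k :: real) \<in> borel_measurable borel" for k by measurable
      have gb: "\<bar>indicator {t..t + d k} s / d k :: real\<bar> \<le> 1 / d k" for k s using d[of k] by (auto simp: indicator_def)
      have gm': "(\<lambda>z::real \<times> (real^'n). indicator {t..t + d k} (fst z) / d k :: real) \<in> borel_measurable (D_leb T)" for k
        by (intro restrict_borel_measurable measurable_compose[OF _ gm] borel_measurable_continuous_onI continuous_intros)
      have wm [measurable]: "w k \<in> borel_measurable (D_leb T)" for k unfolding w_def[abs_def] using gm' by measurable
      have wi: "integrable (D_leb T) (w k)" for k unfolding w_def using gb by (intro rg[OF gm']) auto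
      have wn: "AE z in D_leb T. 0 \<le> w k z" for k using nn
        by eventually_elim (use d[of k] in \<open>auto simp: w_def intro!: mult_nonneg_nonneg\<close>)
      have wint: "(LINT z|D_leb T. w k z * \<theta> (snd z)) = (LINT s|time_leb T. indicator {t..t + d k} s / d k * H \<theta> s)"
        if "smooth \<theta>" "zperiodic \<theta>" for k \<theta>
        using product[OF gm gb that] by (simp add: w_def mult.assoc)
      have wlim: "(\<lambda>k. LINT z|D_leb T. w k z * \<theta> (snd z)) \<longlonglongrightarrow> H \<theta> t" if "smooth \<theta>" "zperiodic \<theta>" for \<theta>
        using averages_tendsto[OF H(1)[OF that], of t] 3 unfolding wint[OF that] d_def by simp
      have sndm: "snd \<in> measurable (D_leb T) (torus_borel :: (real^'n) measure)"
        by (rule measurable_restrict_space2)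
           (auto simp: spacetime_def space_restrict_space intro!: restrict_borel_measurable borel_measurable_continuous_onI continuous_intros)
      define \<nu> where "\<nu> k = distr (density (D_leb T) (\<lambda>z. ennreal (w k z))) torus_borel snd" for k
      have \<nu>int: "(LINT x|\<nu> k. \<theta> x) = (LINT z|D_leb T. w k z * \<theta> (snd z))" if \<theta>: "cont_torus \<theta>" for k \<theta>
      proof -
        have m: "\<theta> \<in> borel_measurable torus_borel" by (intro restrict_borel_measurable cont_torus_measurable \<theta>)
        have "(LINT x|\<nu> k. \<theta> x) = (LINT z|density (D_leb T) (\<lambda>z. ennreal (w k z)). \<theta> (snd z))"
          unfolding \<nu>_def using sndm by (intro integral_distr m) simp
        also have "\<dots> = (LINT z|D_leb T. w k z * \<theta> (snd z))"
          by (rule integral_density_D(1)[OF wm wn measurable_compose[OF sndm m]])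
        finally show ?thesis .
      qed
      have "prob_space (\<nu> k)" for k
      proof -
        have "(LINT z|D_leb T. w k z) = (LINT s|time_leb T. indicator {t..t + d k} s / d k * H (\<lambda>_. 1) s)"
          using wint[OF one] by simp
        also have "\<dots> = (LINT s|time_leb T. indicator {t..t + d k} s / d k)"
          using mass by (intro Bochner_Integration.integral_cong) auto
        also have "\<dots> = 1"
        proof -
          have dk: "t + d k \<le> T"
          proof -
            have "d k \<le> (T - t) / 1" unfolding d_def using 3 by (intro divide_left_mono) auto
            then show ?thesis by simp
          qed
          have "(LINT s|time_leb T. indicator {t..t + d k} s / d k) = measure (time_leb T) ({t..t + d k} \<inter> {0..T}) / d k" by simp
          also have "{t..t + d k} \<inter> {0..T} = {t..t + d k}" using 3 dk by auto
          also have "measure (time_leb T) {t..t + d k} = d k" using 3 d[of k] dk by (subst measure_restrict_space) auto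
          finally show ?thesis using d[of k] by simp
        qed
        finally have w1: "(LINT z|D_leb T. w k z) = 1" .
        have "emeasure (density (D_leb T) (\<lambda>z. ennreal (w k z))) (spacetime T) = (\<integral>\<^sup>+z. ennreal (w k z) \<partial>D_leb T)"
          using sets.top[of "D_leb T :: (real \<times> (real^'n)) measure"]
          by (subst emeasure_density) (auto intro!: nn_integral_cong)
        also have "\<dots> = ennreal 1" using wi wn by (subst nn_integral_eq_integral) (auto simp: w1)
        finally have "prob_space (density (D_leb T) (\<lambda>z. ennreal (w k z)))" by (intro prob_spaceI) simp
        then show ?thesis unfolding \<nu>_def using sndm by (intro prob_space.prob_space_distr) simp_all
      qed
      moreover have "sets (\<nu> k) = sets torus_borel" for k by (simp add: \<nu>_def)
      ultimately obtain m \<nu>' where m: "strict_mono m" and \<nu>': "prob_space \<nu>'" "sets \<nu>' = sets torus_borel"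
        and lim: "\<And>\<eta>. cont_torus \<eta> \<Longrightarrow> (\<lambda>k. LINT x|\<nu> (m k). \<eta> x) \<longlonglongrightarrow> (LINT x|\<nu>'. \<eta> x)"
        by (rule torus_weak_limit[of \<nu>]) (rule that)
      have "(LINT x|\<nu>'. \<theta> x) = H \<theta> t" if \<theta>: "smooth \<theta>" "zperiodic \<theta>" for \<theta>
      proof (rule LIMSEQ_unique)
        show "(\<lambda>k. LINT x|\<nu> (m k). \<theta> x) \<longlonglongrightarrow> (LINT x|\<nu>'. \<theta> x)" by (rule lim[OF cont_torus_smooth[OF \<theta>]])
        show "(\<lambda>k. LINT x|\<nu> (m k). \<theta> x) \<longlonglongrightarrow> H \<theta> t"
          unfolding \<nu>int[OF cont_torus_smooth[OF \<theta>]]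
          using LIMSEQ_subseq_LIMSEQ[OF wlim[OF \<theta>] m] by (simp add: comp_def)
      qed
      then show ?thesis using \<nu>' 3 by (intro exI[of _ \<nu>']) (auto simp: Q_def)
    qed
  qed
  then obtain \<mu> where \<mu>: "\<And>t. t \<in> {0..T} \<Longrightarrow> Q t (\<mu> t)" by metis
  have c: "curve T \<mu>"
    unfolding curve_def
  proof (intro conjI ballI allI impI)
    show "prob_space (\<mu> t)" "sets (\<mu> t) = sets torus_borel" if "t \<in> {0..T}" for t using \<mu>[OF that] by (auto simp: Q_def)
    fix \<theta> :: "real^'n \<Rightarrow> real" assume \<theta>: "cont_torus \<theta>"
    show "continuous_on {0..T} (\<lambda>t. LINT x|\<mu> t. \<theta> x)"
      unfolding continuous_on_iff
    proof (intro ballI allI impI)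
      fix s e :: real assume s: "s \<in> {0..T}" and e: "e > 0"
      \<comment> \<open>Continuity is known for smooth functions through \<open>H\<close>. Since
        every \<open>\<mu> t\<close> has mass one, a uniform approximation costs the same at all
        times.\<close>
      obtain \<eta> where \<eta>: "smooth \<eta>" "zperiodic \<eta>" "\<And>x. \<bar>\<eta> x - \<theta> x\<bar> \<le> e / 4"
        using cont_torus_approx[OF \<theta>, of "e / 4"] e by auto
      have near: "\<bar>(LINT x|\<mu> t. \<theta> x) - H \<eta> t\<bar> \<le> e / 4" if t: "t \<in> {0..T}" for t
      proof -
        have q: "prob_space (\<mu> t)" "sets (\<mu> t) = sets torus_borel" "H \<eta> t = (LINT x|\<mu> t. \<eta> x)"
          using \<mu>[OF t] \<eta> by (auto simp: Q_def)
        interpret prob_space "\<mu> t" by (rule q(1))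
        note i = integrable_cont_torus[OF \<theta> finite_measure_axioms q(2)] integrable_cont_torus[OF cont_torus_smooth[OF \<eta>(1,2)] finite_measure_axioms q(2)]
        have "\<bar>(LINT x|\<mu> t. \<theta> x) - H \<eta> t\<bar> = \<bar>LINT x|\<mu> t. \<theta> x - \<eta> x\<bar>" using i q(3) by simp
        also have "\<dots> \<le> (LINT x|\<mu> t. \<bar>\<theta> x - \<eta> x\<bar>)" by (rule integral_abs_bound)
        also have "\<dots> \<le> (LINT x|\<mu> t. e / 4)" using i \<eta>(3) by (intro integral_mono) (auto simp: abs_minus_commute)
        finally show ?thesis using prob_space by simp
      qed
      obtain a where a: "a > 0" "\<And>t. t \<in> {0..T} \<Longrightarrow> dist t s < a \<Longrightarrow> dist (H \<eta> t) (H \<eta> s) < e / 4"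
        using H(1)[OF \<eta>(1,2)] s e unfolding continuous_on_iff by (metis zero_less_divide_iff zero_less_numeral)
      show "\<exists>d>0. \<forall>t\<in>{0..T}. dist t s < d \<longrightarrow> dist (LINT x|\<mu> t. \<theta> x) (LINT x|\<mu> s. \<theta> x) < e"
      proof (intro exI[of _ a] conjI ballI impI a(1))
        fix t assume t: "t \<in> {0..T}" "dist t s < a"
        have "\<bar>H \<eta> t - H \<eta> s\<bar> < e / 4" using a(2)[OF t] by (simp add: dist_real_def)
        then show "dist (LINT x|\<mu> t. \<theta> x) (LINT x|\<mu> s. \<theta> x) < e"
          using near[OF t(1)] near[OF s] unfolding dist_real_def by linarith
      qed
    qed
  qed
  \<comment> \<open>On a product test function both measures give the time integral of
    \<open>\<zeta> t * H \<theta> t\<close>.\<close>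
  have "curve_measure T \<mu> = ?R"
  proof (rule measure_eq_if_test_integrals_eq[OF T finite_curve_measure[OF c T'] sets_curve_measure[OF c T'] finite_density_D[OF ri]])
    show "sets ?R = sets (D_borel T)" by (simp add: sets_D_leb)
    show "AE z in curve_measure T \<mu>. 0 < fst z \<and> fst z < T" by (rule curve_measure_ends[OF c T])
    show "AE z in ?R. 0 < fst z \<and> fst z < T"
      by (subst AE_density) (use D_leb_ends[OF T] in auto)
    fix \<zeta> :: "real \<Rightarrow> real" and \<theta> :: "real^'n \<Rightarrow> real" assume a: "smooth \<zeta>" "supp_in T \<zeta>" "smooth \<theta>" "zperiodic \<theta>"
    have tf: "test_fun T (\<lambda>z. \<zeta> (fst z) * \<theta> (snd z))" by (rule test_fun_product[OF a])
    have "(LINT z|curve_measure T \<mu>. \<zeta> (fst z) * \<theta> (snd z)) = (LINT t|time_leb T. LINT x|\<mu> t. \<zeta> t * \<theta> x)"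
      by (simp add: integral_curve_measure[OF c T' cont_D_test_fun[OF tf]])
    also have "\<dots> = (LINT t|time_leb T. \<zeta> t * H \<theta> t)"
      using \<mu> a(3,4) by (intro Bochner_Integration.integral_cong) (auto simp: Q_def)
    also have "\<dots> = (LINT z|D_leb T. r z * (\<zeta> (fst z) * \<theta> (snd z)))"
    proof -
      have cz: "continuous_on UNIV \<zeta>" by (rule smooth_continuous[OF a(1)])
      obtain B where B: "B > 0" "\<And>s. \<bar>\<zeta> s\<bar> \<le> B"
      proof -
        obtain p q where pq: "\<And>s. s \<notin> {p..q} \<Longrightarrow> \<zeta> s = 0" using a(2) unfolding supp_in_def by blast
        have "bounded (\<zeta> ` {p..q})"
          by (intro compact_imp_bounded compact_continuous_image compact_Icc continuous_on_subset[OF cz]) auto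
        then obtain B where B: "B > 0" "\<And>s. s \<in> {p..q} \<Longrightarrow> \<bar>\<zeta> s\<bar> \<le> B" unfolding bounded_pos by auto
        have "\<bar>\<zeta> s\<bar> \<le> B" for s using B pq[of s] by (cases "s \<in> {p..q}") auto
        with B(1) show ?thesis by (rule that)
      qed
      show ?thesis by (rule product[OF borel_measurable_continuous_onI[OF cz] B(2) a(3,4), symmetric])
    qed
    also have "\<dots> = (LINT z|?R. \<zeta> (fst z) * \<theta> (snd z))"
      by (rule integral_density_D(1)[OF rm nn cont_D_measurable(2)[OF cont_D_test_fun[OF tf]], symmetric])
    finally show "(LINT z|curve_measure T \<mu>. \<zeta> (fst z) * \<theta> (snd z)) = (LINT z|?R. \<zeta> (fst z) * \<theta> (snd z))" .
  qed
  moreover have "\<mu> 0 = \<rho>0" "\<mu> T = \<rho>T" using \<mu>[of 0] \<mu>[of T] T by (auto simp: Q_def)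
  ultimately show ?thesis using c that by blast
qed

subsection \<open>Square integrable fields\<close>

lemma in_L2_integrable: "in_L2 M f \<Longrightarrow> integrable M (\<lambda>z. (norm (f z))\<^sup>2)"
  by (rule integrableI_bounded) (auto simp: in_L2_def)

lemma in_L2_iff: "in_L2 M f \<longleftrightarrow> f \<in> borel_measurable M \<and> integrable M (\<lambda>z. (norm (f z))\<^sup>2)"
  by (auto simp: in_L2_integrable) (auto simp: in_L2_def integrable_iff_bounded)

lemma in_L2_diff:
  assumes "in_L2 M f" "in_L2 M g" shows "in_L2 M (\<lambda>z. f z - g z)"
  unfolding in_L2_iff
proof
  have [measurable]: "f \<in> borel_measurable M" "g \<in> borel_measurable M" using assms by (auto simp: in_L2_def)
  show "(\<lambda>z. f z - g z) \<in> borel_measurable M" by measurable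
  show "integrable M (\<lambda>z. (norm (f z - g z))\<^sup>2)"
  proof (rule Bochner_Integration.integrable_bound[where f="\<lambda>z. 2 * (norm (f z))\<^sup>2 + 2 * (norm (g z))\<^sup>2"])
    show "integrable M (\<lambda>z. 2 * (norm (f z))\<^sup>2 + 2 * (norm (g z))\<^sup>2)" using in_L2_integrable[OF assms(1)] in_L2_integrable[OF assms(2)] by auto
    show "AE z in M. norm ((norm (f z - g z))\<^sup>2) \<le> norm (2 * (norm (f z))\<^sup>2 + 2 * (norm (g z))\<^sup>2)"
    proof (rule AE_I2)
      fix z
      have "(norm (f z - g z))\<^sup>2 \<le> (norm (f z) + norm (g z))\<^sup>2" by (intro power_mono norm_triangle_ineq4) auto
      also have "\<dots> \<le> 2 * (norm (f z))\<^sup>2 + 2 * (norm (g z))\<^sup>2"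
        using sum_squares_bound[of "norm (f z)" "norm (g z)"] by (simp add: power2_sum)
      finally show "norm ((norm (f z - g z))\<^sup>2) \<le> norm (2 * (norm (f z))\<^sup>2 + 2 * (norm (g z))\<^sup>2)" by simp
    qed
  qed measurable
qed

lemma in_L2_inner:
  assumes f: "in_L2 M f" and g: "in_L2 M g" shows "integrable M (\<lambda>z. f z \<bullet> g z)"
proof (rule Bochner_Integration.integrable_bound[where f="\<lambda>z. (norm (f z))\<^sup>2 + (norm (g z))\<^sup>2"])
  have [measurable]: "f \<in> borel_measurable M" "g \<in> borel_measurable M" using assms by (auto simp: in_L2_def)
  show "integrable M (\<lambda>z. (norm (f z))\<^sup>2 + (norm (g z))\<^sup>2)" using in_L2_integrable[OF f] in_L2_integrable[OF g] by auto
  show "(\<lambda>z. f z \<bullet> g z) \<in> borel_measurable M" by measurable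
  show "AE z in M. norm (f z \<bullet> g z) \<le> norm ((norm (f z))\<^sup>2 + (norm (g z))\<^sup>2)"
  proof (rule AE_I2)
    fix z
    have "\<bar>f z \<bullet> g z\<bar> \<le> norm (f z) * norm (g z)" by (rule Cauchy_Schwarz_ineq2)
    also have "\<dots> \<le> (norm (f z))\<^sup>2 + (norm (g z))\<^sup>2"
    proof -
      have "0 \<le> norm (f z) * norm (g z)" by simp
      then show ?thesis using sum_squares_bound[of "norm (f z)" "norm (g z)"] by linarith
    qed
    finally show "norm (f z \<bullet> g z) \<le> norm ((norm (f z))\<^sup>2 + (norm (g z))\<^sup>2)" by simp
  qed
qed

lemma in_L2_bounded:
  assumes "finite_measure M" "f \<in> borel_measurable M" "AE z in M. norm (f z) \<le> C"
  shows "in_L2 M f"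
  unfolding in_L2_iff
proof
  interpret finite_measure M by fact
  have [measurable]: "f \<in> borel_measurable M" by fact
  show "integrable M (\<lambda>z. (norm (f z))\<^sup>2)"
  proof (rule integrable_const_bound[where B="C\<^sup>2"])
    show "AE z in M. norm ((norm (f z))\<^sup>2) \<le> C\<^sup>2"
      using assms(3) by eventually_elim (auto intro: power_mono)
  qed measurable
qed (rule assms)

lemma in_L2_L1:
  fixes f :: "'a \<Rightarrow> 'b::euclidean_space"
  assumes "finite_measure M" "in_L2 M f" shows "integrable M f"
proof (rule Bochner_Integration.integrable_bound[where f="\<lambda>z. 1 + (norm (f z))\<^sup>2"])
  interpret finite_measure M by fact
  show "integrable M (\<lambda>z. 1 + (norm (f z))\<^sup>2)" using in_L2_integrable[OF assms(2)] by auto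
  show "f \<in> borel_measurable M" using assms(2) by (simp add: in_L2_def)
  show "AE z in M. norm (f z) \<le> norm (1 + (norm (f z))\<^sup>2)"
  proof (rule AE_I2)
    fix z
    have "2 * norm (f z) \<le> 1 + (norm (f z))\<^sup>2" using sum_squares_bound[of 1 "norm (f z)"] by simp
    then have "norm (f z) \<le> 1 + (norm (f z))\<^sup>2" using norm_ge_zero[of "f z"] by linarith
    then show "norm (f z) \<le> norm (1 + (norm (f z))\<^sup>2)" by simp
  qed
qed

text \<open>Weighted Young inequality in place of Cauchy-Schwarz: the product is at most
  \<open>|X|^2 / (2 c) + c |w|^2 / 2\<close>, with \<open>c\<close> chosen before
  \<open>k\<close>.\<close>

lemma L2_tendsto_inner:
  fixes X :: "nat \<Rightarrow> 'a \<Rightarrow> 'b::euclidean_space"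
  assumes X: "\<And>k. in_L2 M (X k)" and w: "in_L2 M w" and lim: "(\<lambda>k. LINT z|M. (norm (X k z))\<^sup>2) \<longlonglongrightarrow> 0"
  shows "(\<lambda>k. LINT z|M. X k z \<bullet> w z) \<longlonglongrightarrow> 0"
proof (rule tendstoI)
  fix e :: real assume e: "e > 0"
  define W where "W = (LINT z|M. (norm (w z))\<^sup>2)"
  have W: "W \<ge> 0" unfolding W_def by simp
  \<comment> \<open>Makes the contribution of \<open>w\<close> at most \<open>e / 2\<close>; the
    \<open>+ 1\<close> avoids division by zero.\<close>
  define c where "c = e / (W + 1)"
  have c: "c > 0" using e W by (simp add: c_def add_nonneg_pos)
  have "\<forall>\<^sub>F k in sequentially. (LINT z|M. (norm (X k z))\<^sup>2) < c * e"
    using lim c e by (intro order_tendstoD(2)) auto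
  then show "\<forall>\<^sub>F k in sequentially. dist (LINT z|M. X k z \<bullet> w z) 0 < e"
  proof eventually_elim
    case (elim k)
    note i = in_L2_integrable[OF X[of k]] in_L2_integrable[OF w]
    have "\<bar>LINT z|M. X k z \<bullet> w z\<bar> \<le> (LINT z|M. \<bar>X k z \<bullet> w z\<bar>)" by (rule integral_abs_bound)
    also have "\<dots> \<le> (LINT z|M. (norm (X k z))\<^sup>2 / (2 * c) + c / 2 * (norm (w z))\<^sup>2)"
    proof (rule integral_mono)
      fix z
      have "0 \<le> (norm (X k z) - c * norm (w z))\<^sup>2 / (2 * c)" using c by simp
      also have "\<dots> = (norm (X k z))\<^sup>2 / (2 * c) + c / 2 * (norm (w z))\<^sup>2 - norm (X k z) * norm (w z)"
        using c by (simp add: power2_eq_square field_simps)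
      finally have "norm (X k z) * norm (w z) \<le> (norm (X k z))\<^sup>2 / (2 * c) + c / 2 * (norm (w z))\<^sup>2" by simp
      then show "\<bar>X k z \<bullet> w z\<bar> \<le> (norm (X k z))\<^sup>2 / (2 * c) + c / 2 * (norm (w z))\<^sup>2"
        using Cauchy_Schwarz_ineq2[of "X k z" "w z"] by linarith
    qed (use i in_L2_inner[OF X w] in auto)
    also have "\<dots> = (LINT z|M. (norm (X k z))\<^sup>2) / (2 * c) + c / 2 * W"
      unfolding W_def using i by simp
    also have "\<dots> < e / 2 + e / 2"
    proof (rule add_less_le_mono)
      show "(LINT z|M. (norm (X k z))\<^sup>2) / (2 * c) < e / 2" using elim c by (simp add: field_simps)
      have "c * W \<le> e" using e W by (simp add: c_def field_simps)
      then show "c / 2 * W \<le> e / 2" by simp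
    qed
    finally show ?case by (simp add: dist_real_def)
  qed
qed

text \<open>Riesz-Fischer: a fast subsequence converges almost everywhere since its increments are
  summable, and Fatou transfers the Cauchy estimate to the limit.\<close>

lemma L2_complete:
  fixes G :: "nat \<Rightarrow> 'a \<Rightarrow> 'b::euclidean_space"
  assumes fin: "finite_measure M" and G: "\<And>k. in_L2 M (G k)"
    and cauchy: "\<And>e. e > 0 \<Longrightarrow> \<exists>N. \<forall>m\<ge>N. \<forall>n\<ge>N. (LINT z|M. (norm (G m z - G n z))\<^sup>2) < e"
  obtains g where "in_L2 M g" "(\<lambda>k. LINT z|M. (norm (G k z - g z))\<^sup>2) \<longlonglongrightarrow> 0"
proof -
  interpret finite_measure M by fact
  have Gm [measurable]: "G k \<in> borel_measurable M" for k using G by (simp add: in_L2_def)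
  have I: "integrable M (\<lambda>z. (norm (G m z - G n z))\<^sup>2)" for m n by (intro in_L2_integrable in_L2_diff G)
  have nnI: "(\<integral>\<^sup>+z. ennreal ((norm (G m z - G n z))\<^sup>2) \<partial>M) = ennreal (LINT z|M. (norm (G m z - G n z))\<^sup>2)" for m n
    using I by (intro nn_integral_eq_integral) auto
  have "\<forall>k. \<exists>N. \<forall>m\<ge>N. \<forall>n\<ge>N. (LINT z|M. (norm (G m z - G n z))\<^sup>2) < (1 / 4) ^ k"
    using cauchy by simp
  then obtain N where N: "\<And>k m n. m \<ge> N k \<Longrightarrow> n \<ge> N k \<Longrightarrow> (LINT z|M. (norm (G m z - G n z))\<^sup>2) < (1 / 4) ^ k" by metis
  \<comment> \<open>Dominates both \<open>k\<close> and \<open>N k\<close> and is non-decreasing by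
    construction, so no subsequence has to be chosen recursively.\<close>
  define s where "s k = k + (\<Sum>j\<le>k. N j)" for k
  have sN: "s k \<ge> N k" for k
    using member_le_sum[of k "{..k}" N] by (simp add: s_def)
  have sk: "s k \<ge> k" for k by (simp add: s_def)
  have smono: "s k \<le> s (Suc k)" for k by (simp add: s_def)
  define D where "D k z = norm (G (s (Suc k)) z - G (s k) z)" for k z
  \<comment> \<open>From \<open>2 a <= 2^k a^2 + 2^-k\<close> and squared norms below
    \<open>4^-k\<close>: on a finite measure space the L1 norms of the increments are of order
    \<open>2^-k\<close>.\<close>
  have Dbound: "(\<integral>\<^sup>+z. ennreal (D k z) \<partial>M) \<le> ennreal ((1 / 2) ^ k * (1 + measure M (space M)))" for k
  proof -
    have "(\<integral>\<^sup>+z. ennreal (D k z) \<partial>M) \<le> (\<integral>\<^sup>+z. ennreal (2 ^ k * (norm (G (s (Suc k)) z - G (s k) z))\<^sup>2 + (1 / 2) ^ k) \<partial>M)"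
    proof (intro nn_integral_mono ennreal_leI)
      fix z
      define a where "a = D k z"
      have a: "a \<ge> 0" by (simp add: a_def D_def)
      have "0 \<le> 2 ^ k * (a - (1 / 2) ^ k)\<^sup>2" by simp
      also have "\<dots> = 2 ^ k * a\<^sup>2 - 2 * a * (2 ^ k * (1 / 2) ^ k) + (2 ^ k * (1 / 2) ^ k) * (1 / 2) ^ k"
        by (simp only: power2_eq_square) (simp add: algebra_simps)
      also have "(2::real) ^ k * (1 / 2) ^ k = 1" by (simp flip: power_mult_distrib)
      finally have "2 * a \<le> 2 ^ k * a\<^sup>2 + (1 / 2) ^ k" by simp
      then show "D k z \<le> 2 ^ k * (norm (G (s (Suc k)) z - G (s k) z))\<^sup>2 + (1 / 2) ^ k"
        using a unfolding a_def[symmetric] D_def[symmetric] by simp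
    qed
    also have "\<dots> = ennreal (LINT z|M. 2 ^ k * (norm (G (s (Suc k)) z - G (s k) z))\<^sup>2 + (1 / 2) ^ k)"
      using I by (intro nn_integral_eq_integral) auto
    also have "(LINT z|M. 2 ^ k * (norm (G (s (Suc k)) z - G (s k) z))\<^sup>2 + (1 / 2) ^ k)
        = 2 ^ k * (LINT z|M. (norm (G (s (Suc k)) z - G (s k) z))\<^sup>2) + (1 / 2) ^ k * measure M (space M)"
      using I by simp
    also have "\<dots> \<le> 2 ^ k * (1 / 4) ^ k + (1 / 2) ^ k * measure M (space M)"
      using N[of k "s (Suc k)" "s k"] sN[of k] smono[of k] by (intro add_right_mono mult_left_mono) auto
    also have "(2::real) ^ k * (1 / 4) ^ k = (1 / 2) ^ k" by (simp flip: power_mult_distrib)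
    also have "(1 / 2) ^ k + (1 / 2) ^ k * measure M (space M) = (1 / 2) ^ k * (1 + measure M (space M))" by (simp add: algebra_simps)
    finally show ?thesis by (simp add: ennreal_leI)
  qed
  have "(\<integral>\<^sup>+z. (\<Sum>k. ennreal (D k z)) \<partial>M) = (\<Sum>k. \<integral>\<^sup>+z. ennreal (D k z) \<partial>M)"
    by (rule nn_integral_suminf) (simp add: D_def)
  also have "\<dots> \<le> (\<Sum>k. ennreal ((1 / 2) ^ k * (1 + measure M (space M))))"
    by (intro suminf_le Dbound) auto
  also have "\<dots> = ennreal (\<Sum>k. (1 / 2) ^ k * (1 + measure M (space M)))"
    by (intro suminf_ennreal2 summable_mult2 summable_geometric) auto
  also have "\<dots> < \<infinity>" by simp
  finally have "AE z in M. (\<Sum>k. ennreal (D k z)) \<noteq> \<infinity>"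
    by (intro nn_integral_noteq_infinite) (auto simp: D_def)
  then have conv: "AE z in M. (\<lambda>k. G (s k) z) \<longlonglongrightarrow> lim (\<lambda>k. G (s k) z)"
  proof eventually_elim
    case (elim z)
    have "summable (\<lambda>k. D k z)"
      using elim by (intro summable_suminf_not_top) (auto simp: D_def)
    then have "summable (\<lambda>k. G (s (Suc k)) z - G (s k) z)"
      unfolding D_def by (rule summable_norm_cancel)
    then have "convergent (\<lambda>n. \<Sum>k<n. G (s (Suc k)) z - G (s k) z)" by (simp add: summable_iff_convergent)
    then have "convergent (\<lambda>n. (G (s n) z - G (s 0) z))" by (simp add: sum_lessThan_telescope[of "\<lambda>k. G (s k) z"])
    then have "convergent (\<lambda>n. (G (s n) z - G (s 0) z) + G (s 0) z)" by (intro convergent_add convergent_const)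
    then show ?case by (simp add: convergent_LIMSEQ_iff)
  qed
  define g where "g z = lim (\<lambda>k. G (s k) z)" for z
  have gm [measurable]: "g \<in> borel_measurable M" unfolding g_def[abs_def] by measurable
  \<comment> \<open>Fatou along the subsequence turns an estimate against all late members into one
    against the limit.\<close>
  have bound: "(\<integral>\<^sup>+z. ennreal ((norm (G n z - g z))\<^sup>2) \<partial>M) \<le> ennreal e"
    if n: "\<And>m. m \<ge> K \<Longrightarrow> (LINT z|M. (norm (G n z - G m z))\<^sup>2) \<le> e" for n K e
  proof -
    have "(\<integral>\<^sup>+z. ennreal ((norm (G n z - g z))\<^sup>2) \<partial>M) = (\<integral>\<^sup>+z. liminf (\<lambda>k. ennreal ((norm (G n z - G (s k) z))\<^sup>2)) \<partial>M)"
    proof (rule nn_integral_cong_AE)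
      show "AE z in M. ennreal ((norm (G n z - g z))\<^sup>2) = liminf (\<lambda>k. ennreal ((norm (G n z - G (s k) z))\<^sup>2))"
        using conv
      proof eventually_elim
        case (elim z)
        have l: "(\<lambda>k. ennreal ((norm (G n z - G (s k) z))\<^sup>2)) \<longlonglongrightarrow> ennreal ((norm (G n z - g z))\<^sup>2)"
          using elim unfolding g_def by (intro tendsto_ennrealI tendsto_power tendsto_norm tendsto_diff tendsto_const)
        show ?case by (rule lim_imp_Liminf[OF _ l, symmetric]) simp
      qed
    qed
    also have "\<dots> \<le> liminf (\<lambda>k. \<integral>\<^sup>+z. ennreal ((norm (G n z - G (s k) z))\<^sup>2) \<partial>M)"
      by (rule nn_integral_liminf) measurable
    also have "\<dots> \<le> limsup (\<lambda>k. \<integral>\<^sup>+z. ennreal ((norm (G n z - G (s k) z))\<^sup>2) \<partial>M)"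
      by (rule Liminf_le_Limsup) simp
    also have "\<dots> \<le> ennreal e"
    proof (rule Limsup_bounded)
      show "\<forall>\<^sub>F k in sequentially. (\<integral>\<^sup>+z. ennreal ((norm (G n z - G (s k) z))\<^sup>2) \<partial>M) \<le> ennreal e"
        unfolding nnI eventually_sequentially
        using n sk by (intro exI[of _ K]) (auto intro!: ennreal_leI intro: order_trans)
    qed
    finally show ?thesis .
  qed
  have gL2: "in_L2 M (\<lambda>z. G n z - g z)" if n: "\<And>m. m \<ge> K \<Longrightarrow> (LINT z|M. (norm (G n z - G m z))\<^sup>2) \<le> e" for n K e
  proof -
    have "(\<integral>\<^sup>+z. ennreal ((norm (G n z - g z))\<^sup>2) \<partial>M) < \<infinity>"
      by (rule le_less_trans[OF bound[where K=K and n=n and e=e]]) (use n in auto)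
    then show ?thesis unfolding in_L2_def using G[of n] gm by (auto simp: in_L2_def)
  qed
  obtain N1 where N1: "\<And>m n. m \<ge> N1 \<Longrightarrow> n \<ge> N1 \<Longrightarrow> (LINT z|M. (norm (G m z - G n z))\<^sup>2) < 1"
    using cauchy[of 1] by auto
  \<comment> \<open>The limit is written as a difference of two functions already known to be square
    integrable.\<close>
  have "in_L2 M (\<lambda>z. G N1 z - (G N1 z - g z))"
    by (intro in_L2_diff G gL2[where K=N1 and n=N1 and e=1]) (use N1 in \<open>auto intro: less_imp_le\<close>)
  then have g: "in_L2 M g" by simp
  have "(\<lambda>k. LINT z|M. (norm (G k z - g z))\<^sup>2) \<longlonglongrightarrow> 0"
  proof (rule tendstoI)
    fix e :: real assume e: "e > 0"
    obtain N2 where N2: "\<And>m n. m \<ge> N2 \<Longrightarrow> n \<ge> N2 \<Longrightarrow> (LINT z|M. (norm (G m z - G n z))\<^sup>2) < e / 2"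
      using cauchy[of "e / 2"] e by auto
    have "dist (LINT z|M. (norm (G k z - g z))\<^sup>2) 0 < e" if "k \<ge> N2" for k
    proof -
      have "ennreal (LINT z|M. (norm (G k z - g z))\<^sup>2) = (\<integral>\<^sup>+z. ennreal ((norm (G k z - g z))\<^sup>2) \<partial>M)"
        using in_L2_integrable[OF in_L2_diff[OF G g], of k] by (subst nn_integral_eq_integral) auto
      also have "\<dots> \<le> ennreal (e / 2)" by (rule bound[of N2]) (use N2 that in \<open>auto intro: less_imp_le\<close>)
      finally have "(LINT z|M. (norm (G k z - g z))\<^sup>2) \<le> e / 2" using e by (subst (asm) ennreal_le_iff) auto
      then show ?thesis using e by (simp add: dist_real_def)
    qed
    then show "\<forall>\<^sub>F k in sequentially. dist (LINT z|M. (norm (G k z - g z))\<^sup>2) 0 < e"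
      unfolding eventually_sequentially by blast
  qed
  with g show ?thesis by (rule that)
qed

subsection \<open>Weak gradients\<close>

lemma strip_sets: "{a..b} \<times> torus_cell \<in> sets (borel :: (real \<times> (real^'n)) measure)"
  by (subst borel_prod[symmetric]) (intro pair_measureI; simp)

lemma loc_L1_integrable:
  fixes f :: "real \<times> (real^'n) \<Rightarrow> 'b::euclidean_space"
  assumes "integrable (D_leb T) f" shows "loc_L1 T f"
proof -
  have "set_integrable (D_leb T) ({a..b} \<times> torus_cell) f" if "0 < a" "b < T" for a b
    unfolding set_integrable_def
  proof (rule integrable_mult_indicator[OF _ assms])
    have "{a..b} \<times> torus_cell \<subseteq> (spacetime T :: (real \<times> (real^'n)) set)" using that by (auto simp: spacetime_def)
    then show "{a..b} \<times> torus_cell \<in> sets (D_leb T :: (real \<times> (real^'n)) measure)"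
      using strip_sets[of a b, where 'n='n] by (subst sets_restrict_space_iff) auto
  qed
  then show ?thesis using assms by (auto simp: loc_L1_def)
qed

lemma loc_L1_vec_nth: "loc_L1 T g \<Longrightarrow> loc_L1 T (\<lambda>z. g z $ i)" for g :: "real \<times> (real^'n) \<Rightarrow> real^'n"
proof -
  assume g: "loc_L1 T g"
  have "(\<lambda>z. g z $ i) \<in> borel_measurable (D_leb T)"
    using g by (intro measurable_compose[of g _ borel "\<lambda>x. x $ i"] borel_measurable_continuous_onI continuous_intros)
      (auto simp: loc_L1_def)
  moreover have "set_integrable (D_leb T) S (\<lambda>z. g z $ i)" if "set_integrable (D_leb T) S g" for S
    using integrable_vec_nth[OF that[unfolded set_integrable_def], of i] by (simp add: set_integrable_def)
  ultimately show ?thesis using g by (auto simp: loc_L1_def)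
qed

text \<open>The compact time support of \<open>\<eta>\<close> turns local integrability into
  integrability.\<close>

lemma loc_L1_mult_test:
  fixes f :: "real \<times> (real^'n) \<Rightarrow> real"
  assumes f: "loc_L1 T f" and \<eta>: "test_fun T \<eta>"
  shows "integrable (D_leb T) (\<lambda>z. f z * \<eta> z)"
proof -
  obtain a b where ab: "0 < a" "a < b" "b < T" "\<And>t x. t \<notin> {a..b} \<Longrightarrow> \<eta> (t, x) = 0"
    using \<eta> unfolding test_fun_def by blast
  obtain B where B: "B > 0" "\<And>t x. t \<in> {0..T} \<Longrightarrow> norm (\<eta> (t, x)) \<le> B" using cont_D_bounded[OF cont_D_test_fun[OF \<eta>]] by metis
  have i: "integrable (D_leb T) (\<lambda>z. indicator ({a..b} \<times> torus_cell) z *\<^sub>R f z)"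
    using f ab unfolding loc_L1_def set_integrable_def by blast
  show ?thesis
  proof (rule Bochner_Integration.integrable_bound[where f="\<lambda>z. B * (indicator ({a..b} \<times> torus_cell) z *\<^sub>R f z)"])
    show "integrable (D_leb T) (\<lambda>z. B * (indicator ({a..b} \<times> torus_cell) z *\<^sub>R f z))" using i by auto
    show "(\<lambda>z. f z * \<eta> z) \<in> borel_measurable (D_leb T)"
      using f cont_D_measurable(2)[OF cont_D_test_fun[OF \<eta>]] by (intro borel_measurable_times) (auto simp: loc_L1_def)
    show "AE z in D_leb T. norm (f z * \<eta> z) \<le> norm (B * (indicator ({a..b} \<times> torus_cell) z *\<^sub>R f z))"
    proof (rule AE_I2)
      fix z assume "z \<in> space (D_leb T :: (real \<times> (real^'n)) measure)"
      then have z: "z \<in> spacetime T" by simp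
      then have "\<bar>\<eta> z\<bar> \<le> B" using B(2)[of "fst z" "snd z"] by (auto simp: spacetime_def)
      from mult_left_mono[OF this, of "\<bar>f z\<bar>"] B(1) ab(4)[of "fst z" "snd z"] z
      show "norm (f z * \<eta> z) \<le> norm (B * (indicator ({a..b} \<times> torus_cell) z *\<^sub>R f z))"
        by (cases "fst z \<in> {a..b}") (auto simp: abs_mult mult.commute spacetime_def)
    qed
  qed
qed

text \<open>\<open>f\<close> need not be integrable up to the ends. Its product with a time cutoff
  is, and the product of a cutoff with a test function is again a test function.\<close>

lemma loc_L1_zero:
  fixes f :: "real \<times> (real^'n) \<Rightarrow> real"
  assumes T: "T > 0" and f: "loc_L1 T f" and zero: "\<And>\<eta>. test_fun T \<eta> \<Longrightarrow> (LINT z|D_leb T. f z * \<eta> z) = 0"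
  shows "AE z in D_leb T. f z = 0"
proof -
  obtain \<zeta> where \<zeta>: "\<And>n. smooth (\<zeta> n)" "\<And>n t. 0 \<le> \<zeta> n t" "\<And>n t. \<zeta> n t \<le> 1" "\<And>n. supp_in T (\<zeta> n)"
    "\<And>t. (\<lambda>n. \<zeta> n t) \<longlonglongrightarrow> indicator {0<..<T} t"
    by (rule time_cutoffs[OF T]) (rule that)
  have "AE z in D_leb T. f z * \<zeta> n (fst z) = 0" for n
  proof (rule AE_zero_if_test_integrals_zero[OF T sets_D_leb D_leb_ends[OF T]])
    have tf: "test_fun T (\<lambda>z :: real \<times> (real^'n). \<zeta> n (fst z))"
      using test_fun_cutoff[OF \<zeta>(1,4) smooth_periodic_const, of n 1] by simp
    show "integrable (D_leb T) (\<lambda>z. f z * \<zeta> n (fst z))" by (rule loc_L1_mult_test[OF f tf])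
    fix \<eta> :: "real \<times> (real^'n) \<Rightarrow> real" assume \<eta>: "test_fun T \<eta>"
    have "test_fun T (\<lambda>z. \<zeta> n (fst z) * \<eta> z)" by (intro test_fun_cutoff \<zeta> test_fun_smooth_periodic[OF \<eta>])
    from zero[OF this] show "(LINT z|D_leb T. f z * \<zeta> n (fst z) * \<eta> z) = 0" by (simp add: mult.assoc)
  qed
  then have "AE z in D_leb T. \<forall>n. f z * \<zeta> n (fst z) = 0" unfolding AE_all_countable by blast
  then show ?thesis using D_leb_ends[OF T]
  proof eventually_elim
    case (elim z)
    have "(\<lambda>n. f z * \<zeta> n (fst z)) \<longlonglongrightarrow> f z * 1"
      using \<zeta>(5)[of "fst z"] elim by (intro tendsto_mult tendsto_const) simp
    then show ?case using elim by (simp add: LIMSEQ_const_iff)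
  qed
qed

lemma weak_grad_unique:
  fixes g h :: "real \<times> (real^'n) \<Rightarrow> real^'n"
  assumes T: "T > 0" and g: "has_weak_grad T f g" and h: "has_weak_grad T f h"
  shows "AE z in D_leb T. g z = h z"
proof -
  have l: "loc_L1 T (\<lambda>z. g z $ i)" "loc_L1 T (\<lambda>z. h z $ i)" for i
    using g h by (auto simp: has_weak_grad_def intro: loc_L1_vec_nth)
  have ld: "loc_L1 T (\<lambda>z. g z $ i - h z $ i)" for i
    using l[of i] by (auto simp: loc_L1_def)
  have "AE z in D_leb T. g z $ i - h z $ i = 0" for i
  proof (rule loc_L1_zero[OF T ld])
    fix \<eta> :: "real \<times> (real^'n) \<Rightarrow> real" assume \<eta>: "test_fun T \<eta>"
    have "(LINT z|D_leb T. (g z $ i - h z $ i) * \<eta> z) = (LINT z|D_leb T. g z $ i * \<eta> z) - (LINT z|D_leb T. h z $ i * \<eta> z)"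
      using loc_L1_mult_test[OF l(1) \<eta>] loc_L1_mult_test[OF l(2) \<eta>] by (simp add: left_diff_distrib)
    also have "(LINT z|D_leb T. g z $ i * \<eta> z) = (LINT z|D_leb T. h z $ i * \<eta> z)"
    proof -
      have "(LINT z|D_leb T. f z * d_x i \<eta> z) = - (LINT z|D_leb T. g z $ i * \<eta> z)"
        "(LINT z|D_leb T. f z * d_x i \<eta> z) = - (LINT z|D_leb T. h z $ i * \<eta> z)"
        using g h \<eta> unfolding has_weak_grad_def by blast+
      then show ?thesis by linarith
    qed
    finally show "(LINT z|D_leb T. (g z $ i - h z $ i) * \<eta> z) = 0" by simp
  qed
  then have "AE z in D_leb T. \<forall>i\<in>UNIV. g z $ i - h z $ i = 0" by (intro AE_finite_allI) auto
  then show ?thesis by eventually_elim (simp add: vec_eq_iff)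
qed

text \<open>The chosen representative \<open>weak_grad\<close> may be exchanged for any explicit
  weak gradient, because the two agree almost everywhere; energies are therefore unaffected.\<close>

lemma weak_grad_L2:
  fixes g :: "real \<times> (real^'n) \<Rightarrow> real^'n"
  assumes T: "T > 0" and g: "has_weak_grad T f g" "in_L2 (D_leb T) g"
  shows "has_weak_grad T f (weak_grad T f)" "in_L2 (D_leb T) (weak_grad T f)" "AE z in D_leb T. weak_grad T f z = g z"
proof -
  show w: "has_weak_grad T f (weak_grad T f)" unfolding weak_grad_def by (rule someI[of "has_weak_grad T f", OF g(1)])
  show ae: "AE z in D_leb T. weak_grad T f z = g z" by (rule weak_grad_unique[OF T w g(1)])
  have "(\<integral>\<^sup>+z. ennreal ((norm (weak_grad T f z))\<^sup>2) \<partial>D_leb T) = (\<integral>\<^sup>+z. ennreal ((norm (g z))\<^sup>2) \<partial>D_leb T)"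
    using ae by (intro nn_integral_cong_AE) (auto elim!: eventually_mono)
  then show "in_L2 (D_leb T) (weak_grad T f)" using w g(2) by (simp add: in_L2_def has_weak_grad_def loc_L1_def)
qed

text \<open>The Poisson equation for functions that do not vanish near the ends. It has derivatives
  in space only, so removing the cutoffs leaves no boundary terms. This evaluates smooth functions
  against a possibly singular \<open>M\<close>.\<close>

lemma poisson_closed:
  fixes p :: "real \<times> (real^'n) \<Rightarrow> real" and P :: "real \<times> (real^'n) \<Rightarrow> real^'n"
  assumes T: "T > 0" and P: "has_weak_grad T p P" "in_L2 (D_leb T) P" and M: "finite_measure M" "sets M = sets (D_borel T)"
    and ends: "AE z in M. 0 < fst z \<and> fst z < T" and poi: "poisson T p (\<lambda>\<eta>. LINT z|M. \<eta> z)"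
    and \<Psi>: "smooth_periodic \<Psi>"
  shows "(LINT z|M. \<Psi> z) = (LINT z|D_leb T. \<Psi> z) - (LINT z|D_leb T. P z \<bullet> grad_x \<Psi> z)"
proof -
  have T': "T \<ge> 0" using T by simp
  note fD = finite_measure_D_leb[OF T', where 'n='n]
  obtain \<zeta> where \<zeta>: "\<And>n. smooth (\<zeta> n)" "\<And>n t. 0 \<le> \<zeta> n t" "\<And>n t. \<zeta> n t \<le> 1" "\<And>n. supp_in T (\<zeta> n)"
    "\<And>t. (\<lambda>n. \<zeta> n t) \<longlonglongrightarrow> indicator {0<..<T} t"
    by (rule time_cutoffs[OF T]) (rule that)
  have sm: "smooth \<Psi>" by (rule smooth_periodicD(1)[OF \<Psi>])
  have lim: "(\<lambda>n. LINT z|N. \<zeta> n (fst z) * F z) \<longlonglongrightarrow> (LINT z|N. F z)"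
    if N: "finite_measure N" "sets N = sets (D_borel T)" "AE z in N. 0 < fst z \<and> fst z < T" and F: "integrable N F"
    for N and F :: "real \<times> (real^'n) \<Rightarrow> real"
  proof (rule integral_dominated_convergence[where w="\<lambda>z. \<bar>F z\<bar>"])
    have zm: "(\<lambda>z. \<zeta> n (fst z)) \<in> borel_measurable N" for n
      using integrable_cont_D[OF cont_D_smooth_periodic[OF smooth_periodic_fst[OF \<zeta>(1)]] N(1,2)] by auto
    show "(\<lambda>z. \<zeta> n (fst z) * F z) \<in> borel_measurable N" for n using zm F by auto
    show "AE z in N. (\<lambda>n. \<zeta> n (fst z) * F z) \<longlonglongrightarrow> F z"
      using N(3)
    proof eventually_elim
      case (elim z)
      then have "(\<lambda>n. \<zeta> n (fst z) * F z) \<longlonglongrightarrow> 1 * F z"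
        using \<zeta>(5)[of "fst z"] by (intro tendsto_mult tendsto_const) simp
      then show ?case by simp
    qed
    show "AE z in N. norm (\<zeta> n (fst z) * F z) \<le> \<bar>F z\<bar>" for n
      using \<zeta>(2,3) by (intro AE_I2) (auto simp: abs_mult intro!: mult_left_le_one_le)
  qed (use F in auto)
  \<comment> \<open>A cutoff in time passes through space derivatives untouched.\<close>
  have dxz: "d_x i (\<lambda>z. \<zeta> n (fst z) * \<Psi> z) = (\<lambda>z. \<zeta> n (fst z) * d_x i \<Psi> z)" for n i
    by (rule ext) (simp add: d_x_mult smooth_fst \<zeta>(1) sm d_x_fst)
  have tf: "test_fun T (\<lambda>z. \<zeta> n (fst z) * d_x i \<Psi> z)" for n i
    by (intro test_fun_cutoff \<zeta> smooth_periodic_d_x \<Psi>)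
  have tf2: "test_fun T (d_x i (\<lambda>z. \<zeta> n (fst z) * d_x i \<Psi> z))" for n i
  proof -
    have "d_x i (\<lambda>z. \<zeta> n (fst z) * d_x i \<Psi> z) = (\<lambda>z. \<zeta> n (fst z) * d_x i (d_x i \<Psi>) z)"
      by (rule ext) (simp add: d_x_mult smooth_fst \<zeta>(1) smooth_d_x[OF sm] d_x_fst)
    then show ?thesis by (simp add: test_fun_cutoff \<zeta> smooth_periodic_d_x \<Psi>)
  qed
  have grad2: "in_L2 (D_leb T) (grad_x \<Psi>)"
  proof -
    obtain B where B: "\<And>t x. t \<in> {0..T} \<Longrightarrow> norm (grad_x \<Psi> (t, x)) \<le> B" using cont_D_bounded[OF cont_D_grad[OF \<Psi>]] by metis
    show ?thesis
    proof (rule in_L2_bounded[OF fD cont_D_measurable(2)[OF cont_D_grad[OF \<Psi>]]])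
      show "AE z in D_leb T. norm (grad_x \<Psi> z) \<le> B"
      proof (rule AE_I2)
        fix z assume "z \<in> space (D_leb T :: (real \<times> (real^'n)) measure)"
        then have "z \<in> spacetime T" by simp
        then show "norm (grad_x \<Psi> z) \<le> B" using B[of "fst z" "snd z"] by (auto simp: spacetime_def)
      qed
    qed
  qed
  have key: "(LINT z|M. \<zeta> n (fst z) * \<Psi> z) = (LINT z|D_leb T. \<zeta> n (fst z) * \<Psi> z) - (LINT z|D_leb T. \<zeta> n (fst z) * (P z \<bullet> grad_x \<Psi> z))" for n
  proof -
    have pl: "loc_L1 T p" and Pl: "loc_L1 T (\<lambda>z. P z $ i)" for i
      using P(1) by (auto simp: has_weak_grad_def intro: loc_L1_vec_nth)
    have "(LINT z|M. \<zeta> n (fst z) * \<Psi> z) - (LINT z|D_leb T. \<zeta> n (fst z) * \<Psi> z) = (LINT z|D_leb T. p z * lap_x (\<lambda>z. \<zeta> n (fst z) * \<Psi> z) z)"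
      using poi test_fun_cutoff[OF \<zeta>(1,4) \<Psi>] unfolding poisson_def by simp
    also have "\<dots> = (LINT z|D_leb T. (\<Sum>i\<in>UNIV. p z * d_x i (\<lambda>z. \<zeta> n (fst z) * d_x i \<Psi> z) z))"
      by (simp add: lap_x_def dxz sum_distrib_left)
    also have "\<dots> = (\<Sum>i\<in>UNIV. LINT z|D_leb T. p z * d_x i (\<lambda>z. \<zeta> n (fst z) * d_x i \<Psi> z) z)"
      by (rule Bochner_Integration.integral_sum) (rule loc_L1_mult_test[OF pl tf2])
    also have "\<dots> = (\<Sum>i\<in>UNIV. - (LINT z|D_leb T. P z $ i * (\<zeta> n (fst z) * d_x i \<Psi> z)))"
      using P(1) tf unfolding has_weak_grad_def by (intro sum.cong) blast+
    also have "\<dots> = - (LINT z|D_leb T. (\<Sum>i\<in>UNIV. P z $ i * (\<zeta> n (fst z) * d_x i \<Psi> z)))"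
      unfolding sum_negf by (subst Bochner_Integration.integral_sum) (auto intro: loc_L1_mult_test[OF Pl tf])
    also have "(\<lambda>z. \<Sum>i\<in>UNIV. P z $ i * (\<zeta> n (fst z) * d_x i \<Psi> z)) = (\<lambda>z. \<zeta> n (fst z) * (P z \<bullet> grad_x \<Psi> z))"
      by (rule ext) (simp add: inner_vec_def grad_x_def sum_distrib_left mult_ac)
    finally show ?thesis by simp
  qed
  have "(\<lambda>n. LINT z|M. \<zeta> n (fst z) * \<Psi> z) \<longlonglongrightarrow> (LINT z|M. \<Psi> z)"
    by (rule lim[OF M ends integrable_cont_D[OF cont_D_smooth_periodic[OF \<Psi>] M]])
  moreover have "(\<lambda>n. (LINT z|D_leb T. \<zeta> n (fst z) * \<Psi> z) - (LINT z|D_leb T. \<zeta> n (fst z) * (P z \<bullet> grad_x \<Psi> z)))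
      \<longlonglongrightarrow> (LINT z|D_leb T. \<Psi> z) - (LINT z|D_leb T. P z \<bullet> grad_x \<Psi> z)"
    by (intro tendsto_diff lim fD sets_D_leb D_leb_ends T integrable_smooth_periodic \<Psi> T' in_L2_inner P grad2)
  ultimately show ?thesis unfolding key by (rule LIMSEQ_unique)
qed

text \<open>\<open>q\<close> being bounded and \<open>r\<close> integrable, \<open>\<integral> |\<nabla>q|\<^sup>2 = \<integral> q (1 - r)\<close> is finite:
  the mollified gradients are Cauchy because \<open>\<integral> q\<^sub>m r\<^sub>n\<close> converges as \<open>m, n \<rightarrow> \<infinity>\<close>.\<close>

lemma bounded_potential_gradient:
  fixes q r :: "real \<times> (real^'n) \<Rightarrow> real"
  assumes T: "T > 0" and q: "q \<in> borel_measurable (D_leb T)" "AE z in D_leb T. \<bar>q z\<bar> \<le> C" and r: "integrable (D_leb T) r"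
    and poi: "poisson T q (\<lambda>\<eta>. LINT z|D_leb T. r z * \<eta> z)"
  obtains g where "has_weak_grad T q g" "in_L2 (D_leb T) g"
    "(\<lambda>k. LINT z|D_leb T. (norm (grad_x (moll T k q) z - g z))\<^sup>2) \<longlonglongrightarrow> 0"
    "(LINT z|D_leb T. r z * q z) = (LINT z|D_leb T. q z) - (LINT z|D_leb T. (norm (g z))\<^sup>2)"
proof -
  let ?D = "D_leb T :: (real \<times> (real^'n)) measure"
  have T': "T \<ge> 0" using T by simp
  note fD = finite_measure_D_leb[OF T', where 'n='n]
  interpret finite_measure ?D by (rule fD)
  have qi: "integrable ?D q" by (rule integrable_D_bounded[OF T q(1)]) (use q(2) in simp)
  define Q where "Q k = moll T k q" for k
  define S where "S k = moll T k r" for k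
  have Q: "smooth_periodic (Q k)" for k unfolding Q_def by (rule smooth_periodic_moll[OF T qi])
  have Si: "integrable ?D (S k)" for k unfolding S_def by (rule integrable_moll[OF T r])
  have Qb: "\<bar>Q k z\<bar> \<le> C" if "z \<in> spacetime T" for k z
    using moll_bounded[OF T q, of "fst z" k "snd z"] that by (auto simp: Q_def spacetime_def)
  have lapQ: "lap_x (Q k) z = S k z - 1" if "z \<in> spacetime T" for k z
    using lap_x_moll[OF T qi poi, of "fst z" k "snd z"] that by (auto simp: Q_def S_def spacetime_def)
  have Qfi: "integrable ?D (\<lambda>z. f z * Q k z)" if "integrable ?D f" for f k
    unfolding Q_def by (rule moll_weak_tendsto(3)[OF T q that])
  \<comment> \<open>Two indices, because expanding the distance of two mollified gradients produces
    mixed products.\<close>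
  define J where "J m n = (LINT z|?D. S n z * Q m z)" for m n
  define J0 where "J0 = (LINT z|?D. r z * q z)"
  define a where "a n = C * (LINT z|?D. \<bar>S n z - r z\<bar>)" for n
  define b where "b m = \<bar>(LINT z|?D. r z * Q m z) - J0\<bar>" for m
  \<comment> \<open>The errors separate: in \<open>n\<close> the mollifications of \<open>r\<close>
    converge in L1 against the uniformly bounded \<open>Q m\<close>, and in \<open>m\<close> those
    of \<open>q\<close> converge against the fixed weight \<open>r\<close>.\<close>
  have Jbound: "\<bar>J m n - J0\<bar> \<le> a n + b m" for m n
  proof -
    have "J m n - J0 = (LINT z|?D. (S n z - r z) * Q m z) + ((LINT z|?D. r z * Q m z) - J0)"
      using Qfi[OF Si] Qfi[OF r] by (simp add: J_def left_diff_distrib)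
    moreover have "\<bar>LINT z|?D. (S n z - r z) * Q m z\<bar> \<le> a n"
    proof -
      have "\<bar>LINT z|?D. (S n z - r z) * Q m z\<bar> \<le> (LINT z|?D. \<bar>(S n z - r z) * Q m z\<bar>)" by (rule integral_abs_bound)
      also have "\<dots> \<le> (LINT z|?D. C * \<bar>S n z - r z\<bar>)"
      proof (rule integral_mono)
        show "integrable ?D (\<lambda>z. \<bar>(S n z - r z) * Q m z\<bar>)" using Qfi[of "\<lambda>z. S n z - r z"] Si r by auto
        show "integrable ?D (\<lambda>z. C * \<bar>S n z - r z\<bar>)" using Si r by auto
        fix z assume "z \<in> space ?D"
        then have "\<bar>Q m z\<bar> \<le> C" by (intro Qb) simp
        from mult_left_mono[OF this, of "\<bar>S n z - r z\<bar>"] show "\<bar>(S n z - r z) * Q m z\<bar> \<le> C * \<bar>S n z - r z\<bar>"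
          by (simp add: abs_mult mult.commute)
      qed
      finally show ?thesis by (simp add: a_def)
    qed
    ultimately show ?thesis unfolding b_def by linarith
  qed
  have alim: "a \<longlonglongrightarrow> 0"
    using tendsto_mult[OF tendsto_const moll_L1_tendsto[OF T r], of C] by (simp add: a_def[abs_def] S_def)
  have blim: "b \<longlonglongrightarrow> 0"
  proof -
    have "(\<lambda>m. LINT z|?D. r z * Q m z) \<longlonglongrightarrow> J0" unfolding Q_def J0_def by (rule moll_weak_tendsto(1)[OF T q r])
    then have "(\<lambda>m. (LINT z|?D. r z * Q m z) - J0) \<longlonglongrightarrow> 0" by (simp add: LIM_zero)
    then show ?thesis unfolding b_def[abs_def] by (rule tendsto_rabs_zero)
  qed
  define G where "G k = grad_x (Q k)" for k
  have G2: "in_L2 ?D (G k)" for k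
  proof -
    obtain B where B: "\<And>t x. t \<in> {0..T} \<Longrightarrow> norm (grad_x (Q k) (t, x)) \<le> B" using cont_D_bounded[OF cont_D_grad[OF Q]] by metis
    show ?thesis
      unfolding G_def
    proof (rule in_L2_bounded[OF fD cont_D_measurable(2)[OF cont_D_grad[OF Q]]])
      show "AE z in D_leb T. norm (grad_x (Q k) z) \<le> B"
      proof (rule AE_I2)
        fix z assume "z \<in> space ?D"
        then have "z \<in> spacetime T" by simp
        then show "norm (grad_x (Q k) z) \<le> B" using B[of "fst z" "snd z"] by (auto simp: spacetime_def)
      qed
    qed
  qed
  \<comment> \<open>Green's formula, with the mollified Poisson equation inserted for the
    Laplacian.\<close>
  have GG: "(LINT z|?D. G m z \<bullet> G n z) = (LINT z|?D. Q m z) - J m n" for m n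
  proof -
    have "(LINT z|?D. G m z \<bullet> G n z) = - (LINT z|?D. Q m z * lap_x (Q n) z)"
      using Green_D[OF Q Q T'] by (simp add: G_def)
    also have "(LINT z|?D. Q m z * lap_x (Q n) z) = (LINT z|?D. S n z * Q m z - Q m z)"
      by (intro Bochner_Integration.integral_cong) (auto simp: lapQ algebra_simps)
    also have "\<dots> = J m n - (LINT z|?D. Q m z)"
      unfolding J_def using Qfi[OF Si] integrable_smooth_periodic[OF Q T'] by simp
    finally show ?thesis by simp
  qed
  \<comment> \<open>The integrals of \<open>Q m\<close> and \<open>Q n\<close> cancel. What remains
    is a second difference of \<open>J\<close>, small because all four entries are near
    \<open>J0\<close>.\<close>
  have dist: "(LINT z|?D. (norm (G m z - G n z))\<^sup>2) = - J m m + J m n + J n m - J n n" for m n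
  proof -
    have "(LINT z|?D. (norm (G m z - G n z))\<^sup>2) = (LINT z|?D. G m z \<bullet> G m z - G m z \<bullet> G n z - (G n z \<bullet> G m z - G n z \<bullet> G n z))"
      by (simp add: power2_norm_eq_inner inner_diff_left inner_diff_right inner_commute algebra_simps)
    also have "\<dots> = (LINT z|?D. G m z \<bullet> G m z) - (LINT z|?D. G m z \<bullet> G n z) - ((LINT z|?D. G n z \<bullet> G m z) - (LINT z|?D. G n z \<bullet> G n z))"
      using in_L2_inner[OF G2 G2] by simp
    finally show ?thesis by (simp add: GG)
  qed
  have cauchy: "\<exists>N. \<forall>m\<ge>N. \<forall>n\<ge>N. (LINT z|?D. (norm (G m z - G n z))\<^sup>2) < e" if e: "e > 0" for e
  proof -
    have "(\<lambda>n. a n + b n) \<longlonglongrightarrow> 0 + 0" by (intro tendsto_add alim blim)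
    then have "\<forall>\<^sub>F n in sequentially. a n + b n < e / 4" using e by (intro order_tendstoD(2)) auto
    then obtain N where N: "\<And>n. n \<ge> N \<Longrightarrow> a n + b n < e / 4" by (auto simp: eventually_sequentially)
    have "(LINT z|?D. (norm (G m z - G n z))\<^sup>2) < e" if "m \<ge> N" "n \<ge> N" for m n
      using dist[of m n] Jbound[of m m] Jbound[of m n] Jbound[of n m] Jbound[of n n] N[OF that(1)] N[OF that(2)] by linarith
    then show ?thesis by blast
  qed
  obtain g where g: "in_L2 ?D g" and glim: "(\<lambda>k. LINT z|?D. (norm (G k z - g z))\<^sup>2) \<longlonglongrightarrow> 0"
    using L2_complete[OF fD G2 cauchy] by blast
  have gi: "integrable ?D g" by (rule in_L2_L1[OF fD g])
  have Ginner: "(\<lambda>k. LINT z|?D. G k z \<bullet> w z) \<longlonglongrightarrow> (LINT z|?D. g z \<bullet> w z)" if w: "in_L2 ?D w" for w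
  proof -
    have "(\<lambda>k. LINT z|?D. (G k z - g z) \<bullet> w z) \<longlonglongrightarrow> 0" by (rule L2_tendsto_inner[OF in_L2_diff[OF G2 g] w glim])
    moreover have "(LINT z|?D. (G k z - g z) \<bullet> w z) = (LINT z|?D. G k z \<bullet> w z) - (LINT z|?D. g z \<bullet> w z)" for k
      using in_L2_inner[OF G2 w] in_L2_inner[OF g w] by (simp add: inner_diff_left)
    ultimately show ?thesis by (simp add: LIM_zero_cancel)
  qed
  \<comment> \<open>Integration by parts for the smooth \<open>Q k\<close> passes to the limit:
    strong convergence on the gradient side, weak convergence of the mollified \<open>q\<close> on
    the other.\<close>
  have "has_weak_grad T q g"
    unfolding has_weak_grad_def
  proof (intro conjI allI impI loc_L1_integrable qi gi)
    fix \<eta> :: "real \<times> (real^'n) \<Rightarrow> real" and i assume \<eta>: "test_fun T \<eta>"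
    have sp: "smooth_periodic \<eta>" by (rule test_fun_smooth_periodic[OF \<eta>])
    have w: "in_L2 ?D (\<lambda>z. \<eta> z *\<^sub>R axis i 1 :: real^'n)"
    proof -
      obtain B where B: "\<And>t x. t \<in> {0..T} \<Longrightarrow> norm (\<eta> (t, x)) \<le> B" using cont_D_bounded[OF cont_D_test_fun[OF \<eta>]] by metis
      show ?thesis
      proof (rule in_L2_bounded[OF fD])
        show "(\<lambda>z. \<eta> z *\<^sub>R axis i 1 :: real^'n) \<in> borel_measurable ?D"
          using cont_D_measurable(2)[OF cont_D_test_fun[OF \<eta>]] by measurable
        show "AE z in ?D. norm (\<eta> z *\<^sub>R axis i 1 :: real^'n) \<le> B"
        proof (rule AE_I2)
          fix z assume "z \<in> space ?D"
          then have "z \<in> spacetime T" by simp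
          then show "norm (\<eta> z *\<^sub>R axis i 1 :: real^'n) \<le> B" using B[of "fst z" "snd z"] by (auto simp: spacetime_def)
        qed
      qed
    qed
    have "(LINT z|?D. G k z \<bullet> (\<eta> z *\<^sub>R axis i 1)) = - (LINT z|?D. d_x i \<eta> z * moll T k q z)" for k
      using integral_by_parts_D[OF sp Q T', of i k] by (simp add: G_def inner_axis grad_x_def Q_def mult.commute)
    then have "(\<lambda>k. - (LINT z|?D. d_x i \<eta> z * moll T k q z)) \<longlonglongrightarrow> (LINT z|?D. g z \<bullet> (\<eta> z *\<^sub>R axis i 1))"
      using Ginner[OF w] by simp
    moreover have "(\<lambda>k. - (LINT z|?D. d_x i \<eta> z * moll T k q z)) \<longlonglongrightarrow> - (LINT z|?D. d_x i \<eta> z * q z)"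
      by (intro tendsto_minus moll_weak_tendsto(1)[OF T q] integrable_smooth_periodic smooth_periodic_d_x sp T')
    ultimately have "(LINT z|?D. g z \<bullet> (\<eta> z *\<^sub>R axis i 1)) = - (LINT z|?D. d_x i \<eta> z * q z)" by (rule LIMSEQ_unique)
    then show "(LINT z|?D. q z * d_x i \<eta> z) = - (LINT z|?D. g z $ i * \<eta> z)" by (simp add: inner_axis mult.commute)
  qed
  \<comment> \<open>The diagonal of \<open>GG\<close> has two limits: the squared norm of
    \<open>g\<close> by strong convergence, and the integral of \<open>q\<close> minus
    \<open>J0\<close> by \<open>Jbound\<close>.\<close>
  moreover have "(LINT z|?D. r z * q z) = (LINT z|?D. q z) - (LINT z|?D. (norm (g z))\<^sup>2)"
  proof -
    have "(\<lambda>k. LINT z|?D. G k z \<bullet> G k z) \<longlonglongrightarrow> (LINT z|?D. (norm (g z))\<^sup>2)"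
    proof -
      have "(LINT z|?D. G k z \<bullet> G k z) = (LINT z|?D. (norm (G k z - g z))\<^sup>2) + 2 * (LINT z|?D. G k z \<bullet> g z) - (LINT z|?D. (norm (g z))\<^sup>2)" for k
      proof -
        have "(LINT z|?D. (norm (G k z - g z))\<^sup>2) = (LINT z|?D. G k z \<bullet> G k z - 2 * (G k z \<bullet> g z) + (norm (g z))\<^sup>2)"
          by (simp add: power2_norm_eq_inner inner_diff_left inner_diff_right inner_commute algebra_simps)
        also have "\<dots> = (LINT z|?D. G k z \<bullet> G k z) - 2 * (LINT z|?D. G k z \<bullet> g z) + (LINT z|?D. (norm (g z))\<^sup>2)"
          using in_L2_inner[OF G2 G2] in_L2_inner[OF G2 g] in_L2_integrable[OF g] by simp
        finally show ?thesis by simp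
      qed
      moreover have "(\<lambda>k. (LINT z|?D. (norm (G k z - g z))\<^sup>2) + 2 * (LINT z|?D. G k z \<bullet> g z) - (LINT z|?D. (norm (g z))\<^sup>2))
          \<longlonglongrightarrow> 0 + 2 * (LINT z|?D. g z \<bullet> g z) - (LINT z|?D. (norm (g z))\<^sup>2)"
        by (intro tendsto_intros glim Ginner g)
      ultimately show ?thesis by (simp add: power2_norm_eq_inner)
    qed
    moreover have "(\<lambda>k. LINT z|?D. G k z \<bullet> G k z) \<longlonglongrightarrow> (LINT z|?D. q z) - J0"
      unfolding GG
    proof (rule tendsto_diff)
      have "integrable ?D (\<lambda>_. 1 :: real)" by simp
      from moll_weak_tendsto(1)[OF T q this] show "(\<lambda>k. LINT z|?D. Q k z) \<longlonglongrightarrow> (LINT z|?D. q z)" by (simp add: Q_def)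
      have "(\<lambda>k. J k k - J0) \<longlonglongrightarrow> 0"
      proof (rule Lim_null_comparison)
        show "\<forall>\<^sub>F k in sequentially. norm (J k k - J0) \<le> a k + b k" using Jbound by simp
        show "(\<lambda>k. a k + b k) \<longlonglongrightarrow> 0" using tendsto_add[OF alim blim] by simp
      qed
      then show "(\<lambda>k. J k k) \<longlonglongrightarrow> J0" by (simp add: LIM_zero_cancel)
    qed
    ultimately have "(LINT z|?D. (norm (g z))\<^sup>2) = (LINT z|?D. q z) - J0" by (rule LIMSEQ_unique)
    then show ?thesis by (simp add: J0_def)
  qed
  ultimately show ?thesis using g glim that unfolding G_def Q_def by blast
qed

subsection \<open>Lower and upper bounds of the action\<close>

text \<open>Countable additivity is dominated convergence of the integrals over finite
  unions.\<close>

lemma signed_measure_density: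
  assumes f: "integrable M (f :: 'a \<Rightarrow> real)" and setsN: "sets N = sets M"
  shows "signed_measure N (\<lambda>A. LINT z:A|M. f z)"
  unfolding signed_measure_def
proof (intro conjI allI impI)
  show "(LINT z:{}|M. f z) = 0" by (simp add: set_lebesgue_integral_def)
  fix A :: "nat \<Rightarrow> 'a set" assume A: "range A \<subseteq> sets N \<and> disjoint_family A"
  then have As [measurable]: "A i \<in> sets M" for i using setsN by auto
  have fi: "integrable M (\<lambda>z. indicator B z *\<^sub>R f z)" if "B \<in> sets M" for B by (rule integrable_mult_indicator[OF that f])
  have sum: "(\<Sum>i<n. LINT z:A i|M. f z) = (LINT z|M. indicator (\<Union>i<n. A i) z *\<^sub>R f z)" for n
  proof -
    have "(\<Sum>i<n. LINT z:A i|M. f z) = (LINT z|M. (\<Sum>i<n. indicator (A i) z *\<^sub>R f z))"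
      unfolding set_lebesgue_integral_def by (rule Bochner_Integration.integral_sum[symmetric]) (rule fi[OF As])
    also have "(\<lambda>z. \<Sum>i<n. indicator (A i) z *\<^sub>R f z) = (\<lambda>z. indicator (\<Union>i<n. A i) z *\<^sub>R f z)"
    proof
      fix z
      have "indicator (\<Union>i<n. A i) z = (\<Sum>i<n. indicator (A i) z :: real)"
        using A by (intro indicator_UN_disjoint) (auto simp: disjoint_family_on_def)
      then show "(\<Sum>i<n. indicator (A i) z *\<^sub>R f z) = indicator (\<Union>i<n. A i) z *\<^sub>R f z" by (simp add: sum_distrib_right)
    qed
    finally show ?thesis .
  qed
  have "(\<lambda>n. LINT z|M. indicator (\<Union>i<n. A i) z *\<^sub>R f z) \<longlonglongrightarrow> (LINT z|M. indicator (\<Union>i. A i) z *\<^sub>R f z)"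
  proof (rule integral_dominated_convergence[where w="\<lambda>z. norm (f z)"])
    show "AE z in M. (\<lambda>n. indicator (\<Union>i<n. A i) z *\<^sub>R f z) \<longlonglongrightarrow> indicator (\<Union>i. A i) z *\<^sub>R f z"
      by (intro AE_I2 tendsto_scaleR tendsto_const LIMSEQ_indicator_UN)
  qed (use f in \<open>auto simp: indicator_def\<close>)
  then show "(\<lambda>i. LINT z:A i|M. f z) sums (LINT z:(\<Union>i. A i)|M. f z)"
    unfolding sums_def sum by (simp add: set_lebesgue_integral_def)
qed

lemma energy_eq:
  assumes "in_L2 M f"
  shows "enn2ereal (\<integral>\<^sup>+z. ennreal ((norm (f z))\<^sup>2 / 2) \<partial>M) = ereal ((LINT z|M. (norm (f z))\<^sup>2) / 2)"
proof -
  have "(\<integral>\<^sup>+z. ennreal ((norm (f z))\<^sup>2 / 2) \<partial>M) = ennreal (LINT z|M. (norm (f z))\<^sup>2 / 2)"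
    using in_L2_integrable[OF assms] by (intro nn_integral_eq_integral) auto
  then show ?thesis by (simp add: enn2ereal_ennreal)
qed

text \<open>One admissible pair is inserted in the supremum. The field energy is finite, so the
  comparison becomes one between real numbers.\<close>

lemma total_action_lower:
  fixes v :: "real \<times> (real^'n) \<Rightarrow> real^'n"
  assumes v: "integrable M v" "finite_measure M" "sets M = sets (D_borel T)" "\<And>A. A \<in> sets M \<Longrightarrow> J A = (LINT z:A|M. v z)"
    and P: "in_L2 (D_leb T) (weak_grad T p)"
    and c: "cont_D T c" and m: "cont_D T m" and cm: "\<And>z. z \<in> spacetime T \<Longrightarrow> c z + (norm (m z))\<^sup>2 / 2 \<le> 0"
  shows "ereal ((LINT z|M. c z + v z \<bullet> m z) + (LINT z|D_leb T. (norm (weak_grad T p z))\<^sup>2) / 2) \<le> total_action T M J p"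
proof -
  note d = integral_dot_density[OF v(1,3,4,2) m]
  have "ereal ((LINT z|M. c z) + integral_dot T m J) \<le> (SUP (c, m)\<in>{(c, m). cont_D T c \<and> cont_D T m \<and>
                     (\<forall>z\<in>spacetime T. c z + (norm (m z))\<^sup>2 / 2 \<le> 0)}.
        ereal ((LINT z|M. c z) + integral_dot T m J))"
    by (rule SUP_upper2[of "(c, m)"]) (use c m cm in auto)
  moreover have "(LINT z|M. c z) + integral_dot T m J = (LINT z|M. c z + v z \<bullet> m z)"
    using d integrable_cont_D[OF c v(2,3)] by simp
  ultimately show ?thesis
    unfolding total_action_def energy_eq[OF P] plus_ereal.simps(1)[symmetric] by (intro add_mono) simp_all
qed

text \<open>Pointwise, \<open>c + v \<bullet> m\<close> is at most
  \<open>v \<bullet> m - |m|^2 / 2\<close>, and completing the square bounds this by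
  \<open>|v|^2 / 2\<close>. This easy half of the duality is enough to price the candidate.\<close>

lemma total_action_upper:
  fixes v :: "real \<times> (real^'n) \<Rightarrow> real^'n"
  assumes v: "in_L2 M v" "finite_measure M" "sets M = sets (D_borel T)" "\<And>A. A \<in> sets M \<Longrightarrow> J A = (LINT z:A|M. v z)"
    and P: "in_L2 (D_leb T) (weak_grad T p)"
  shows "total_action T M J p \<le> ereal ((LINT z|M. (norm (v z))\<^sup>2) / 2 + (LINT z|D_leb T. (norm (weak_grad T p z))\<^sup>2) / 2)"
proof -
  have spM: "space M = spacetime T" using sets_eq_imp_space_eq[OF v(3)] by simp
  have "(SUP (c, m)\<in>{(c, m). cont_D T c \<and> cont_D T m \<and>
                     (\<forall>z\<in>spacetime T. c z + (norm (m z))\<^sup>2 / 2 \<le> 0)}.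
        ereal ((LINT z|M. c z) + integral_dot T m J)) \<le> ereal ((LINT z|M. (norm (v z))\<^sup>2) / 2)"
  proof (rule SUP_least, clarify)
    fix c and m :: "real \<times> (real^'n) \<Rightarrow> real^'n"
    assume c: "cont_D T c" and m: "cont_D T m" and cm: "\<forall>z\<in>spacetime T. c z + (norm (m z))\<^sup>2 / 2 \<le> 0"
    note d = integral_dot_density[OF in_L2_L1[OF v(2,1)] v(3,4,2) m]
    have ci: "integrable M c" by (rule integrable_cont_D[OF c v(2,3)])
    have "(LINT z|M. c z) + integral_dot T m J = (LINT z|M. c z + v z \<bullet> m z)"
      using d ci by simp
    also have "\<dots> \<le> (LINT z|M. (norm (v z))\<^sup>2 / 2)"
    proof (rule integral_mono)
      fix z assume "z \<in> space M"
      then have "c z \<le> - ((norm (m z))\<^sup>2 / 2)" using cm spM by force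
      moreover have "0 \<le> (norm (v z - m z))\<^sup>2" by simp
      ultimately show "c z + v z \<bullet> m z \<le> (norm (v z))\<^sup>2 / 2"
        by (simp add: power2_norm_eq_inner inner_diff_left inner_diff_right inner_commute)
    qed (use ci d in_L2_integrable[OF v(1)] in auto)
    finally show "ereal ((LINT z|M. c z) + integral_dot T m J) \<le> ereal ((LINT z|M. (norm (v z))\<^sup>2) / 2)" by simp
  qed
  then show ?thesis
    unfolding total_action_def energy_eq[OF P] plus_ereal.simps(1)[symmetric] by (intro add_mono) simp_all
qed

subsection \<open>Mollification of the Hamilton-Jacobi inequality\<close>

lemma moll_inner:
  fixes g :: "real \<times> (real^'n) \<Rightarrow> real^'n"
  assumes T: "T > 0" and g: "\<And>i. integrable (D_leb T) (\<lambda>z. g z $ i)"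
  shows "moll T k (\<lambda>z. a \<bullet> g z) w = (\<Sum>i\<in>UNIV. a $ i * moll T k (\<lambda>z. g z $ i) w)"
  unfolding moll_def conv_def inner_vec_def sum_distrib_right
  using integrable_mult_bump[OF T g]
  by (subst Bochner_Integration.integral_sum) (simp_all add: mult.assoc)

text \<open>The square \<open>|\<nabla>\<psi>|\<^sup>2 / 2\<close> is the supremum of the affine functions \<open>a \<bullet> \<nabla>\<psi> - |a|\<^sup>2 / 2\<close>, so it only decreases
  under averaging.\<close>

lemma moll_Hamilton_Jacobi:
  fixes \<psi> h q :: "real \<times> (real^'n) \<Rightarrow> real" and g :: "real \<times> (real^'n) \<Rightarrow> real^'n"
  assumes T: "T > 0" and \<psi>: "integrable (D_leb T) \<psi>"
    and h: "has_weak_dt T \<psi> h" "h \<in> borel_measurable (D_leb T)" "AE z in D_leb T. \<bar>h z\<bar> \<le> C"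
    and g: "has_weak_grad T \<psi> g" "integrable (D_leb T) g" and q: "integrable (D_leb T) q"
    and HJ: "AE z in D_leb T. h z + (norm (g z))\<^sup>2 / 2 + q z \<le> 0" and t: "t \<in> {0..T}"
  shows "d_t (moll T k \<psi>) (t, x) + (norm (grad_x (moll T k \<psi>) (t, x)))\<^sup>2 / 2 + moll T k q (t, x) \<le> (1 - dilation k) * C"
proof -
  \<comment> \<open>The slope of the affine minorant is frozen at the mollified gradient of the very
    point, where the averaged minorant attains \<open>|a|^2 / 2\<close>.\<close>
  define a where "a = grad_x (moll T k \<psi>) (t, x)"
  have ai: "a $ i = moll T k (\<lambda>z. g z $ i) (t, x)" for i unfolding a_def by (rule grad_x_moll[OF T \<psi> g(1) t])
  have gi: "integrable (D_leb T) (\<lambda>z. g z $ i)" for i by (rule integrable_vec_nth[OF g(2)])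
  have hi: "integrable (D_leb T) h" by (rule integrable_D_bounded[OF T h(2)]) (use h(3) in simp)
  have ag: "integrable (D_leb T) (\<lambda>z. a \<bullet> g z)" using g(2) by simp
  have ci: "integrable (D_leb T) (\<lambda>_. c)" for c :: real by (rule integrable_D_bounded[OF T, of _ "\<bar>c\<bar>"]) auto
  have "moll T k (\<lambda>z. (h z + q z) + (a \<bullet> g z - (norm a)\<^sup>2 / 2)) (t, x) \<le> moll T k (\<lambda>_. 0) (t, x)"
  proof (rule moll_mono[OF T _ ci])
    show "integrable (D_leb T) (\<lambda>z. (h z + q z) + (a \<bullet> g z - (norm a)\<^sup>2 / 2))"
      by (intro Bochner_Integration.integrable_add Bochner_Integration.integrable_diff hi q ag ci)
    show "AE z in D_leb T. (h z + q z) + (a \<bullet> g z - (norm a)\<^sup>2 / 2) \<le> 0"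
      using HJ
    proof eventually_elim
      case (elim z)
      have "0 \<le> (norm (a - g z))\<^sup>2" by simp
      then have "a \<bullet> g z - (norm a)\<^sup>2 / 2 \<le> (norm (g z))\<^sup>2 / 2"
        by (simp add: power2_norm_eq_inner inner_diff_left inner_diff_right inner_commute)
      then show ?case using elim by linarith
    qed
  qed
  also have "moll T k (\<lambda>z. (h z + q z) + (a \<bullet> g z - (norm a)\<^sup>2 / 2)) (t, x)
      = moll T k h (t, x) + moll T k q (t, x) + (a \<bullet> a - (norm a)\<^sup>2 / 2)"
  proof -
    have "moll T k (\<lambda>z. a \<bullet> g z) (t, x) = a \<bullet> a"
      unfolding moll_inner[OF T gi] by (simp add: inner_vec_def ai)
    then show ?thesis
      using moll_add(1)[OF T Bochner_Integration.integrable_add[OF hi q] Bochner_Integration.integrable_diff[OF ag ci]]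
        moll_add(1)[OF T hi q] moll_add(2)[OF T ag ci] by (simp add: moll_const[OF T t])
  qed
  finally have 1: "moll T k h (t, x) + moll T k q (t, x) + (norm a)\<^sup>2 / 2 \<le> 0"
    by (simp add: power2_norm_eq_inner moll_const[OF T t])
  \<comment> \<open>The contraction of time leaves the fraction \<open>1 - dilation k\<close> of the
    mollified time derivative unmatched; its size is controlled by the bound on
    \<open>h\<close>.\<close>
  have "d_t (moll T k \<psi>) (t, x) = moll T k h (t, x) - (1 - dilation k) * moll T k h (t, x)"
    by (simp add: d_t_moll[OF T \<psi> h(1) t] algebra_simps)
  also have "\<dots> \<le> moll T k h (t, x) + (1 - dilation k) * C"
  proof -
    have "- moll T k h (t, x) \<le> C" using moll_bounded[OF T h(2,3) t, of k x] by linarith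
    from mult_left_mono[OF this, of "1 - dilation k"] dilation_bounds(2)[of k] show ?thesis by simp
  qed
  finally show ?thesis using 1 by (simp add: a_def)
qed

lemma prob_in_LpD: "prob_in_Lp s \<mu> \<Longrightarrow> prob_space \<mu>" "prob_in_Lp s \<mu> \<Longrightarrow> sets \<mu> = sets torus_borel"
  by (auto simp: prob_in_Lp_def sets_torus_leb)

theorem theorem7p1:
  fixes T :: real
    and \<rho>0 \<rho>T :: "(real^'n) measure"
    and \<rho> :: "(real \<times> (real^'n)) measure"
    and J :: "(real \<times> (real^'n)) set \<Rightarrow> real^'n"
    and p \<phi> \<psi> dt\<psi> r q :: "real \<times> (real^'n) \<Rightarrow> real"
    and grad\<phi> grad\<psi> :: "real \<times> (real^'n) \<Rightarrow> real^'n"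
  assumes T: "T > 0"
    and data0: "prob_in_Lp (2 * real CARD('n) / (real CARD('n) + 2)) \<rho>0"
    and dataT: "prob_in_Lp (2 * real CARD('n) / (real CARD('n) + 2)) \<rho>T"
    and minimizer: "solves_P T \<rho>0 \<rho>T \<rho> J p"
    and potential: "loc_L2_H1 T \<phi> grad\<phi>"
    and velocity: "has_velocity \<rho> J grad\<phi>"
    and psi: "in_W1inf T \<psi> dt\<psi> grad\<psi>"
    and r_space: "in_L2_Hm1 T r" "in_Linf_L1 T r"
    and r_nonneg: "AE z in D_leb T. 0 \<le> r z"
    and q: "in_Linf (D_leb T) q"
    and HJ_le: "AE z in D_leb T. dt\<psi> z + (norm (grad\<psi> z))\<^sup>2 / 2 + q z \<le> 0"
    and HJ_eq: "AE z in D_leb T. r z * (dt\<psi> z + (norm (grad\<psi> z))\<^sup>2 / 2 + q z) = 0"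
    and continuity: "weak_continuity T r grad\<psi>"
    and traces: "has_traces T r \<rho>0 \<rho>T"
    and poisson_q: "poisson T q (\<lambda>\<eta>. LINT z|D_leb T. r z * \<eta> z)"
  shows "\<rho> = density (D_leb T) (\<lambda>z. ennreal (r z)) \<and> (AE z in \<rho>. grad\<phi> z = grad\<psi> z)"
proof -
  let ?D = "D_leb T :: (real \<times> (real^'n)) measure"
  define R where "R = density ?D (\<lambda>z. ennreal (r z))"
  have T': "T \<ge> 0" using T by simp
  note fD = finite_measure_D_leb[OF T', where 'n='n]
  have ri: "integrable ?D r" by (rule integrable_in_Linf_L1[OF r_space(2)])
  have rm: "r \<in> borel_measurable ?D" using ri by auto
  note LR = integral_density_D[OF rm r_nonneg, folded R_def]
  have finR: "finite_measure R" unfolding R_def by (rule finite_density_D[OF ri])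
  have setsR: "sets R = sets (D_borel T)" by (simp add: R_def sets_D_leb)
  have endsR: "AE z in R. 0 < fst z \<and> fst z < T"
    unfolding R_def by (subst AE_density) (use D_leb_ends[OF T] rm in auto)

  \<comment> \<open>Regularity of the candidate potentials\<close>
  obtain C\<psi> where \<psi>m: "\<psi> \<in> borel_measurable ?D" and C\<psi>: "AE z in ?D. norm (\<psi> z) \<le> C\<psi>"
    using psi by (auto simp: in_W1inf_def in_Linf_def)
  have \<psi>i: "integrable ?D \<psi>" by (rule integrable_D_bounded[OF T \<psi>m C\<psi>])
  obtain Ch where hm: "dt\<psi> \<in> borel_measurable ?D" and Ch: "AE z in ?D. \<bar>dt\<psi> z\<bar> \<le> Ch"
    using psi by (auto simp: in_W1inf_def in_Linf_def)
  obtain Cg where gm: "grad\<psi> \<in> borel_measurable ?D" and Cg: "AE z in ?D. norm (grad\<psi> z) \<le> Cg"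
    using psi by (auto simp: in_W1inf_def in_Linf_def)
  obtain Cq where qm: "q \<in> borel_measurable ?D" and Cq: "AE z in ?D. \<bar>q z\<bar> \<le> Cq"
    using q by (auto simp: in_Linf_def)
  have h\<psi>: "has_weak_dt T \<psi> dt\<psi>" and g\<psi>: "has_weak_grad T \<psi> grad\<psi>" using psi by (auto simp: in_W1inf_def)
  have gi: "integrable ?D grad\<psi>" by (rule integrable_D_bounded[OF T gm Cg])
  have qi: "integrable ?D q" by (rule integrable_D_bounded[OF T qm]) (use Cq in simp)
  have gim: "(\<lambda>z. grad\<psi> z $ i) \<in> borel_measurable ?D" for i using integrable_vec_nth[OF gi] by auto
  have Cgi: "AE z in ?D. \<bar>grad\<psi> z $ i\<bar> \<le> Cg" for i
    using Cg by eventually_elim (use component_le_norm_cart order_trans in blast)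
  \<comment> \<open>Gives the candidate finite field energy, which admissibility demands, and the
    identity for \<open>r q\<close> that closes the square at the end.\<close>
  obtain g where g: "has_weak_grad T q g" "in_L2 ?D g"
    "(\<lambda>k. LINT z|?D. (norm (grad_x (moll T k q) z - g z))\<^sup>2) \<longlonglongrightarrow> 0"
    and rq: "(LINT z|?D. r z * q z) = (LINT z|?D. q z) - (LINT z|?D. (norm (g z))\<^sup>2)"
    by (rule bounded_potential_gradient[OF T qm Cq ri poisson_q]) (rule that)
  note wq = weak_grad_L2[OF T g(1,2)]
  have gR: "in_L2 R grad\<psi>"
  proof (rule in_L2_bounded[OF finR])
    show "grad\<psi> \<in> borel_measurable R" using gm by (simp add: R_def)
    show "AE z in R. norm (grad\<psi> z) \<le> Cg" unfolding R_def by (subst AE_density) (use Cg rm in auto)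
  qed
  note gRi = in_L2_L1[OF finR gR]

  \<comment> \<open>Curve, velocity and field of the minimizer\<close>
  have adm: "admissible T \<rho>0 \<rho>T \<rho> J p" using minimizer by (simp add: solves_P_def)
  obtain \<mu> where \<mu>: "curve T \<mu>" "\<rho> = curve_measure T \<mu>" "\<mu> 0 = \<rho>0" "\<mu> T = \<rho>T"
    using adm by (auto simp: admissible_def wstar_curve_iff[OF T'])
  have fin\<rho>: "finite_measure \<rho>" and sets\<rho>: "sets \<rho> = sets (D_borel T)" and ends\<rho>: "AE z in \<rho>. 0 < fst z \<and> fst z < T"
    unfolding \<mu>(2) by (rule finite_curve_measure[OF \<mu>(1) T'] sets_curve_measure[OF \<mu>(1) T'] curve_measure_ends[OF \<mu>(1) T])+
  obtain P0 where P0: "has_weak_grad T p P0" "in_L2 ?D P0" using adm by (auto simp: admissible_def)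
  define P where "P = weak_grad T p"
  have P: "has_weak_grad T p P" "in_L2 ?D P" using weak_grad_L2[OF T P0] by (simp_all add: P_def)
  have v2: "in_L2 \<rho> grad\<phi>" and vJ: "\<And>A. A \<in> sets \<rho> \<Longrightarrow> J A = (LINT z:A|\<rho>. grad\<phi> z)"
    using velocity by (auto simp: has_velocity_def)
  note vi = in_L2_L1[OF fin\<rho> v2]
  have cont\<rho>: "(LINT z|\<rho>. d_t \<eta> z + grad\<phi> z \<bullet> grad_x \<eta> z) = 0" if \<eta>: "test_fun T \<eta>" for \<eta>
  proof -
    note sp = test_fun_smooth_periodic[OF \<eta>]
    note d = integral_dot_density[OF vi sets\<rho> vJ fin\<rho> cont_D_grad[OF sp]]
    have "(LINT z|\<rho>. d_t \<eta> z) + integral_dot T (grad_x \<eta>) J = 0" using adm \<eta> by (simp add: admissible_def)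
    then show ?thesis
      using d integrable_cont_D[OF cont_D_smooth_periodic[OF smooth_periodic_d_t[OF sp]] fin\<rho> sets\<rho>] by simp
  qed
  have poi\<rho>: "poisson T p (\<lambda>\<eta>. LINT z|\<rho>. \<eta> z)" using adm by (simp add: admissible_def)

  \<comment> \<open>Admissibility and cost of the candidate\<close>
  define JR where "JR A = (LINT z:A|R. grad\<psi> z)" for A
  obtain \<nu> where \<nu>: "curve T \<nu>" "curve_measure T \<nu> = R" "\<nu> 0 = \<rho>0" "\<nu> T = \<rho>T"
    using density_curve[OF T r_space(2) r_nonneg continuity traces prob_in_LpD[OF data0] prob_in_LpD[OF dataT]]
    unfolding R_def by blast
  have contR: "(LINT z|R. d_t \<eta> z + grad\<psi> z \<bullet> grad_x \<eta> z) = 0" if \<eta>: "test_fun T \<eta>" for \<eta>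
  proof -
    note sp = test_fun_smooth_periodic[OF \<eta>]
    have "(\<lambda>z. d_t \<eta> z + grad\<psi> z \<bullet> grad_x \<eta> z) \<in> borel_measurable ?D"
      using cont_D_measurable(2)[OF cont_D_smooth_periodic[OF smooth_periodic_d_t[OF sp]]] cont_D_measurable(2)[OF cont_D_grad[OF sp]] gm
      by measurable
    from LR(1)[OF this] show ?thesis using continuity \<eta> by (simp add: weak_continuity_def)
  qed
  have poiR: "poisson T q (\<lambda>\<eta>. LINT z|R. \<eta> z)"
    unfolding poisson_def
  proof (intro allI impI)
    fix \<eta> :: "real \<times> (real^'n) \<Rightarrow> real" assume \<eta>: "test_fun T \<eta>"
    show "(LINT z|?D. q z * lap_x \<eta> z) = (LINT z|R. \<eta> z) - (LINT z|?D. \<eta> z)"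
      using poisson_q \<eta> LR(1)[OF cont_D_measurable(2)[OF cont_D_test_fun[OF \<eta>]]] by (simp add: poisson_def)
  qed
  have admR: "admissible T \<rho>0 \<rho>T R JR q"
    unfolding admissible_def
  proof (intro conjI allI impI)
    show "\<exists>\<mu>. wstar_curve T R \<mu> \<and> \<mu> 0 = \<rho>0 \<and> \<mu> T = \<rho>T" using \<nu> wstar_curve_iff[OF T'] by blast
    have "signed_measure (D_borel T) (\<lambda>A. JR A $ i)" for i
    proof -
      have "signed_measure (D_borel T) (\<lambda>A. LINT z:A|R. grad\<psi> z $ i)"
        by (rule signed_measure_density[OF integrable_vec_nth[OF gRi] setsR[symmetric]])
      moreover have "(LINT z:A|R. grad\<psi> z $ i) = JR A $ i" if "A \<in> sets (D_borel T)" for A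
        using set_integral_vec_nth[OF gRi, of A i] that setsR by (simp add: JR_def)
      moreover have "(\<Union>k. A k) \<in> sets (D_borel T)" if "range A \<subseteq> sets (D_borel T)" for A :: "nat \<Rightarrow> (real \<times> (real^'n)) set"
        using that by (rule sets.countable_UN)
      ultimately show ?thesis
        unfolding signed_measure_def by (simp add: range_subsetD)
    qed
    then show "vector_measure_D T JR" by (simp add: vector_measure_D_def)
    show "\<exists>g. has_weak_grad T q g \<and> in_L2 (D_leb T) g" using g by blast
    show "poisson T q (integral\<^sup>L R)" using poiR by simp
    fix \<eta> :: "real \<times> (real^'n) \<Rightarrow> real" assume \<eta>: "test_fun T \<eta>"
    note sp = test_fun_smooth_periodic[OF \<eta>]
    note d = integral_dot_density[OF gRi setsR JR_def finR cont_D_grad[OF sp]]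
    show "(LINT z|R. d_t \<eta> z) + integral_dot T (grad_x \<eta>) JR = 0"
      using d contR[OF \<eta>] integrable_cont_D[OF cont_D_smooth_periodic[OF smooth_periodic_d_t[OF sp]] finR setsR] by simp
  qed
  define E where "E = (LINT z|R. (norm (grad\<psi> z))\<^sup>2) / 2 + (LINT z|?D. (norm (g z))\<^sup>2) / 2"
  \<comment> \<open>The only place where minimality is used; apart from it, only admissibility of
    the minimizer enters.\<close>
  have "total_action T \<rho> J p \<le> total_action T R JR q" using minimizer admR by (simp add: solves_P_def)
  also have "\<dots> \<le> ereal ((LINT z|R. (norm (grad\<psi> z))\<^sup>2) / 2 + (LINT z|?D. (norm (weak_grad T q z))\<^sup>2) / 2)"
    by (rule total_action_upper[OF gR finR setsR JR_def wq(2)])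
  also have "(LINT z|?D. (norm (weak_grad T q z))\<^sup>2) = (LINT z|?D. (norm (g z))\<^sup>2)"
    using wq g by (intro Bochner_Integration.integral_cong_AE) (auto simp: in_L2_def elim!: eventually_mono)
  finally have upper: "total_action T \<rho> J p \<le> ereal E" by (simp add: E_def)

  \<comment> \<open>The dual field is \<open>\<nabla>\<Psi> k + s w\<close>: at \<open>s = 0\<close> it gives \<open>\<nabla>p = \<nabla>q\<close>, and letting \<open>s\<close> vary then identifies the velocity.\<close>
  define \<Psi> where "\<Psi> k = moll T k \<psi>" for k
  define Q where "Q k = moll T k q" for k
  define B where "B k = (LINT z|\<rho>. d_t (\<Psi> k) z + grad\<phi> z \<bullet> grad_x (\<Psi> k) z)" for k
  have \<Psi>: "smooth_periodic (\<Psi> k)" and Q: "smooth_periodic (Q k)" for k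
    unfolding \<Psi>_def Q_def by (rule smooth_periodic_moll[OF T \<psi>i] smooth_periodic_moll[OF T qi])+
  have HJk: "d_t (\<Psi> k) z + (norm (grad_x (\<Psi> k) z))\<^sup>2 / 2 + Q k z \<le> (1 - dilation k) * Ch" if "z \<in> spacetime T" for k z
    using moll_Hamilton_Jacobi[OF T \<psi>i h\<psi> hm Ch g\<psi> gi qi HJ_le, of "fst z" k "snd z"] that
    by (auto simp: \<Psi>_def Q_def spacetime_def)
  have sp\<rho>: "space \<rho> = spacetime T" using sets_eq_imp_space_eq[OF sets\<rho>] by simp
  have main: "B k + (LINT z|\<rho>. Q k z) - (1 - dilation k) * Ch * T
      + s * ((LINT z|\<rho>. grad\<phi> z \<bullet> w z) - (LINT z|\<rho>. grad_x (\<Psi> k) z \<bullet> w z))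
      - s\<^sup>2 / 2 * (LINT z|\<rho>. (norm (w z))\<^sup>2) + (LINT z|?D. (norm (P z))\<^sup>2) / 2 \<le> E"
    if w: "cont_D T w" for w :: "real \<times> (real^'n) \<Rightarrow> real^'n" and k and s :: real
  proof -
    define m where "m z = grad_x (\<Psi> k) z + s *\<^sub>R w z" for z
    \<comment> \<open>The largest \<open>c\<close> that the constraint allows for the given
      \<open>m\<close>.\<close>
    define c where "c z = - ((norm (m z))\<^sup>2 / 2)" for z
    have m: "cont_D T m"
      using cont_D_grad[OF \<Psi>[of k], of T] w unfolding m_def[abs_def] cont_D_def by (auto intro!: continuous_intros simp: zperiodic_def)
    have c: "cont_D T c"
      using m unfolding c_def[abs_def] cont_D_def by (auto intro!: continuous_intros simp: zperiodic_def)
    have w2: "cont_D T (\<lambda>z. (norm (w z))\<^sup>2)" and gw: "cont_D T (\<lambda>z. grad_x (\<Psi> k) z \<bullet> w z)"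
      using cont_D_grad[OF \<Psi>[of k], of T] w unfolding cont_D_def by (auto intro!: continuous_intros simp: zperiodic_def)
    note i1 = integrable_cont_D[OF cont_D_smooth_periodic[OF smooth_periodic_d_t[OF \<Psi>[of k]]] fin\<rho> sets\<rho>]
    note i2 = integral_dot_density(2)[OF vi sets\<rho> vJ fin\<rho> cont_D_grad[OF \<Psi>[of k]]]
    note i3 = integrable_cont_D[OF cont_D_smooth_periodic[OF Q[of k]] fin\<rho> sets\<rho>]
    note i4 = integral_dot_density(2)[OF vi sets\<rho> vJ fin\<rho> w]
    note i5 = integrable_cont_D[OF gw fin\<rho> sets\<rho>] integrable_cont_D[OF w2 fin\<rho> sets\<rho>]
    note i6 = finite_measure.integrable_const[OF fin\<rho>, of "(1 - dilation k) * Ch"]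
    have i7: "integrable \<rho> (\<lambda>z. c z + grad\<phi> z \<bullet> m z)"
      using integrable_cont_D[OF c fin\<rho> sets\<rho>] integral_dot_density(2)[OF vi sets\<rho> vJ fin\<rho> m] by simp
    have mass: "measure \<rho> (space \<rho>) = T"
      using emeasure_curve_measure_space[OF \<mu>(1) T'] T by (simp add: measure_def sp\<rho>) (simp add: \<mu>(2))
    have "B k + (LINT z|\<rho>. Q k z) - (1 - dilation k) * Ch * T
        + s * ((LINT z|\<rho>. grad\<phi> z \<bullet> w z) - (LINT z|\<rho>. grad_x (\<Psi> k) z \<bullet> w z))
        - s\<^sup>2 / 2 * (LINT z|\<rho>. (norm (w z))\<^sup>2)
      = (LINT z|\<rho>. (d_t (\<Psi> k) z + grad\<phi> z \<bullet> grad_x (\<Psi> k) z) + Q k z - (1 - dilation k) * Ch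
          + s * (grad\<phi> z \<bullet> w z - grad_x (\<Psi> k) z \<bullet> w z) - s\<^sup>2 / 2 * (norm (w z))\<^sup>2)"
      unfolding B_def using i1 i2 i3 i4 i5 i6 by (simp add: mass)
    \<comment> \<open>The square of \<open>m\<close> is expanded and \<open>HJk\<close> replaces
      \<open>- |\<nabla>(\<Psi> k)|^2 / 2\<close>. It holds at every point, which is essential since
      \<open>\<rho>\<close> may charge Lebesgue null sets.\<close>
    also have "\<dots> \<le> (LINT z|\<rho>. c z + grad\<phi> z \<bullet> m z)"
    proof (rule integral_mono)
      fix z assume "z \<in> space \<rho>"
      then have "d_t (\<Psi> k) z + (norm (grad_x (\<Psi> k) z))\<^sup>2 / 2 + Q k z \<le> (1 - dilation k) * Ch" by (intro HJk) (simp add: sp\<rho>)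
      moreover have "c z + grad\<phi> z \<bullet> m z = grad\<phi> z \<bullet> grad_x (\<Psi> k) z - (norm (grad_x (\<Psi> k) z))\<^sup>2 / 2
          + s * (grad\<phi> z \<bullet> w z - grad_x (\<Psi> k) z \<bullet> w z) - s\<^sup>2 / 2 * (norm (w z))\<^sup>2"
        unfolding c_def m_def power2_norm_eq_inner
        by (simp add: inner_add_left inner_add_right inner_commute algebra_simps power2_eq_square add_divide_distrib)
      ultimately show "(d_t (\<Psi> k) z + grad\<phi> z \<bullet> grad_x (\<Psi> k) z) + Q k z - (1 - dilation k) * Ch
          + s * (grad\<phi> z \<bullet> w z - grad_x (\<Psi> k) z \<bullet> w z) - s\<^sup>2 / 2 * (norm (w z))\<^sup>2 \<le> c z + grad\<phi> z \<bullet> m z"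
        by linarith
    qed (use i1 i2 i3 i4 i5 i6 i7 in auto)
    finally have le: "B k + (LINT z|\<rho>. Q k z) - (1 - dilation k) * Ch * T
        + s * ((LINT z|\<rho>. grad\<phi> z \<bullet> w z) - (LINT z|\<rho>. grad_x (\<Psi> k) z \<bullet> w z))
        - s\<^sup>2 / 2 * (LINT z|\<rho>. (norm (w z))\<^sup>2) \<le> (LINT z|\<rho>. c z + grad\<phi> z \<bullet> m z)" .
    have "ereal ((LINT z|\<rho>. c z + grad\<phi> z \<bullet> m z) + (LINT z|?D. (norm (weak_grad T p z))\<^sup>2) / 2) \<le> total_action T \<rho> J p"
      by (rule total_action_lower[OF vi fin\<rho> sets\<rho> vJ _ c m]) (use P in \<open>auto simp: P_def c_def\<close>)
    then have "(LINT z|\<rho>. c z + grad\<phi> z \<bullet> m z) + (LINT z|?D. (norm (P z))\<^sup>2) / 2 \<le> E"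
      using upper unfolding P_def by (meson ereal_less_eq(3) order_trans)
    with le show ?thesis by linarith
  qed

  \<comment> \<open>Both curves have the same end points, so \<open>B k\<close> can be computed along either of them.\<close>
  have BR: "B k = (LINT z|R. d_t (\<Psi> k) z + grad\<psi> z \<bullet> grad_x (\<Psi> k) z)" for k
  proof -
    have "B k = (LINT x|\<mu> T. \<Psi> k (T, x)) - (LINT x|\<mu> 0. \<Psi> k (0, x))"
      unfolding B_def \<mu>(2)
      by (rule continuity_boundary[OF \<mu>(1) T _ _ \<Psi>]) (use vi cont\<rho> in \<open>simp_all flip: \<mu>(2)\<close>)
    also have "\<dots> = (LINT x|\<nu> T. \<Psi> k (T, x)) - (LINT x|\<nu> 0. \<Psi> k (0, x))" by (simp add: \<mu> \<nu>)
    also have "\<dots> = (LINT z|R. d_t (\<Psi> k) z + grad\<psi> z \<bullet> grad_x (\<Psi> k) z)"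
      unfolding \<nu>(2)[symmetric]
      by (rule continuity_boundary[OF \<nu>(1) T _ _ \<Psi>, symmetric]) (use gRi contR in \<open>simp_all add: \<nu>(2)\<close>)
    finally show ?thesis .
  qed

  \<comment> \<open>Passage to the limit in the mollification\<close>
  have rgi: "integrable ?D (\<lambda>z. r z * f z)" if "f \<in> borel_measurable ?D" "AE z in ?D. \<bar>f z\<bar> \<le> C" for f C
    by (rule moll_weak_tendsto(2)[OF T that ri])
  have grad\<Psi>: "grad_x (\<Psi> k) z $ i = moll T k (\<lambda>z. grad\<psi> z $ i) z" if "z \<in> spacetime T" for k z i
    using grad_x_moll[OF T \<psi>i g\<psi>, of "fst z" k "snd z" i] that by (auto simp: \<Psi>_def spacetime_def)
  have Gm: "grad_x (\<Psi> k) \<in> borel_measurable ?D" for k by (rule cont_D_measurable(2)[OF cont_D_grad[OF \<Psi>]])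
  \<comment> \<open>Coordinatewise, the weight \<open>r * u_i\<close> is merely integrable while the
    components of \<open>\<nabla>(\<Psi> k)\<close> mollify bounded functions, precisely the setting
    of \<open>moll_weak_tendsto\<close>.\<close>
  have inner_lim: "(\<lambda>k. LINT z|?D. r z * (u z \<bullet> grad_x (\<Psi> k) z)) \<longlonglongrightarrow> (LINT z|?D. r z * (u z \<bullet> grad\<psi> z))"
    and inner_int: "\<And>k. integrable ?D (\<lambda>z. r z * (u z \<bullet> grad_x (\<Psi> k) z))"
    if u: "\<And>i. (\<lambda>z. u z $ i) \<in> borel_measurable ?D" "\<And>i. AE z in ?D. \<bar>u z $ i\<bar> \<le> C" for u :: "real \<times> (real^'n) \<Rightarrow> real^'n" and C
  proof -
    note ru = rgi[OF u]
    note mw = moll_weak_tendsto[OF T gim Cgi ru]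
    have e: "(LINT z|?D. r z * (u z \<bullet> grad_x (\<Psi> k) z)) = (\<Sum>i\<in>UNIV. LINT z|?D. (r z * u z $ i) * moll T k (\<lambda>z. grad\<psi> z $ i) z)" for k
    proof -
      have "(LINT z|?D. r z * (u z \<bullet> grad_x (\<Psi> k) z)) = (LINT z|?D. (\<Sum>i\<in>UNIV. (r z * u z $ i) * moll T k (\<lambda>z. grad\<psi> z $ i) z))"
        by (rule Bochner_Integration.integral_cong) (auto simp: inner_vec_def grad\<Psi> sum_distrib_left mult.assoc)
      also have "\<dots> = (\<Sum>i\<in>UNIV. LINT z|?D. (r z * u z $ i) * moll T k (\<lambda>z. grad\<psi> z $ i) z)"
        by (rule Bochner_Integration.integral_sum) (rule mw(3))
      finally show ?thesis .
    qed
    show "integrable ?D (\<lambda>z. r z * (u z \<bullet> grad_x (\<Psi> k) z))" for k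
    proof -
      have "integrable ?D (\<lambda>z. \<Sum>i\<in>UNIV. (r z * u z $ i) * moll T k (\<lambda>z. grad\<psi> z $ i) z)"
        by (rule Bochner_Integration.integrable_sum) (rule mw(3))
      then show ?thesis
        by (rule Bochner_Integration.integrable_cong[THEN iffD1, rotated -1])
           (auto simp: inner_vec_def grad\<Psi> sum_distrib_left mult.assoc)
    qed
    have "(\<lambda>k. \<Sum>i\<in>UNIV. LINT z|?D. (r z * u z $ i) * moll T k (\<lambda>z. grad\<psi> z $ i) z) \<longlonglongrightarrow> (\<Sum>i\<in>UNIV. LINT z|?D. (r z * u z $ i) * grad\<psi> z $ i)"
      by (intro tendsto_sum mw(1))
    moreover have "(\<Sum>i\<in>UNIV. LINT z|?D. (r z * u z $ i) * grad\<psi> z $ i) = (LINT z|?D. r z * (u z \<bullet> grad\<psi> z))"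
    proof -
      have "(\<Sum>i\<in>UNIV. LINT z|?D. (r z * u z $ i) * grad\<psi> z $ i) = (LINT z|?D. (\<Sum>i\<in>UNIV. (r z * u z $ i) * grad\<psi> z $ i))"
        by (rule Bochner_Integration.integral_sum[symmetric]) (rule mw(2))
      then show ?thesis by (simp add: inner_vec_def sum_distrib_left mult.assoc)
    qed
    ultimately show "(\<lambda>k. LINT z|?D. r z * (u z \<bullet> grad_x (\<Psi> k) z)) \<longlonglongrightarrow> (LINT z|?D. r z * (u z \<bullet> grad\<psi> z))"
      by (simp add: e)
  qed
  have Blim: "B \<longlonglongrightarrow> (LINT z|R. (norm (grad\<psi> z))\<^sup>2) / 2 - (LINT z|?D. r z * q z)"
  proof -
    have dtm: "d_t (\<Psi> k) \<in> borel_measurable ?D" for k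
      by (rule cont_D_measurable(2)[OF cont_D_smooth_periodic[OF smooth_periodic_d_t[OF \<Psi>]]])
    have dtk: "d_t (\<Psi> k) z = dilation k * moll T k dt\<psi> z" if "z \<in> spacetime T" for k z
      using d_t_moll[OF T \<psi>i h\<psi>, of "fst z" k "snd z"] that by (auto simp: \<Psi>_def spacetime_def)
    note mh = moll_weak_tendsto[OF T hm Ch ri]
    have Bk: "B k = dilation k * (LINT z|?D. r z * moll T k dt\<psi> z) + (LINT z|?D. r z * (grad\<psi> z \<bullet> grad_x (\<Psi> k) z))" for k
    proof -
      have "B k = (LINT z|?D. r z * (d_t (\<Psi> k) z + grad\<psi> z \<bullet> grad_x (\<Psi> k) z))"
        unfolding BR by (rule LR(1)) (use dtm gm Gm in measurable)
      also have "\<dots> = (LINT z|?D. dilation k * (r z * moll T k dt\<psi> z) + r z * (grad\<psi> z \<bullet> grad_x (\<Psi> k) z))"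
        by (rule Bochner_Integration.integral_cong) (auto simp: dtk algebra_simps)
      also have "\<dots> = dilation k * (LINT z|?D. r z * moll T k dt\<psi> z) + (LINT z|?D. r z * (grad\<psi> z \<bullet> grad_x (\<Psi> k) z))"
        using mh(3)[of k] inner_int[OF gim Cgi, of k] by simp
      finally show ?thesis .
    qed
    have "B \<longlonglongrightarrow> 1 * (LINT z|?D. r z * dt\<psi> z) + (LINT z|?D. r z * (grad\<psi> z \<bullet> grad\<psi> z))"
      unfolding ext[of B, OF Bk]
      by (intro tendsto_add tendsto_mult dilation_tendsto mh(1) inner_lim[OF gim Cgi])
    moreover have "(LINT z|?D. r z * dt\<psi> z) + (LINT z|?D. r z * (grad\<psi> z \<bullet> grad\<psi> z))
        = (LINT z|R. (norm (grad\<psi> z))\<^sup>2) / 2 - (LINT z|?D. r z * q z)"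
    proof -
      have n2m: "(\<lambda>z. (norm (grad\<psi> z))\<^sup>2) \<in> borel_measurable ?D" using gm by measurable
      have n2: "integrable ?D (\<lambda>z. r z * (norm (grad\<psi> z))\<^sup>2)" using in_L2_integrable[OF gR] LR(2)[OF n2m] by simp
      \<comment> \<open>The complementarity relation converts \<open>r * dt\<psi>\<close> into minus
        one half of the kinetic density minus \<open>r * q\<close>. One half of the kinetic energy
        is left over.\<close>
      have "(LINT z|?D. r z * dt\<psi> z) = (LINT z|?D. - (r z * (norm (grad\<psi> z))\<^sup>2) / 2 - r z * q z)"
      proof (rule Bochner_Integration.integral_cong_AE)
        show "AE z in ?D. r z * dt\<psi> z = - (r z * (norm (grad\<psi> z))\<^sup>2) / 2 - r z * q z"
          using HJ_eq by eventually_elim (simp add: algebra_simps)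
      qed (use rm hm qm n2m in auto)
      also have "\<dots> = - (LINT z|?D. r z * (norm (grad\<psi> z))\<^sup>2) / 2 - (LINT z|?D. r z * q z)"
        using n2 rgi[OF qm Cq] by simp
      finally show ?thesis using LR(1)[OF n2m] by (simp add: power2_norm_eq_inner)
    qed
    ultimately show ?thesis by simp
  qed
  \<comment> \<open>Directly, \<open>Q k\<close> has no limit that could be integrated against
    \<open>\<rho>\<close>. The Poisson equation of \<open>p\<close> replaces this by a pairing of
    \<open>P\<close> with gradients that converge strongly in L2.\<close>
  have Qlim: "(\<lambda>k. LINT z|\<rho>. Q k z) \<longlonglongrightarrow> (LINT z|?D. q z) - (LINT z|?D. P z \<bullet> g z)"
  proof -
    have "(LINT z|\<rho>. Q k z) = (LINT z|?D. Q k z) - (LINT z|?D. P z \<bullet> grad_x (Q k) z)" for k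
      by (rule poisson_closed[OF T P fin\<rho> sets\<rho> ends\<rho> poi\<rho> Q])
    moreover have "(\<lambda>k. (LINT z|?D. Q k z) - (LINT z|?D. P z \<bullet> grad_x (Q k) z)) \<longlonglongrightarrow> (LINT z|?D. q z) - (LINT z|?D. P z \<bullet> g z)"
    proof (rule tendsto_diff)
      have "integrable ?D (\<lambda>_. 1 :: real)" by (rule finite_measure.integrable_const[OF fD])
      from moll_weak_tendsto(1)[OF T qm Cq this] show "(\<lambda>k. LINT z|?D. Q k z) \<longlonglongrightarrow> (LINT z|?D. q z)" by (simp add: Q_def)
      have G2: "in_L2 ?D (grad_x (Q k))" for k
      proof -
        obtain B where B: "\<And>t x. t \<in> {0..T} \<Longrightarrow> norm (grad_x (Q k) (t, x)) \<le> B" using cont_D_bounded[OF cont_D_grad[OF Q]] by metis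
        show ?thesis
        proof (rule in_L2_bounded[OF fD cont_D_measurable(2)[OF cont_D_grad[OF Q]]])
          show "AE z in ?D. norm (grad_x (Q k) z) \<le> B"
          proof (rule AE_I2)
            fix z assume "z \<in> space ?D"
            then have "z \<in> spacetime T" by simp
            then show "norm (grad_x (Q k) z) \<le> B" using B[of "fst z" "snd z"] by (auto simp: spacetime_def)
          qed
        qed
      qed
      have "(\<lambda>k. LINT z|?D. (grad_x (Q k) z - g z) \<bullet> P z) \<longlonglongrightarrow> 0"
        by (rule L2_tendsto_inner[OF in_L2_diff[OF G2 g(2)] P(2)]) (use g(3) in \<open>simp add: Q_def\<close>)
      moreover have "(LINT z|?D. (grad_x (Q k) z - g z) \<bullet> P z) = (LINT z|?D. P z \<bullet> grad_x (Q k) z) - (LINT z|?D. P z \<bullet> g z)" for k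
        using in_L2_inner[OF P(2) G2] in_L2_inner[OF P(2) g(2)] by (simp add: inner_diff_left inner_diff_right inner_commute)
      ultimately show "(\<lambda>k. LINT z|?D. P z \<bullet> grad_x (Q k) z) \<longlonglongrightarrow> (LINT z|?D. P z \<bullet> g z)"
        by (simp add: LIM_zero_cancel)
    qed
    ultimately show ?thesis by simp
  qed
  have elim0: "(\<lambda>k. (1 - dilation k) * Ch * T) \<longlonglongrightarrow> 0"
  proof -
    have "(\<lambda>k. (1 - dilation k) * Ch * T) \<longlonglongrightarrow> (1 - 1) * Ch * T" by (intro tendsto_intros dilation_tendsto)
    then show ?thesis by simp
  qed
  have gap: "(LINT z|?D. (norm (P z - g z))\<^sup>2) = (LINT z|?D. (norm (P z))\<^sup>2) - 2 * (LINT z|?D. P z \<bullet> g z) + (LINT z|?D. (norm (g z))\<^sup>2)"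
  proof -
    have "(LINT z|?D. (norm (P z - g z))\<^sup>2) = (LINT z|?D. (norm (P z))\<^sup>2 - 2 * (P z \<bullet> g z) + (norm (g z))\<^sup>2)"
      by (simp add: power2_norm_eq_inner inner_diff_left inner_diff_right inner_commute algebra_simps)
    then show ?thesis using in_L2_integrable[OF P(2)] in_L2_integrable[OF g(2)] in_L2_inner[OF P(2) g(2)] by simp
  qed
  \<comment> \<open>The limit of \<open>main\<close> for an arbitrary perturbation. The convergence
    of the perturbation term is a hypothesis: it is trivial for \<open>s = 0\<close>, and for other
    \<open>s\<close> it can be checked only once \<open>\<rho>\<close> is known to have a
    density.\<close>
  have limit: "(LINT z|?D. (norm (P z - g z))\<^sup>2) / 2 + s * X - s\<^sup>2 / 2 * (LINT z|\<rho>. (norm (w z))\<^sup>2) \<le> 0"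
    if w: "cont_D T w" and X: "(\<lambda>k. s * ((LINT z|\<rho>. grad\<phi> z \<bullet> w z) - (LINT z|\<rho>. grad_x (\<Psi> k) z \<bullet> w z))) \<longlonglongrightarrow> s * X"
    for w :: "real \<times> (real^'n) \<Rightarrow> real^'n" and s X :: real
  proof -
    have "(\<lambda>k. B k + (LINT z|\<rho>. Q k z) - (1 - dilation k) * Ch * T
      + s * ((LINT z|\<rho>. grad\<phi> z \<bullet> w z) - (LINT z|\<rho>. grad_x (\<Psi> k) z \<bullet> w z))
      - s\<^sup>2 / 2 * (LINT z|\<rho>. (norm (w z))\<^sup>2) + (LINT z|?D. (norm (P z))\<^sup>2) / 2)
      \<longlonglongrightarrow> ((LINT z|R. (norm (grad\<psi> z))\<^sup>2) / 2 - (LINT z|?D. r z * q z)) + ((LINT z|?D. q z) - (LINT z|?D. P z \<bullet> g z)) - 0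
      + s * X - s\<^sup>2 / 2 * (LINT z|\<rho>. (norm (w z))\<^sup>2) + (LINT z|?D. (norm (P z))\<^sup>2) / 2"
      by (intro tendsto_add tendsto_diff Blim Qlim elim0 X tendsto_const)
    from LIMSEQ_le_const2[OF this, of E] main[OF w]
    have "((LINT z|R. (norm (grad\<psi> z))\<^sup>2) / 2 - (LINT z|?D. r z * q z)) + ((LINT z|?D. q z) - (LINT z|?D. P z \<bullet> g z)) - 0
      + s * X - s\<^sup>2 / 2 * (LINT z|\<rho>. (norm (w z))\<^sup>2) + (LINT z|?D. (norm (P z))\<^sup>2) / 2 \<le> E" by blast
    \<comment> \<open>Here \<open>a\<close> is the kinetic integral over \<open>R\<close>,
      \<open>b\<close> the integral of \<open>q\<close>, and \<open>c\<close>, \<open>d\<close>,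
      \<open>e\<close> are the integrals of \<open>|P|^2\<close>, \<open>P \<bullet> g\<close>,
      \<open>|g|^2\<close>. Kinetic energy and \<open>b\<close> cancel, and a perfect square
      remains.\<close>
    moreover have "(c - 2 * d + e) / 2 + f - l \<le> 0" if "a / 2 - (b - e) + (b - d) - 0 + f - l + c / 2 \<le> a / 2 + e / 2"
      for a b c d e f l :: real using that by argo
    ultimately show ?thesis unfolding E_def rq gap by blast
  qed

  \<comment> \<open>Identification of the field and of the density\<close>
  have Pg: "AE z in ?D. P z = g z"
  proof -
    have "cont_D T (\<lambda>_. 0 :: real^'n)" by (simp add: cont_D_def zperiodic_def)
    from limit[OF this, of 0 0] have "(LINT z|?D. (norm (P z - g z))\<^sup>2) \<le> 0" by simp
    moreover have "0 \<le> (LINT z|?D. (norm (P z - g z))\<^sup>2)" by simp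
    ultimately have "(LINT z|?D. (norm (P z - g z))\<^sup>2) = 0" by linarith
    then have "AE z in ?D. (norm (P z - g z))\<^sup>2 = 0"
      using in_L2_integrable[OF in_L2_diff[OF P(2) g(2)]] by (subst (asm) integral_nonneg_eq_0_iff_AE) auto
    then show ?thesis by eventually_elim simp
  qed
  \<comment> \<open>By \<open>poisson_closed\<close> the gradient of the potential determines the
    integral of every product test function, so equal gradients give equal measures.\<close>
  have \<rho>R: "\<rho> = R"
  proof (rule measure_eq_if_test_integrals_eq[OF T fin\<rho> sets\<rho> finR setsR ends\<rho> endsR])
    fix \<zeta> :: "real \<Rightarrow> real" and \<theta> :: "real^'n \<Rightarrow> real" assume a: "smooth \<zeta>" "supp_in T \<zeta>" "smooth \<theta>" "zperiodic \<theta>"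
    define \<eta> where "\<eta> z = \<zeta> (fst z) * \<theta> (snd z)" for z
    have sp: "smooth_periodic \<eta>" unfolding \<eta>_def[abs_def] by (rule test_fun_smooth_periodic[OF test_fun_product[OF a]])
    have "(LINT z|\<rho>. \<eta> z) = (LINT z|?D. \<eta> z) - (LINT z|?D. P z \<bullet> grad_x \<eta> z)"
      by (rule poisson_closed[OF T P fin\<rho> sets\<rho> ends\<rho> poi\<rho> sp])
    also have "(LINT z|?D. P z \<bullet> grad_x \<eta> z) = (LINT z|?D. g z \<bullet> grad_x \<eta> z)"
    proof (rule Bochner_Integration.integral_cong_AE)
      have "P \<in> borel_measurable ?D" "g \<in> borel_measurable ?D" using P(2) g(2) by (auto simp: in_L2_def)
      then show "(\<lambda>z. P z \<bullet> grad_x \<eta> z) \<in> borel_measurable ?D" "(\<lambda>z. g z \<bullet> grad_x \<eta> z) \<in> borel_measurable ?D"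
        using cont_D_measurable(2)[OF cont_D_grad[OF sp]] by measurable
      show "AE z in ?D. P z \<bullet> grad_x \<eta> z = g z \<bullet> grad_x \<eta> z" using Pg by eventually_elim simp
    qed
    also have "(LINT z|?D. \<eta> z) - (LINT z|?D. g z \<bullet> grad_x \<eta> z) = (LINT z|R. \<eta> z)"
      by (rule poisson_closed[OF T g(1,2) finR setsR endsR poiR sp, symmetric])
    finally show "(LINT z|\<rho>. \<zeta> (fst z) * \<theta> (snd z)) = (LINT z|R. \<zeta> (fst z) * \<theta> (snd z))" by (simp add: \<eta>_def)
  qed

  \<comment> \<open>Identification of the velocity\<close>
  have gap0: "(LINT z|?D. (norm (P z - g z))\<^sup>2) = 0"
    using Pg by (intro integral_eq_zero_AE) (auto elim!: eventually_mono)
  have "AE z in R. (grad\<phi> z - grad\<psi> z) $ i = 0" for i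
  proof (rule AE_zero_if_test_integrals_zero[OF T setsR endsR])
    have vR: "integrable R grad\<phi>" using vi \<rho>R by simp
    then show "integrable R (\<lambda>z. (grad\<phi> z - grad\<psi> z) $ i)" using gRi by (intro integrable_vec_nth) auto
    fix \<eta> :: "real \<times> (real^'n) \<Rightarrow> real" assume \<eta>: "test_fun T \<eta>"
    \<comment> \<open>The perturbation points in one coordinate direction with a test function as
      profile, so that the pairing isolates component \<open>i\<close> of the difference of
      velocities.\<close>
    define w where "w z = \<eta> z *\<^sub>R (axis i 1 :: real^'n)" for z
    have w: "cont_D T w"
      using cont_D_test_fun[OF \<eta>] unfolding w_def[abs_def] cont_D_def by (auto intro!: continuous_intros simp: zperiodic_def)
    define X where "X = (LINT z|R. grad\<phi> z \<bullet> w z) - (LINT z|R. grad\<psi> z \<bullet> w z)"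
    define Y where "Y = (LINT z|R. (norm (w z))\<^sup>2)"
    obtain Bw where Bw: "\<And>t x. t \<in> {0..T} \<Longrightarrow> norm (w (t, x)) \<le> Bw" using cont_D_bounded[OF w] by metis
    have wim: "(\<lambda>z. w z $ j) \<in> borel_measurable ?D" for j
      using integrable_vec_nth[OF integrable_cont_D[OF w fD sets_D_leb]] by (rule borel_measurable_integrable)
    have wib: "AE z in ?D. \<bar>w z $ j\<bar> \<le> Bw" for j
    proof (rule AE_I2)
      fix z assume "z \<in> space ?D"
      then have "z \<in> spacetime T" by simp
      then have "norm (w z) \<le> Bw" using Bw[of "fst z" "snd z"] by (auto simp: spacetime_def)
      then show "\<bar>w z $ j\<bar> \<le> Bw" using component_le_norm_cart[of "w z" j] by linarith
    qed
    have wm: "w \<in> borel_measurable ?D" by (rule cont_D_measurable(2)[OF w])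
    \<comment> \<open>With \<open>\<rho> = R\<close> the measure has the Lebesgue density
      \<open>r\<close>, so the weak convergence of the mollified gradients is now available under
      it.\<close>
    have "(\<lambda>k. LINT z|R. grad_x (\<Psi> k) z \<bullet> w z) \<longlonglongrightarrow> (LINT z|R. grad\<psi> z \<bullet> w z)"
    proof -
      have "(LINT z|R. grad_x (\<Psi> k) z \<bullet> w z) = (LINT z|?D. r z * (w z \<bullet> grad_x (\<Psi> k) z))" for k
        by (subst LR(1)) (use Gm wm in \<open>auto simp: inner_commute\<close>)
      moreover have "(LINT z|R. grad\<psi> z \<bullet> w z) = (LINT z|?D. r z * (w z \<bullet> grad\<psi> z))"
        by (subst LR(1)) (use gm wm in \<open>auto simp: inner_commute\<close>)
      ultimately show ?thesis using inner_lim[OF wim wib] by simp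
    qed
    then have "(\<lambda>k. s * ((LINT z|\<rho>. grad\<phi> z \<bullet> w z) - (LINT z|\<rho>. grad_x (\<Psi> k) z \<bullet> w z))) \<longlonglongrightarrow> s * X" for s
      unfolding X_def \<rho>R by (intro tendsto_intros)
    from limit[OF w this] have sX: "s * X \<le> s\<^sup>2 / 2 * Y" for s by (simp add: gap0 Y_def \<rho>R)
    have Y: "Y \<ge> 0" by (simp add: Y_def)
    have "X = 0"
    proof -
      \<comment> \<open>A linear function of \<open>s\<close> of either sign is dominated by a
        quadratic one. This \<open>s\<close> makes the contradiction explicit for \<open>X\<close>
        non-zero: it yields \<open>s^2 (Y / 2 + 1) <= 0\<close>, and the \<open>+ 1\<close> covers
        \<open>Y = 0\<close>.\<close>
      define s where "s = X / (Y + 1)"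
      have Xs: "X = s * (Y + 1)" using Y by (simp add: s_def)
      have "s * (s * (Y + 1)) \<le> s\<^sup>2 / 2 * Y" using sX[of s] Xs by simp
      then have "s\<^sup>2 * (Y / 2 + 1) \<le> 0" by (simp add: power2_eq_square algebra_simps)
      then have "s = 0" using Y by (simp add: mult_le_0_iff)
      then show ?thesis using Xs by simp
    qed
    moreover have "(LINT z|R. (grad\<phi> z - grad\<psi> z) $ i * \<eta> z) = X"
    proof -
      have "(LINT z|R. (grad\<phi> z - grad\<psi> z) $ i * \<eta> z) = (LINT z|R. grad\<phi> z \<bullet> w z - grad\<psi> z \<bullet> w z)"
        by (simp add: w_def inner_axis algebra_simps)
      also have "\<dots> = X"
        unfolding X_def
        by (rule Bochner_Integration.integral_diff)
           (rule integral_dot_density(2)[OF vR setsR _ finR w, of "\<lambda>A. LINT z:A|R. grad\<phi> z"]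
              integral_dot_density(2)[OF gRi setsR JR_def finR w], (rule refl)?)+
      finally show ?thesis .
    qed
    ultimately show "(LINT z|R. (grad\<phi> z - grad\<psi> z) $ i * \<eta> z) = 0" by simp
  qed
  then have "AE z in R. \<forall>i\<in>UNIV. (grad\<phi> z - grad\<psi> z) $ i = 0" by (intro AE_finite_allI) auto
  then have "AE z in R. grad\<phi> z = grad\<psi> z" by eventually_elim (simp add: vec_eq_iff)
  then show ?thesis unfolding \<rho>R by (simp add: R_def)
qed

end
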